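(* Let $v$ be a vertex of the associahedron $\overline{X}_{S,\delta}$, and let $F_v$ be the set of faces $F_{ij}$ of $\overline{X}_{S,\delta}$ meeting $v$. Then there is a unique solution $L_{v,\delta}$ of the differential equation $dL=\Omega_{S,\delta}L$, with values in $\widehat{\mathfrak{B}}_{S,\delta}(\mathbb{C})$, such that $$L_{v,\delta}(z)=f_{v,\delta}(z)\,\exp\Big(\sum_{\{i,j\}:\,F_{ij}\in F_v}\delta_{ij}\log u_{ij}\Big),$$ where $f_{v,\delta}(z)$ is holomorphic in a neighbourhood of $v\in\mathfrak{M}^\delta_{0,S}(\mathbb{C})$, and $f_{v,\delta}(v)=1$.
   Context: Let $n=\ell+3\ge4$, $S=\{1,\ldots,n\}$ with its standard dihedral structure $\delta$: $S$ is the set of edges of an $n$-gon in order, and "vertex $i$" of the $n$-gon lies between edges $i$ and $i+1$ (indices mod $n$). Let $\chi_{S,\delta}$ be the set of chords: unordered pairs $\{i,j\}$ with $i,i+1,j,j+1$ distinct mod $n$ (the chord joins vertices $i$ and $j$). Two chords cross if they have no common endpoint and their endpoints interlace on the polygon. Let $\mathfrak{M}_{0,S}=\mathrm{PSL}_2\backslash(\mathbb{P}^1)^n_*$, where $(\mathbb{P}^1)^n_*$ is the set of $n$-tuples of distinct points. The dihedral coordinates are $$u_{ij}=[i\ i{+}1\,|\,j{+}1\ j],\qquad[ij|kl]=\frac{(z_i-z_k)(z_j-z_l)}{(z_i-z_l)(z_j-z_k)},\quad\{i,j\}\in\chi_{S,\delta}.$$ Sets $A,B\subset\chi_{S,\delta}$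 cross completely if $A$ is exactly the set of chords crossing every chord of $B$ and vice versa. $\mathfrak{M}^\delta_{0,S}=\mathrm{Spec}\,\mathbb{Z}[u_{ij}]/(\prod_{a\in A}u_a+\prod_{b\in B}u_b-1)$, over all completely crossing pairs $A,B$; it is smooth and contains $\mathfrak{M}_{0,S}$ as the open set where all $u_{ij}\ne0$. Put $\overline{X}_{S,\delta}=\{u_{ij}\ge0\ \forall\{i,j\}\}\subset\mathfrak{M}^\delta_{0,S}(\mathbb{R})$ and $X_{S,\delta}=\{u_{ij}>0\}$, with faces $F_{ij}=\overline{X}_{S,\delta}\cap\{u_{ij}=0\}$. Vertices $v$ of $\overline{X}_{S,\delta}$ correspond to triangulations $\alpha$ of the $n$-gon by $\ell$ pairwise non-crossing chords: $v$ is the point with $u_{ij}=0$ for all $\{i,j\}\in\alpha$. Let $\delta_{ij}=\delta_{ji}$, $\{i,j\}\in\chi_{S,\delta}$, be non-commuting symbols, with $\delta_{ii}=\delta_{i\,i+1}=0$. The dihedral braid relations are $$[\delta_{i-1\,j}+\delta_{i\,j-1}-\delta_{i-1\,j-1}-\delta_{ij},\ \delta_{k-1\,l}+\delta_{k\,l-1}-\delta_{k-1\,l-1}-\delta_{kl}]=0$$ for all distinct $i,j,k,l\in S$; they imply $[\delta_{ij},\delta_{kl}]=0$ for non-crossing chords. $\widehat{\mathfrak{B}}_{S,\delta}(\mathbb{C})$ is the ring of non-commutative formal power series $\mathbb{C}\langle\langle\delta_{ij}\rangle\rangle$ modulo the closed ideal generated by these relations. Let $\Omega_{S,\delta}=\sum_{\{i,j\}\in\chi_{S,\delta}}\delta_{ij}\,d\log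 u_{ij}$, which is integrable modulo the relations. A solution $L$ is a multi-valued function on $\mathfrak{M}_{0,S}(\mathbb{C})$ (holomorphic on a universal covering), with a distinguished branch on the simply connected cell $X_{S,\delta}$; $\log u_{ij}$ is the branch which is real for $u_{ij}>0$, and the displayed factorisation is on $X_{S,\delta}$ near $v$ (then by analytic continuation). Holomorphic means each coefficient is holomorphic.
   Formalization: The relations defining the dihedral space are taken only for completely crossing pairs A, B given by four consecutive non-empty arcs of vertices; read literally, the definition also admits the pair (empty set, all chords), which forces the product of all u_ij to be 0 and excludes M_{0,S}. *)

theory Defs
  imports "HOL-Analysis.Analysis" "HOL-Algebra.QuotRing"
begin

section \<open>Chords of the polygon\<close>

text \<open>
  The set \<open>S\<close> is \<open>{1..n}\<close>, and \<open>nxt\<close>, \<open>prv\<close> are \<open>i + 1\<close>, \<open>i - 1\<close> modulo \<open>n\<close>.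
  The chord joining the vertices \<open>i\<close> and \<open>j\<close> is the set \<open>{i, j}\<close>.
\<close>

definition nxt :: "nat \<Rightarrow> nat \<Rightarrow> nat" where
  "nxt n i = (if i = n then 1 else i + 1)"

definition prv :: "nat \<Rightarrow> nat \<Rightarrow> nat" where
  "prv n i = (if i = 1 then n else i - 1)"

definition chords :: "nat \<Rightarrow> nat set set" where
  "chords n = {{i, j} | i j. i \<in> {1..n} \<and> j \<in> {1..n} \<and> distinct [i, nxt n i, j, nxt n j]}"

definition crosses :: "nat set \<Rightarrow> nat set \<Rightarrow> bool" where
  "crosses c d \<longleftrightarrow>
     (\<exists>i j k l. i < j \<and> j < k \<and> k < l \<and> (c = {i, k} \<and> d = {j, l} \<or> c = {j, l} \<and> d = {i, k}))"

definition cross_completely :: "nat \<Rightarrow> nat set set \<Rightarrow> nat set set \<Rightarrow> bool" where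
  "cross_completely n A B \<longleftrightarrow>
     A = {a \<in> chords n. \<forall>b\<in>B. crosses a b} \<and> B = {b \<in> chords n. \<forall>a\<in>A. crosses a b}"

definition joining :: "nat set \<Rightarrow> nat set \<Rightarrow> nat set set" where
  "joining P Q = {{p, q} | p q. p \<in> P \<and> q \<in> Q}"

text \<open>
  The condition \<^const>\<open>cross_completely\<close> alone also holds for the pair \<open>({}, chords n)\<close>, for
  \<open>n \<ge> 5\<close>, and, for \<open>n = 8\<close>, for the pair \<open>({{1,5},{3,7}}, {{2,6},{4,8}})\<close>; the corresponding
  equations \<open>\<Prod>A + \<Prod>B = 1\<close> fail for cross-ratios. The pairs which define the dihedral
  coordinate ring are those cut out by a partition of the vertices into four consecutive
  non-empty arcs: \<open>A\<close> joins the first to the third arc, and \<open>B\<close> the second to the fourth.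
  The equation is then the identity \<open>[ij|lk] + [jk|il] = 1\<close>.
\<close>

definition crossing_pair :: "nat \<Rightarrow> nat set set \<Rightarrow> nat set set \<Rightarrow> bool" where
  "crossing_pair n A B \<longleftrightarrow> cross_completely n A B \<and>
     (\<exists>i j k l. 1 \<le> i \<and> i < j \<and> j < k \<and> k < l \<and> l \<le> n \<and>
        (let P = joining {i..<j} {k..<l}; Q = joining {j..<k} ({l..n} \<union> {1..<i})
         in A = P \<and> B = Q \<or> A = Q \<and> B = P))"

definition triangulation :: "nat \<Rightarrow> nat set set \<Rightarrow> bool" where
  "triangulation n \<alpha> \<longleftrightarrow>
     \<alpha> \<subseteq> chords n \<and> card \<alpha> = n - 3 \<and> (\<forall>c\<in>\<alpha>. \<forall>d\<in>\<alpha>. \<not> crosses c d)"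


section \<open>The moduli spaces and the associahedron\<close>

text \<open>
  A point of \<open>\<MM>\<^sup>\<delta>\<close> with values in a commutative ring is the family of its
  dihedral coordinates, extended by \<open>0\<close> to indices which are not chords.
  For \<open>real\<close> and \<open>complex\<close> the topology of the function type is the analytic topology.
\<close>

definition M_delta :: "nat \<Rightarrow> (nat set \<Rightarrow> 'a::comm_ring_1) set" where
  "M_delta n = {u. (\<forall>c. c \<notin> chords n \<longrightarrow> u c = 0) \<and>
     (\<forall>A B. crossing_pair n A B \<longrightarrow> (\<Prod>a\<in>A. u a) + (\<Prod>b\<in>B. u b) - 1 = 0)}"

text \<open>
  Points of the projective line are given by homogeneous coordinates; \<open>wedge a b\<close> becomes
  \<open>a - b\<close> on the affine chart \<open>(a, 1), (b, 1)\<close>, and vanishes iff the two points coincide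
  (or a pair of coordinates is \<open>(0, 0)\<close>).
\<close>

definition wedge :: "complex \<times> complex \<Rightarrow> complex \<times> complex \<Rightarrow> complex" where
  "wedge a b = fst a * snd b - snd a * fst b"

definition configurations :: "nat \<Rightarrow> (nat \<Rightarrow> complex \<times> complex) set" where
  "configurations n = {z. \<forall>i\<in>{1..n}. \<forall>j\<in>{1..n}. i \<noteq> j \<longrightarrow> wedge (z i) (z j) \<noteq> 0}"

definition cross_ratio ::
    "(nat \<Rightarrow> complex \<times> complex) \<Rightarrow> nat \<Rightarrow> nat \<Rightarrow> nat \<Rightarrow> nat \<Rightarrow> complex" where
  "cross_ratio z i j k l =
     (wedge (z i) (z k) * wedge (z j) (z l)) / (wedge (z i) (z l) * wedge (z j) (z k))"

text \<open>The cross-ratio below is symmetric in the end points of the chord.\<close>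

definition dihedral_coords ::
    "nat \<Rightarrow> (nat \<Rightarrow> complex \<times> complex) \<Rightarrow> nat set \<Rightarrow> complex" where
  "dihedral_coords n z c =
     (if c \<in> chords n
      then let i = Min c; j = Max c in cross_ratio z i (nxt n i) (nxt n j) j
      else 0)"

text \<open>
  The dihedral coordinates embed the quotient of the configuration space by \<open>PSL\<^sub>2\<close>, with image
  the locus of \<open>M_delta n\<close> where no coordinate vanishes. So \<open>\<MM>\<^sub>0\<^sub>,\<^sub>S(\<complex>)\<close> is that image.
\<close>

definition M0 :: "nat \<Rightarrow> (nat set \<Rightarrow> complex) set" where
  "M0 n = dihedral_coords n ` configurations n"

definition X_closed :: "nat \<Rightarrow> (nat set \<Rightarrow> real) set" where
  "X_closed n = {u \<in> M_delta n. \<forall>c\<in>chords n. u c \<ge> 0}"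

definition X_open :: "nat \<Rightarrow> (nat set \<Rightarrow> real) set" where
  "X_open n = {u \<in> M_delta n. \<forall>c\<in>chords n. u c > 0}"

definition cpx :: "(nat set \<Rightarrow> real) \<Rightarrow> nat set \<Rightarrow> complex" where
  "cpx u = (\<lambda>c. complex_of_real (u c))"

definition face :: "nat \<Rightarrow> nat set \<Rightarrow> (nat set \<Rightarrow> real) set" where
  "face n c = X_closed n \<inter> {u. u c = 0}"

definition faces_at :: "nat \<Rightarrow> (nat set \<Rightarrow> real) \<Rightarrow> (nat set \<Rightarrow> real) set set" where
  "faces_at n v = {face n c | c. c \<in> chords n \<and> v \<in> face n c}"

definition associahedron_vertex :: "nat \<Rightarrow> (nat set \<Rightarrow> real) \<Rightarrow> bool" where
  "associahedron_vertex n v \<longleftrightarrow>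
     v \<in> X_closed n \<and> (\<exists>\<alpha>. triangulation n \<alpha> \<and> (\<forall>c\<in>\<alpha>. v c = 0))"


section \<open>Non-commutative series and the dihedral braid algebra\<close>

text \<open>A series assigns to each word in the letters \<open>\<delta>\<^sub>c\<close>, \<open>c \<in> chords n\<close>, its coefficient.\<close>

type_synonym ncseries = "nat set list \<Rightarrow> complex"

definition nc_mult :: "ncseries \<Rightarrow> ncseries \<Rightarrow> ncseries" where
  "nc_mult a b = (\<lambda>w. \<Sum>k\<le>length w. a (take k w) * b (drop k w))"

definition nc_ring :: "nat \<Rightarrow> ncseries ring" where
  "nc_ring n =
     \<lparr>carrier = {a. \<forall>w. \<not> set w \<subseteq> chords n \<longrightarrow> a w = 0},
      mult = nc_mult,
      one = (\<lambda>w. if w = [] then 1 else 0),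
      zero = (\<lambda>w. 0),
      add = (\<lambda>a b w. a w + b w)\<rparr>"

definition letter :: "nat set \<Rightarrow> ncseries" where
  "letter c = (\<lambda>w. if w = [c] then 1 else 0)"

definition delta :: "nat \<Rightarrow> nat \<Rightarrow> nat \<Rightarrow> ncseries" where
  "delta n i j = (if {i, j} \<in> chords n then letter {i, j} else (\<lambda>w. 0))"

definition braid_term :: "nat \<Rightarrow> nat \<Rightarrow> nat \<Rightarrow> ncseries" where
  "braid_term n i j = (\<lambda>w.
     delta n (prv n i) j w + delta n i (prv n j) w - delta n (prv n i) (prv n j) w - delta n i j w)"

definition nc_commutator :: "ncseries \<Rightarrow> ncseries \<Rightarrow> ncseries" where
  "nc_commutator a b = (\<lambda>w. nc_mult a b w - nc_mult b a w)"

definition braid_relations :: "nat \<Rightarrow> ncseries set" where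
  "braid_relations n =
     {nc_commutator (braid_term n i j) (braid_term n k l) | i j k l.
        {i, j, k, l} \<subseteq> {1..n} \<and> distinct [i, j, k, l]}"

text \<open>
  The closure is taken for coefficientwise convergence in \<open>\<complex>\<close>. For linear subspaces
  it agrees with the closure in the topology given by the order of series, since there are
  finitely many words of each length.
\<close>

definition braid_ideal :: "nat \<Rightarrow> ncseries set" where
  "braid_ideal n = closure (genideal (nc_ring n) (braid_relations n))"

definition B_hat :: "nat \<Rightarrow> ncseries set ring" where
  "B_hat n = nc_ring n Quot braid_ideal n"

definition B_class :: "nat \<Rightarrow> ncseries \<Rightarrow> ncseries set" where
  "B_class n a = a_r_coset (nc_ring n) (braid_ideal n) a"

text \<open>The exponential of a series without constant term; powers above \<open>length w\<close> do not
  contribute to the coefficient of \<open>w\<close>.\<close>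

definition nc_exp :: "nat \<Rightarrow> ncseries \<Rightarrow> ncseries" where
  "nc_exp n a = (\<lambda>w. \<Sum>k\<le>length w. (a [^]\<^bsub>nc_ring n\<^esub> k) w / fact k)"


section \<open>Holomorphic functions and the differential equation\<close>

text \<open>
  Let \<open>E\<close> be a space with a map \<open>p\<close> to the coordinate space \<open>\<complex>\<^sup>C\<close> which is locally a
  homeomorphism to a complex submanifold: an open subset of \<open>M_delta n\<close> with the inclusion, or
  a covering of \<open>M0 n\<close> with the covering map. In the coordinates \<open>u\<^sub>c\<close>, \<open>c \<in> C\<close>, the following
  says that \<open>g\<close> is complex differentiable at \<open>e\<close>, with \<open>dg = \<Sum>\<^sub>c D c du\<^sub>c\<close> on the tangent space.
  On a submanifold the coefficients \<open>D c\<close> are not determined by \<open>g\<close>, only the form is.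
  A function is holomorphic iff it is complex differentiable at every point.
\<close>

definition has_differential ::
    "nat set set \<Rightarrow> ('e::topological_space \<Rightarrow> nat set \<Rightarrow> complex) \<Rightarrow> 'e set \<Rightarrow>
     ('e \<Rightarrow> complex) \<Rightarrow> (nat set \<Rightarrow> complex) \<Rightarrow> 'e \<Rightarrow> bool" where
  "has_differential C p E g D e \<longleftrightarrow>
     (\<forall>\<epsilon>>0. \<forall>\<^sub>F e' in at e within E.
        cmod (g e' - g e - (\<Sum>c\<in>C. D c * (p e' c - p e c)))
          \<le> \<epsilon> * (\<Sum>c\<in>C. cmod (p e' c - p e c)))"

text \<open>A function with values in the quotient is holomorphic if it is represented by a series
  whose coefficients are holomorphic.\<close>

definition B_holomorphic_on ::
    "nat \<Rightarrow> ((nat set \<Rightarrow> complex) \<Rightarrow> ncseries set) \<Rightarrow> (nat set \<Rightarrow> complex) set \<Rightarrow> bool" where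
  "B_holomorphic_on n F U \<longleftrightarrow> F \<in> U \<rightarrow> carrier (B_hat n) \<and>
     (\<exists>f. (\<forall>u\<in>U. f u \<in> F u) \<and>
        (\<forall>w. \<forall>u\<in>U. \<exists>D. has_differential (chords n) (\<lambda>u. u) U (\<lambda>u. f u w) D u))"

text \<open>
  \<open>Omega_coeff n u c\<close> is the coefficient \<open>\<delta>\<^sub>c / u\<^sub>c\<close> of \<open>du\<^sub>c\<close> in the form
  \<open>\<Sum>\<^sub>c \<delta>\<^sub>c d log u\<^sub>c\<close>. The equation \<open>dL = \<Omega> L\<close> says that \<open>L\<close> is represented by a series
  with holomorphic coefficients, whose differential \<open>\<Sum>\<^sub>c D\<^sub>c du\<^sub>c\<close> has coefficients
  \<open>D\<^sub>c\<close> representing \<open>(\<delta>\<^sub>c / u\<^sub>c) L\<close>.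
\<close>

definition Omega_coeff :: "nat \<Rightarrow> (nat set \<Rightarrow> complex) \<Rightarrow> nat set \<Rightarrow> ncseries set" where
  "Omega_coeff n u c = B_class n (\<lambda>w. letter c w / u c)"

definition solves_on ::
    "nat \<Rightarrow> ('e::topological_space \<Rightarrow> nat set \<Rightarrow> complex) \<Rightarrow> 'e set \<Rightarrow>
     ('e \<Rightarrow> ncseries set) \<Rightarrow> bool" where
  "solves_on n p E L \<longleftrightarrow> L \<in> E \<rightarrow> carrier (B_hat n) \<and>
     (\<exists>f. (\<forall>e\<in>E. f e \<in> L e) \<and>
        (\<forall>e\<in>E. \<exists>D. (\<forall>c\<in>chords n. D c \<in> Omega_coeff n (p e) c \<otimes>\<^bsub>B_hat n\<^esub> L e) \<and>
           (\<forall>w. has_differential (chords n) p E (\<lambda>e. f e w) (\<lambda>c. D c w) e)))"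

text \<open>
  A universal covering \<open>p\<close> of \<open>\<MM>\<^sub>0\<^sub>,\<^sub>S(\<complex>)\<close> with a lift \<open>s\<close> of the cell: multi-valued functions
  are functions on \<open>E\<close>, with distinguished branch the composition with \<open>s\<close>.
\<close>

definition universal_covering_M0 ::
    "nat \<Rightarrow> 'e::topological_space set \<Rightarrow> ('e \<Rightarrow> nat set \<Rightarrow> complex) \<Rightarrow>
     ((nat set \<Rightarrow> real) \<Rightarrow> 'e) \<Rightarrow> bool" where
  "universal_covering_M0 n E p s \<longleftrightarrow>
     covering_space E p (M0 n) \<and> simply_connected E \<and>
     continuous_on (X_open n) s \<and> s ` X_open n \<subseteq> E \<and> (\<forall>x\<in>X_open n. p (s x) = cpx x)"

definition log_part :: "nat \<Rightarrow> (nat set \<Rightarrow> real) \<Rightarrow> (nat set \<Rightarrow> real) \<Rightarrow> ncseries" where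
  "log_part n v x = (\<lambda>w. \<Sum>c | c \<in> chords n \<and> face n c \<in> faces_at n v.
     letter c w * complex_of_real (ln (x c)))"

text \<open>The factorisation of \<open>L\<close> on the part of the cell in a neighbourhood of \<open>v\<close>.\<close>

definition normalised_at ::
    "nat \<Rightarrow> ((nat set \<Rightarrow> real) \<Rightarrow> 'e) \<Rightarrow> (nat set \<Rightarrow> real) \<Rightarrow> ('e \<Rightarrow> ncseries set) \<Rightarrow> bool" where
  "normalised_at n s v L \<longleftrightarrow>
     (\<exists>U f. openin (top_of_set (M_delta n)) U \<and> cpx v \<in> U \<and>
        B_holomorphic_on n f U \<and> f (cpx v) = \<one>\<^bsub>B_hat n\<^esub> \<and>
        (\<forall>x\<in>X_open n. cpx x \<in> U \<longrightarrow>
           L (s x) = f (cpx x) \<otimes>\<^bsub>B_hat n\<^esub> B_class n (nc_exp n (log_part n v x))))"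


section \<open>The series form a ring, and the braid ideal is an ideal\<close>

lemma nc_mult_assoc: "nc_mult (nc_mult a b) c = nc_mult a (nc_mult b c)"
proof
  fix w :: "nat set list"
  let ?N = "length w"
  let ?g = "\<lambda>j k. a (take j w) * b (drop j (take k w)) * c (drop k w)"
  have "nc_mult (nc_mult a b) c w = (\<Sum>k\<le>?N. \<Sum>j\<le>k. ?g j k)"
    by (auto simp: nc_mult_def sum_distrib_right min_def intro!: sum.cong)
  also have "\<dots> = (\<Sum>j\<le>?N. \<Sum>k\<in>{j..?N}. ?g j k)"
    unfolding sum.Sigma[OF finite_atMost ballI, OF finite_atMost]
      sum.Sigma[OF finite_atMost ballI, OF finite_atLeastAtMost]
    by (rule sum.reindex_bij_witness[where i="\<lambda>(a,b). (b,a)" and j="\<lambda>(a,b). (b,a)"]) auto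
  also have "\<dots> = (\<Sum>j\<le>?N. \<Sum>m\<le>?N - j. ?g j (j + m))"
  proof (rule sum.cong[OF refl])
    fix j assume "j \<in> {..?N}"
    then show "(\<Sum>k\<in>{j..?N}. ?g j k) = (\<Sum>m\<le>?N - j. ?g j (j + m))"
      by (intro sum.reindex_bij_witness[where i="\<lambda>m. j + m" and j="\<lambda>k. k - j"]) auto
  qed
  also have "\<dots> = nc_mult a (nc_mult b c) w"
    by (auto simp: nc_mult_def sum_distrib_left mult.assoc drop_take add.commute intro!: sum.cong)
  finally show "nc_mult (nc_mult a b) c w = nc_mult a (nc_mult b c) w" .
qed

lemma nc_mult_one:
  "nc_mult (\<lambda>w. if w = [] then 1 else 0) a = a" "nc_mult a (\<lambda>w. if w = [] then 1 else 0) = a"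
proof -
  show "nc_mult (\<lambda>w. if w = [] then 1 else 0) a = a"
  proof
    fix w
    have "nc_mult (\<lambda>w. if w = [] then 1 else 0) a w = (\<Sum>k\<le>length w. if k = 0 then a w else 0)"
      unfolding nc_mult_def by (intro sum.cong) auto
    then show "nc_mult (\<lambda>w. if w = [] then 1 else 0) a w = a w" by simp
  qed
  show "nc_mult a (\<lambda>w. if w = [] then 1 else 0) = a"
  proof
    fix w
    have "nc_mult a (\<lambda>w. if w = [] then 1 else 0) w
        = (\<Sum>k\<le>length w. if k = length w then a w else 0)"
      unfolding nc_mult_def by (intro sum.cong) auto
    then show "nc_mult a (\<lambda>w. if w = [] then 1 else 0) w = a w" by simp
  qed
qed

lemma nc_mult_closed:
  assumes "a \<in> carrier (nc_ring n)" "b \<in> carrier (nc_ring n)"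
  shows "nc_mult a b \<in> carrier (nc_ring n)"
proof -
  have "a (take k w) * b (drop k w) = 0" if "\<not> set w \<subseteq> chords n" for w k
  proof -
    have "set w = set (take k w) \<union> set (drop k w)"
      by (metis append_take_drop_id set_append)
    then have "\<not> set (take k w) \<subseteq> chords n \<or> \<not> set (drop k w) \<subseteq> chords n"
      using that by blast
    then show ?thesis using assms by (auto simp: nc_ring_def)
  qed
  then have "nc_mult a b w = 0" if "\<not> set w \<subseteq> chords n" for w
    using that unfolding nc_mult_def by (intro sum.neutral) blast
  then show ?thesis by (simp add: nc_ring_def)
qed

lemma nc_ring_ring: "ring (nc_ring n)"
proof (rule ringI)
  show "abelian_group (nc_ring n)"
  proof (rule abelian_groupI)
    fix x assume "x \<in> carrier (nc_ring n)"
    then show "\<exists>y\<in>carrier (nc_ring n). y \<oplus>\<^bsub>nc_ring n\<^esub> x = \<zero>\<^bsub>nc_ring n\<^esub>"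
      by (intro bexI[of _ "\<lambda>w. - x w"]) (auto simp: nc_ring_def)
  qed (auto simp: nc_ring_def add_ac)
  show "Group.monoid (nc_ring n)"
    by (rule monoidI, use nc_mult_closed in \<open>auto simp: nc_ring_def nc_mult_assoc nc_mult_one\<close>)
qed (auto simp: nc_ring_def nc_mult_def algebra_simps sum.distrib)

lemma continuous_on_coord: "continuous_on A (\<lambda>a. a w)"
  for A :: "('i \<Rightarrow> 'a::topological_space) set"
  by (rule continuous_on_subset[OF continuous_on_product_coordinates subset_UNIV])

lemma closed_carrier_nc_ring: "closed (carrier (nc_ring n))"
proof -
  have "carrier (nc_ring n) = (\<Inter>w\<in>{w. \<not> set w \<subseteq> chords n}. {a. a w = (0::complex)})"
    by (auto simp: nc_ring_def)
  then show ?thesis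
    by (auto intro!: closed_Collect_eq continuous_on_coord)
qed

lemma closure_invariant:
  assumes "continuous_on UNIV h" "\<And>x. x \<in> I \<Longrightarrow> h x \<in> closure I" "x \<in> closure I"
  shows "h x \<in> closure I"
  using image_closure_subset[of I h "closure I"] assms
  by (meson closed_closure continuous_on_subset image_subset_iff subset_UNIV)

lemma braid_relations_carrier: "braid_relations n \<subseteq> carrier (nc_ring n)"
proof -
  have d: "delta n i j \<in> carrier (nc_ring n)" for i j
    by (auto simp: delta_def letter_def nc_ring_def)
  have t: "braid_term n i j \<in> carrier (nc_ring n)" for i j
    using d[of "prv n i" j] d[of i "prv n j"] d[of "prv n i" "prv n j"] d[of i j]
    by (auto simp: braid_term_def nc_ring_def)
  have "nc_commutator a b \<in> carrier (nc_ring n)"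
    if "a \<in> carrier (nc_ring n)" "b \<in> carrier (nc_ring n)" for a b
    using nc_mult_closed[OF that] nc_mult_closed[OF that(2,1)]
    by (auto simp: nc_commutator_def nc_ring_def)
  then show ?thesis using t by (auto simp: braid_relations_def)
qed

lemma braid_ideal_ideal: "ideal (braid_ideal n) (nc_ring n)"
proof -
  interpret R: ring "nc_ring n" by (rule nc_ring_ring)
  define I where "I = genideal (nc_ring n) (braid_relations n)"
  interpret I: ideal I "nc_ring n"
    unfolding I_def by (rule R.genideal_ideal[OF braid_relations_carrier])
  have J: "braid_ideal n = closure I" by (simp add: braid_ideal_def I_def)
  have sub: "closure I \<subseteq> carrier (nc_ring n)"
    using closed_carrier_nc_ring I.a_subset by (simp add: closure_minimal)
  have IJ: "x \<in> I \<Longrightarrow> x \<in> closure I" for x using closure_subset by blast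
  have addI: "(\<lambda>w. x w + y w) \<in> I" if "x \<in> I" "y \<in> I" for x y
    using I.a_closed[OF that] by (simp add: nc_ring_def)
  have add1: "(\<lambda>w. x w + y w) \<in> closure I" if "x \<in> I" "y \<in> closure I" for x y
    by (rule closure_invariant[OF _ _ that(2)])
      (auto intro!: continuous_on_coordinatewise_then_product continuous_intros
        continuous_on_coord IJ addI that)
  have add: "(\<lambda>w. x w + y w) \<in> closure I" if "x \<in> closure I" "y \<in> closure I" for x y
    by (rule closure_invariant[OF _ _ that(1)])
      (auto intro!: continuous_on_coordinatewise_then_product continuous_intros
        continuous_on_coord add1 that)
  have l: "nc_mult a x \<in> closure I" if "x \<in> closure I" "a \<in> carrier (nc_ring n)" for a x
  proof (rule closure_invariant[OF _ _ that(1)])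
    show "continuous_on UNIV (nc_mult a)"
      unfolding nc_mult_def
      by (intro continuous_on_coordinatewise_then_product continuous_intros continuous_on_coord)
    show "nc_mult a y \<in> closure I" if "y \<in> I" for y
      using I.I_l_closed[OF that \<open>a \<in> _\<close>] by (auto intro!: IJ simp: nc_ring_def)
  qed
  have r: "nc_mult x a \<in> closure I" if "x \<in> closure I" "a \<in> carrier (nc_ring n)" for a x
  proof (rule closure_invariant[OF _ _ that(1)])
    show "continuous_on UNIV (\<lambda>x. nc_mult x a)"
      unfolding nc_mult_def
      by (intro continuous_on_coordinatewise_then_product continuous_intros continuous_on_coord)
    show "nc_mult y a \<in> closure I" if "y \<in> I" for y
      using I.I_r_closed[OF that \<open>a \<in> _\<close>] by (auto intro!: IJ simp: nc_ring_def)
  qed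
  have zero: "\<zero>\<^bsub>nc_ring n\<^esub> \<in> closure I" by (intro IJ I.zero_closed)
  have minus: "\<ominus>\<^bsub>nc_ring n\<^esub> x \<in> closure I" if "x \<in> closure I" for x
  proof -
    have "\<ominus>\<^bsub>nc_ring n\<^esub> x = (\<ominus>\<^bsub>nc_ring n\<^esub> \<one>\<^bsub>nc_ring n\<^esub>) \<otimes>\<^bsub>nc_ring n\<^esub> x"
      using that sub by (simp add: R.l_minus subset_iff)
    also have "\<dots> \<in> closure I"
      using l[OF that, of "\<ominus>\<^bsub>nc_ring n\<^esub> \<one>\<^bsub>nc_ring n\<^esub>"] R.a_inv_closed[OF R.one_closed]
      by (simp add: nc_ring_def)
    finally show ?thesis .
  qed
  have "subgroup (closure I) (add_monoid (nc_ring n))"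
    using sub add zero minus
    by (intro R.add.subgroupI) (auto simp: nc_ring_def a_inv_def)
  then have "ideal (closure I) (nc_ring n)"
    using l r by (intro idealI nc_ring_ring) (auto simp: nc_ring_def)
  then show ?thesis by (simp add: J)
qed

lemma B_hat_ring: "ring (B_hat n)"
  unfolding B_hat_def by (rule ideal.quotient_is_ring[OF braid_ideal_ideal])

end

theory Submission
  imports Defs "HOL-Complex_Analysis.Complex_Analysis" "HOL-Library.Multiset" "HOL-Library.Function_Algebras" "HOL-Real_Asymp.Real_Asymp"
begin

text \<open>
  The quotient by the braid ideal is graded with finite-dimensional pieces, so that choosing a linear
  normal form turns the equation into a triangular system for the coefficients of words, which is
  solved by induction on the length of the word. Each step asks for a primitive of a closed form;
  that the form is closed is the integrability of \<open>\<Omega>\<close>, a consequence of the braid relations and of the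
  Arnold relations between the \<open>d log (z\<^sub>i - z\<^sub>j)\<close>.

  At the vertex of a triangulation \<open>\<alpha>\<close>, the \<open>u\<^sub>c\<close> with \<open>c \<in> \<alpha>\<close> are coordinates, the other \<open>u\<^sub>c\<close> are units, and
  \<open>\<Omega>\<close> has the logarithmic poles \<open>\<delta>\<^sub>c du\<^sub>c / u\<^sub>c\<close>, where the \<open>\<delta>\<^sub>c\<close> commute. So \<open>f exp (\<Sum>\<^sub>c \<delta>\<^sub>c log u\<^sub>c)\<close> is a
  solution iff \<open>df = \<Omega> f - f \<Sum>\<^sub>c \<delta>\<^sub>c d log u\<^sub>c\<close>, which has a unique power series solution with \<open>f = 1\<close> at
  the vertex. It continues along the universal covering, where the system is solved by patching local
  primitives. Two normalised solutions differ in the lowest degree by a constant, which vanishes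
  in the limit at the vertex.
\<close>

section \<open>Power series in several variables\<close>

text \<open>Holomorphy is phrased through power series on polydiscs because the form has poles along
  the coordinate hyperplanes. On coefficients a logarithmic equation
  \<open>x i * dp i g x = b i x\<close> is a division by exponents, and for a closed form the only
  obstruction is a nonzero value at the origin. Identities are proved where no coordinate vanishes,
  hence where a chart lands in \<open>M0\<close>, and extended by continuity.

  The obstacle at a vertex is that a chart has to be produced from the equations of
  \<open>M_delta\<close>. The contraction imposes the equations of the chords outside the
  triangulation. Those of its own chords follow from the identity theorem, started at explicit
  configurations close to the vertex.

  One notion of chart serves vertices and points of \<open>M0\<close>; in the latter case the polar
  part is zero. Solutions come from a sequence in which every term solves the equation with its
  predecessor on the right. Since a letter lengthens words, the diagonal of the sequence is an exact
  solution and no limit of series is taken.\<close>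

definition pd :: "nat set set \<Rightarrow> real \<Rightarrow> (nat set \<Rightarrow> complex) set" where
  "pd Z r = {x. (\<forall>c\<in>Z. cmod (x c) < r) \<and> (\<forall>c. c \<notin> Z \<longrightarrow> x c = 0)}"

definition mon :: "nat set multiset \<Rightarrow> (nat set \<Rightarrow> complex) \<Rightarrow> complex" where
  "mon m x = (\<Prod>c\<in>#m. x c)"

definition msets :: "nat set set \<Rightarrow> nat set multiset set" where
  "msets Z = {m. set_mset m \<subseteq> Z}"

text \<open>\<open>has_sum\<close> is unconditional, so over the complex numbers convergence at a
  point is absolute. Exponents are multisets: monomials multiply by adding them, and induction on a
  multiset adds one variable at a time.\<close>

definition ps :: "nat set set \<Rightarrow> real \<Rightarrow> (nat set multiset \<Rightarrow> complex) \<Rightarrow>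
    ((nat set \<Rightarrow> complex) \<Rightarrow> complex) \<Rightarrow> bool" where
  "ps Z r a F \<longleftrightarrow> (\<forall>x\<in>pd Z r. ((\<lambda>m. a m * mon m x) has_sum F x) (msets Z))"

definition hol :: "nat set set \<Rightarrow> real \<Rightarrow> ((nat set \<Rightarrow> complex) \<Rightarrow> complex) \<Rightarrow> bool" where
  "hol Z r F \<longleftrightarrow> (\<exists>a. ps Z r a F)"

text \<open>A bound on the weighted l1 norm of the coefficients at the full radius. This norm is
  submultiplicative and dominates the values, so estimates pass to series of functions as in a
  Banach algebra.\<close>

definition psn :: "nat set set \<Rightarrow> real \<Rightarrow> real \<Rightarrow> ((nat set \<Rightarrow> complex) \<Rightarrow> complex) \<Rightarrow> bool" where
  "psn Z r K F \<longleftrightarrow> (\<exists>a. (\<lambda>m. cmod (a m) * r ^ size m) summable_on msets Z \<and>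
     (\<Sum>\<^sub>\<infinity>m\<in>msets Z. cmod (a m) * r ^ size m) \<le> K \<and> ps Z r a F)"

lemma mon_simps [simp]: "mon {#} x = 1" "mon (add_mset c m) x = x c * mon m x"
  "mon (m + m') x = mon m x * mon m' x"
  by (auto simp: mon_def)

lemma msets_simps [simp]: "{#} \<in> msets Z" "add_mset c m \<in> msets Z \<longleftrightarrow> c \<in> Z \<and> m \<in> msets Z"
  "m + m' \<in> msets Z \<longleftrightarrow> m \<in> msets Z \<and> m' \<in> msets Z"
  by (auto simp: msets_def)

lemma msets_subset: "m \<in> msets Z ==> k \<subseteq># m ==> k \<in> msets Z"
  by (auto simp: msets_def dest: mset_subset_eqD)

lemma norm_mon_le:
  assumes "m \<in> msets Z" "\<And>c. c \<in> Z ==> cmod (x c) \<le> \<rho>"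
  shows "cmod (mon m x) \<le> \<rho> ^ size m"
  using assms(1)
proof (induction m)
  case (add c m)
  then have "0 \<le> \<rho>" using order_trans[OF norm_ge_zero assms(2)[of c]] by simp
  with add show ?case by (auto simp: norm_mult intro!: mult_mono assms(2))
qed auto

lemma pd_radius:
  assumes "finite Z" "0 < r" "x \<in> pd Z r"
  obtains \<rho> where "0 < \<rho>" "\<rho> < r" "\<And>c. c \<in> Z ==> cmod (x c) \<le> \<rho>"
proof
  \<comment> \<open>Inserting \<open>r/2\<close> keeps the maximum defined and positive when all
    coordinates are zero or \<open>Z\<close> is empty.\<close>
  define \<rho> where "\<rho> = Max (insert (r/2) ((\<lambda>c. cmod (x c)) ` Z))"
  have f: "finite (insert (r/2) ((\<lambda>c. cmod (x c)) ` Z))" using assms(1) by auto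
  have "\<forall>a\<in>insert (r/2) ((\<lambda>c. cmod (x c)) ` Z). a < r" using assms by (auto simp: pd_def)
  then show "\<rho> < r" unfolding \<rho>_def using Max_less_iff[OF f] by blast
  have "r/2 \<le> \<rho>" unfolding \<rho>_def using f by (intro Max_ge) auto
  then show "0 < \<rho>" using assms by auto
  show "cmod (x c) \<le> \<rho>" if "c \<in> Z" for c unfolding \<rho>_def using f that by (intro Max_ge) auto
qed

lemma mon_const: "m \<in> msets Z ==> mon m (\<lambda>c. if c \<in> Z then t else 0) = t ^ size m"
  by (induction m) auto

lemma zero_in_pd [simp]: "0 < r ==> (\<lambda>c. 0) \<in> pd Z r"
  by (auto simp: pd_def)

text \<open>At the point with all coordinates equal to \<rho> a monomial takes the value
  \<open>\<rho> ^ size m\<close>, and unconditional summability there is absolute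
  summability.\<close>

lemma ps_abs_summable:
  assumes "ps Z r a F" "0 \<le> \<rho>" "\<rho> < r"
  shows "(\<lambda>m. cmod (a m) * \<rho> ^ size m) summable_on msets Z"
proof -
  define x :: "nat set \<Rightarrow> complex" where "x = (\<lambda>c. if c \<in> Z then of_real \<rho> else 0)"
  have "x \<in> pd Z r" using assms by (auto simp: x_def pd_def)
  then have "(\<lambda>m. a m * mon m x) summable_on msets Z"
    using assms(1) by (auto simp: ps_def summable_on_def)
  then have "(\<lambda>m. cmod (a m * mon m x)) summable_on msets Z"
    by (rule iffD1[OF summable_on_iff_abs_summable_on_complex])
  then show ?thesis
    by (rule summable_on_cong[THEN iffD1, rotated])
      (use assms in \<open>simp add: x_def mon_const norm_mult norm_power\<close>)
qed

lemma psI: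
  assumes "finite Z" "0 < r"
    and "\<And>\<rho>. 0 < \<rho> ==> \<rho> < r ==> (\<lambda>m. cmod (a m) * \<rho> ^ size m) summable_on msets Z"
    and "\<And>x. x \<in> pd Z r ==> F x = (\<Sum>\<^sub>\<infinity>m\<in>msets Z. a m * mon m x)"
  shows "ps Z r a F"
  unfolding ps_def
proof
  fix x assume x: "x \<in> pd Z r"
  obtain \<rho> where \<rho>: "0 < \<rho>" "\<rho> < r" "\<And>c. c \<in> Z ==> cmod (x c) \<le> \<rho>"
    using pd_radius[OF assms(1,2) x] by blast
  have "(\<lambda>m. norm (a m * mon m x)) summable_on msets Z"
    by (rule summable_on_comparison_test[OF assms(3)[OF \<rho>(1,2)]])
      (use norm_mon_le[of _ Z x, OF _ \<rho>(3)] in \<open>auto simp: norm_mult intro!: mult_left_mono\<close>)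
  then show "((\<lambda>m. a m * mon m x) has_sum F x) (msets Z)"
    unfolding assms(4)[OF x] by (rule has_sum_infsum[OF abs_summable_summable])
qed

lemma ps_infsum: "ps Z r a F ==> x \<in> pd Z r ==> F x = (\<Sum>\<^sub>\<infinity>m\<in>msets Z. a m * mon m x)"
  by (auto simp: ps_def infsumI)

lemma abs_summable_times:
  fixes f :: "'a \<Rightarrow> 'c::{banach,real_normed_field}"
  assumes "(\<lambda>x. norm (f x)) summable_on A" "(\<lambda>x. norm (g x)) summable_on B"
  shows "(\<lambda>z. norm (case z of (x,y) \<Rightarrow> f x * g y)) summable_on (A \<times> B)"
proof -
  have "(\<lambda>x. norm (f x) * (\<Sum>\<^sub>\<infinity>y\<in>B. norm (g y))) summable_on A"
    by (rule summable_on_cmult_left[OF assms(1)])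
  moreover have "(\<lambda>y. norm (f x) * norm (g y)) summable_on B" for x
    by (rule summable_on_cmult_right[OF assms(2)])
  ultimately show ?thesis
    unfolding Infinite_Sum.abs_summable_on_Sigma_iff
    by (simp add: norm_mult infsum_cmult_right' abs_mult infsum_nonneg)
qed

lemma has_sum_times:
  fixes f :: "'a \<Rightarrow> 'c::{banach,real_normed_field}"
  assumes "(f has_sum s) A" "(g has_sum t) B" "(\<lambda>x. norm (f x)) summable_on A" "(\<lambda>x. norm (g x)) summable_on B"
  shows "((\<lambda>(x,y). f x * g y) has_sum (s * t)) (A \<times> B)"
proof (rule has_sum_SigmaI)
  show "(\<lambda>(x,y). f x * g y) summable_on (A \<times> B)"
    by (rule abs_summable_summable[OF abs_summable_times[OF assms(3,4)]])
  show "((\<lambda>x. f x * t) has_sum s * t) A" by (rule has_sum_cmult_left[OF assms(1)])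
  show "((\<lambda>y. case (x, y) of (x, y) \<Rightarrow> f x * g y) has_sum f x * t) B" for x
    using has_sum_cmult_right[OF assms(2)] by simp
qed

lemma finite_sub_mset: "finite {k. k \<subseteq># (m :: 'a multiset)}"
proof (induction m)
  case (add c m)
  have "{k. k \<subseteq># add_mset c m} \<subseteq> {k. k \<subseteq># m} \<union> add_mset c ` {k. k \<subseteq># m}"
  proof
    fix k assume k: "k \<in> {k. k \<subseteq># add_mset c m}"
    show "k \<in> {k. k \<subseteq># m} \<union> add_mset c ` {k. k \<subseteq># m}"
    proof (cases "c \<in># k")
      case True
      then obtain k' where "k = add_mset c k'" by (meson mset_add)
      then show ?thesis using k by auto
    next
      case False
      then have "count k a \<le> count m a" for a
        using k by (cases "a = c") (auto simp: subseteq_mset_def not_in_iff dest: spec[of _ a])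
      then show ?thesis by (auto simp: subseteq_mset_def)
    qed
  qed
  then show ?case using add finite_subset by blast
qed auto

text \<open>Cauchy product: the pairs \<open>(k, l)\<close> of \<open>has_sum_times\<close> are
  reindexed as \<open>(k + l, k)\<close>, with finitely many \<open>k\<close> for each sum.\<close>

lemma has_sum_conv:
  fixes f :: "nat set multiset \<Rightarrow> 'c::{banach,real_normed_field}"
  assumes "(f has_sum s) (msets Z)" "(g has_sum t) (msets Z)"
    "(\<lambda>x. norm (f x)) summable_on msets Z" "(\<lambda>x. norm (g x)) summable_on msets Z"
  shows "((\<lambda>m. \<Sum>k | k \<subseteq># m. f k * g (m - k)) has_sum (s * t)) (msets Z)"
proof (rule has_sum_SigmaD)
  have "((\<lambda>(m,k). f k * g (m - k)) has_sum s * t) (SIGMA m:msets Z. {k. k \<subseteq># m}) \<longleftrightarrow>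
     ((\<lambda>(x,y). f x * g y) has_sum (s * t)) (msets Z \<times> msets Z)"
    by (rule has_sum_reindex_bij_witness[where i="\<lambda>(k,l). (k + l, k)" and j="\<lambda>(m,k). (k, m - k)"])
      (auto intro: msets_subset)
  then show "((\<lambda>(m,k). f k * g (m - k)) has_sum s * t) (SIGMA m:msets Z. {k. k \<subseteq># m})"
    using has_sum_times[OF assms] by blast
  show "((\<lambda>y. case (m, y) of (m, k) \<Rightarrow> f k * g (m - k)) has_sum
      (\<Sum>k | k \<subseteq># m. f k * g (m - k))) {k. k \<subseteq># m}" for m
    by (auto intro!: has_sum_finiteI finite_sub_mset)
qed

lemma ps_mult:
  assumes "ps Z r a F" "ps Z r b G"
  shows "ps Z r (\<lambda>m. \<Sum>k | k \<subseteq># m. a k * b (m - k)) (\<lambda>x. F x * G x)"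
  unfolding ps_def
proof
  fix x assume x: "x \<in> pd Z r"
  have 1: "((\<lambda>m. a m * mon m x) has_sum F x) (msets Z)" "((\<lambda>m. b m * mon m x) has_sum G x) (msets Z)"
    using assms x by (auto simp: ps_def)
  have "((\<lambda>m. \<Sum>k | k \<subseteq># m. (a k * mon k x) * (b (m - k) * mon (m - k) x)) has_sum (F x * G x)) (msets Z)"
    using 1 by (intro has_sum_conv)
      (auto intro: has_sum_imp_summable iffD1[OF summable_on_iff_abs_summable_on_complex])
  also have "(\<lambda>m. \<Sum>k | k \<subseteq># m. (a k * mon k x) * (b (m - k) * mon (m - k) x)) =
     (\<lambda>m. (\<Sum>k | k \<subseteq># m. a k * b (m - k)) * mon m x)"
  proof
    fix m
    have "mon m x = mon k x * mon (m - k) x" if "k \<subseteq># m" for k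
      using that by (metis mon_simps(3) subset_mset.add_diff_inverse)
    then show "(\<Sum>k | k \<subseteq># m. (a k * mon k x) * (b (m - k) * mon (m - k) x)) =
      (\<Sum>k | k \<subseteq># m. a k * b (m - k)) * mon m x"
      by (auto simp: sum_distrib_right intro!: sum.cong)
  qed
  finally show "((\<lambda>m. (\<Sum>k | k \<subseteq># m. a k * b (m - k)) * mon m x) has_sum (F x * G x)) (msets Z)" .
qed

lemma ps_cong: "ps Z r a F ==> (\<And>x. x \<in> pd Z r ==> F x = G x) ==> ps Z r a G"
  by (simp add: ps_def)

lemma ps_add: "ps Z r a F ==> ps Z r b G ==> ps Z r (\<lambda>m. a m + b m) (\<lambda>x. F x + G x)"
  by (auto simp: ps_def ring_distribs intro!: has_sum_add)

lemma ps_cmult: "ps Z r a F ==> ps Z r (\<lambda>m. k * a m) (\<lambda>x. k * F x)"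
  by (auto simp: ps_def mult.assoc intro!: has_sum_cmult_right)

lemma ps_const: "ps Z r (\<lambda>m. if m = {#} then k else 0) (\<lambda>x. k)"
  unfolding ps_def by (auto intro!: has_sum_finite_neutralI[where B="{{#}}"] split: if_splits)

lemma ps_coord:
  assumes "c \<in> Z" shows "ps Z r (\<lambda>m. if m = {#c#} then 1 else 0) (\<lambda>x. x c)"
  unfolding ps_def using assms by (auto intro!: has_sum_finite_neutralI[where B="{{#c#}}"] split: if_splits)

lemma hol_cong: "hol Z r F ==> (\<And>x. x \<in> pd Z r ==> F x = G x) ==> hol Z r G"
  by (meson hol_def ps_cong)

lemma hol_const [simp]: "hol Z r (\<lambda>x. k)"
  using ps_const hol_def by blast

lemma hol_coord: "c \<in> Z ==> hol Z r (\<lambda>x. x c)"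
  using ps_coord hol_def by blast

lemma hol_add: "hol Z r F ==> hol Z r G ==> hol Z r (\<lambda>x. F x + G x)"
  unfolding hol_def using ps_add by blast

lemma hol_mult: "hol Z r F ==> hol Z r G ==> hol Z r (\<lambda>x. F x * G x)"
  unfolding hol_def using ps_mult by blast

lemma hol_minus: "hol Z r F ==> hol Z r (\<lambda>x. - F x)"
  using hol_mult[OF hol_const[of Z r "-1"]] by simp

lemma hol_diff: "hol Z r F ==> hol Z r G ==> hol Z r (\<lambda>x. F x - G x)"
  using hol_add[OF _ hol_minus] by simp

lemma hol_sum: "(\<And>i. i \<in> I ==> hol Z r (F i)) ==> hol Z r (\<lambda>x. \<Sum>i\<in>I. F i x)"
  by (induction I rule: infinite_finite_induct) (auto intro: hol_add)

lemma hol_prod: "(\<And>i. i \<in> I ==> hol Z r (F i)) ==> hol Z r (\<lambda>x. \<Prod>i\<in>I. F i x)"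
  by (induction I rule: infinite_finite_induct) (auto intro: hol_mult)

section \<open>Weighted norms of coefficients\<close>

lemma psnI:
  assumes "(\<lambda>m. cmod (a m) * r ^ size m) summable_on msets Z"
    and "(\<Sum>\<^sub>\<infinity>m\<in>msets Z. cmod (a m) * r ^ size m) \<le> K" and "ps Z r a F"
  shows "psn Z r K F"
  unfolding psn_def using assms by (intro exI[of _ a] conjI)

lemma psn_hol: "psn Z r K F ==> hol Z r F"
  unfolding psn_def hol_def by blast

lemma psn_mono: "psn Z r K F ==> K \<le> K' ==> psn Z r K' F"
  unfolding psn_def using order_trans by blast

lemma psn_const: "cmod k \<le> K ==> psn Z r K (\<lambda>x. k)"
proof -
  assume k: "cmod k \<le> K"
  have "((\<lambda>m. cmod (if m = {#} then k else 0) * r ^ size m) has_sum cmod k) (msets Z)"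
    by (rule has_sum_finite_neutralI[where B="{{#}}"]) (auto split: if_splits)
  from has_sum_imp_summable[OF this] infsumI[OF this] show ?thesis
    unfolding psn_def using k ps_const[of Z r k]
    by (intro exI[of _ "\<lambda>m. if m = {#} then k else 0"]) simp
qed

lemma psn_coord: "c \<in> Z ==> psn Z r r (\<lambda>x. x c)"
proof -
  assume c: "c \<in> Z"
  have "((\<lambda>m. cmod (if m = {#c#} then 1 else 0) * r ^ size m) has_sum r) (msets Z)"
    by (rule has_sum_finite_neutralI[where B="{{#c#}}"]) (use c in \<open>auto split: if_splits\<close>)
  from has_sum_imp_summable[OF this] infsumI[OF this] show ?thesis
    unfolding psn_def using ps_coord[OF c, of r]
    by (intro exI[of _ "\<lambda>m. if m = {#c#} then 1 else 0"]) simp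
qed

lemma psn_add:
  assumes "psn Z r K F" "psn Z r L G" "0 \<le> r"
  shows "psn Z r (K + L) (\<lambda>x. F x + G x)"
proof -
  obtain a b where a: "(\<lambda>m. cmod (a m) * r ^ size m) summable_on msets Z"
      "(\<Sum>\<^sub>\<infinity>m\<in>msets Z. cmod (a m) * r ^ size m) \<le> K" "ps Z r a F"
    and b: "(\<lambda>m. cmod (b m) * r ^ size m) summable_on msets Z"
      "(\<Sum>\<^sub>\<infinity>m\<in>msets Z. cmod (b m) * r ^ size m) \<le> L" "ps Z r b G"
    using assms unfolding psn_def by blast
  have le: "cmod (a m + b m) * r ^ size m \<le> cmod (a m) * r ^ size m + cmod (b m) * r ^ size m" for m
    using norm_triangle_ineq[of "a m" "b m"] assms(3)
    by (metis distrib_right mult_right_mono zero_le_power)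
  have s: "(\<lambda>m. cmod (a m) * r ^ size m + cmod (b m) * r ^ size m) summable_on msets Z"
    by (rule summable_on_add[OF a(1) b(1)])
  have s2: "(\<lambda>m. cmod (a m + b m) * r ^ size m) summable_on msets Z"
    by (rule summable_on_comparison_test[OF s le]) (use assms in auto)
  have "(\<Sum>\<^sub>\<infinity>m\<in>msets Z. cmod (a m + b m) * r ^ size m) \<le> K + L"
    using infsum_mono[OF s2 s le] infsum_add[OF a(1) b(1)] a(2) b(2) by linarith
  then show ?thesis by (rule psnI[OF s2 _ ps_add[OF a(3) b(3)]])
qed

lemma psn_mult:
  assumes "psn Z r K F" "psn Z r L G" "0 \<le> r"
  shows "psn Z r (K * L) (\<lambda>x. F x * G x)"
proof -
  obtain a b where a: "(\<lambda>m. cmod (a m) * r ^ size m) summable_on msets Z"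
      "(\<Sum>\<^sub>\<infinity>m\<in>msets Z. cmod (a m) * r ^ size m) \<le> K" "ps Z r a F"
    and b: "(\<lambda>m. cmod (b m) * r ^ size m) summable_on msets Z"
      "(\<Sum>\<^sub>\<infinity>m\<in>msets Z. cmod (b m) * r ^ size m) \<le> L" "ps Z r b G"
    using assms unfolding psn_def by blast
  define s where "s = (\<Sum>\<^sub>\<infinity>m\<in>msets Z. cmod (a m) * r ^ size m)"
  define t where "t = (\<Sum>\<^sub>\<infinity>m\<in>msets Z. cmod (b m) * r ^ size m)"
  have n: "norm (cmod z * r ^ j) = cmod z * r ^ j" for z j using assms(3) by simp
  have hs: "((\<lambda>m. \<Sum>k | k \<subseteq># m. (cmod (a k) * r ^ size k) * (cmod (b (m - k)) * r ^ size (m - k)))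
      has_sum (s * t)) (msets Z)"
    by (rule has_sum_conv) (unfold n s_def t_def, use a(1) b(1) in \<open>auto intro: has_sum_infsum\<close>)
  let ?c = "\<lambda>m. \<Sum>k | k \<subseteq># m. a k * b (m - k)"
  have le: "cmod (?c m) * r ^ size m
      \<le> (\<Sum>k | k \<subseteq># m. (cmod (a k) * r ^ size k) * (cmod (b (m - k)) * r ^ size (m - k)))" for m
  proof -
    have e: "r ^ size k * r ^ size (m - k) = r ^ size m" if "k \<subseteq># m" for k
      using that by (metis power_add size_union subset_mset.add_diff_inverse)
    have "cmod (?c m) * r ^ size m \<le> (\<Sum>k | k \<subseteq># m. cmod (a k * b (m - k))) * r ^ size m"
      by (intro mult_right_mono norm_sum) (use assms(3) in auto)
    also have "\<dots> = (\<Sum>k | k \<subseteq># m. (cmod (a k) * r ^ size k) * (cmod (b (m - k)) * r ^ size (m - k)))"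
      unfolding sum_distrib_right by (intro sum.cong) (auto simp: norm_mult mult_ac simp flip: e)
    finally show ?thesis .
  qed
  have s2: "(\<lambda>m. cmod (?c m) * r ^ size m) summable_on msets Z"
    by (rule summable_on_comparison_test[OF has_sum_imp_summable[OF hs] le]) (use assms in auto)
  have "(\<Sum>\<^sub>\<infinity>m\<in>msets Z. cmod (?c m) * r ^ size m) \<le> s * t"
    using infsum_mono[OF s2 has_sum_imp_summable[OF hs] le] infsumI[OF hs] by simp
  also have "\<dots> \<le> K * L"
  proof (rule mult_mono)
    show t0: "0 \<le> t" unfolding t_def using assms by (auto intro: infsum_nonneg)
    have "0 \<le> s" unfolding s_def using assms by (auto intro: infsum_nonneg)
    then show "0 \<le> K" using a by (simp add: s_def)
  qed (use a b in \<open>auto simp: s_def t_def\<close>)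
  finally show ?thesis by (rule psnI[OF s2 _ ps_mult[OF a(3) b(3)]])
qed

lemma psn_minus: "psn Z r K F ==> 0 \<le> r ==> psn Z r K (\<lambda>x. - F x)"
  using psn_mult[OF psn_const[of "-1" 1 Z r]] by simp

lemma psn_diff: "psn Z r K F ==> psn Z r L G ==> 0 \<le> r ==> psn Z r (K + L) (\<lambda>x. F x - G x)"
  using psn_add[OF _ psn_minus] by simp

lemma psn_prod:
  assumes "finite I" "\<And>i. i \<in> I ==> psn Z r K (F i)" "0 \<le> r"
  shows "psn Z r (K ^ card I) (\<lambda>x. \<Prod>i\<in>I. F i x)"
  using assms(1,2)
proof (induction I)
  case (insert i I)
  then show ?case using psn_mult[OF insert(4)[of i] insert(3)] assms(3) by simp
qed (auto intro: psn_const)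

lemma psn_bound:
  assumes "psn Z r K F" "x \<in> pd Z r"
  shows "cmod (F x) \<le> K"
proof -
  obtain a where a: "(\<lambda>m. cmod (a m) * r ^ size m) summable_on msets Z"
      "(\<Sum>\<^sub>\<infinity>m\<in>msets Z. cmod (a m) * r ^ size m) \<le> K" "ps Z r a F"
    using assms unfolding psn_def by blast
  have le: "cmod (a m * mon m x) \<le> cmod (a m) * r ^ size m" if "m \<in> msets Z" for m
    using norm_mon_le[OF that, of x r] assms(2)
    by (auto simp: norm_mult pd_def less_imp_le intro!: mult_left_mono)
  have s: "(\<lambda>m. cmod (a m * mon m x)) summable_on msets Z"
    by (rule summable_on_comparison_test[OF a(1) le]) auto
  have "cmod (F x) \<le> (\<Sum>\<^sub>\<infinity>m\<in>msets Z. cmod (a m * mon m x))"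
    unfolding ps_infsum[OF a(3) assms(2)] by (rule norm_infsum_bound[OF s])
  also have "\<dots> \<le> (\<Sum>\<^sub>\<infinity>m\<in>msets Z. cmod (a m) * r ^ size m)" by (rule infsum_mono[OF s a(1) le])
  finally show ?thesis using a(2) by simp
qed

text \<open>The sums over \<open>N\<close> and over exponents are exchanged twice: for the
  nonnegative majorant, which bounds the norm of the summed coefficients, and then for the series at
  a point.\<close>

lemma psn_suminf:
  assumes psn: "\<And>N. psn Z r (K N) (F N)" and K: "summable K" and r: "0 < r"
  shows "psn Z r (suminf K) (\<lambda>x. \<Sum>N. F N x)" "x \<in> pd Z r ==> (\<lambda>N. F N x) sums (\<Sum>N. F N x)"
proof -
  have "\<forall>N. \<exists>a. (\<lambda>m. cmod (a m) * r ^ size m) summable_on msets Z \<and>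
      (\<Sum>\<^sub>\<infinity>m\<in>msets Z. cmod (a m) * r ^ size m) \<le> K N \<and> ps Z r a (F N)"
    using psn unfolding psn_def by blast
  from choice[OF this] obtain a where "\<forall>N. (\<lambda>m. cmod (a N m) * r ^ size m) summable_on msets Z \<and>
      (\<Sum>\<^sub>\<infinity>m\<in>msets Z. cmod (a N m) * r ^ size m) \<le> K N \<and> ps Z r (a N) (F N)" ..
  then have a: "\<And>N. (\<lambda>m. cmod (a N m) * r ^ size m) summable_on msets Z"
      "\<And>N. (\<Sum>\<^sub>\<infinity>m\<in>msets Z. cmod (a N m) * r ^ size m) \<le> K N" "\<And>N. ps Z r (a N) (F N)"
    by blast+
  define S where "S = (\<lambda>N. \<Sum>\<^sub>\<infinity>m\<in>msets Z. cmod (a N m) * r ^ size m)"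
  have S0: "0 \<le> S N" for N unfolding S_def using r by (auto intro: infsum_nonneg)
  have Ssum: "summable S"
    by (rule summable_comparison_test'[OF K, of 0]) (use S0 a(2) in \<open>auto simp: S_def\<close>)
  have Son: "S summable_on UNIV" using Ssum S0 by (simp add: summable_on_UNIV_nonneg_real_iff)
  have nn: "norm (cmod z * r ^ j) = cmod z * r ^ j" for z j using r by simp
  let ?n = "\<lambda>z. case z of (N, m) \<Rightarrow> cmod (a N m) * r ^ size m"
  have "(\<lambda>z. norm (?n z)) summable_on (UNIV \<times> msets Z)"
    unfolding Infinite_Sum.abs_summable_on_Sigma_iff
    using a(1) Son S0 r by (simp add: S_def infsum_nonneg)
  then have ab: "?n summable_on (UNIV \<times> msets Z)"
    by (rule abs_summable_summable)
  define \<alpha> where "\<alpha> = (\<lambda>m. \<Sum>\<^sub>\<infinity>N. a N m)"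
  define T where "T = (\<lambda>m. \<Sum>\<^sub>\<infinity>N. cmod (a N m) * r ^ size m)"
  have ab2: "(\<lambda>(m, N). cmod (a N m) * r ^ size m) summable_on (msets Z \<times> UNIV)"
    using iffD1[OF summable_on_swap ab] by simp
  have inner: "(\<lambda>N. cmod (a N m) * r ^ size m) summable_on UNIV" if "m \<in> msets Z" for m
    using summable_on_SigmaD1[OF ab2 that] .
  have am: "(\<lambda>N. cmod (a N m)) summable_on UNIV" if "m \<in> msets Z" for m
    using summable_on_cmult_left[OF inner[OF that], of "inverse (r ^ size m)"] r
    by (simp add: field_simps)
  have Ttot: "(T has_sum (\<Sum>\<^sub>\<infinity>z\<in>msets Z \<times> UNIV. case z of (m, N) \<Rightarrow> cmod (a N m) * r ^ size m)) (msets Z)"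
    by (rule has_sum_SigmaD[OF has_sum_infsum[OF ab2]]) (use inner in \<open>auto simp: T_def intro!: has_sum_infsum\<close>)
  have Stot: "(S has_sum (\<Sum>\<^sub>\<infinity>z\<in>UNIV \<times> msets Z. ?n z)) UNIV"
    by (rule has_sum_SigmaD[OF has_sum_infsum[OF ab]]) (use a(1) in \<open>auto simp: S_def intro!: has_sum_infsum\<close>)
  have eq: "(\<Sum>\<^sub>\<infinity>z\<in>msets Z \<times> UNIV. case z of (m, N) \<Rightarrow> cmod (a N m) * r ^ size m) = (\<Sum>\<^sub>\<infinity>z\<in>UNIV \<times> msets Z. ?n z)"
    by (rule infsumI, subst has_sum_swap) (use has_sum_infsum[OF ab] in \<open>simp add: case_prod_unfold\<close>)
  have le: "cmod (\<alpha> m) * r ^ size m \<le> T m" if "m \<in> msets Z" for m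
  proof -
    have "cmod (\<alpha> m) \<le> (\<Sum>\<^sub>\<infinity>N. cmod (a N m))" unfolding \<alpha>_def
      by (rule norm_infsum_bound) (use am[OF that] in auto)
    then have "cmod (\<alpha> m) * r ^ size m \<le> (\<Sum>\<^sub>\<infinity>N. cmod (a N m)) * r ^ size m"
      using r by (intro mult_right_mono) auto
    also have "\<dots> = T m" unfolding T_def by (rule infsum_cmult_left'[symmetric])
    finally show ?thesis .
  qed
  have s2: "(\<lambda>m. cmod (\<alpha> m) * r ^ size m) summable_on msets Z"
    by (rule summable_on_comparison_test[OF has_sum_imp_summable[OF Ttot] le]) (use r in auto)
  have "(\<Sum>\<^sub>\<infinity>m\<in>msets Z. cmod (\<alpha> m) * r ^ size m) \<le> suminf S"
    using infsum_mono[OF s2 has_sum_imp_summable[OF Ttot] le] infsumI[OF Ttot] eq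
      sums_unique[OF has_sum_imp_sums[OF Stot]] by simp
  also have "\<dots> \<le> suminf K" using Ssum K a(2) by (intro suminf_le) (auto simp: S_def)
  finally have tot: "(\<Sum>\<^sub>\<infinity>m\<in>msets Z. cmod (\<alpha> m) * r ^ size m) \<le> suminf K" .
  have main: "(\<lambda>N. F N x) sums (\<Sum>N. F N x) \<and> ((\<lambda>m. \<alpha> m * mon m x) has_sum (\<Sum>N. F N x)) (msets Z)"
    if x: "x \<in> pd Z r" for x
  proof -
    let ?f = "\<lambda>z. case z of (N, m) \<Rightarrow> a N m * mon m x"
    have "(\<lambda>z. norm (?f z)) summable_on (UNIV \<times> msets Z)"
    proof (rule summable_on_comparison_test[OF ab])
      fix z :: "nat \<times> nat set multiset" assume "z \<in> UNIV \<times> msets Z"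
      then show "norm (?f z) \<le> ?n z"
        using norm_mon_le[of "snd z" Z x r] x
        by (auto simp: norm_mult pd_def less_imp_le intro!: mult_left_mono)
    qed auto
    then have f: "?f summable_on (UNIV \<times> msets Z)" by (rule abs_summable_summable)
    have 1: "((\<lambda>N. F N x) has_sum infsum ?f (UNIV \<times> msets Z)) UNIV"
      by (rule has_sum_SigmaD[OF has_sum_infsum[OF f]]) (use a(3) x in \<open>auto simp: ps_def\<close>)
    have eq: "(\<Sum>N. F N x) = infsum ?f (UNIV \<times> msets Z)"
      using sums_unique[OF has_sum_imp_sums[OF 1]] by simp
    have "((\<lambda>(m, N). a N m * mon m x) has_sum infsum ?f (UNIV \<times> msets Z)) (msets Z \<times> UNIV)"
      using has_sum_infsum[OF f] by (subst has_sum_swap) (simp add: case_prod_unfold)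
    then have "((\<lambda>m. \<alpha> m * mon m x) has_sum infsum ?f (UNIV \<times> msets Z)) (msets Z)"
    proof (rule has_sum_SigmaD)
      fix m assume "m \<in> msets Z"
      then show "((\<lambda>N. case (m, N) of (m, N) \<Rightarrow> a N m * mon m x) has_sum \<alpha> m * mon m x) UNIV"
        using abs_summable_summable[OF am] by (auto simp: \<alpha>_def intro!: has_sum_cmult_left)
    qed
    then show ?thesis using has_sum_imp_sums[OF 1] by (simp add: eq)
  qed
  show "psn Z r (suminf K) (\<lambda>x. \<Sum>N. F N x)"
    by (rule psnI[OF s2 tot]) (use main in \<open>simp add: ps_def\<close>)
  show "x \<in> pd Z r ==> (\<lambda>N. F N x) sums (\<Sum>N. F N x)" using main by blast
qed

lemma psn_power: "psn Z r K F ==> 0 \<le> r ==> psn Z r (K ^ N) (\<lambda>x. F x ^ N)"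
  by (induction N) (auto intro: psn_const psn_mult)

text \<open>Geometric series in \<open>F\<close>, whose terms have norms bounded by the powers of
  \<open>K\<close>.\<close>

lemma hol_inverse_one_minus:
  assumes "psn Z r K F" "K < 1" "0 < r"
  shows "hol Z r (\<lambda>x. 1 / (1 - F x))"
proof -
  have K: "0 \<le> K" using psn_bound[OF assms(1) zero_in_pd[OF assms(3)]] norm_ge_zero order_trans by blast
  have "psn Z r (\<Sum>N. K ^ N) (\<lambda>x. \<Sum>N. F x ^ N)"
    using assms K by (intro psn_suminf psn_power) (auto intro: summable_geometric)
  then have "hol Z r (\<lambda>x. \<Sum>N. F x ^ N)" by (rule psn_hol)
  then show ?thesis
  proof (rule hol_cong)
    fix x assume "x \<in> pd Z r"
    then have "cmod (F x) < 1" using psn_bound[OF assms(1)] assms(2) by fastforce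
    then show "(\<Sum>N. F x ^ N) = 1 / (1 - F x)" by (simp add: suminf_geometric)
  qed
qed

section \<open>Differentiation of power series\<close>

lemma has_sum_sum':
  fixes f :: "'i \<Rightarrow> 'a \<Rightarrow> complex"
  assumes "\<And>i. i \<in> I ==> (f i has_sum s i) A"
  shows "((\<lambda>x. \<Sum>i\<in>I. f i x) has_sum (\<Sum>i\<in>I. s i)) A"
  using assms by (induction I rule: infinite_finite_induct) (auto intro: has_sum_add)

text \<open>A factor quadratic in the degree is paid for by a slightly larger radius. With
  \<open>q\<close> the square root of the ratio, it suffices that \<open>(k + 1) * q ^ k\<close> is
  bounded, and this bound is squared.\<close>

lemma polynomial_times_power_bounded:
  assumes "0 < \<rho>" "\<rho> < (\<rho>' :: real)"
  obtains K where "0 < K" "\<And>k. real (Suc k) ^ 2 * \<rho> ^ k \<le> K * \<rho>' ^ k"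
proof -
  define q where "q = sqrt (\<rho> / \<rho>')"
  have q: "0 < q" "q < 1" "q ^ 2 = \<rho> / \<rho>'" using assms by (auto simp: q_def)
  have "(\<lambda>k. real k * q ^ k) \<longlonglongrightarrow> 0" using powser_times_n_limit_0[of q] q by auto
  moreover have "(\<lambda>k. q ^ k) \<longlonglongrightarrow> 0" using q by (intro LIMSEQ_power_zero) auto
  ultimately have "(\<lambda>k. real k * q ^ k + q ^ k) \<longlonglongrightarrow> 0 + 0" by (rule tendsto_add)
  then have "Bseq (\<lambda>k. real k * q ^ k + q ^ k)" by (rule convergent_imp_Bseq[OF convergentI])
  then obtain B where B: "B > 0" "\<And>k. norm (real k * q ^ k + q ^ k) \<le> B" by (auto elim: BseqE)
  have "real (Suc k) ^ 2 * \<rho> ^ k \<le> B ^ 2 * \<rho>' ^ k" for k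
  proof -
    have "(real k * q ^ k + q ^ k) ^ 2 \<le> B ^ 2"
      using B(2)[of k] q by (intro power_mono) auto
    also have "(real k * q ^ k + q ^ k) ^ 2 = real (Suc k) ^ 2 * (q ^ 2) ^ k"
      by (simp add: power2_eq_square algebra_simps power_mult_distrib)
    finally have "real (Suc k) ^ 2 * (\<rho> / \<rho>') ^ k \<le> B ^ 2" unfolding q .
    then show ?thesis using assms by (simp add: power_divide field_simps)
  qed
  then show ?thesis using B(1) that[of "B ^ 2"] by auto
qed

definition dcoeff :: "nat set \<Rightarrow> (nat set multiset \<Rightarrow> complex) \<Rightarrow> nat set multiset \<Rightarrow> complex" where
  "dcoeff c a m = of_nat (Suc (count m c)) * a (add_mset c m)"

lemma count_le_size: "count m c \<le> size m"
  by (metis count_le_replicate_mset_subset_eq order_refl size_mset_mono size_replicate_mset)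

lemma dcoeff_summable:
  assumes "0 < r" "ps Z r a F" "c \<in> Z" "0 < \<rho>" "\<rho> < r"
  shows "(\<lambda>m. cmod (dcoeff c a m) * \<rho> ^ size m) summable_on msets Z"
proof -
  define \<rho>' where "\<rho>' = (\<rho> + r) / 2"
  have \<rho>': "\<rho> < \<rho>'" "\<rho>' < r" "0 < \<rho>'" using assms by (auto simp: \<rho>'_def)
  obtain K where K: "0 < K" "\<And>k. real (Suc k) ^ 2 * \<rho> ^ k \<le> K * \<rho>' ^ k"
    using polynomial_times_power_bounded[OF assms(4) \<rho>'(1)] by blast
  have "(\<lambda>m. cmod (a m) * \<rho>' ^ size m) summable_on (add_mset c ` msets Z)"
    by (rule summable_on_subset[OF ps_abs_summable[OF assms(2)]]) (use assms \<rho>' in auto)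
  then have "((\<lambda>m. cmod (a m) * \<rho>' ^ size m) \<circ> add_mset c) summable_on msets Z"
    by (subst summable_on_reindex[symmetric]) (auto simp: inj_on_def)
  then have 1: "(\<lambda>m. (cmod (a (add_mset c m)) * \<rho>' ^ Suc (size m)) * (K / \<rho>')) summable_on msets Z"
    by (intro summable_on_cmult_left) (simp add: o_def)
  show ?thesis
  proof (rule summable_on_comparison_test[OF 1])
    fix m
    have "real (Suc (count m c)) * \<rho> ^ size m \<le> real (Suc (size m)) ^ 2 * \<rho> ^ size m"
    proof (intro mult_right_mono)
      have "real (Suc (count m c)) \<le> real (Suc (size m))" using count_le_size by simp
      also have "\<dots> \<le> real (Suc (size m)) ^ 2" by (simp add: power2_eq_square)
      finally show "real (Suc (count m c)) \<le> real (Suc (size m)) ^ 2" .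
    qed (use assms in auto)
    also have "\<dots> \<le> K * \<rho>' ^ size m" by (rule K)
    finally have "cmod (a (add_mset c m)) * (real (Suc (count m c)) * \<rho> ^ size m)
       \<le> cmod (a (add_mset c m)) * (K * \<rho>' ^ size m)" by (rule mult_left_mono) auto
    then show "cmod (dcoeff c a m) * \<rho> ^ size m \<le> (cmod (a (add_mset c m)) * \<rho>' ^ Suc (size m)) * (K / \<rho>')"
      using \<rho>' by (simp add: dcoeff_def norm_mult mult_ac del: of_nat_Suc)
  qed (use assms in auto)
qed

definition psd :: "nat set set \<Rightarrow> (nat set multiset \<Rightarrow> complex) \<Rightarrow> nat set \<Rightarrow> (nat set \<Rightarrow> complex) \<Rightarrow> complex" where
  "psd Z a c x = (\<Sum>\<^sub>\<infinity>m\<in>msets Z. dcoeff c a m * mon m x)"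

lemma ps_psd:
  assumes "finite Z" "0 < r" "ps Z r a F" "c \<in> Z"
  shows "ps Z r (dcoeff c a) (psd Z a c)"
  by (rule psI[OF assms(1,2)]) (use dcoeff_summable[OF assms(2-4)] in \<open>auto simp: psd_def\<close>)

text \<open>The termwise derivative indexed by the monomials of \<open>F\<close> itself, so that it
  can be subtracted term by term from the series of \<open>F\<close>; monomials without
  \<open>c\<close> contribute 0.\<close>

lemma psd_has_sum:
  assumes "finite Z" "0 < r" "ps Z r a F" "c \<in> Z" "x \<in> pd Z r"
  shows "((\<lambda>m. of_nat (count m c) * a m * mon (m - {#c#}) x) has_sum psd Z a c x) (msets Z)"
proof -
  let ?g = "\<lambda>m. of_nat (count m c) * a m * mon (m - {#c#}) x"
  have "((\<lambda>m. dcoeff c a m * mon m x) has_sum psd Z a c x) (msets Z)"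
    using ps_psd[OF assms(1-4)] assms(5) by (auto simp: ps_def)
  then have "((?g \<circ> add_mset c) has_sum psd Z a c x) (msets Z)"
    by (simp add: o_def dcoeff_def)
  then have "(?g has_sum psd Z a c x) (add_mset c ` msets Z)"
    by (subst has_sum_reindex) (auto simp: inj_on_def)
  then show ?thesis
  proof (rule has_sum_cong_neutral[THEN iffD1, rotated -1])
    fix m assume m: "m \<in> msets Z - add_mset c ` msets Z"
    have "c \<notin># m"
    proof
      assume "c \<in># m"
      then obtain m' where "m = add_mset c m'" by (meson mset_add)
      then show False using m by auto
    qed
    then show "?g m = 0" by (simp add: not_in_iff)
  qed (use assms in auto)
qed

definition dmon :: "nat set set \<Rightarrow> nat set multiset \<Rightarrow> (nat set \<Rightarrow> complex) \<Rightarrow> (nat set \<Rightarrow> complex) \<Rightarrow> complex" where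
  "dmon Z m x h = (\<Sum>c\<in>Z. of_nat (count m c) * mon (m - {#c#}) x * h c)"

lemma dmon_add_mset:
  assumes "finite Z" "d \<in> Z"
  shows "dmon Z (add_mset d m) x h = h d * mon m x + x d * dmon Z m x h"
proof -
  have "of_nat (count (add_mset d m) c) * mon (add_mset d m - {#c#}) x * h c
    = (if c = d then h d * mon m x else 0) + x d * (of_nat (count m c) * mon (m - {#c#}) x * h c)" for c
  proof (cases "c \<in># m")
    case True
    then obtain m' where m': "m = add_mset c m'" by (meson mset_add)
    show ?thesis unfolding m' by (auto simp: algebra_simps add_mset_commute[of d c])
  next
    case False
    then show ?thesis by (auto simp: not_in_iff)
  qed
  then show ?thesis using assms by (simp add: dmon_def sum.distrib sum_distrib_left)
qed

text \<open>The factors \<open>\<rho>\<close> and \<open>\<rho> ^ 2\<close> on the left replace the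
  exponents \<open>size m - 1\<close> and \<open>size m - 2\<close>, which would be truncated at 0.
  When one variable is added to \<open>m\<close>, the second bound follows from both bounds for the
  smaller multiset.\<close>

lemma mon_taylor:
  assumes "finite Z" "m \<in> msets Z" "0 < \<rho>" "\<And>c. c \<in> Z ==> cmod (x c) \<le> \<rho>" "\<And>c. c \<in> Z ==> cmod (y c) \<le> \<rho>"
  defines "S \<equiv> (\<Sum>c\<in>Z. cmod (y c - x c)) :: real"
  shows "cmod (mon m y - mon m x) * \<rho> \<le> real (size m) * \<rho> ^ size m * S"
    and "cmod (mon m y - mon m x - dmon Z m x (\<lambda>c. y c - x c)) * \<rho> ^ 2 \<le> real (size m) ^ 2 * \<rho> ^ size m * S ^ 2"
proof -
  have S0: "0 \<le> S" unfolding S_def by (intro sum_nonneg) auto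
  have hS: "cmod (y d - x d) \<le> S" if "d \<in> Z" for d
    unfolding S_def using member_le_sum[of d Z "\<lambda>c. cmod (y c - x c)"] that assms(1) by auto
  have "cmod (mon m y - mon m x) * \<rho> \<le> real (size m) * \<rho> ^ size m * S \<and>
    cmod (mon m y - mon m x - dmon Z m x (\<lambda>c. y c - x c)) * \<rho> ^ 2 \<le> real (size m) ^ 2 * \<rho> ^ size m * S ^ 2"
    using assms(2)
  proof (induction m)
    case empty then show ?case by (simp add: dmon_def)
  next
    case (add d m)
    then have dZ: "d \<in> Z" and mZ: "m \<in> msets Z" by auto
    note IH = add.IH[OF mZ]
    let ?A = "mon m y - mon m x" and ?k = "size m"
    let ?B = "mon m y - mon m x - dmon Z m x (\<lambda>c. y c - x c)"
    have ym: "cmod (mon m y) \<le> \<rho> ^ ?k" by (rule norm_mon_le[OF mZ assms(5)])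
    have e1: "mon (add_mset d m) y - mon (add_mset d m) x = x d * ?A + (y d - x d) * mon m y"
      by (simp add: algebra_simps)
    have "cmod (x d * ?A + (y d - x d) * mon m y) \<le> \<rho> * cmod ?A + S * \<rho> ^ ?k"
      using norm_triangle_ineq[of "x d * ?A" "(y d - x d) * mon m y"]
        mult_mono[OF assms(4)[OF dZ] order_refl[of "cmod ?A"]] mult_mono[OF hS[OF dZ] ym] assms(3) S0
      by (simp add: norm_mult)
    then have "cmod (x d * ?A + (y d - x d) * mon m y) * \<rho> \<le> (\<rho> * cmod ?A + S * \<rho> ^ ?k) * \<rho>"
      by (rule mult_right_mono) (use assms in auto)
    also have "\<dots> = \<rho> * (cmod ?A * \<rho>) + S * \<rho> ^ Suc ?k" by (simp add: algebra_simps)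
    also have "\<dots> \<le> \<rho> * (real ?k * \<rho> ^ ?k * S) + S * \<rho> ^ Suc ?k"
      using IH assms(3) by (intro add_right_mono mult_left_mono) auto
    finally have 1: "cmod (mon (add_mset d m) y - mon (add_mset d m) x) * \<rho> \<le> real (Suc ?k) * \<rho> ^ Suc ?k * S"
      unfolding e1 by (simp add: algebra_simps)
    have e2: "mon (add_mset d m) y - mon (add_mset d m) x - dmon Z (add_mset d m) x (\<lambda>c. y c - x c)
        = x d * ?B + (y d - x d) * ?A"
      by (simp add: dmon_add_mset[OF assms(1) dZ] algebra_simps)
    have "cmod (x d * ?B + (y d - x d) * ?A) \<le> \<rho> * cmod ?B + S * cmod ?A"
      using norm_triangle_ineq[of "x d * ?B" "(y d - x d) * ?A"]
        mult_mono[OF assms(4)[OF dZ] order_refl[of "cmod ?B"]] mult_mono[OF hS[OF dZ] order_refl[of "cmod ?A"]] assms(3) S0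
      by (simp add: norm_mult)
    then have "cmod (x d * ?B + (y d - x d) * ?A) * \<rho> ^ 2 \<le> (\<rho> * cmod ?B + S * cmod ?A) * \<rho> ^ 2"
      by (rule mult_right_mono) (use assms in auto)
    also have "\<dots> = \<rho> * (cmod ?B * \<rho> ^ 2) + S * \<rho> * (cmod ?A * \<rho>)" by (simp add: algebra_simps power2_eq_square)
    also have "\<dots> \<le> \<rho> * (real ?k ^ 2 * \<rho> ^ ?k * S ^ 2) + S * \<rho> * (real ?k * \<rho> ^ ?k * S)"
      using IH assms(3) S0 by (intro add_mono mult_left_mono) auto
    also have "\<dots> = (real ?k ^ 2 + real ?k) * (\<rho> ^ Suc ?k * S ^ 2)"
      by (simp add: algebra_simps power2_eq_square)
    also have "\<dots> \<le> real (Suc ?k) ^ 2 * (\<rho> ^ Suc ?k * S ^ 2)"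
      using assms(3) S0 by (intro mult_right_mono) (auto simp: power2_eq_square algebra_simps)
    finally have 2: "cmod (mon (add_mset d m) y - mon (add_mset d m) x - dmon Z (add_mset d m) x (\<lambda>c. y c - x c)) * \<rho> ^ 2
       \<le> real (Suc ?k) ^ 2 * \<rho> ^ Suc ?k * S ^ 2"
      unfolding e2 by (simp add: algebra_simps)
    show ?case using 1 2 by simp
  qed
  then show "cmod (mon m y - mon m x) * \<rho> \<le> real (size m) * \<rho> ^ size m * S"
    and "cmod (mon m y - mon m x - dmon Z m x (\<lambda>c. y c - x c)) * \<rho> ^ 2 \<le> real (size m) ^ 2 * \<rho> ^ size m * S ^ 2"
    by auto
qed

lemma eventually_coords_close:
  assumes "finite Z" "0 < \<eta>"
  shows "\<forall>\<^sub>F y in at x within A. (\<Sum>c\<in>Z. cmod (y c - x c :: complex)) < \<eta>"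
proof -
  have "((\<lambda>y. y c) \<longlongrightarrow> x c) (at x within A)" for c
    using continuous_on_coord[of UNIV c] by (auto simp: continuous_on_def intro: tendsto_within_subset)
  then have "((\<lambda>y. \<Sum>c\<in>Z. cmod (y c - x c)) \<longlongrightarrow> (\<Sum>c\<in>Z. cmod (x c - x c))) (at x within A)"
    by (intro tendsto_intros)
  then show ?thesis using assms by (auto dest: order_tendstoD(2))
qed

text \<open>The quadratic remainders of the monomials are summed. Three radii are nested:
  \<open>x\<close> lies within \<open>\<rho>0\<close>, nearby points within \<open>\<rho>\<close>,
  and the coefficients are summable at \<open>\<rho>'\<close>, which absorbs the square of the
  degree.\<close>

lemma ps_has_differential:
  assumes "finite Z" "0 < r" "ps Z r a F" "x \<in> pd Z r"
  shows "has_differential Z (\<lambda>x. x) (pd Z r) F (\<lambda>c. psd Z a c x) x"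
proof -
  obtain \<rho>0 where \<rho>0: "0 < \<rho>0" "\<rho>0 < r" "\<And>c. c \<in> Z ==> cmod (x c) \<le> \<rho>0"
    using pd_radius[OF assms(1,2,4)] by blast
  define \<rho> where "\<rho> = (\<rho>0 + r) / 2"
  define \<rho>' where "\<rho>' = (\<rho> + r) / 2"
  have \<rho>: "\<rho>0 < \<rho>" "\<rho> < \<rho>'" "\<rho>' < r" "0 < \<rho>" "0 < \<rho>'"
    using \<rho>0 by (auto simp: \<rho>_def \<rho>'_def field_simps)
  obtain K where K: "0 < K" "\<And>k. real (Suc k) ^ 2 * \<rho> ^ k \<le> K * \<rho>' ^ k"
    using polynomial_times_power_bounded[OF \<rho>(4,2)] by blast
  have sm: "(\<lambda>m. cmod (a m) * \<rho>' ^ size m) summable_on msets Z"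
    by (rule ps_abs_summable[OF assms(3)]) (use \<rho> in auto)
  \<comment> \<open>The summand 1 makes \<open>C\<close> positive, so that
    \<open>\<epsilon> / C\<close> is a usable distance even if all coefficients vanish.\<close>
  define C where "C = (\<Sum>\<^sub>\<infinity>m\<in>msets Z. cmod (a m) * \<rho>' ^ size m) * (K / \<rho> ^ 2) + 1"
  have C: "0 < C" unfolding C_def
    by (intro add_nonneg_pos mult_nonneg_nonneg infsum_nonneg divide_nonneg_nonneg) (use K \<rho> in auto)
  have bound: "cmod (F y - F x - (\<Sum>c\<in>Z. psd Z a c x * (y c - x c))) \<le> C * (\<Sum>c\<in>Z. cmod (y c - x c)) ^ 2"
    if y: "y \<in> pd Z r" "\<And>c. c \<in> Z ==> cmod (y c) \<le> \<rho>" for y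
  proof -
    define S where "S = (\<Sum>c\<in>Z. cmod (y c - x c))"
    let ?R = "\<lambda>m. mon m y - mon m x - dmon Z m x (\<lambda>c. y c - x c)"
    have "((\<lambda>m. a m * mon m y + - (a m * mon m x)) has_sum F y + - F x) (msets Z)"
      using assms y by (intro has_sum_add has_sum_uminusI) (auto simp: ps_def)
    moreover have "((\<lambda>m. \<Sum>c\<in>Z. of_nat (count m c) * a m * mon (m - {#c#}) x * (y c - x c)) has_sum
        (\<Sum>c\<in>Z. psd Z a c x * (y c - x c))) (msets Z)"
      by (intro has_sum_sum' has_sum_cmult_left psd_has_sum[OF assms(1-3) _ assms(4)])
    ultimately have "((\<lambda>m. a m * mon m y + - (a m * mon m x) + - (\<Sum>c\<in>Z. of_nat (count m c) * a m * mon (m - {#c#}) x * (y c - x c)))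
        has_sum (F y + - F x + - (\<Sum>c\<in>Z. psd Z a c x * (y c - x c)))) (msets Z)"
      by (rule has_sum_add[OF _ has_sum_uminusI])
    moreover have "a m * mon m y + - (a m * mon m x) + - (\<Sum>c\<in>Z. of_nat (count m c) * a m * mon (m - {#c#}) x * (y c - x c))
        = a m * ?R m" for m
      by (simp add: dmon_def right_diff_distrib sum_distrib_left mult_ac)
    ultimately have hs: "((\<lambda>m. a m * ?R m) has_sum (F y - F x - (\<Sum>c\<in>Z. psd Z a c x * (y c - x c)))) (msets Z)"
      by simp
    have le: "cmod (a m * ?R m) \<le> cmod (a m) * \<rho>' ^ size m * (K / \<rho> ^ 2 * S ^ 2)" if "m \<in> msets Z" for m
    proof -
      have "cmod (?R m) * \<rho> ^ 2 \<le> real (size m) ^ 2 * \<rho> ^ size m * S ^ 2"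
        unfolding S_def by (rule mon_taylor(2)[OF assms(1) that \<rho>(4)])
          (use \<rho>0(3) \<rho>(1) y(2) in \<open>auto intro: order_trans[OF _ less_imp_le]\<close>)
      also have "\<dots> \<le> (K * \<rho>' ^ size m) * S ^ 2"
      proof (rule mult_right_mono)
        have "real (size m) ^ 2 * \<rho> ^ size m \<le> real (Suc (size m)) ^ 2 * \<rho> ^ size m"
          using \<rho> by (intro mult_right_mono power_mono) auto
        then show "real (size m) ^ 2 * \<rho> ^ size m \<le> K * \<rho>' ^ size m" using K(2) order_trans by blast
      qed auto
      finally have "cmod (?R m) \<le> \<rho>' ^ size m * (K / \<rho> ^ 2 * S ^ 2)" using \<rho>(4) by (simp add: field_simps)
      from mult_left_mono[OF this norm_ge_zero[of "a m"]] show ?thesis by (simp add: norm_mult mult.assoc)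
    qed
    have s1: "(\<lambda>m. cmod (a m) * \<rho>' ^ size m * (K / \<rho> ^ 2 * S ^ 2)) summable_on msets Z"
      by (rule summable_on_cmult_left[OF sm])
    have s2: "(\<lambda>m. cmod (a m * ?R m)) summable_on msets Z"
      by (rule summable_on_comparison_test[OF s1 le]) auto
    have "cmod (F y - F x - (\<Sum>c\<in>Z. psd Z a c x * (y c - x c))) \<le> (\<Sum>\<^sub>\<infinity>m\<in>msets Z. cmod (a m * ?R m))"
      using norm_infsum_bound[OF s2] infsumI[OF hs] by simp
    also have "\<dots> \<le> (\<Sum>\<^sub>\<infinity>m\<in>msets Z. cmod (a m) * \<rho>' ^ size m * (K / \<rho> ^ 2 * S ^ 2))"
      by (rule infsum_mono[OF s2 s1 le])
    also have "\<dots> = (C - 1) * S ^ 2" by (subst infsum_cmult_left') (simp add: C_def)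
    also have "\<dots> \<le> C * S ^ 2" by (intro mult_right_mono) auto
    finally show ?thesis by (simp add: S_def)
  qed
  show ?thesis
    unfolding has_differential_def
  proof (intro allI impI)
    fix \<epsilon> :: real assume \<epsilon>: "0 < \<epsilon>"
    have "\<forall>\<^sub>F y in at x within pd Z r. (\<Sum>c\<in>Z. cmod (y c - x c)) < min (\<epsilon> / C) (\<rho> - \<rho>0) \<and> y \<in> pd Z r"
      using \<epsilon> C \<rho>(1) by (intro eventually_conj eventually_coords_close assms(1)) (auto simp: eventually_at_filter)
    then show "\<forall>\<^sub>F y in at x within pd Z r. cmod (F y - F x - (\<Sum>c\<in>Z. psd Z a c x * (y c - x c)))
        \<le> \<epsilon> * (\<Sum>c\<in>Z. cmod (y c - x c))"
    proof eventually_elim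
      case (elim y)
      define S where "S = (\<Sum>c\<in>Z. cmod (y c - x c))"
      have S: "0 \<le> S" "S < \<epsilon> / C" "S < \<rho> - \<rho>0" using elim by (auto simp: S_def intro: sum_nonneg)
      have "cmod (y c) \<le> \<rho>" if "c \<in> Z" for c
      proof -
        have "cmod (y c - x c) \<le> S" unfolding S_def
          using member_le_sum[of c Z "\<lambda>c. cmod (y c - x c)"] that assms(1) by auto
        then show ?thesis using \<rho>0(3)[OF that] S(3) norm_triangle_sub[of "y c" "x c"] by linarith
      qed
      then have "cmod (F y - F x - (\<Sum>c\<in>Z. psd Z a c x * (y c - x c))) \<le> C * S ^ 2"
        unfolding S_def using elim by (intro bound) auto
      also have "\<dots> \<le> \<epsilon> * S" using S C mult_right_mono[of "C * S" \<epsilon> S]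
        by (simp add: power2_eq_square field_simps)
      finally show ?case by (simp add: S_def)
    qed
  qed
qed

text \<open>The chain rule for a curve \<open>e\<close>; the points with \<open>e s = e s\<^sub>0\<close>, which the filter of
  \<^const>\<open>has_differential\<close> leaves out, contribute nothing.\<close>

lemma has_differential_chain:
  fixes e :: "'a::real_normed_vector \<Rightarrow> 'e::topological_space"
  assumes g: "has_differential C p E g D (e s0)" and C: "finite C"
    and ev: "\<forall>\<^sub>F s in at s0 within S. e s \<in> E" and lim: "(e \<longlongrightarrow> e s0) (at s0 within S)"
    and p: "\<And>c. c \<in> C ==> ((\<lambda>s. p (e s) c) has_derivative \<gamma> c) (at s0 within S)"
  shows "((\<lambda>s. g (e s)) has_derivative (\<lambda>h. \<Sum>c\<in>C. D c * \<gamma> c h)) (at s0 within S)"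
proof -
  have lin: "bounded_linear (\<gamma> c)" if "c \<in> C" for c using p[OF that] by (rule has_derivative_bounded_linear)
  have "\<exists>B>0. \<forall>h. norm (\<gamma> c h) \<le> norm h * B" if "c \<in> C" for c
    using bounded_linear.pos_bounded[OF lin[OF that]] by auto
  then obtain B where B: "\<And>c. c \<in> C ==> 0 < B c" "\<And>c h. c \<in> C ==> norm (\<gamma> c h) \<le> norm h * B c"
    by metis
  define M where "M = (\<Sum>c\<in>C. B c + 1)"
  define N where "N = (\<Sum>c\<in>C. cmod (D c))"
  have M: "0 \<le> M" unfolding M_def using B by (intro sum_nonneg) (auto simp: less_imp_le)
  have N: "0 \<le> N" unfolding N_def by (intro sum_nonneg) auto
  show ?thesis
    unfolding has_derivative_within_alt2
  proof (intro conjI allI impI)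
    show "bounded_linear (\<lambda>h. \<Sum>c\<in>C. D c * \<gamma> c h)"
      by (intro bounded_linear_sum bounded_linear_const_mult lin)
    fix \<epsilon> :: real assume \<epsilon>: "0 < \<epsilon>"
    define \<eta> where "\<eta> = \<epsilon> / (2 * (M + N + 1))"
    have \<eta>: "0 < \<eta>" "\<eta> * M \<le> \<epsilon> / 2" "\<eta> * N \<le> \<epsilon> / 2"
      using \<epsilon> M N by (auto simp: \<eta>_def field_simps)
    have "\<forall>\<^sub>F e' in at (e s0) within E. cmod (g e' - g (e s0) - (\<Sum>c\<in>C. D c * (p e' c - p (e s0) c)))
          \<le> \<eta> * (\<Sum>c\<in>C. cmod (p e' c - p (e s0) c))"
      using g \<eta> unfolding has_differential_def by blast
    then obtain T where T: "open T" "e s0 \<in> T" "\<And>e'. e' \<in> T ==> e' \<noteq> e s0 ==> e' \<in> E ==>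
       cmod (g e' - g (e s0) - (\<Sum>c\<in>C. D c * (p e' c - p (e s0) c)))
          \<le> \<eta> * (\<Sum>c\<in>C. cmod (p e' c - p (e s0) c))"
      unfolding eventually_at_topological by blast
    have 1: "\<forall>\<^sub>F s in at s0 within S. e s \<in> T" using lim T(1,2) by (rule topological_tendstoD)
    have 2: "\<forall>\<^sub>F s in at s0 within S. \<forall>c\<in>C. cmod (p (e s) c - p (e s0) c - \<gamma> c (s - s0)) \<le> min 1 \<eta> * norm (s - s0)"
      using C p \<eta>(1) unfolding has_derivative_within_alt2 by (intro eventually_ball_finite) auto
    show "\<forall>\<^sub>F s in at s0 within S. norm (g (e s) - g (e s0) - (\<Sum>c\<in>C. D c * \<gamma> c (s - s0))) \<le> \<epsilon> * norm (s - s0)"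
      using ev 1 2
    proof eventually_elim
      case (elim s)
      let ?h = "norm (s - s0)" and ?d = "\<lambda>c. p (e s) c - p (e s0) c"
      have d: "cmod (?d c) \<le> (B c + 1) * ?h" if "c \<in> C" for c
      proof -
        have "cmod (?d c - \<gamma> c (s - s0)) \<le> ?h"
          using elim(3) that mult_right_mono[of "min 1 \<eta>" 1 ?h] by fastforce
        moreover have "cmod (\<gamma> c (s - s0)) \<le> ?h * B c" using B(2)[OF that] .
        ultimately show ?thesis using norm_triangle_sub[of "?d c" "\<gamma> c (s - s0)"] by (simp add: algebra_simps)
      qed
      have "(\<Sum>c\<in>C. cmod (?d c)) \<le> M * ?h"
        unfolding M_def sum_distrib_right by (intro sum_mono d)
      then have "cmod (g (e s) - g (e s0) - (\<Sum>c\<in>C. D c * ?d c)) \<le> \<eta> * (M * ?h)"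
        using T(3)[of "e s"] elim \<eta>(1) M
        by (cases "e s = e s0") (auto intro: order_trans[OF _ mult_left_mono[of _ "M * ?h" \<eta>]])
      also have "\<dots> \<le> \<epsilon> / 2 * ?h" using mult_right_mono[OF \<eta>(2), of ?h] by (simp add: mult.assoc)
      finally have 3: "cmod (g (e s) - g (e s0) - (\<Sum>c\<in>C. D c * ?d c)) \<le> \<epsilon> / 2 * ?h" .
      have "cmod (\<Sum>c\<in>C. D c * (?d c - \<gamma> c (s - s0))) \<le> (\<Sum>c\<in>C. cmod (D c) * (\<eta> * ?h))"
      proof (rule sum_norm_le)
        fix c assume "c \<in> C"
        then have "cmod (?d c - \<gamma> c (s - s0)) \<le> \<eta> * ?h"
          using elim(3) mult_right_mono[of "min 1 \<eta>" \<eta> ?h] by fastforce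
        then show "cmod (D c * (?d c - \<gamma> c (s - s0))) \<le> cmod (D c) * (\<eta> * ?h)"
          by (simp add: norm_mult mult_left_mono)
      qed
      also have "\<dots> = \<eta> * N * ?h" by (simp add: N_def sum_distrib_left sum_distrib_right mult_ac)
      also have "\<dots> \<le> \<epsilon> / 2 * ?h" using mult_right_mono[OF \<eta>(3), of ?h] by simp
      finally have 4: "cmod (\<Sum>c\<in>C. D c * (?d c - \<gamma> c (s - s0))) \<le> \<epsilon> / 2 * ?h" .
      have "g (e s) - g (e s0) - (\<Sum>c\<in>C. D c * \<gamma> c (s - s0))
         = (g (e s) - g (e s0) - (\<Sum>c\<in>C. D c * ?d c)) + (\<Sum>c\<in>C. D c * (?d c - \<gamma> c (s - s0)))"
        by (simp add: right_diff_distrib sum_subtractf)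
      then show ?case
        using norm_triangle_ineq[of "g (e s) - g (e s0) - (\<Sum>c\<in>C. D c * ?d c)" "\<Sum>c\<in>C. D c * (?d c - \<gamma> c (s - s0))"] 3 4
        by (simp add: field_simps)
    qed
  qed
qed

text \<open>Taken from \<open>deriv\<close> and not from coefficients, so that it depends on the
  function alone; \<open>ps_dp\<close> identifies it with the termwise derivative.\<close>

definition dp :: "nat set \<Rightarrow> ((nat set \<Rightarrow> complex) \<Rightarrow> complex) \<Rightarrow> (nat set \<Rightarrow> complex) \<Rightarrow> complex" where
  "dp c F x = deriv (\<lambda>t. F (x(c := t))) (x c)"

lemma tendsto_fun_upd_self: "((\<lambda>t. x(c := t)) \<longlongrightarrow> x) (at (x c))"
  for x :: "'i \<Rightarrow> 'a::topological_space"
proof -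
  have "continuous_on UNIV (\<lambda>t. x(c := t))"
  proof (rule continuous_on_coordinatewise_then_product)
    show "continuous_on UNIV (\<lambda>t. (x(c := t)) i)" for i
      by (cases "i = c") auto
  qed
  then have "((\<lambda>t. x(c := t)) \<longlongrightarrow> x(c := x c)) (at (x c))"
    by (simp only: continuous_on_def) (drule bspec[of _ _ "x c"], simp_all)
  then show ?thesis by simp
qed

lemma eventually_upd_pd:
  assumes "c \<in> Z" "x \<in> pd Z r"
  shows "\<forall>\<^sub>F t in nhds (x c). x(c := t) \<in> pd Z r"
proof -
  have "\<forall>\<^sub>F t in nhds (x c). cmod t < r"
    using assms by (intro order_tendstoD(2)[OF tendsto_norm[OF filterlim_ident]]) (auto simp: pd_def)
  then show ?thesis by eventually_elim (use assms in \<open>auto simp: pd_def\<close>)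
qed

lemma has_differential_has_field_derivative:
  assumes "has_differential Z (\<lambda>x. x) (pd Z r) F D x" "finite Z" "c \<in> Z" "x \<in> pd Z r"
  shows "((\<lambda>t. F (x(c := t))) has_field_derivative D c) (at (x c))"
proof -
  have "((\<lambda>t. F (x(c := t))) has_derivative (\<lambda>h. \<Sum>d\<in>Z. D d * (if d = c then h else 0))) (at (x c))"
  proof (rule has_differential_chain[where E="pd Z r" and p="\<lambda>x. x" and e="\<lambda>t. x(c := t)"])
    show "has_differential Z (\<lambda>x. x) (pd Z r) F D (x(c := x c))" using assms by simp
    show "\<forall>\<^sub>F t in at (x c). x(c := t) \<in> pd Z r"
      using eventually_upd_pd[OF assms(3,4)] by (auto simp: eventually_at_filter elim: eventually_mono)
    show "((\<lambda>t. x(c := t)) \<longlongrightarrow> x(c := x c)) (at (x c))" using tendsto_fun_upd_self[of x c] by simp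
    fix d assume "d \<in> Z"
    show "((\<lambda>t. (x(c := t)) d) has_derivative (\<lambda>h. if d = c then h else 0)) (at (x c))"
      by (cases "d = c") (auto intro: derivative_eq_intros)
  qed (use assms in auto)
  moreover have "(\<Sum>d\<in>Z. D d * (if d = c then h else 0)) = D c * h" for h
    using assms by (simp add: if_distrib cong: if_cong)
  ultimately show ?thesis by (simp add: has_field_derivative_def)
qed

lemma ps_dp:
  assumes "finite Z" "0 < r" "ps Z r a F" "c \<in> Z" "x \<in> pd Z r"
  shows "dp c F x = psd Z a c x" "((\<lambda>t. F (x(c := t))) has_field_derivative dp c F x) (at (x c))"
proof -
  have 1: "((\<lambda>t. F (x(c := t))) has_field_derivative psd Z a c x) (at (x c))"
    by (rule has_differential_has_field_derivative[OF ps_has_differential[OF assms(1-3,5)] assms(1,4,5)])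
  show 2: "dp c F x = psd Z a c x" unfolding dp_def by (rule DERIV_imp_deriv[OF 1])
  show "((\<lambda>t. F (x(c := t))) has_field_derivative dp c F x) (at (x c))" unfolding 2 by (rule 1)
qed

lemma ps_dp_ps:
  assumes "finite Z" "0 < r" "ps Z r a F" "c \<in> Z"
  shows "ps Z r (dcoeff c a) (dp c F)"
  by (rule ps_cong[OF ps_psd[OF assms]]) (use ps_dp(1)[OF assms] in auto)

section \<open>Partial derivatives on a polydisc and the logarithmic Poincare lemma\<close>

locale polydisc =
  fixes Z :: "nat set set" and r :: real
  assumes fin: "finite Z" and pos: "0 < r"
begin

lemma hol_dp: "hol Z r F ==> c \<in> Z ==> hol Z r (dp c F)"
  unfolding hol_def using ps_dp_ps[OF fin pos] by blast

lemma hol_DERIV: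
  "hol Z r F ==> c \<in> Z ==> x \<in> pd Z r ==> ((\<lambda>t. F (x(c := t))) has_field_derivative dp c F x) (at (x c))"
  unfolding hol_def using ps_dp(2)[OF fin pos] by blast

lemma hol_has_differential:
  assumes "hol Z r F" "x \<in> pd Z r"
  shows "has_differential Z (\<lambda>x. x) (pd Z r) F (\<lambda>c. dp c F x) x"
proof -
  obtain a where a: "ps Z r a F" using assms by (auto simp: hol_def)
  show ?thesis using ps_has_differential[OF fin pos a assms(2)] ps_dp(1)[OF fin pos a _ assms(2)]
    by (simp add: has_differential_def)
qed

lemma dp_cong:
  assumes "\<And>x. x \<in> pd Z r ==> F x = G x" "c \<in> Z" "x \<in> pd Z r"
  shows "dp c F x = dp c G x"
  unfolding dp_def
  by (rule deriv_cong_ev[OF eventually_mono[OF eventually_upd_pd[OF assms(2,3)]]]) (use assms(1) in auto)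

lemma dp_eqI: "((\<lambda>t. F (x(c := t))) has_field_derivative D) (at (x c)) ==> dp c F x = D"
  unfolding dp_def by (rule DERIV_imp_deriv)

lemma dp_const [simp]: "dp c (\<lambda>x. k) x = 0"
  by (rule dp_eqI) (auto intro!: derivative_eq_intros)

lemma dp_coord: "dp c (\<lambda>x. x d) x = (if c = d then 1 else 0)"
  by (rule dp_eqI) (auto intro!: derivative_eq_intros)

lemma dp_add: "hol Z r F ==> hol Z r G ==> c \<in> Z ==> x \<in> pd Z r ==> dp c (\<lambda>x. F x + G x) x = dp c F x + dp c G x"
  by (rule dp_eqI) (intro DERIV_add hol_DERIV)

lemma dp_diff: "hol Z r F ==> hol Z r G ==> c \<in> Z ==> x \<in> pd Z r ==> dp c (\<lambda>x. F x - G x) x = dp c F x - dp c G x"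
  by (rule dp_eqI) (intro DERIV_diff hol_DERIV)

lemma dp_mult: "hol Z r F ==> hol Z r G ==> c \<in> Z ==> x \<in> pd Z r ==>
    dp c (\<lambda>x. F x * G x) x = dp c F x * G x + dp c G x * F x"
  by (rule dp_eqI, drule (2) hol_DERIV, drule (2) hol_DERIV, drule (1) DERIV_mult) simp

lemma dp_sum:
  assumes "\<And>i. i \<in> I ==> hol Z r (F i)" "c \<in> Z" "x \<in> pd Z r"
  shows "dp c (\<lambda>x. \<Sum>i\<in>I. F i x) x = (\<Sum>i\<in>I. dp c (F i) x)"
  by (rule dp_eqI) (intro DERIV_sum hol_DERIV assms)

text \<open>On coefficients, both orders multiply the same coefficient by the same two
  integers.\<close>

lemma dp_commute:
  assumes "hol Z r F" "c \<in> Z" "d \<in> Z" "x \<in> pd Z r"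
  shows "dp c (dp d F) x = dp d (dp c F) x"
proof -
  obtain a where a: "ps Z r a F" using assms by (auto simp: hol_def)
  have "dcoeff c (dcoeff d a) = dcoeff d (dcoeff c a)"
    by (cases "c = d") (auto simp: dcoeff_def fun_eq_iff add_mset_commute[of c d])
  then show ?thesis
    using ps_infsum[OF ps_dp_ps[OF fin pos ps_dp_ps[OF fin pos a assms(3)] assms(2)] assms(4)]
      ps_infsum[OF ps_dp_ps[OF fin pos ps_dp_ps[OF fin pos a assms(2)] assms(3)] assms(4)] by simp
qed

text \<open>The constant coefficient is the value at the origin. The coefficient at
  \<open>add_mset c m\<close> is, up to a positive integer, the coefficient at \<open>m\<close> of
  the derivative in \<open>c\<close>, which vanishes as well.\<close>

lemma ps_zero_coeffs:
  assumes "ps Z r a F" "\<And>x. x \<in> pd Z r ==> F x = 0" "m \<in> msets Z"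
  shows "a m = 0"
  using assms
proof (induction m arbitrary: a F)
  case empty
  have "((\<lambda>m. a m * mon m (\<lambda>c. 0)) has_sum a {#}) (msets Z)"
    by (rule has_sum_finite_neutralI[where B="{{#}}"]) (auto simp: mon_def)
  moreover have "((\<lambda>m. a m * mon m (\<lambda>c. 0)) has_sum F (\<lambda>c. 0)) (msets Z)"
    using empty(1) pos by (auto simp: ps_def)
  ultimately show ?case using has_sum_unique empty(2) pos zero_in_pd by metis
next
  case (add c m)
  have c: "c \<in> Z" "m \<in> msets Z" using add.prems by auto
  have "dp c F x = 0" if "x \<in> pd Z r" for x
    using dp_cong[of F "\<lambda>x. 0" c x] add.prems(2) c that by simp
  from add.IH[OF ps_dp_ps[OF fin pos add.prems(1) c(1)] this c(2)]
  show ?case by (simp add: dcoeff_def del: of_nat_Suc)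
qed

lemma ps_coeffs_unique:
  assumes "ps Z r a F" "ps Z r b F" "m \<in> msets Z"
  shows "a m = b m"
proof -
  have "ps Z r (\<lambda>m. a m + (-1) * b m) (\<lambda>x. F x + (-1) * F x)"
    by (intro ps_add ps_cmult assms)
  from ps_zero_coeffs[OF this _ assms(3)] show ?thesis by simp
qed

lemma ps_euler:
  assumes a: "ps Z r a F" and c: "c \<in> Z"
  shows "ps Z r (\<lambda>m. of_nat (count m c) * a m) (\<lambda>x. x c * dp c F x)"
  unfolding ps_def
proof
  fix x assume x: "x \<in> pd Z r"
  have "((\<lambda>m. x c * (of_nat (count m c) * a m * mon (m - {#c#}) x)) has_sum x c * dp c F x) (msets Z)"
    unfolding ps_dp(1)[OF fin pos a c x] by (intro has_sum_cmult_right psd_has_sum[OF fin pos a c x])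
  moreover have "x c * (of_nat (count m c) * a m * mon (m - {#c#}) x) = of_nat (count m c) * a m * mon m x" for m
  proof (cases "c \<in># m")
    case True
    then obtain m' where m': "m = add_mset c m'" by (meson mset_add)
    show ?thesis unfolding m' by simp
  qed (simp add: not_in_iff)
  ultimately show "((\<lambda>m. of_nat (count m c) * a m * mon m x) has_sum x c * dp c F x) (msets Z)" by simp
qed

text \<open>On coefficients the Euler operators \<open>x\<^sub>i \<partial>\<^sub>i\<close> are diagonal, and the primitive divides the
  coefficient of a monomial by its degree.\<close>

lemma log_poincare:
  assumes b: "\<And>i. i \<in> Z ==> hol Z r (b i)" and b0: "\<And>i. i \<in> Z ==> b i (\<lambda>c. 0) = 0"
    and closed: "\<And>i j x. i \<in> Z ==> j \<in> Z ==> x \<in> pd Z r ==> x i * dp i (b j) x = x j * dp j (b i) x"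
  obtains g where "hol Z r g" "g (\<lambda>c. 0) = k" "\<And>i x. i \<in> Z ==> x \<in> pd Z r ==> x i * dp i g x = b i x"
proof -
  have "\<forall>i. \<exists>a. i \<in> Z \<longrightarrow> ps Z r a (b i)" using b by (auto simp: hol_def)
  from choice[OF this] obtain \<beta> where \<beta>: "\<And>i. i \<in> Z ==> ps Z r (\<beta> i) (b i)" by blast
  \<comment> \<open>Closedness compared coefficient by coefficient: for each monomial, the vector of
    the \<open>\<beta> i m\<close> is proportional to the vector of exponents.\<close>
  have sym: "of_nat (count m i) * \<beta> j m = of_nat (count m j) * \<beta> i m" if "i \<in> Z" "j \<in> Z" "m \<in> msets Z" for i j m
    by (rule ps_coeffs_unique[OF ps_euler[OF \<beta>[OF that(2)] that(1)] ps_cong[OF ps_euler[OF \<beta>[OF that(1)] that(2)]] that(3)])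
      (use closed that in auto)
  have \<beta>0: "\<beta> i {#} = 0" if "i \<in> Z" for i
  proof -
    have "((\<lambda>m. \<beta> i m * mon m (\<lambda>c. 0)) has_sum \<beta> i {#}) (msets Z)"
      by (rule has_sum_finite_neutralI[where B="{{#}}"]) (auto simp: mon_def)
    moreover have "((\<lambda>m. \<beta> i m * mon m (\<lambda>c. 0)) has_sum b i (\<lambda>c. 0)) (msets Z)"
      using \<beta>[OF that] pos by (auto simp: ps_def)
    ultimately show ?thesis using has_sum_unique b0[OF that] by metis
  qed
  \<comment> \<open>Summing \<open>sym\<close> over \<open>j\<close> gives \<open>size m * \<beta> i
    m = count m i * (\<Sum>j\<in>Z. \<beta> j m)\<close>, whence this quotient. The constant term is
    free and carries the initial value.\<close>
  define \<gamma> where "\<gamma> m = (if m = {#} then k else (\<Sum>j\<in>Z. \<beta> j m) / of_nat (size m))" for m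
  define g where "g x = (\<Sum>\<^sub>\<infinity>m\<in>msets Z. \<gamma> m * mon m x)" for x
  have g: "ps Z r \<gamma> g"
  proof (rule psI[OF fin pos])
    fix \<rho> assume \<rho>: "0 < \<rho>" "\<rho> < r"
    have "(\<lambda>m. \<Sum>j\<in>J. cmod (\<beta> j m) * \<rho> ^ size m) summable_on msets Z" if "finite J" "J \<subseteq> Z" for J
      using that \<rho> by (induction J) (auto intro!: summable_on_add ps_abs_summable[OF \<beta>])
    from this[OF fin order_refl] have s: "(\<lambda>m. cmod (if m = {#} then k else 0) * \<rho> ^ size m + (\<Sum>j\<in>Z. cmod (\<beta> j m) * \<rho> ^ size m)) summable_on msets Z"
      using \<rho> by (intro summable_on_add ps_abs_summable[OF ps_const]) auto
    show "(\<lambda>m. cmod (\<gamma> m) * \<rho> ^ size m) summable_on msets Z"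
    proof (rule summable_on_comparison_test[OF s])
      fix m
      show "cmod (\<gamma> m) * \<rho> ^ size m \<le> cmod (if m = {#} then k else 0) * \<rho> ^ size m + (\<Sum>j\<in>Z. cmod (\<beta> j m) * \<rho> ^ size m)"
      proof (cases "m = {#}")
        case True then show ?thesis using \<rho> by (auto simp: \<gamma>_def intro: sum_nonneg)
      next
        case False
        then have "1 \<le> real (size m)" by (cases m) auto
        then have "cmod (\<gamma> m) \<le> cmod (\<Sum>j\<in>Z. \<beta> j m)"
          using False mult_left_mono[of 1 "real (size m)" "cmod (\<Sum>j\<in>Z. \<beta> j m)"]
          by (simp add: \<gamma>_def norm_divide divide_le_eq)
        also have "\<dots> \<le> (\<Sum>j\<in>Z. cmod (\<beta> j m))" by (rule norm_sum)
        finally have "cmod (\<gamma> m) * \<rho> ^ size m \<le> (\<Sum>j\<in>Z. cmod (\<beta> j m)) * \<rho> ^ size m"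
          using \<rho> by (intro mult_right_mono) auto
        then show ?thesis using False by (simp add: sum_distrib_right)
      qed
    qed (use \<rho> in auto)
  qed (simp add: g_def)
  show ?thesis
  proof
    show "hol Z r g" using g by (auto simp: hol_def)
    have "((\<lambda>m. \<gamma> m * mon m (\<lambda>c. 0)) has_sum \<gamma> {#}) (msets Z)"
      by (rule has_sum_finite_neutralI[where B="{{#}}"]) (auto simp: mon_def)
    moreover have "((\<lambda>m. \<gamma> m * mon m (\<lambda>c. 0)) has_sum g (\<lambda>c. 0)) (msets Z)"
      using g pos by (auto simp: ps_def)
    ultimately show "g (\<lambda>c. 0) = k" using has_sum_unique by (fastforce simp: \<gamma>_def)
    fix i x assume i: "i \<in> Z" and x: "x \<in> pd Z r"
    have "of_nat (count m i) * \<gamma> m = \<beta> i m" if m: "m \<in> msets Z" for m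
    proof (cases "m = {#}")
      case True then show ?thesis using \<beta>0[OF i] by simp
    next
      case False
      have "size m = (\<Sum>j\<in>Z. count m j)"
        unfolding size_multiset_overloaded_eq using m fin
        by (intro sum.mono_neutral_left) (auto simp: msets_def not_in_iff)
      then have "(of_nat (size m) :: complex) = (\<Sum>j\<in>Z. of_nat (count m j))" by simp
      moreover have "of_nat (count m i) * (\<Sum>j\<in>Z. \<beta> j m) = (\<Sum>j\<in>Z. of_nat (count m j)) * \<beta> i m"
        unfolding sum_distrib_left sum_distrib_right using sym[OF i _ m] by (intro sum.cong) auto
      moreover have "(of_nat (size m) :: complex) \<noteq> 0" using False by simp
      ultimately show ?thesis using False by (simp add: \<gamma>_def field_simps)
    qed
    then have "((\<lambda>m. \<beta> i m * mon m x) has_sum x i * dp i g x) (msets Z)"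
      using ps_euler[OF g i] x by (auto simp: ps_def cong: has_sum_cong)
    moreover have "((\<lambda>m. \<beta> i m * mon m x) has_sum b i x) (msets Z)"
      using \<beta>[OF i] x by (auto simp: ps_def)
    ultimately show "x i * dp i g x = b i x" by (rule has_sum_unique)
  qed
qed

end

section \<open>Cross-ratios and the basic equations\<close>

text \<open>Chords with their end points in increasing order. The pair \<open>(1, n)\<close> is
  excluded because these vertices are neighbours on the polygon.\<close>

definition chordp :: "nat \<Rightarrow> nat \<Rightarrow> nat \<Rightarrow> bool" where
  "chordp n p q \<longleftrightarrow> 1 \<le> p \<and> p + 2 \<le> q \<and> q \<le> n \<and> \<not> (p = 1 \<and> q = n)"

definition crossing :: "nat \<Rightarrow> nat set \<Rightarrow> nat set set" where
  "crossing n c = {b \<in> chords n. crosses b c}"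

text \<open>The equation of the pair with \<open>A = {c}\<close>. Among families without zeros these
  equations already characterise \<open>M0\<close>, see \<open>M0I\<close>, so they are what the
  chart at a vertex is made to solve.\<close>

definition basic :: "nat \<Rightarrow> (nat set \<Rightarrow> 'a::comm_ring_1) \<Rightarrow> nat set \<Rightarrow> bool" where
  "basic n u c \<longleftrightarrow> u c + (\<Prod>b\<in>crossing n c. u b) = 1"

lemma chord_iff: "p < q ==> {p, q} \<in> chords n \<longleftrightarrow> chordp n p q"
proof
  assume pq: "p < q" and "{p, q} \<in> chords n"
  then obtain i j where ij: "{p, q} = {i, j}" "i \<in> {1..n}" "j \<in> {1..n}" "distinct [i, nxt n i, j, nxt n j]"
    unfolding chords_def by blast
  then have "p = i \<and> q = j \<or> p = j \<and> q = i" by (auto simp: doubleton_eq_iff)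
  then show "chordp n p q" using ij(2-4) pq by (auto simp: chordp_def nxt_def split: if_splits)
next
  assume "p < q" "chordp n p q"
  then show "{p, q} \<in> chords n"
    unfolding chords_def chordp_def by (intro CollectI exI[of _ p] exI[of _ q]) (auto simp: nxt_def)
qed

lemma chordsE:
  assumes "c \<in> chords n"
  obtains p q where "c = {p, q}" "chordp n p q"
proof -
  obtain i j where ij: "c = {i, j}" "i \<in> {1..n}" "j \<in> {1..n}" "distinct [i, nxt n i, j, nxt n j]"
    using assms by (auto simp: chords_def)
  then consider "i < j" | "j < i" by fastforce
  then show ?thesis
  proof cases
    case 1 then show ?thesis using that[of i j] ij assms chord_iff by blast
  next
    case 2 then show ?thesis using that[of j i] ij assms chord_iff by (metis insert_commute)
  qed
qed

lemma chordp_less: "chordp n p q ==> p < q" by (simp add: chordp_def)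

lemma chordp_chord: "chordp n p q ==> {p, q} \<in> chords n"
  using chord_iff chordp_less by blast

lemma finite_chords [simp]: "finite (chords n)"
proof -
  have "chords n \<subseteq> Pow {1..n}" by (auto simp: chords_def)
  then show ?thesis using finite_subset by blast
qed

lemma finite_crossing [simp]: "finite (crossing n c)"
  by (simp add: crossing_def)

lemma crosses_iff:
  "a < b ==> p < q ==> crosses {a, b} {p, q} \<longleftrightarrow> a < p \<and> p < b \<and> b < q \<or> p < a \<and> a < q \<and> q < b"
  unfolding crosses_def by (auto simp: doubleton_eq_iff)

lemma crosses_sym: "crosses c d \<longleftrightarrow> crosses d c"
  unfolding crosses_def by blast

lemma not_crosses_self: "\<not> crosses c c"
  unfolding crosses_def by (auto simp: doubleton_eq_iff)

lemma crossing_eq: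
  assumes "chordp n p q"
  shows "crossing n {p, q} = joining {p<..<q} ({1..<p} \<union> {q<..n})"
proof (intro equalityI subsetI)
  fix b assume b: "b \<in> crossing n {p, q}"
  then obtain r s where rs: "b = {r, s}" "chordp n r s" by (auto simp: crossing_def elim: chordsE)
  then have "r < p \<and> p < s \<and> s < q \<or> p < r \<and> r < q \<and> q < s"
    using b crosses_iff[of r s p q] chordp_less[OF assms] chordp_less[OF rs(2)] by (simp add: crossing_def)
  then show "b \<in> joining {p<..<q} ({1..<p} \<union> {q<..n})"
  proof
    assume "r < p \<and> p < s \<and> s < q"
    then show ?thesis using rs unfolding joining_def chordp_def
      by (intro CollectI exI[of _ s] exI[of _ r]) auto
  next
    assume "p < r \<and> r < q \<and> q < s"
    then show ?thesis using rs unfolding joining_def chordp_def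
      by (intro CollectI exI[of _ r] exI[of _ s]) auto
  qed
next
  fix b assume "b \<in> joining {p<..<q} ({1..<p} \<union> {q<..n})"
  then obtain a d where b: "b = {a, d}" "p < a" "a < q" "1 \<le> d \<and> d < p \<or> q < d \<and> d \<le> n"
    by (auto simp: joining_def)
  from b(4) show "b \<in> crossing n {p, q}"
  proof
    assume d: "1 \<le> d \<and> d < p"
    then have "b = {d, a}" "chordp n d a" using b assms by (auto simp: chordp_def)
    then show ?thesis using b d chordp_chord crosses_iff[of d a p q] chordp_less[OF assms] by (auto simp: crossing_def)
  next
    assume d: "q < d \<and> d \<le> n"
    then have "chordp n a d" using b assms by (auto simp: chordp_def)
    then show ?thesis using b d chordp_chord crosses_iff[of a d p q] chordp_less[OF assms] by (auto simp: crossing_def)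
  qed
qed

lemma prod_joining:
  assumes "finite P" "finite Q" "P \<inter> Q = {}"
  shows "(\<Prod>c\<in>joining P Q. f c) = (\<Prod>p\<in>P. \<Prod>q\<in>Q. f {p, q})"
proof -
  have "joining P Q = (\<lambda>(p, q). {p, q}) ` (P \<times> Q)" by (auto simp: joining_def)
  moreover have "inj_on (\<lambda>(p, q). {p, q}) (P \<times> Q)"
    using assms(3) by (auto simp: inj_on_def doubleton_eq_iff)
  ultimately have "(\<Prod>c\<in>joining P Q. f c) = (\<Prod>(p, q)\<in>P \<times> Q. f {p, q})"
    by (simp add: prod.reindex case_prod_unfold)
  then show ?thesis by (simp add: prod.cartesian_product)
qed

lemma joining_commute: "joining P Q = joining Q P"
  unfolding joining_def by (auto simp: insert_commute)

lemma crossing_pairI: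
  assumes "cross_completely n A B" "1 \<le> i" "i < j" "j < k" "k < l" "l \<le> n"
    and "A = joining {i..<j} {k..<l} \<and> B = joining {j..<k} ({l..n} \<union> {1..<i})
        \<or> A = joining {j..<k} ({l..n} \<union> {1..<i}) \<and> B = joining {i..<j} {k..<l}"
  shows "crossing_pair n A B"
  unfolding crossing_pair_def Let_def using assms by blast

text \<open>That only \<open>c\<close> crosses everything in \<open>crossing n c\<close>: at each
  vertex other than the ends of \<open>c\<close> begins a chord crossing \<open>c\<close>, and
  chords with a common end do not cross.\<close>

lemma crossing_pair_basic:
  assumes c: "c \<in> chords n"
  shows "crossing_pair n {c} (crossing n c)"
proof -
  obtain p q where pq: "c = {p, q}" "chordp n p q" using chordsE[OF c] .
  note X = crossing_eq[OF pq(2)]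
  have "{c} = {a \<in> chords n. \<forall>b\<in>crossing n c. crosses a b}"
  proof (intro equalityI subsetI)
    fix a assume "a \<in> {c}" then show "a \<in> {a \<in> chords n. \<forall>b\<in>crossing n c. crosses a b}"
      using c by (auto simp: crossing_def crosses_sym[of c])
  next
    fix a assume a: "a \<in> {a \<in> chords n. \<forall>b\<in>crossing n c. crosses a b}"
    then obtain r s where rs: "a = {r, s}" "chordp n r s" using chordsE by blast
    have no: "\<not> crosses a b" if "b = {t, t'}" "t \<in> a" for b t t'
      using that rs unfolding crosses_def by (auto simp: doubleton_eq_iff)
    have "t \<in> {p, q}" if t: "t \<in> a" for t
    proof (rule ccontr)
      assume "t \<notin> {p, q}"
      have tn: "1 \<le> t" "t \<le> n" using t rs by (auto simp: chordp_def)
      obtain t' where "{t, t'} \<in> joining {p<..<q} ({1..<p} \<union> {q<..n})"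
      proof (cases "p < t \<and> t < q")
        case True
        have "(if p = 1 then n else 1) \<in> {1..<p} \<union> {q<..n}" using pq(2) by (auto simp: chordp_def)
        then show ?thesis using True that[of "if p = 1 then n else 1"] unfolding joining_def by auto
      next
        case False
        then have "t \<in> {1..<p} \<union> {q<..n}" using tn \<open>t \<notin> {p, q}\<close> by auto
        moreover have "Suc p \<in> {p<..<q}" using pq(2) by (auto simp: chordp_def)
        ultimately have "{Suc p, t} \<in> joining {p<..<q} ({1..<p} \<union> {q<..n})" unfolding joining_def by blast
        then show ?thesis using that[of "Suc p"] by (simp add: insert_commute)
      qed
      then show False using no[OF refl t] a X pq by auto
    qed
    then have "a \<subseteq> {p, q}" by blast
    moreover have "card a = 2" "card {p, q} = 2" using rs(2) pq(2) unfolding rs by (auto simp: chordp_def)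
    ultimately have "a = {p, q}" by (metis card_subset_eq finite.emptyI finite_insert)
    then show "a \<in> {c}" using pq by simp
  qed
  moreover have "crossing n c = {b \<in> chords n. \<forall>a\<in>{c}. crosses a b}"
    by (auto simp: crossing_def crosses_sym[of c])
  ultimately have cc: "cross_completely n {c} (crossing n c)" unfolding cross_completely_def by (rule conjI)
  show ?thesis
  \<comment> \<open>The fourth arc has to contain \<open>n\<close>. So for \<open>q = n\<close> the
    partition is rotated, and \<open>c\<close> joins the second arc \<open>{p}\<close> to the fourth
    arc \<open>{n}\<close>.\<close>
  proof (cases "q = n")
    case False
    have "{c} = joining {p..<Suc p} {q..<Suc q}" by (simp add: joining_def pq)
    moreover have "crossing n c = joining {Suc p..<q} ({Suc q..n} \<union> {1..<p})"
      unfolding pq X by (intro arg_cong2[of _ _ _ _ joining]) auto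
    moreover have "1 \<le> p" "Suc p < q" "Suc q \<le> n" using pq(2) False by (auto simp: chordp_def)
    ultimately show ?thesis
      by (intro crossing_pairI[OF cc, of p "Suc p" q "Suc q"] lessI disjI1 conjI)
  next
    case True
    have "{c} = joining {p..<Suc p} ({n..n} \<union> {1..<1})" by (simp add: joining_def pq True)
    moreover have "crossing n c = joining {1..<p} {Suc p..<n}"
      unfolding pq X by (subst joining_commute, intro arg_cong2[of _ _ _ _ joining]) (auto simp: True)
    moreover have "1 < p" "Suc p < n" using pq(2) True by (auto simp: chordp_def)
    ultimately show ?thesis
      by (intro crossing_pairI[OF cc, of 1 p "Suc p" n] lessI order_refl disjI2 conjI)
  qed
qed

lemma M_delta_basic:
  assumes "u \<in> M_delta n" "c \<in> chords n"
  shows "basic n u c"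
proof -
  have "\<forall>A B. crossing_pair n A B \<longrightarrow> (\<Prod>a\<in>A. u a) + (\<Prod>b\<in>B. u b) - 1 = 0"
    using assms(1) by (simp add: M_delta_def)
  from this[rule_format, OF crossing_pair_basic[OF assms(2)]]
  show ?thesis by (simp add: basic_def)
qed

section \<open>Cross-ratios satisfy the equations\<close>

lemma wedge_swap: "wedge a b = - wedge b a"
  by (simp add: wedge_def)

text \<open>Exchanging \<open>p\<close> and \<open>q\<close> reverses all four wedges and the signs
  cancel, so the formula needs no order of the end points.\<close>

lemma dihedral_coords_eq:
  assumes "{p, q} \<in> chords n"
  shows "dihedral_coords n z {p, q} =
    wedge (z p) (z (nxt n q)) * wedge (z (nxt n p)) (z q) / (wedge (z p) (z q) * wedge (z (nxt n p)) (z (nxt n q)))"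
proof -
  have eq: "dihedral_coords n z {a, b} =
    wedge (z a) (z (nxt n b)) * wedge (z (nxt n a)) (z b) / (wedge (z a) (z b) * wedge (z (nxt n a)) (z (nxt n b)))"
    if "a < b" "{a, b} \<in> chords n" for a b
    using that by (simp add: dihedral_coords_def cross_ratio_def)
  obtain a b where "{p, q} = {a, b}" "chordp n a b" using chordsE[OF assms] .
  then have "p \<noteq> q" by (auto simp: doubleton_eq_iff chordp_def)
  then consider "p < q" | "q < p" by fastforce
  then show ?thesis
  proof cases
    case 1 then show ?thesis using eq assms by blast
  next
    case 2
    have "dihedral_coords n z {p, q} = dihedral_coords n z {q, p}" by (simp add: insert_commute)
    also have "\<dots> = wedge (z q) (z (nxt n p)) * wedge (z (nxt n q)) (z p) / (wedge (z q) (z p) * wedge (z (nxt n q)) (z (nxt n p)))"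
      by (rule eq[OF 2]) (use assms in \<open>simp add: insert_commute\<close>)
    finally show ?thesis
      using wedge_swap[of "z q" "z (nxt n p)"] wedge_swap[of "z (nxt n q)" "z p"]
        wedge_swap[of "z q" "z p"] wedge_swap[of "z (nxt n q)" "z (nxt n p)"] by (simp add: mult_ac)
  qed
qed

lemma prod_telescope:
  fixes h :: "nat \<Rightarrow> complex"
  assumes "i \<le> j" "\<And>p. i \<le> p ==> p \<le> j ==> h p \<noteq> 0"
  shows "(\<Prod>p\<in>{i..<j}. h (Suc p) / h p) = h j / h i"
  using assms
proof (induction j rule: dec_induct)
  case (step m)
  then show ?case by (simp add: prod.atLeastLessThan_Suc)
qed auto

lemma prod_telescope_nxt:
  fixes h :: "nat \<Rightarrow> complex"
  assumes "i \<le> j" "j \<le> n" "\<And>p. i \<le> p ==> p \<le> j ==> h p \<noteq> 0"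
  shows "(\<Prod>p\<in>{i..<j}. h (nxt n p) / h p) = h j / h i"
proof -
  have "(\<Prod>p\<in>{i..<j}. h (nxt n p) / h p) = (\<Prod>p\<in>{i..<j}. h (Suc p) / h p)"
    using assms(2) by (intro prod.cong) (auto simp: nxt_def)
  then show ?thesis using prod_telescope[OF assms(1,3)] by simp
qed

text \<open>Over a rectangle of two arcs the product of dihedral coordinates telescopes in both
  directions to a single cross-ratio of the points where the four arcs begin. The two cross-ratios
  add up to 1 by the Pluecker relation.\<close>

lemma configurations_M_delta:
  assumes z: "z \<in> configurations n"
  shows "dihedral_coords n z \<in> M_delta n"
proof -
  define g where "g p q = wedge (z p) (z q)" for p q
  define V where "V p q = g p (nxt n q) * g (nxt n p) q / (g p q * g (nxt n p) (nxt n q))" for p q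
  have g0: "g p q \<noteq> 0" if "p \<in> {1..n}" "q \<in> {1..n}" "p \<noteq> q" for p q
    using z that by (auto simp: configurations_def g_def)
  have main: "(\<Prod>a\<in>joining {i..<j} {k..<l}. dihedral_coords n z a) + (\<Prod>b\<in>joining {j..<k} ({l..n} \<union> {1..<i}). dihedral_coords n z b) = 1"
    if h: "1 \<le> i" "i < j" "j < k" "k < l" "l \<le> n"
      and ch: "joining {i..<j} {k..<l} \<subseteq> chords n" "joining {j..<k} ({l..n} \<union> {1..<i}) \<subseteq> chords n" for i j k l
  proof -
    have row: "(\<Prod>p\<in>{a..<b}. V p q) = g b q * g a (nxt n q) / (g b (nxt n q) * g a q)"
      if "1 \<le> a" "a \<le> b" "b \<le> n" "q \<in> {1..n}" "nxt n q \<in> {1..n}" "q \<notin> {a..b}" "nxt n q \<notin> {a..b}" for a b q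
    proof -
      have "(\<Prod>p\<in>{a..<b}. V p q) = (\<Prod>p\<in>{a..<b}. (g (nxt n p) q / g (nxt n p) (nxt n q)) / (g p q / g p (nxt n q)))"
        by (intro prod.cong) (auto simp: V_def mult.commute)
      also have "\<dots> = (g b q / g b (nxt n q)) / (g a q / g a (nxt n q))"
        by (rule prod_telescope_nxt) (use that g0 in auto)
      finally show ?thesis by simp
    qed
    have dV: "dihedral_coords n z {p, q} = V p q" if "{p, q} \<in> chords n" for p q
      using dihedral_coords_eq[OF that] by (simp add: V_def g_def)
    have "(\<Prod>a\<in>joining {i..<j} {k..<l}. dihedral_coords n z a) = (\<Prod>p\<in>{i..<j}. \<Prod>q\<in>{k..<l}. dihedral_coords n z {p, q})"
      using h by (intro prod_joining) auto
    also have "\<dots> = (\<Prod>p\<in>{i..<j}. \<Prod>q\<in>{k..<l}. V p q)"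
      using ch(1) by (intro prod.cong refl dV) (auto simp: joining_def)
    also have "\<dots> = (\<Prod>q\<in>{k..<l}. \<Prod>p\<in>{i..<j}. V p q)" by (rule prod.swap)
    also have "\<dots> = (\<Prod>q\<in>{k..<l}. (g i (nxt n q) / g j (nxt n q)) / (g i q / g j q))"
    proof (intro prod.cong refl)
      fix q assume "q \<in> {k..<l}"
      then have "(\<Prod>p\<in>{i..<j}. V p q) = g j q * g i (nxt n q) / (g j (nxt n q) * g i q)"
        using h by (intro row) (auto simp: nxt_def)
      then show "(\<Prod>p\<in>{i..<j}. V p q) = (g i (nxt n q) / g j (nxt n q)) / (g i q / g j q)" by (simp add: mult_ac)
    qed
    also have "\<dots> = (g i l / g j l) / (g i k / g j k)"
      by (rule prod_telescope_nxt) (use h g0 in auto)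
    finally have A: "(\<Prod>a\<in>joining {i..<j} {k..<l}. dihedral_coords n z a) = (g i l / g j l) / (g i k / g j k)" .
    let ?Q = "{l..n} \<union> {1..<i}"
    have "(\<Prod>a\<in>joining {j..<k} ?Q. dihedral_coords n z a) = (\<Prod>p\<in>{j..<k}. \<Prod>q\<in>?Q. dihedral_coords n z {p, q})"
      using h by (intro prod_joining) auto
    also have "\<dots> = (\<Prod>p\<in>{j..<k}. \<Prod>q\<in>?Q. V p q)"
      using ch(2) by (intro prod.cong refl dV) (auto simp: joining_def)
    also have "\<dots> = (\<Prod>q\<in>?Q. \<Prod>p\<in>{j..<k}. V p q)" by (rule prod.swap)
    also have "\<dots> = (\<Prod>q\<in>?Q. (g j (nxt n q) / g k (nxt n q)) / (g j q / g k q))"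
    proof (intro prod.cong refl)
      fix q assume "q \<in> ?Q"
      then have "(\<Prod>p\<in>{j..<k}. V p q) = g k q * g j (nxt n q) / (g k (nxt n q) * g j q)"
        using h by (intro row) (auto simp: nxt_def)
      then show "(\<Prod>p\<in>{j..<k}. V p q) = (g j (nxt n q) / g k (nxt n q)) / (g j q / g k q)" by (simp add: mult_ac)
    qed
    \<comment> \<open>The fourth arc passes from \<open>n\<close> to 1. It is split there, and the
      factor at \<open>q = n\<close>, where \<open>nxt n n = 1\<close>, links the two telescoping
      products.\<close>
    also have "\<dots> = (\<Prod>q\<in>{l..n}. (g j (nxt n q) / g k (nxt n q)) / (g j q / g k q)) *
        (\<Prod>q\<in>{1..<i}. (g j (nxt n q) / g k (nxt n q)) / (g j q / g k q))"
      using h by (intro prod.union_disjoint) auto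
    also have "(\<Prod>q\<in>{1..<i}. (g j (nxt n q) / g k (nxt n q)) / (g j q / g k q)) = (g j i / g k i) / (g j 1 / g k 1)"
      by (rule prod_telescope_nxt) (use h g0 in auto)
    also have "(\<Prod>q\<in>{l..n}. (g j (nxt n q) / g k (nxt n q)) / (g j q / g k q)) =
       (g j (nxt n n) / g k (nxt n n)) / (g j n / g k n) * (\<Prod>q\<in>{l..<n}. (g j (nxt n q) / g k (nxt n q)) / (g j q / g k q))"
    proof -
      have "{l..n} = insert n {l..<n}" using h by auto
      then show ?thesis by (simp only:) (subst prod.insert, auto)
    qed
    also have "nxt n n = 1" by (simp add: nxt_def)
    also have "(\<Prod>q\<in>{l..<n}. (g j (nxt n q) / g k (nxt n q)) / (g j q / g k q)) = (g j n / g k n) / (g j l / g k l)"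
      by (rule prod_telescope_nxt) (use h g0 in auto)
    finally have B: "(\<Prod>b\<in>joining {j..<k} ?Q. dihedral_coords n z b) = (g j i / g k i) / (g j l / g k l)"
      using h g0[of j n] g0[of k n] g0[of j 1] g0[of k 1] by (auto simp: field_simps)
    have "g i l * g j k + g i j * g k l = g i k * g j l"
      unfolding g_def wedge_def by (simp add: algebra_simps)
    moreover have "g j i = - g i j" "g k i = - g i k" unfolding g_def using wedge_swap by blast+
    moreover have "g i k \<noteq> 0" "g j l \<noteq> 0" "g j k \<noteq> 0" "g k l \<noteq> 0" using h g0 by auto
    ultimately show ?thesis unfolding A B by (simp add: field_simps)
  qed
  show ?thesis
    unfolding M_delta_def
  proof (intro CollectI conjI allI impI)
    show "dihedral_coords n z c = 0" if "c \<notin> chords n" for c using that by (simp add: dihedral_coords_def)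
    fix A B assume "crossing_pair n A B"
    then obtain i j k l where cc: "cross_completely n A B" and h: "1 \<le> i" "i < j" "j < k" "k < l" "l \<le> n"
      and AB: "A = joining {i..<j} {k..<l} \<and> B = joining {j..<k} ({l..n} \<union> {1..<i})
        \<or> A = joining {j..<k} ({l..n} \<union> {1..<i}) \<and> B = joining {i..<j} {k..<l}"
      unfolding crossing_pair_def Let_def by blast
    have "A \<subseteq> chords n" "B \<subseteq> chords n" using cc unfolding cross_completely_def by blast+
    then have "(\<Prod>a\<in>A. dihedral_coords n z a) + (\<Prod>b\<in>B. dihedral_coords n z b) = 1"
      using AB main[OF h] by (auto simp: add.commute)
    then show "(\<Prod>a\<in>A. dihedral_coords n z a) + (\<Prod>b\<in>B. dihedral_coords n z b) - 1 = 0" by simp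
  qed
qed

lemma configurations_nonzero:
  assumes z: "z \<in> configurations n" and c: "c \<in> chords n"
  shows "dihedral_coords n z c \<noteq> 0"
proof -
  obtain p q where pq: "c = {p, q}" "chordp n p q" using chordsE[OF c] .
  have g0: "wedge (z a) (z b) \<noteq> 0" if "a \<in> {1..n}" "b \<in> {1..n}" "a \<noteq> b" for a b
    using z that by (auto simp: configurations_def)
  have *: "nxt n p = Suc p" "nxt n q \<in> {1..n}" "nxt n q \<noteq> p" "nxt n q \<noteq> Suc p"
    "p \<in> {1..n}" "Suc p \<in> {1..n}" "q \<in> {1..n}" "p \<noteq> q" "Suc p \<noteq> q"
    using pq(2) by (auto simp: nxt_def chordp_def)
  have "wedge (z p) (z (nxt n q)) \<noteq> 0" "wedge (z (Suc p)) (z q) \<noteq> 0"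
    "wedge (z p) (z q) \<noteq> 0" "wedge (z (Suc p)) (z (nxt n q)) \<noteq> 0"
    by (rule g0, use * in force, use * in force, use * in force)+
  then show ?thesis
    using * c unfolding pq(1) by (simp add: dihedral_coords_eq)
qed

lemma M0_M_delta: "u \<in> M0 n ==> u \<in> M_delta n"
  using configurations_M_delta by (auto simp: M0_def)

lemma M0_nonzero: "u \<in> M0 n ==> c \<in> chords n ==> u c \<noteq> 0"
  using configurations_nonzero by (auto simp: M0_def)

section \<open>Recovering the points from the coordinates\<close>

definition cf :: "(nat \<Rightarrow> complex) \<Rightarrow> nat \<Rightarrow> complex \<times> complex" where
  "cf z j = (if j = 1 then (1, 0) else (z j, 1))"

definition zz :: "nat \<Rightarrow> (nat set \<Rightarrow> complex) \<Rightarrow> nat \<Rightarrow> complex" where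
  "zz n u q = (if q \<le> 2 then 0 else \<Prod>k\<in>{q..<n}. u {1, k})"

definition Dih :: "nat \<Rightarrow> (nat \<Rightarrow> complex) \<Rightarrow> nat set \<Rightarrow> complex" where
  "Dih n z = dihedral_coords n (cf z)"

lemma wedge_cf:
  "wedge (cf z p) (cf z q) = (if p = 1 then (if q = 1 then 0 else 1) else if q = 1 then -1 else z p - z q)"
  by (auto simp: wedge_def cf_def)

lemma cf_configurations:
  assumes "inj_on z {2..n}"
  shows "cf z \<in> configurations n"
  using assms by (auto simp: configurations_def wedge_cf inj_on_def)

lemma Dih_M0: "inj_on z {2..n} ==> Dih n z \<in> M0 n"
  unfolding Dih_def M0_def using cf_configurations by blast

lemma Dih_simps:
  assumes "chordp n p q"
  shows "p \<noteq> 1 ==> q < n ==> Dih n z {p, q} = (z p - z (Suc q)) * (z (Suc p) - z q) / ((z p - z q) * (z (Suc p) - z (Suc q)))"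
    and "p = 1 ==> Dih n z {p, q} = (z 2 - z q) / (z 2 - z (Suc q))"
    and "q = n ==> Dih n z {p, q} = (z n - z (Suc p)) / (z n - z p)"
  using assms dihedral_coords_eq[OF chordp_chord[OF assms], of "cf z"]
  by (auto simp: Dih_def wedge_cf nxt_def chordp_def numeral_2_eq_2)

text \<open>\<open>zz\<close> gives the points when the first is moved to \<open>\<infinity>\<close>, the second to \<open>0\<close> and the last to
  \<open>1\<close>. The products \<open>D p q\<close> below satisfy the same three-term relation as the differences
  \<open>z\<^sub>q - z\<^sub>p\<close>; this determines them, starting from \<open>p = 2\<close>.\<close>

lemma basic_imp_Dih:
  assumes bas: "\<And>c. c \<in> chords n ==> basic n u c" and nz: "\<And>c. c \<in> chords n ==> u c \<noteq> 0"
    and supp: "\<And>c. c \<notin> chords n ==> u c = 0" and n: "n \<ge> 4"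
  shows "inj_on (zz n u) {2..n}" "u = Dih n (zz n u)"
proof -
  define z where "z = zz n u"
  \<comment> \<open>The aim is \<open>C p q = 1 - z p / z q\<close>, that is
    \<open>D p q = z q - z p\<close>. \<open>R p q\<close> is the row by which \<open>C\<close>
    grows when \<open>p\<close> increases.\<close>
  define C where "C p q = (\<Prod>a\<in>{2..<p}. \<Prod>b\<in>{q..n}. u {a, b})" for p q
  define R where "R p q = (\<Prod>b\<in>{q..n}. u {p, b})" for p q
  define D where "D p q = z q * C p q" for p q
  have ch: "{a, b} \<in> chords n" if "2 \<le> a" "a + 2 \<le> b" "b \<le> n" for a b
    using that by (intro chordp_chord) (auto simp: chordp_def)
  have ch1: "{1, b} \<in> chords n" if "3 \<le> b" "b < n" for b
    using that by (intro chordp_chord) (auto simp: chordp_def)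
  have z2: "z 2 = 0" by (simp add: z_def zz_def)
  have zS: "z q = u {1, q} * z (Suc q)" if "3 \<le> q" "q < n" for q
    using that by (simp add: z_def zz_def prod.atLeast_Suc_lessThan)
  have z0: "z q \<noteq> 0" if "3 \<le> q" "q \<le> n" for q
    using that nz ch1 by (auto simp: z_def zz_def)
  have C0: "C p q \<noteq> 0" if "p < q" "q \<le> n" for p q
    unfolding C_def using that by (auto simp: prod_zero_iff intro!: nz ch)
  have CS: "C (Suc p) q = C p q * R p q" if "2 \<le> p" for p q
    using that by (simp add: C_def R_def prod.atLeastLessThan_Suc)
  have RS: "R p q = u {p, q} * R p (Suc q)" if "q \<le> n" for p q
    using that by (simp add: R_def prod.atLeast_Suc_atMost)
  have B1: "1 - u {1, q} = C q (Suc q)" if "3 \<le> q" "q < n" for q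
  proof -
    have cp: "chordp n 1 q" using that by (auto simp: chordp_def)
    have e: "{1<..<q} = {2..<q}" "{1..<1} \<union> {q<..n} = {Suc q..n}" by auto
    have "u {1, q} + (\<Prod>b\<in>joining {2..<q} {Suc q..n}. u b) = 1"
      using bas[OF chordp_chord[OF cp]] unfolding basic_def crossing_eq[OF cp] e .
    then show ?thesis by (subst (asm) prod_joining) (auto simp: C_def algebra_simps)
  qed
  have D1: "D q (Suc q) = z (Suc q) - z q" if "3 \<le> q" "q < n" for q
    using B1[OF that] zS[OF that] by (simp add: D_def algebra_simps flip: B1[OF that])
  have D1': "D q (Suc q) = z (Suc q) - z q" if "2 \<le> q" "q < n" for q
    using D1[of q] that z2 by (cases "q = 2") (auto simp: D_def C_def)
  \<comment> \<open>The basic equation of \<open>{p, q}\<close> multiplied out; it is the Pluecker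
    relation for the differences of the \<open>z q\<close>.\<close>
  have B2: "D p q * D (Suc p) (Suc q) = D p (Suc q) * D (Suc p) q + D p (Suc p) * D q (Suc q)"
    if "2 \<le> p" "p + 2 \<le> q" "q < n" for p q
  proof -
    have cp: "chordp n p q" using that by (auto simp: chordp_def)
    have e: "{p<..<q} = {Suc p..<q}" "{1..<p} \<union> {q<..n} = insert 1 ({2..<p} \<union> {Suc q..n})" using that by auto
    define B where "B = (\<Prod>a\<in>{Suc p..<q}. \<Prod>b\<in>insert 1 ({2..<p} \<union> {Suc q..n}). u {a, b})"
    have uB: "u {p, q} + B = 1"
    proof -
      have "u {p, q} + (\<Prod>b\<in>joining {Suc p..<q} (insert 1 ({2..<p} \<union> {Suc q..n})). u b) = 1"
        using bas[OF chordp_chord[OF cp]] unfolding basic_def crossing_eq[OF cp] e .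
      then show ?thesis unfolding B_def using that by (subst (asm) prod_joining) auto
    qed
    \<comment> \<open>The chords crossing \<open>{p, q}\<close> end at the vertex 1, in
      \<open>{2..<p}\<close> or in \<open>{Suc q..n}\<close>. Each of these three blocks is a ratio
      of two values of \<open>z\<close> or of \<open>C\<close>.\<close>
    have Be: "B = (\<Prod>a\<in>{Suc p..<q}. u {1, a}) * (\<Prod>a\<in>{2..<p}. \<Prod>b\<in>{Suc p..<q}. u {a, b}) * (\<Prod>a\<in>{Suc p..<q}. \<Prod>b\<in>{Suc q..n}. u {a, b})"
    proof -
      have "B = (\<Prod>a\<in>{Suc p..<q}. u {1, a} * ((\<Prod>b\<in>{2..<p}. u {b, a}) * (\<Prod>b\<in>{Suc q..n}. u {a, b})))"
        unfolding B_def
      proof (intro prod.cong refl)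
        fix a assume "a \<in> {Suc p..<q}"
        have "(\<Prod>b\<in>{2..<p} \<union> {Suc q..n}. u {a, b}) = (\<Prod>b\<in>{2..<p}. u {a, b}) * (\<Prod>b\<in>{Suc q..n}. u {a, b})"
          using that by (intro prod.union_disjoint) auto
        then show "(\<Prod>b\<in>insert 1 ({2..<p} \<union> {Suc q..n}). u {a, b}) = u {1, a} * ((\<Prod>b\<in>{2..<p}. u {b, a}) * (\<Prod>b\<in>{Suc q..n}. u {a, b}))"
          using that by (subst prod.insert) (auto simp: insert_commute)
      qed
      also have "\<dots> = (\<Prod>a\<in>{Suc p..<q}. u {1, a}) * ((\<Prod>a\<in>{Suc p..<q}. \<Prod>b\<in>{2..<p}. u {b, a}) * (\<Prod>a\<in>{Suc p..<q}. \<Prod>b\<in>{Suc q..n}. u {a, b}))"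
        by (simp only: prod.distrib)
      also have "(\<Prod>a\<in>{Suc p..<q}. \<Prod>b\<in>{2..<p}. u {b, a}) = (\<Prod>a\<in>{2..<p}. \<Prod>b\<in>{Suc p..<q}. u {a, b})" by (rule prod.swap)
      finally show ?thesis by (simp only: mult.assoc)
    qed
    have c1: "C p (Suc p) = (\<Prod>a\<in>{2..<p}. \<Prod>b\<in>{Suc p..<q}. u {a, b}) * C p q"
    proof -
      have "{Suc p..n} = {Suc p..<q} \<union> {q..n}" using that by auto
      then have "(\<Prod>b\<in>{Suc p..n}. u {a, b}) = (\<Prod>b\<in>{Suc p..<q}. u {a, b}) * (\<Prod>b\<in>{q..n}. u {a, b})" for a
        by (simp only:) (rule prod.union_disjoint, auto)
      then show ?thesis by (simp only: C_def prod.distrib)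
    qed
    have c2: "C q (Suc q) = C (Suc p) (Suc q) * (\<Prod>a\<in>{Suc p..<q}. \<Prod>b\<in>{Suc q..n}. u {a, b})"
    proof -
      have "{2..<q} = {2..<Suc p} \<union> {Suc p..<q}" using that by auto
      then show ?thesis unfolding C_def by (simp only:) (rule prod.union_disjoint, auto)
    qed
    have c3: "z (Suc p) = (\<Prod>a\<in>{Suc p..<q}. u {1, a}) * z q"
    proof -
      have "{Suc p..<n} = {Suc p..<q} \<union> {q..<n}" using that by auto
      then have "(\<Prod>k\<in>{Suc p..<n}. u {1, k}) = (\<Prod>k\<in>{Suc p..<q}. u {1, k}) * (\<Prod>k\<in>{q..<n}. u {1, k})"
        by (simp only:) (rule prod.union_disjoint, auto)
      then show ?thesis using that by (simp add: z_def zz_def)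
    qed
    have "D p q * D (Suc p) (Suc q) = (u {p, q} + B) * (D p q * D (Suc p) (Suc q))" using uB by simp
    also have "\<dots> = u {p, q} * D p q * D (Suc p) (Suc q) + B * D p q * D (Suc p) (Suc q)" by (simp add: algebra_simps)
    also have "u {p, q} * D p q * D (Suc p) (Suc q) = D p (Suc q) * D (Suc p) q"
      using that by (simp add: D_def CS RS[of q p])
    also have "B * D p q * D (Suc p) (Suc q) = D p (Suc p) * D q (Suc q)"
      by (simp add: D_def Be c1 c2 c3 mult_ac)
    finally show ?thesis .
  qed
  \<comment> \<open>Row by row in \<open>p\<close> and, within a row, by induction on
    \<open>q\<close>: \<open>B2\<close> is solved for its last unknown
    \<open>D (Suc p) (Suc q)\<close>, which is possible since \<open>D p q\<close> is not 0.\<close>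
  have main: "\<forall>q. p < q \<and> q \<le> n \<longrightarrow> D p q = z q - z p" if "2 \<le> p" for p
    using that
  proof (induction p rule: dec_induct)
    case base then show ?case using z2 by (auto simp: D_def C_def)
  next
    case (step p)
    note st = step
    have "D (Suc p) q = z q - z (Suc p)" if "Suc (Suc p) \<le> q" "q \<le> n" for q
      using that
    proof (induction q rule: dec_induct)
      case base then show ?case using D1'[of "Suc p"] step(1) by auto
    next
      case (step q)
      have D0: "D p q \<noteq> 0" using z0[of q] C0[of p q] st(1) step by (auto simp: D_def)
      have "D p q * D (Suc p) (Suc q) = D p (Suc q) * D (Suc p) q + D p (Suc p) * D q (Suc q)"
        using st step by (intro B2) auto
      also have "\<dots> = (z (Suc q) - z p) * (z q - z (Suc p)) + (z (Suc p) - z p) * (z (Suc q) - z q)"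
        using st step D1'[of q] by auto
      also have "\<dots> = (z q - z p) * (z (Suc q) - z (Suc p))" by (simp add: algebra_simps)
      also have "z q - z p = D p q" using st step by auto
      finally show ?case using D0 by simp
    qed
    then show ?case by auto
  qed
  have diff: "z q - z p = z q * C p q" "z q - z p \<noteq> 0" if "2 \<le> p" "p < q" "q \<le> n" for p q
    using main[of p] that z0[of q] C0[of p q] by (auto simp: D_def)
  show "inj_on (zz n u) {2..n}"
    unfolding inj_on_def z_def[symmetric]
  proof (intro ballI impI)
    fix p q assume h: "p \<in> {2..n}" "q \<in> {2..n}" "z p = z q"
    show "p = q" using diff(2)[of p q] diff(2)[of q p] h by (cases p q rule: linorder_cases) auto
  qed
  show "u = Dih n (zz n u)"
  proof
    fix c
    show "u c = Dih n (zz n u) c"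
    proof (cases "c \<in> chords n")
      case False then show ?thesis using supp by (simp add: Dih_def dihedral_coords_def)
    next
      case True
      then obtain p q where c: "c = {p, q}" and cp: "chordp n p q" using chordsE by blast
      have b: "p < q" "p + 2 \<le> q" "q \<le> n" "1 \<le> p" using cp by (auto simp: chordp_def)
      consider "p = 1" | "p \<noteq> 1" "q = n" | "p \<noteq> 1" "q < n" using b by linarith
      then show ?thesis unfolding c z_def[symmetric]
      proof cases
        case 1
        then have "3 \<le> q" "q < n" using cp by (auto simp: chordp_def)
        moreover have "Dih n z {p, q} = (z 2 - z q) / (z 2 - z (Suc q))" by (rule Dih_simps(2)[OF cp 1])
        ultimately show "u {p, q} = Dih n z {p, q}" using 1 zS[of q] z0[of "Suc q"] z2 by simp
      next
        case 2
        have "Dih n z {p, q} = (z n - z (Suc p)) / (z n - z p)"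
          by (rule Dih_simps(3)[OF cp 2(2)])
        also have "\<dots> = C (Suc p) n / C p n" using 2 b diff[of p n] diff[of "Suc p" n] z0[of n] n by simp
        also have "\<dots> = u {p, q}" using 2 b C0[of p n] by (simp add: CS R_def)
        finally show "u {p, q} = Dih n z {p, q}" by simp
      next
        case 3
        have "Dih n z {p, q} = ((z (Suc q) - z p) * (z q - z (Suc p))) / ((z q - z p) * (z (Suc q) - z (Suc p)))"
          unfolding Dih_simps(1)[OF cp 3]
          by (intro arg_cong2[of _ _ _ _ "(/)"]) (simp_all add: algebra_simps)
        also have "\<dots> = (C p (Suc q) * C (Suc p) q) / (C p q * C (Suc p) (Suc q))"
          using 3 b diff[of p "Suc q"] diff[of "Suc p" q] diff[of p q] diff[of "Suc p" "Suc q"] z0[of q] z0[of "Suc q"] by simp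
        also have "\<dots> = u {p, q}"
          using 3 b C0[of p q] C0[of "Suc p" "Suc q"] by (simp add: CS RS[of q p])
        finally show "u {p, q} = Dih n z {p, q}" by simp
      qed
    qed
  qed
qed

lemma M0I:
  assumes "\<And>c. c \<in> chords n ==> basic n u c" "\<And>c. c \<in> chords n ==> u c \<noteq> 0"
    "\<And>c. c \<notin> chords n ==> u c = 0" "n \<ge> 4"
  shows "u \<in> M0 n"
  using Dih_M0 basic_imp_Dih[OF assms] by metis

lemma M0_Dih:
  assumes "u \<in> M0 n" "n \<ge> 4"
  shows "inj_on (zz n u) {2..n}" "u = Dih n (zz n u)"
  using basic_imp_Dih[OF M_delta_basic[OF M0_M_delta] M0_nonzero _ assms(2), OF assms(1) _ assms(1)] M0_M_delta[OF assms(1)]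
  by (auto simp: M_delta_def)

lemma zz_Dih:
  assumes "inj_on z {2..n}" "z 2 = 0" "z n = 1" "q \<in> {2..n}" "n \<ge> 4"
  shows "zz n (Dih n z) q = z q"
proof (cases "q = 2")
  case False
  have z0: "z k \<noteq> 0" if "3 \<le> k" "k \<le> n" for k using assms that inj_onD[OF assms(1), of k 2] by auto
  have "Dih n z {1, k} = inverse (z (Suc k)) / inverse (z k)" if "k \<in> {q..<n}" for k
    using Dih_simps(2)[of n 1 k z] that False assms by (auto simp: chordp_def field_simps)
  then have "zz n (Dih n z) q = (\<Prod>k\<in>{q..<n}. inverse (z (Suc k)) / inverse (z k))"
    using False assms unfolding zz_def by (auto intro!: prod.cong)
  also have "\<dots> = inverse (z n) / inverse (z q)"
    by (rule prod_telescope[where h="\<lambda>k. inverse (z k)"]) (use False assms z0 in auto)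
  finally show ?thesis using assms by (simp add: field_simps)
qed (use assms in \<open>simp add: zz_def\<close>)

section \<open>Primitives on simply connected spaces\<close>

text \<open>\<open>\<Phi>\<close> differs from each \<open>g i\<close> by a locally constant
  function. Patching uses only this, so it needs no differentiability and works along continuous
  paths.\<close>

definition primitive_on :: "'i set \<Rightarrow> ('i \<Rightarrow> 'b::topological_space set) \<Rightarrow> ('i \<Rightarrow> 'b \<Rightarrow> complex) \<Rightarrow>
    'b set \<Rightarrow> ('b \<Rightarrow> complex) \<Rightarrow> bool" where
  "primitive_on I A g T \<Phi> \<longleftrightarrow> (\<forall>i\<in>I. \<forall>x\<in>T \<inter> A i. \<forall>\<^sub>F y in at x within T. \<Phi> y - g i y = \<Phi> x - g i x)"

lemma primitive_on_subset: "primitive_on I A g T \<Phi> ==> T' \<subseteq> T ==> primitive_on I A g T' \<Phi>"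
  unfolding primitive_on_def by (blast intro: filter_leD at_le)

lemma primitive_on_add_const:
  "primitive_on I A g T \<Phi> ==> primitive_on I A g T (\<lambda>x. \<Phi> x + k)"
  unfolding primitive_on_def by (simp add: algebra_simps)

lemma locally_constant_on_connected:
  fixes f :: "'b::topological_space \<Rightarrow> 'c"
  assumes "connected T" "\<And>x. x \<in> T ==> \<forall>\<^sub>F y in at x within T. f y = f x" "x \<in> T" "y \<in> T"
  shows "f x = f y"
proof -
  have "\<exists>U. open U \<and> x \<in> U \<and> (\<forall>y\<in>U \<inter> T. f y = f x)" if "x \<in> T" for x
    using assms(2)[OF that] unfolding eventually_at_topological by (metis IntE)
  then obtain U where U: "\<And>x. x \<in> T ==> open (U x) \<and> x \<in> U x \<and> (\<forall>y\<in>U x \<inter> T. f y = f x)" by metis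
  define P where "P = (\<Union>z\<in>{z\<in>T. f z = f x}. U z)"
  define Q where "Q = (\<Union>z\<in>{z\<in>T. f z \<noteq> f x}. U z)"
  have "open P" "open Q" unfolding P_def Q_def using U by (auto intro!: open_UN)
  moreover have "T \<subseteq> P \<union> Q" unfolding P_def Q_def using U by blast
  moreover have "P \<inter> Q \<inter> T = {}"
  proof (rule ccontr)
    assume "P \<inter> Q \<inter> T \<noteq> {}"
    then obtain y a b where "a \<in> T" "f a = f x" "y \<in> U a" "b \<in> T" "f b \<noteq> f x" "y \<in> U b" "y \<in> T"
      unfolding P_def Q_def by blast
    then show False using U[of a] U[of b] by (metis IntI)
  qed
  moreover have "x \<in> P \<inter> T" unfolding P_def using U assms(3) by blast
  ultimately have "Q \<inter> T = {}" using connectedD[OF assms(1)] by blast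
  moreover have "y \<in> Q \<inter> T" if "f y \<noteq> f x" using that U assms(4) unfolding Q_def by blast
  ultimately show ?thesis by (metis empty_iff)
qed

lemma primitive_on_unique:
  assumes "connected T" "T \<subseteq> (\<Union>i\<in>I. A i)" "primitive_on I A g T \<Phi>" "primitive_on I A g T \<Psi>" "x \<in> T" "y \<in> T"
  shows "\<Phi> x - \<Psi> x = \<Phi> y - \<Psi> y"
proof (rule locally_constant_on_connected[OF assms(1) _ assms(5,6), of "\<lambda>x. \<Phi> x - \<Psi> x"])
  fix x assume x: "x \<in> T"
  then obtain i where i: "i \<in> I" "x \<in> A i" using assms(2) by blast
  have "\<forall>\<^sub>F y in at x within T. \<Phi> y - g i y = \<Phi> x - g i x" "\<forall>\<^sub>F y in at x within T. \<Psi> y - g i y = \<Psi> x - g i x"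
    using assms(3,4) i x unfolding primitive_on_def by blast+
  then show "\<forall>\<^sub>F y in at x within T. \<Phi> y - \<Psi> y = \<Phi> x - \<Psi> x"
  proof eventually_elim
    case (elim y)
    then have "\<Phi> y = \<Phi> x - g i x + g i y" "\<Psi> y = \<Psi> x - g i x + g i y" by (simp_all add: diff_eq_eq)
    then show ?case by simp
  qed
qed

text \<open>On the connected overlap the two primitives differ by a constant, which is added to one
  of them. Both sets are closed, so a point outside one of them has a neighbourhood missing it, and
  the condition can be checked on each set separately.\<close>

lemma primitive_on_glue:
  assumes "closed T" "closed T'" "connected (T \<inter> T')" "T \<union> T' \<subseteq> (\<Union>i\<in>I. A i)"
    "primitive_on I A g T \<Phi>" "primitive_on I A g T' \<Psi>"
  obtains \<Theta> where "primitive_on I A g (T \<union> T') \<Theta>"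
proof -
  have "\<exists>k. \<forall>x\<in>T \<inter> T'. \<Psi> x + k = \<Phi> x"
  proof (cases "T \<inter> T' = {}")
    case False
    then obtain z where z: "z \<in> T \<inter> T'" by blast
    have "\<Phi> x - \<Psi> x = \<Phi> z - \<Psi> z" if "x \<in> T \<inter> T'" for x
      by (rule primitive_on_unique[OF assms(3) _ primitive_on_subset[OF assms(5)] primitive_on_subset[OF assms(6)] that z])
        (use assms(4) in auto)
    then show ?thesis by (intro exI[of _ "\<Phi> z - \<Psi> z"]) (auto simp: algebra_simps)
  qed auto
  then obtain k where k: "\<And>x. x \<in> T \<inter> T' ==> \<Psi> x + k = \<Phi> x" by blast
  define \<Theta> where "\<Theta> x = (if x \<in> T then \<Phi> x else \<Psi> x + k)" for x
  have T: "\<Theta> x = \<Phi> x" if "x \<in> T" for x using that by (simp add: \<Theta>_def)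
  have T': "\<Theta> x = \<Psi> x + k" if "x \<in> T'" for x using that k by (auto simp: \<Theta>_def)
  have 2: "primitive_on I A g T' (\<lambda>x. \<Psi> x + k)" by (rule primitive_on_add_const[OF assms(6)])
  have ev: "\<forall>\<^sub>F y in at x within S. \<Theta> y - g i y = \<Theta> x - g i x"
    if "closed S" "primitive_on I A g S f" "\<And>x. x \<in> S ==> \<Theta> x = f x" "i \<in> I" "x \<in> A i" for S f i x
  proof (cases "x \<in> S")
    case True
    then have "\<forall>\<^sub>F y in at x within S. f y - g i y = f x - g i x"
      using that(2,4,5) unfolding primitive_on_def by blast
    moreover have "\<forall>\<^sub>F y in at x within S. y \<in> S" by (auto simp: eventually_at_filter)
    ultimately show ?thesis by eventually_elim (use that(3) True in auto)
  next
    case False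
    have "\<forall>\<^sub>F y in at x within S. y \<in> - S"
      using topological_tendstoD[OF tendsto_ident_at, of "- S" x S] that(1) False by (simp add: open_Compl)
    moreover have "\<forall>\<^sub>F y in at x within S. y \<in> S" by (auto simp: eventually_at_filter)
    ultimately show ?thesis by eventually_elim auto
  qed
  have "primitive_on I A g (T \<union> T') \<Theta>"
    unfolding primitive_on_def at_within_union eventually_sup
    using ev[OF assms(1,5) T] ev[OF assms(2) 2 T'] by blast
  then show ?thesis by (rule that)
qed

text \<open>A rectangle inside a single \<open>A i\<close> has the primitive \<open>g i\<close>, and
  adjacent rectangles meet in a connected segment. Bisection glues them, first along a thin strip
  and then across strips.\<close>

lemma primitive_on_square:
  fixes A :: "'i \<Rightarrow> (real \<times> real) set"
  assumes op: "\<And>i. i \<in> I ==> openin (top_of_set ({0..1} \<times> {0..1})) (A i)"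
    and cov: "{0..1} \<times> {0..1} \<subseteq> (\<Union>i\<in>I. A i)"
    and co: "\<And>i j x. i \<in> I ==> j \<in> I ==> x \<in> A i \<inter> A j ==>
      \<forall>\<^sub>F y in at x within {0..1} \<times> {0..1}. g i y - g j y = g i x - g j x"
  obtains \<Phi> where "primitive_on I A g ({0..1} \<times> {0..1}) \<Phi>"
proof -
  define Q :: "(real \<times> real) set" where "Q = {0..1} \<times> {0..1}"
  define good where "good T \<longleftrightarrow> (\<exists>\<Phi>. primitive_on I A g (T \<inter> Q) \<Phi>)" for T
  have Qc: "closed Q" unfolding Q_def by (intro closed_Times) auto
  have glue: "good (T \<union> T')" if g: "good T" "good T'" and T: "closed T" "closed T'" "connected (T \<inter> T' \<inter> Q)" for T T'
  proof -
    obtain \<Phi> \<Psi> where P: "primitive_on I A g (T \<inter> Q) \<Phi>" "primitive_on I A g (T' \<inter> Q) \<Psi>"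
      using g unfolding good_def by blast
    have e: "(T \<inter> Q) \<inter> (T' \<inter> Q) = T \<inter> T' \<inter> Q" by blast
    have c: "T \<inter> Q \<union> T' \<inter> Q \<subseteq> (\<Union>i\<in>I. A i)" using cov by (auto simp: Q_def)
    obtain \<Theta> where "primitive_on I A g ((T \<inter> Q) \<union> (T' \<inter> Q)) \<Theta>"
      using primitive_on_glue[OF closed_Int[OF T(1) Qc] closed_Int[OF T(2) Qc] T(3)[folded e] c P] .
    then show ?thesis unfolding good_def by (metis Int_Un_distrib2)
  qed
  have local: "\<exists>d>0. \<forall>a b a' b'. a \<le> s \<and> s \<le> b \<and> b - a < d \<and> a' \<le> t \<and> t \<le> b' \<and> b' - a' < d \<longrightarrow> good ({a..b} \<times> {a'..b'})"
    if st: "(s, t) \<in> Q" for s t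
  proof -
    obtain i where i: "i \<in> I" "(s, t) \<in> A i"
      using subsetD[OF cov, of "(s, t)"] st by (auto simp: Q_def)
    obtain W where W: "open W" "A i = Q \<inter> W" using op[OF i(1)] unfolding Q_def openin_open by blast
    obtain U V where UV: "open U" "open V" "s \<in> U" "t \<in> V" "U \<times> V \<subseteq> W"
      using open_prod_elim[OF W(1)] i(2) W(2) by (metis IntD2 mem_Sigma_iff)
    obtain d1 where d1: "d1 > 0" "\<And>y. dist y s < d1 ==> y \<in> U" using UV unfolding open_dist by blast
    obtain d2 where d2: "d2 > 0" "\<And>y. dist y t < d2 ==> y \<in> V" using UV unfolding open_dist by blast
    show ?thesis
    proof (intro exI[of _ "min d1 d2"] conjI allI impI)
      fix a b a' b' assume h: "a \<le> s \<and> s \<le> b \<and> b - a < min d1 d2 \<and> a' \<le> t \<and> t \<le> b' \<and> b' - a' < min d1 d2"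
      have "{a..b} \<subseteq> U" using d1(2) h by (auto simp: dist_real_def)
      moreover have "{a'..b'} \<subseteq> V" using d2(2) h by (auto simp: dist_real_def)
      ultimately have sub: "{a..b} \<times> {a'..b'} \<inter> Q \<subseteq> A i" using W UV(5) by blast
      have "primitive_on I A g ({a..b} \<times> {a'..b'} \<inter> Q) (g i)"
        unfolding primitive_on_def
      proof (intro ballI)
        fix j x assume "j \<in> I" "x \<in> {a..b} \<times> {a'..b'} \<inter> Q \<inter> A j"
        then have "\<forall>\<^sub>F y in at x within Q. g i y - g j y = g i x - g j x"
          using co[OF i(1), of j x] sub by (auto simp: Q_def)
        then show "\<forall>\<^sub>F y in at x within {a..b} \<times> {a'..b'} \<inter> Q. g i y - g j y = g i x - g j x"
          by (rule filter_leD[OF at_le, rotated]) auto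
      qed
      then show "good ({a..b} \<times> {a'..b'})" unfolding good_def by blast
    qed (use d1 d2 in auto)
  qed
  have conn: "connected ({a..b} \<times> {a'..b'} \<inter> Q)" for a b a' b' :: real
    unfolding Q_def Times_Int_Times by (intro connected_Times) (auto simp: Int_atLeastAtMost)
  have strip: "\<exists>d>0. \<forall>a b. a \<le> s \<and> s \<le> b \<and> b - a < d \<longrightarrow> good ({a..b} \<times> {0..1})" if s: "s \<in> {0..1}" for s
  proof -
    \<comment> \<open>The local width \<open>d\<close> depends on the height. Bisection in the
      second coordinate combines the widths into one that serves the whole strip.\<close>
    define P where "P t t' \<longleftrightarrow> (\<exists>d>0. \<forall>a b. a \<le> s \<and> s \<le> b \<and> b - a < d \<longrightarrow> good ({a..b} \<times> {t..t'}))" for t t'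
    have "P 0 1"
    proof (rule Bolzano)
      fix t1 t2 t3 assume h: "P t1 t2" "P t2 t3" "t1 \<le> t2" "t2 \<le> t3"
      obtain d where d: "d > 0" "\<And>a b. a \<le> s \<and> s \<le> b \<and> b - a < d ==> good ({a..b} \<times> {t1..t2})"
        using h unfolding P_def by blast
      obtain d' where d': "d' > 0" "\<And>a b. a \<le> s \<and> s \<le> b \<and> b - a < d' ==> good ({a..b} \<times> {t2..t3})"
        using h unfolding P_def by blast
      show "P t1 t3" unfolding P_def
      proof (intro exI[of _ "min d d'"] conjI allI impI)
        fix a b assume ab: "a \<le> s \<and> s \<le> b \<and> b - a < min d d'"
        have "{a..b} \<times> {t1..t2} \<inter> {a..b} \<times> {t2..t3} = {a..b} \<times> {t2..t2}" using h by auto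
        then have "good ({a..b} \<times> {t1..t2} \<union> {a..b} \<times> {t2..t3})"
          using d d' ab conn[of a b t2 t2] by (intro glue closed_Times) auto
        moreover have "{a..b} \<times> {t1..t2} \<union> {a..b} \<times> {t2..t3} = {a..b} \<times> {t1..t3}" using h by auto
        ultimately show "good ({a..b} \<times> {t1..t3})" by simp
      qed (use d d' in auto)
    next
      fix t :: real assume "0 \<le> t" "t \<le> 1"
      then obtain d where "d > 0" "\<forall>a b a' b'. a \<le> s \<and> s \<le> b \<and> b - a < d \<and> a' \<le> t \<and> t \<le> b' \<and> b' - a' < d \<longrightarrow> good ({a..b} \<times> {a'..b'})"
        using local[of s t] s by (auto simp: Q_def)
      then show "\<exists>d>0. \<forall>a b. a \<le> t \<and> t \<le> b \<and> b - a < d \<longrightarrow> P a b"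
        unfolding P_def by blast
    qed auto
    then show ?thesis unfolding P_def .
  qed
  have "good ({0..1} \<times> {0..1})"
  proof (rule Bolzano[where P="\<lambda>a b. good ({a..b} \<times> {0..1})"])
    fix a b c :: real assume h: "good ({a..b} \<times> {0..1})" "good ({b..c} \<times> {0..1})" "a \<le> b" "b \<le> c"
    have "{a..b} \<times> {0..1} \<inter> {b..c} \<times> {0..1} = {b..b} \<times> {0..1::real}" using h by auto
    then have "good ({a..b} \<times> {0..1} \<union> {b..c} \<times> {0..1})"
      using h conn[of b b 0 1] by (intro glue closed_Times) auto
    moreover have "{a..b} \<times> {0..1} \<union> {b..c} \<times> {0..1} = {a..c} \<times> {0..1::real}" using h by auto
    ultimately show "good ({a..c} \<times> {0..1})" by simp
  qed (use strip in auto)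
  then show ?thesis using that unfolding good_def Q_def by auto
qed

text \<open>Simple connectedness is stated for free homotopies of loops. It applies to the constant
  loops at two points, and their homotopy traces a path from one to the other.\<close>

lemma simply_connected_path_connected:
  fixes E :: "'e::topological_space set"
  assumes sc: "simply_connected E"
  shows "path_connected E"
  unfolding path_connected_def
proof (intro ballI)
  let ?Q = "{0..1} \<times> {0..1} :: (real \<times> real) set"
  fix a b assume "a \<in> E" "b \<in> E"
  then have "homotopic_loops E (\<lambda>t. a) (\<lambda>t. b)"
    using sc[unfolded simply_connected_def, rule_format, of "\<lambda>t. a" "\<lambda>t. b"]
    by (simp add: path_def path_image_def pathstart_def pathfinish_def image_subset_iff)
  then obtain h where h: "continuous_on ?Q h" "h \<in> ?Q \<rightarrow> E" "\<forall>x\<in>{0..1}. h (0, x) = a" "\<forall>x\<in>{0..1}. h (1, x) = b"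
    unfolding homotopic_loops by blast
  have "continuous_on {0..1} (\<lambda>t. h (t, 0))"
    by (rule continuous_on_compose2[OF h(1)]) (auto intro!: continuous_intros)
  then show "\<exists>g. path g \<and> path_image g \<subseteq> E \<and> pathstart g = a \<and> pathfinish g = b" using h
    by (intro exI[of _ "\<lambda>t. h (t, 0)"]) (auto simp: path_def path_image_def pathstart_def pathfinish_def)
qed

text \<open>\<open>G e\<close> is the change of a primitive along a chosen path from a base point.
  Around a loop the change is 0: a contracting homotopy is a square carrying a primitive, two of
  whose opposite sides are the same path while the side opposite to the loop is constant.\<close>

lemma global_primitive:
  fixes E :: "'e::topological_space set" and W :: "'i \<Rightarrow> 'e set" and g :: "'i \<Rightarrow> 'e \<Rightarrow> complex"
  assumes sc: "simply_connected E"
    and op: "\<And>i. i \<in> I ==> openin (top_of_set E) (W i)" and cov: "E \<subseteq> (\<Union>i\<in>I. W i)"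
    and pc: "\<And>i. i \<in> I ==> path_connected (W i)"
    and co: "\<And>i j e. i \<in> I ==> j \<in> I ==> e \<in> W i \<inter> W j ==>
      \<forall>\<^sub>F e' in at e within E. g i e' - g j e' = g i e - g j e"
  obtains G where "\<And>i e e'. i \<in> I ==> e \<in> W i ==> e' \<in> W i ==> G e' - G e = g i e' - g i e"
proof -
  let ?Q = "{0..1} \<times> {0..1} :: (real \<times> real) set"
  have WE: "W i \<subseteq> E" if "i \<in> I" for i using openin_imp_subset[OF op[OF that]] .
  have pcE: "\<exists>\<gamma>. path \<gamma> \<and> path_image \<gamma> \<subseteq> E \<and> pathstart \<gamma> = a \<and> pathfinish \<gamma> = b" if "a \<in> E" "b \<in> E" for a b
    using simply_connected_path_connected[OF sc] that unfolding path_connected_def by blast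
  have square: "\<exists>\<Phi>. primitive_on I (\<lambda>i. ?Q \<inter> h -` W i) (\<lambda>i. g i \<circ> h) ?Q \<Phi>"
    if h: "continuous_on ?Q h" "h ` ?Q \<subseteq> E" for h
  proof -
    have "\<exists>\<Phi>. primitive_on I (\<lambda>i. ?Q \<inter> h -` W i) (\<lambda>i. g i \<circ> h) ?Q \<Phi>"
    proof (rule primitive_on_square[of I "\<lambda>i. ?Q \<inter> h -` W i" "\<lambda>i. g i \<circ> h"])
      show "openin (top_of_set ?Q) (?Q \<inter> h -` W i)" if "i \<in> I" for i
        using continuous_openin_preimage[OF h(1) _ op[OF that]] h(2) by auto
      show "?Q \<subseteq> (\<Union>i\<in>I. ?Q \<inter> h -` W i)"
      proof
        fix z assume z: "z \<in> ?Q"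
        then obtain i where "i \<in> I" "h z \<in> W i" using cov h(2) by (metis UN_E image_subset_iff subsetD)
        then show "z \<in> (\<Union>i\<in>I. ?Q \<inter> h -` W i)" using z by blast
      qed
      fix i j x assume ij: "i \<in> I" "j \<in> I" and x: "x \<in> (?Q \<inter> h -` W i) \<inter> (?Q \<inter> h -` W j)"
      have "\<forall>\<^sub>F e' in at (h x) within E. g i e' - g j e' = g i (h x) - g j (h x)"
        by (rule co[OF ij]) (use x in auto)
      then obtain T where T: "open T" "h x \<in> T" "\<And>y. y \<in> T ==> y \<noteq> h x ==> y \<in> E ==> g i y - g j y = g i (h x) - g j (h x)"
        unfolding eventually_at_topological by blast
      have "\<forall>\<^sub>F y in at x within ?Q. h y \<in> T"
        using h(1) x T(1,2) unfolding continuous_on_def by (auto dest: topological_tendstoD)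
      moreover have "\<forall>\<^sub>F y in at x within ?Q. y \<in> ?Q" by (auto simp: eventually_at_filter)
      ultimately show "\<forall>\<^sub>F y in at x within ?Q. (g i \<circ> h) y - (g j \<circ> h) y = (g i \<circ> h) x - (g j \<circ> h) x"
      proof eventually_elim
        case (elim y)
        then have "h y \<in> E" using h(2) by blast
        then show ?case using T(3)[of "h y"] elim by (cases "h y = h x") auto
      qed
    qed blast
    then show ?thesis .
  qed
  define cont where "cont \<gamma> \<phi> \<longleftrightarrow> primitive_on I (\<lambda>i. {0..1} \<inter> \<gamma> -` W i) (\<lambda>i. g i \<circ> \<gamma>) {0..1::real} \<phi>" for \<gamma> and \<phi> :: "real \<Rightarrow> complex"
  have restrict: "cont (\<lambda>t. h (\<sigma> t)) (\<lambda>t. \<Phi> (\<sigma> t))"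
    if "primitive_on I (\<lambda>i. ?Q \<inter> h -` W i) (\<lambda>i. g i \<circ> h) ?Q \<Phi>" "continuous_on {0..1} \<sigma>" "\<sigma> ` {0..1} \<subseteq> ?Q"
    for h \<Phi> and \<sigma> :: "real \<Rightarrow> real \<times> real"
    unfolding cont_def primitive_on_def
  proof (intro ballI)
    fix i t assume i: "i \<in> I" and t: "t \<in> {0..1} \<inter> ({0..1} \<inter> (\<lambda>t. h (\<sigma> t)) -` W i)"
    then have st: "\<sigma> t \<in> ?Q \<inter> (?Q \<inter> h -` W i)" using that(3) by blast
    have "\<forall>\<^sub>F y in at (\<sigma> t) within ?Q. \<Phi> y - (g i \<circ> h) y = \<Phi> (\<sigma> t) - (g i \<circ> h) (\<sigma> t)"
      by (rule that(1)[unfolded primitive_on_def, rule_format, OF i st])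
    then obtain T where T: "open T" "\<sigma> t \<in> T" "\<And>y. y \<in> T ==> y \<noteq> \<sigma> t ==> y \<in> ?Q ==> \<Phi> y - (g i \<circ> h) y = \<Phi> (\<sigma> t) - (g i \<circ> h) (\<sigma> t)"
      unfolding eventually_at_topological by blast
    have "\<forall>\<^sub>F s in at t within {0..1}. \<sigma> s \<in> T"
      using that(2) t T(1,2) unfolding continuous_on_def by (auto dest: topological_tendstoD)
    moreover have "\<forall>\<^sub>F s in at t within {0..1}. s \<in> {0..1}" by (auto simp: eventually_at_filter)
    ultimately show "\<forall>\<^sub>F s in at t within {0..1}. \<Phi> (\<sigma> s) - (g i \<circ> (\<lambda>t. h (\<sigma> t))) s = \<Phi> (\<sigma> t) - (g i \<circ> (\<lambda>t. h (\<sigma> t))) t"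
    proof eventually_elim
      case (elim s)
      then have "\<sigma> s \<in> ?Q" using that(3) by (metis image_subset_iff)
      then show ?case using T(3)[of "\<sigma> s"] elim(1) by (cases "\<sigma> s = \<sigma> t") (simp_all add: o_def)
    qed
  qed
  have cP: "continuous_on {0..1} (Pair a)" for a :: real
    using continuous_on_Pair[OF continuous_on_const continuous_on_id, of "{0..1}" a] by simp
  have cont_ex: "\<exists>\<phi>. cont \<gamma> \<phi>" if "path \<gamma>" "path_image \<gamma> \<subseteq> E" for \<gamma>
  proof -
    have "continuous_on ?Q (\<lambda>z. \<gamma> (snd z))"
      by (rule continuous_on_compose2[OF that(1)[unfolded path_def]]) (auto intro: continuous_on_snd continuous_on_id)
    moreover have "(\<lambda>z. \<gamma> (snd z)) ` ?Q \<subseteq> E" using that unfolding path_image_def by auto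
    ultimately obtain \<Phi> where "primitive_on I (\<lambda>i. ?Q \<inter> (\<lambda>z. \<gamma> (snd z)) -` W i) (\<lambda>i. g i \<circ> (\<lambda>z. \<gamma> (snd z))) ?Q \<Phi>"
      using square by blast
    then have "cont (\<lambda>t. \<gamma> (snd (0 :: real, t))) (\<lambda>t. \<Phi> (0, t))"
      by (rule restrict) (auto intro!: cP)
    then have "cont \<gamma> (\<lambda>t. \<Phi> (0, t))" by simp
    then show ?thesis by blast
  qed
  have cont_unique: "\<phi> 1 - \<phi> 0 = \<psi> 1 - \<psi> 0" if "cont \<gamma> \<phi>" "cont \<gamma> \<psi>" "path_image \<gamma> \<subseteq> E" for \<gamma> \<phi> \<psi>
  proof -
    have "{0..1} \<subseteq> (\<Union>i\<in>I. {0..1} \<inter> \<gamma> -` W i)"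
    proof
      fix t :: real assume t: "t \<in> {0..1}"
      then have "\<gamma> t \<in> E" using that(3) by (auto simp: path_image_def)
      then show "t \<in> (\<Union>i\<in>I. {0..1} \<inter> \<gamma> -` W i)" using cov t by blast
    qed
    from primitive_on_unique[OF _ this that(1,2)[unfolded cont_def], of 1 0]
    have "\<phi> 1 - \<psi> 1 = \<phi> 0 - \<psi> 0" by simp
    then show ?thesis by (simp add: algebra_simps)
  qed
  have cont_cong: "cont \<gamma>1 \<psi> \<longleftrightarrow> cont \<gamma>2 \<psi>" if eq: "\<And>t. t \<in> {0..1} ==> \<gamma>1 t = \<gamma>2 t" for \<gamma>1 \<gamma>2 \<psi>
  proof -
    have "{0..1} \<inter> ({0..1} \<inter> \<gamma>1 -` X) = {0..1} \<inter> ({0..1} \<inter> \<gamma>2 -` X)" for X using eq by auto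
    moreover have "(\<forall>\<^sub>F y in at x within {0..1}. \<psi> y - (g i \<circ> \<gamma>1) y = \<psi> x - (g i \<circ> \<gamma>1) x) \<longleftrightarrow>
       (\<forall>\<^sub>F y in at x within {0..1}. \<psi> y - (g i \<circ> \<gamma>2) y = \<psi> x - (g i \<circ> \<gamma>2) x)" if "x \<in> {0..1}" for x i
      unfolding eventually_at_filter using eq that by (intro eventually_subst always_eventually) (auto)
    ultimately show ?thesis unfolding cont_def primitive_on_def by simp
  qed
  have loop: "\<phi> 1 = \<phi> 0" if "path \<gamma>" "path_image \<gamma> \<subseteq> E" "pathfinish \<gamma> = pathstart \<gamma>" "cont \<gamma> \<phi>" for \<gamma> \<phi>
  proof -
    define c where "c = \<gamma> 0"
    have "c \<in> E" using that(2) by (auto simp: c_def path_image_def)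
    then have "homotopic_loops E \<gamma> (\<lambda>t. c)"
      using sc[unfolded simply_connected_def, rule_format, of \<gamma> "\<lambda>t. c"] that(1-3)
      by (simp add: path_def path_image_def pathstart_def pathfinish_def image_subset_iff)
    then obtain h where h: "continuous_on ?Q h" "h \<in> ?Q \<rightarrow> E" "\<forall>x\<in>{0..1}. h (0, x) = \<gamma> x" "\<forall>x\<in>{0..1}. h (1, x) = c"
        "\<forall>t\<in>{0..1}. pathfinish (h \<circ> Pair t) = pathstart (h \<circ> Pair t)"
      unfolding homotopic_loops by blast
    have hE: "h ` ?Q \<subseteq> E" using h(2) by auto
    obtain \<Phi> where \<Phi>: "primitive_on I (\<lambda>i. ?Q \<inter> h -` W i) (\<lambda>i. g i \<circ> h) ?Q \<Phi>"
      using square[OF h(1) hE] by blast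
    note R = restrict[OF \<Phi>]
    have c0: "cont (\<lambda>t. h (0, t)) (\<lambda>t. \<Phi> (0, t))" by (rule R) (auto intro!: continuous_intros cP)
    have c1: "cont (\<lambda>t. h (1, t)) (\<lambda>t. \<Phi> (1, t))" by (rule R) (auto intro!: continuous_intros cP)
    have s0: "cont (\<lambda>t. h (t, 0)) (\<lambda>t. \<Phi> (t, 0))" by (rule R) (auto intro!: continuous_intros cP)
    have s1: "cont (\<lambda>t. h (t, 1)) (\<lambda>t. \<Phi> (t, 1))" by (rule R) (auto intro!: continuous_intros cP)
    have "cont (\<lambda>t. c) (\<lambda>t. 0)" by (simp add: cont_def primitive_on_def o_def)
    then have "cont (\<lambda>t. h (1, t)) (\<lambda>t. 0)" by (rule cont_cong[THEN iffD1, rotated]) (use h in auto)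
    from cont_unique[OF c1 this] have e1: "\<Phi> (1, 1) = \<Phi> (1, 0)" using hE by (simp add: path_image_def image_subset_iff)
    have "cont (\<lambda>t. h (t, 0)) (\<lambda>t. \<Phi> (t, 1))"
      by (rule cont_cong[THEN iffD1, OF _ s1]) (use h(5) in \<open>auto simp: pathfinish_def pathstart_def\<close>)
    from cont_unique[OF s0 this] have e2: "\<Phi> (1, 0) - \<Phi> (0, 0) = \<Phi> (1, 1) - \<Phi> (0, 1)"
      using hE by (simp add: path_image_def image_subset_iff)
    have "cont \<gamma> (\<lambda>t. \<Phi> (0, t))" by (rule cont_cong[THEN iffD1, OF _ c0]) (use h in auto)
    from cont_unique[OF that(4) this that(2)] e1 e2 show ?thesis by (simp add: algebra_simps)
  qed
  show ?thesis
  proof (cases "E = {}")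
    case True
    then show ?thesis using that[of "\<lambda>_. 0"] WE by blast
  next
    case False
    then obtain e0 where e0: "e0 \<in> E" by blast
    have "\<forall>e. \<exists>\<gamma>. e \<in> E \<longrightarrow> path \<gamma> \<and> path_image \<gamma> \<subseteq> E \<and> pathstart \<gamma> = e0 \<and> pathfinish \<gamma> = e"
      using pcE[OF e0] by blast
    from choice[OF this] obtain \<gamma> where \<gamma>: "\<And>e. e \<in> E ==> path (\<gamma> e) \<and> path_image (\<gamma> e) \<subseteq> E \<and> pathstart (\<gamma> e) = e0 \<and> pathfinish (\<gamma> e) = e"
      by blast
    have "\<forall>e. \<exists>\<phi>. e \<in> E \<longrightarrow> cont (\<gamma> e) \<phi>" using cont_ex \<gamma> by blast
    from choice[OF this] obtain \<phi> where \<phi>: "\<And>e. e \<in> E ==> cont (\<gamma> e) (\<phi> e)" by blast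
    show ?thesis
    proof (rule that[of "\<lambda>e. \<phi> e 1 - \<phi> e 0"])
      fix i e e' assume i: "i \<in> I" and e: "e \<in> W i" "e' \<in> W i"
      then have eE: "e \<in> E" "e' \<in> E" using WE by auto
      obtain \<delta> where \<delta>: "path \<delta>" "path_image \<delta> \<subseteq> W i" "pathstart \<delta> = e" "pathfinish \<delta> = e'"
        using pc[OF i] e unfolding path_connected_def by blast
      have \<delta>E: "path_image \<delta> \<subseteq> E" using \<delta>(2) WE[OF i] by blast
      \<comment> \<open>The join runs \<open>\<gamma> e\<close> on \<open>[0, 1/2]\<close>,
        \<open>\<delta>\<close> on \<open>[1/2, 3/4]\<close> and the reverse of
        \<open>\<gamma> e'\<close> on \<open>[3/4, 1]\<close>; the substitutions below pick out
        these pieces.\<close>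
      define p where "p = \<gamma> e +++ (\<delta> +++ reversepath (\<gamma> e'))"
      have p: "path p" "path_image p \<subseteq> E" "pathfinish p = pathstart p"
        unfolding p_def using \<gamma>[OF eE(1)] \<gamma>[OF eE(2)] \<delta> \<delta>E by (auto simp: path_image_join)
      have "continuous_on ?Q (\<lambda>z. p (snd z))"
        by (rule continuous_on_compose2[OF p(1)[unfolded path_def]]) (auto intro: continuous_on_snd continuous_on_id)
      moreover have "(\<lambda>z. p (snd z)) ` ?Q \<subseteq> E" using p(2) unfolding path_image_def by auto
      ultimately obtain \<Phi> where \<Phi>: "primitive_on I (\<lambda>i. ?Q \<inter> (\<lambda>z. p (snd z)) -` W i) (\<lambda>i. g i \<circ> (\<lambda>z. p (snd z))) ?Q \<Phi>"
        using square by blast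
      have R: "cont (\<lambda>t. p (\<tau> t)) (\<lambda>t. \<Phi> (0, \<tau> t))" if "continuous_on {0..1} \<tau>" "\<tau> ` {0..1} \<subseteq> {0..1}" for \<tau> :: "real \<Rightarrow> real"
      proof -
        have "cont (\<lambda>t. p (snd (0 :: real, \<tau> t))) (\<lambda>t. \<Phi> (0, \<tau> t))"
          by (rule restrict[OF \<Phi>]) (use that in \<open>auto intro!: continuous_on_Pair\<close>)
        then show ?thesis by simp
      qed
      have "cont p (\<lambda>t. \<Phi> (0, t))" using R[of "\<lambda>t. t"] by (auto intro: continuous_intros)
      from loop[OF p this] have l: "\<Phi> (0, 1) = \<Phi> (0, 0)" .
      have "cont (\<lambda>t. p (t / 2)) (\<lambda>t. \<Phi> (0, t / 2))" by (rule R) (auto intro!: continuous_intros cP)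
      then have "cont (\<gamma> e) (\<lambda>t. \<Phi> (0, t / 2))"
        by (rule cont_cong[THEN iffD1, rotated]) (auto simp: p_def joinpaths_def)
      from cont_unique[OF \<phi>[OF eE(1)] this] have 1: "\<phi> e 1 - \<phi> e 0 = \<Phi> (0, 1/2) - \<Phi> (0, 0)" using \<gamma> eE by auto
      have "cont (\<lambda>t. p (1 - t / 4)) (\<lambda>t. \<Phi> (0, 1 - t / 4))" by (rule R) (auto intro!: continuous_intros cP)
      then have "cont (\<gamma> e') (\<lambda>t. \<Phi> (0, 1 - t / 4))"
        by (rule cont_cong[THEN iffD1, rotated])
          (use \<delta> \<gamma>[OF eE(2)] in \<open>auto simp: p_def joinpaths_def reversepath_def pathfinish_def pathstart_def field_simps\<close>)
      from cont_unique[OF \<phi>[OF eE(2)] this] have 2: "\<phi> e' 1 - \<phi> e' 0 = \<Phi> (0, 3/4) - \<Phi> (0, 1)" using \<gamma> eE by auto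
      have "cont (\<lambda>t. p (1/2 + t / 4)) (\<lambda>t. \<Phi> (0, 1/2 + t / 4))" by (rule R) (auto intro!: continuous_intros cP)
      then have "cont \<delta> (\<lambda>t. \<Phi> (0, 1/2 + t / 4))"
        by (rule cont_cong[THEN iffD1, rotated])
          (use \<delta> \<gamma>[OF eE(1)] in \<open>auto simp: p_def joinpaths_def pathfinish_def pathstart_def\<close>)
      then have pr: "primitive_on I (\<lambda>i. {0..1} \<inter> \<delta> -` W i) (\<lambda>i. g i \<circ> \<delta>) {0..1} (\<lambda>t. \<Phi> (0, 1/2 + t / 4))"
        unfolding cont_def .
      have "\<Phi> (0, 1/2 + 1 / 4) - g i (\<delta> 1) = \<Phi> (0, 1/2 + 0 / 4) - g i (\<delta> 0)"
      proof (rule locally_constant_on_connected[of "{0..1}" "\<lambda>t. \<Phi> (0, 1/2 + t / 4) - g i (\<delta> t)"])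
        fix t :: real assume "t \<in> {0..1}"
        then show "\<forall>\<^sub>F s in at t within {0..1}. \<Phi> (0, 1/2 + s / 4) - g i (\<delta> s) = \<Phi> (0, 1/2 + t / 4) - g i (\<delta> t)"
          using pr i \<delta>(2) unfolding primitive_on_def path_image_def by (auto simp: image_subset_iff)
      qed auto
      then have 3: "\<Phi> (0, 3/4) - \<Phi> (0, 1/2) = g i e' - g i e"
        using \<delta> by (simp add: pathfinish_def pathstart_def algebra_simps)
      show "(\<phi> e' 1 - \<phi> e' 0) - (\<phi> e 1 - \<phi> e 0) = g i e' - g i e"
        unfolding 1 2 l using 3 by simp
    qed
  qed
qed

section \<open>Integrability\<close>

text \<open>The form \<open>d log (z p - z q)\<close> at a tangent vector \<zeta>. The first point
  is at infinity, and wedges with it are constant, whence the value 0.\<close>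

definition lam :: "nat \<Rightarrow> (nat \<Rightarrow> complex) \<Rightarrow> (nat \<Rightarrow> complex) \<Rightarrow> nat \<Rightarrow> nat \<Rightarrow> complex" where
  "lam n z \<zeta> p q = (if p \<in> {2..n} \<and> q \<in> {2..n} \<and> p \<noteq> q then (\<zeta> p - \<zeta> q) / (z p - z q) else 0)"

lemma lam_sym: "lam n z \<zeta> p q = lam n z \<zeta> q p"
  by (auto simp: lam_def minus_divide_divide[symmetric, of "\<zeta> p - \<zeta> q"])

lemma lam_self [simp]: "lam n z \<zeta> p p = 0"
  by (simp add: lam_def)

text \<open>Up to sign, the value at \<open>(\<zeta>, \<eta>)\<close> of the cyclic sum of wedge
  products of the three forms, collected by the factor in \<zeta>. It holds because the three
  differences add up to 0, for the points as for the tangent vectors.\<close>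

lemma arnold:
  assumes "inj_on z {2..n}" "p \<noteq> q" "q \<noteq> s" "s \<noteq> p"
  shows "lam n z \<zeta> p q * (lam n z \<eta> p s - lam n z \<eta> q s) + lam n z \<zeta> q s * (lam n z \<eta> q p - lam n z \<eta> s p)
    + lam n z \<zeta> s p * (lam n z \<eta> s q - lam n z \<eta> p q) = 0"
proof (cases "p \<in> {2..n} \<and> q \<in> {2..n} \<and> s \<in> {2..n}")
  case True
  define a b c where "a = z p - z q" and "b = z q - z s" and "c = z s - z p"
  have ab: "a \<noteq> 0" "b \<noteq> 0" "c \<noteq> 0" using assms True by (auto simp: a_def b_def c_def inj_on_def)
  have c: "c = - (a + b)" by (simp add: a_def b_def c_def)
  define a1 b1 where "a1 = \<zeta> p - \<zeta> q" and "b1 = \<zeta> q - \<zeta> s"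
  define a2 b2 where "a2 = \<eta> p - \<eta> q" and "b2 = \<eta> q - \<eta> s"
  have zps: "z p \<noteq> z s" using ab(3) by (auto simp: c_def)
  have l: "a * lam n z \<zeta> p q = a1" "b * lam n z \<zeta> q s = b1" "(a + b) * lam n z \<zeta> s p = a1 + b1"
    "a * lam n z \<eta> p q = a2" "b * lam n z \<eta> q s = b2" "(a + b) * lam n z \<eta> s p = a2 + b2"
    using True assms(2-4) ab zps lam_sym[of n z \<zeta> s p] lam_sym[of n z \<eta> s p]
    by (simp_all add: lam_def a_def b_def a1_def b1_def a2_def b2_def)
  have s: "lam n z \<eta> p s = lam n z \<eta> s p" "lam n z \<eta> q p = lam n z \<eta> p q" "lam n z \<eta> s q = lam n z \<eta> q s"
    by (rule lam_sym)+
  have "a + b \<noteq> 0" using ab(3) c by (metis neg_equal_0_iff_equal)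
  moreover have "(a + b) * (L1 * (N3 - N2) + L2 * (N1 - N3) + L3 * (N2 - N1)) = 0"
    if "a * L1 = a1" "b * L2 = b1" "(a + b) * L3 = a1 + b1" "a * N1 = a2" "b * N2 = b2" "(a + b) * N3 = a2 + b2"
    for L1 L2 L3 N1 N2 N3
  proof -
    have e: "(a + b) * N3 = a * N1 + b * N2" "(a + b) * L3 = a * L1 + b * L2" using that by simp_all
    have "(a + b) * (L1 * (N3 - N2) + L2 * (N1 - N3) + L3 * (N2 - N1))
      = L1 * ((a + b) * N3 - (a + b) * N2) + L2 * ((a + b) * N1 - (a + b) * N3) + ((a + b) * L3) * (N2 - N1)"
      by (simp add: algebra_simps)
    then show ?thesis unfolding e by (simp add: algebra_simps)
  qed
  from this[OF l] have "(a + b) * (lam n z \<zeta> p q * (lam n z \<eta> s p - lam n z \<eta> q s)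
      + lam n z \<zeta> q s * (lam n z \<eta> p q - lam n z \<eta> s p) + lam n z \<zeta> s p * (lam n z \<eta> q s - lam n z \<eta> p q)) = 0" .
  ultimately show ?thesis unfolding s using mult_eq_0_iff by blast
next
  case False
  have zero: "lam n z \<theta> x y = 0" "lam n z \<theta> y x = 0" if "x \<notin> {2..n}" for x y \<theta>
    using that by (simp_all only: lam_def) auto
  consider "p \<notin> {2..n}" | "q \<notin> {2..n}" | "s \<notin> {2..n}" using False by blast
  then show ?thesis by cases (simp_all add: zero del: atLeastAtMost_iff)
qed

text \<open>Summing over the index \<open>r\<close> removes all terms \<open>B p q r s\<close> but those with exactly one common
  index; these are alternating in the three indices, and meet the Arnold relation.\<close>

lemma arnold_sum:
  fixes B :: "nat \<Rightarrow> nat \<Rightarrow> nat \<Rightarrow> nat \<Rightarrow> complex"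
  assumes z: "inj_on z {2..n}"
    and s1: "\<And>p q r s. B p q r s = B q p r s" and s2: "\<And>p q r s. B p q r s = B p q s r"
    and anti: "\<And>p q r s. B p q r s = - B r s p q"
    and diag: "\<And>p q r. r \<in> {1..n} ==> B p q r r = 0"
    and disj: "\<And>p q r s. {p, q, r, s} \<subseteq> {1..n} ==> distinct [p, q, r, s] ==> B p q r s = 0"
    and row: "\<And>p q r. r \<in> {1..n} ==> (\<Sum>s\<in>{1..n}. B p q r s) = 0"
  shows "(\<Sum>p\<in>{1..n}. \<Sum>q\<in>{1..n}. \<Sum>r\<in>{1..n}. \<Sum>s\<in>{1..n}. B p q r s * lam n z \<zeta> p q * lam n z \<eta> r s) = 0"
proof -
  let ?S = "{1..n}" and ?l = "lam n z \<zeta>" and ?m = "lam n z \<eta>"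
  have self: "B p q p q = 0" for p q using anti[of p q p q] by simp
  have inner: "(\<Sum>r\<in>?S. \<Sum>s\<in>?S. B p q r s * ?m r s) = 2 * (\<Sum>s\<in>?S. B p q p s * (?m p s - ?m q s))"
    if pq: "p \<in> ?S" "q \<in> ?S" "p \<noteq> q" for p q
  proof -
    have e: "B p q r s * ?m r s = (if r = p then B p q p s * ?m p s else 0) + (if r = q then B p q q s * ?m q s else 0)
       + (if s = p then B p q p r * ?m p r else 0) + (if s = q then B p q q r * ?m q r else 0)"
      if "r \<in> ?S" "s \<in> ?S" for r s
    proof -
      consider "r = s" | "r \<noteq> s" "r \<in> {p, q}" "s \<in> {p, q}" | "r \<noteq> s" "r \<in> {p, q}" "s \<notin> {p, q}"
        | "r \<noteq> s" "r \<notin> {p, q}" "s \<in> {p, q}" | "r \<noteq> s" "r \<notin> {p, q}" "s \<notin> {p, q}" by blast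
      then show ?thesis
      proof cases
        case 1 then show ?thesis using diag[OF that(1)] by auto
      next
        case 2 then show ?thesis using self[of p q] s2[of p q q p] pq diag by auto
      next
        case 3 then show ?thesis using pq by auto
      next
        case 4 then show ?thesis using pq s2[of p q r s] lam_sym[of n z \<eta> r s] by auto
      next
        case 5 then show ?thesis using disj[of p q r s] pq that by auto
      qed
    qed
    have "(\<Sum>r\<in>?S. \<Sum>s\<in>?S. B p q r s * ?m r s) = (\<Sum>r\<in>?S. \<Sum>s\<in>?S. (if r = p then B p q p s * ?m p s else 0)
       + (if r = q then B p q q s * ?m q s else 0)
       + (if s = p then B p q p r * ?m p r else 0) + (if s = q then B p q q r * ?m q r else 0))"
      by (intro sum.cong refl e)
    also have "\<dots> = (\<Sum>s\<in>?S. B p q p s * ?m p s) + (\<Sum>s\<in>?S. B p q q s * ?m q s)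
        + (\<Sum>r\<in>?S. B p q p r * ?m p r) + (\<Sum>r\<in>?S. B p q q r * ?m q r)"
    proof -
      have "(\<Sum>r\<in>?S. \<Sum>s\<in>?S. if r = a then f s else 0) = sum f ?S" if "a \<in> ?S" for a and f :: "nat \<Rightarrow> complex"
        by (subst sum.swap) (use that in \<open>simp add: sum.delta\<close>)
      moreover have "(\<Sum>r\<in>?S. \<Sum>s\<in>?S. if s = a then f r else 0) = sum f ?S" if "a \<in> ?S" for a and f :: "nat \<Rightarrow> complex"
        using that by (simp add: sum.delta)
      ultimately show ?thesis using pq by (simp only: sum.distrib)
    qed
    also have "\<dots> = 2 * (\<Sum>s\<in>?S. B p q p s * ?m p s + B p q q s * ?m q s)"
      by (simp add: sum.distrib)
    also have "(\<Sum>s\<in>?S. B p q p s * ?m p s + B p q q s * ?m q s) = (\<Sum>s\<in>?S. B p q p s * (?m p s - ?m q s))"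
    proof (rule sum.cong[OF refl])
      fix s assume s: "s \<in> ?S"
      show "B p q p s * ?m p s + B p q q s * ?m q s = B p q p s * (?m p s - ?m q s)"
      proof (cases "s \<in> {p, q}")
        case True then show ?thesis using self s2[of p q q p] diag pq by auto
      next
        case False
        \<comment> \<open>Row \<open>s\<close> of \<open>B p q\<close> has only its entries at
          \<open>p\<close> and \<open>q\<close> left, and these add up to 0.\<close>
        have "(\<Sum>r\<in>?S. B p q s r) = (\<Sum>r\<in>{p, q}. B p q s r)"
        proof (rule sum.mono_neutral_right)
          show "\<forall>r\<in>?S - {p, q}. B p q s r = 0"
          proof
            fix r assume "r \<in> ?S - {p, q}"
            then show "B p q s r = 0" using disj[of p q s r] diag[OF s] pq s False by (cases "r = s") auto
          qed
        qed (use pq in auto)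
        then have "B p q s p + B p q s q = 0" using row[OF s, of p q] pq by simp
        then have "B p q q s = - B p q p s" using s2[of p q s p] s2[of p q s q] by (simp add: eq_neg_iff_add_eq_0 add.commute)
        then show ?thesis by (simp add: algebra_simps)
      qed
    qed
    finally show ?thesis .
  qed
  define G where "G p q s = ?l p q * (?m p s - ?m q s) * B p q p s" for p q s
  have "(\<Sum>p\<in>?S. \<Sum>q\<in>?S. \<Sum>r\<in>?S. \<Sum>s\<in>?S. B p q r s * ?l p q * ?m r s) = (\<Sum>p\<in>?S. \<Sum>q\<in>?S. 2 * (\<Sum>s\<in>?S. G p q s))"
  proof (intro sum.cong refl)
    fix p q assume pq: "p \<in> ?S" "q \<in> ?S"
    have "(\<Sum>r\<in>?S. \<Sum>s\<in>?S. B p q r s * ?l p q * ?m r s) = ?l p q * (\<Sum>r\<in>?S. \<Sum>s\<in>?S. B p q r s * ?m r s)"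
      by (simp add: sum_distrib_left mult_ac)
    also have "\<dots> = 2 * (\<Sum>s\<in>?S. G p q s)"
    proof (cases "p = q")
      case True then show ?thesis by (simp add: G_def)
    next
      case False then show ?thesis unfolding inner[OF pq False] by (simp add: G_def sum_distrib_left mult_ac)
    qed
    finally show "(\<Sum>r\<in>?S. \<Sum>s\<in>?S. B p q r s * ?l p q * ?m r s) = 2 * (\<Sum>s\<in>?S. G p q s)" .
  qed
  also have "\<dots> = 2 * (\<Sum>p\<in>?S. \<Sum>q\<in>?S. \<Sum>s\<in>?S. G p q s)" by (simp add: sum_distrib_left)
  also have "(\<Sum>p\<in>?S. \<Sum>q\<in>?S. \<Sum>s\<in>?S. G p q s) = 0"
  proof -
    let ?T = "\<Sum>p\<in>?S. \<Sum>q\<in>?S. \<Sum>s\<in>?S. G p q s"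
    have r1: "(\<Sum>p\<in>?S. \<Sum>q\<in>?S. \<Sum>s\<in>?S. G s p q) = ?T"
    proof -
      have "(\<Sum>p\<in>?S. \<Sum>q\<in>?S. \<Sum>s\<in>?S. G s p q) = (\<Sum>p\<in>?S. \<Sum>s\<in>?S. \<Sum>q\<in>?S. G s p q)"
        by (intro sum.cong refl sum.swap)
      also have "\<dots> = ?T" by (rule sum.swap)
      finally show ?thesis .
    qed
    have r2: "(\<Sum>p\<in>?S. \<Sum>q\<in>?S. \<Sum>s\<in>?S. G q s p) = ?T"
    proof -
      have "(\<Sum>p\<in>?S. \<Sum>q\<in>?S. \<Sum>s\<in>?S. G q s p) = (\<Sum>q\<in>?S. \<Sum>p\<in>?S. \<Sum>s\<in>?S. G q s p)" by (rule sum.swap)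
      also have "\<dots> = ?T" by (intro sum.cong refl sum.swap)
      finally show ?thesis .
    qed
    \<comment> \<open>Averaging over the rotations of \<open>(p, q, s)\<close>: by
      \<open>rot\<close> they leave the coefficient \<open>B p q p s\<close> unchanged, so each
      triple contributes a multiple of an Arnold relation.\<close>
    have "?T + ?T + ?T = (\<Sum>p\<in>?S. \<Sum>q\<in>?S. \<Sum>s\<in>?S. G p q s + G q s p + G s p q)"
      by (simp only: sum.distrib r1 r2)
    also have "\<dots> = 0"
    proof (intro sum.neutral ballI)
      fix p q s assume S: "p \<in> ?S" "q \<in> ?S" "s \<in> ?S"
      show "G p q s + G q s p + G s p q = 0"
      proof (cases "p \<noteq> q \<and> q \<noteq> s \<and> s \<noteq> p")
        case True
        have rot: "B b c b a = B a b a c" if "a \<in> ?S" "b \<in> ?S" "c \<in> ?S" "a \<noteq> b" "b \<noteq> c" "c \<noteq> a" for a b c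
        proof -
          have "(\<Sum>r\<in>?S. B a b c r) = (\<Sum>r\<in>{a, b}. B a b c r)"
          proof (rule sum.mono_neutral_right)
            show "\<forall>r\<in>?S - {a, b}. B a b c r = 0"
            proof
              fix r assume "r \<in> ?S - {a, b}"
              then show "B a b c r = 0" using disj[of a b c r] diag[of c] that by (cases "r = c") auto
            qed
          qed (use that in auto)
          then have "B a b c a = - B a b c b" using row[of c a b] that by (simp add: eq_neg_iff_add_eq_0)
          moreover have "B b c b a = - B a b c b" using anti[of b c b a] s1[of b a b c] s2[of a b b c] by simp
          moreover have "B a b a c = B a b c a" by (rule s2)
          ultimately show ?thesis by simp
        qed
        have "B q s q p = B p q p s" "B s p s q = B p q p s"
          using rot[of p q s] rot[of q s p] S True by auto
        then have "G p q s + G q s p + G s p q = (?l p q * (?m p s - ?m q s) + ?l q s * (?m q p - ?m s p)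
            + ?l s p * (?m s q - ?m p q)) * B p q p s" by (simp add: G_def algebra_simps)
        then show ?thesis using arnold[OF z] True by simp
      next
        case False
        then have "G p q s = 0" "G q s p = 0" "G s p q = 0"
          using self s2 diag S unfolding G_def by (metis lam_self mult_zero_left mult_zero_right)+
        then show ?thesis by simp
      qed
    qed
    finally have "3 * ?T = 0" by (simp add: algebra_simps)
    then show ?thesis by simp
  qed
  finally show ?thesis by simp
qed

text \<open>The second difference which takes \<open>\<delta>\<^sub>p\<^sub>q\<close> to the braid term \<open>t\<^sub>p\<^sub>q\<close>.\<close>

definition sdiff :: "nat \<Rightarrow> (nat \<Rightarrow> nat \<Rightarrow> complex) \<Rightarrow> nat \<Rightarrow> nat \<Rightarrow> complex" where
  "sdiff n f p q = f (prv n p) q + f p (prv n q) - f (prv n p) (prv n q) - f p q"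

section \<open>Summation by parts over the polygon\<close>

lemma sum_nxt:
  fixes f :: "nat \<Rightarrow> nat \<Rightarrow> complex"
  shows "(\<Sum>p\<in>{1..n}. f p (nxt n p)) = (\<Sum>p\<in>{1..n}. f (prv n p) p)"
  by (rule sum.reindex_bij_witness[where i="prv n" and j="nxt n"]) (auto simp: nxt_def prv_def)

text \<open>Summation by parts in both indices; on a cycle there are no boundary terms.\<close>

lemma sum_by_parts:
  fixes f l :: "nat \<Rightarrow> nat \<Rightarrow> complex"
  shows "(\<Sum>p\<in>{1..n}. \<Sum>q\<in>{1..n}. f p q * (l p (nxt n q) + l (nxt n p) q - l p q - l (nxt n p) (nxt n q)))
    = (\<Sum>p\<in>{1..n}. \<Sum>q\<in>{1..n}. sdiff n f p q * l p q)"
proof -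
  let ?S = "{1..n}"
  have a: "(\<Sum>q\<in>?S. f p q * l p' (nxt n q)) = (\<Sum>q\<in>?S. f p (prv n q) * l p' q)" for p p'
    using sum_nxt[of "\<lambda>q q'. f p q * l p' q'" n] by simp
  have b: "(\<Sum>p\<in>?S. \<Sum>q\<in>?S. f p (h q) * l (nxt n p) q) = (\<Sum>p\<in>?S. \<Sum>q\<in>?S. f (prv n p) (h q) * l p q)" for h :: "nat \<Rightarrow> nat"
    using sum_nxt[of "\<lambda>p p'. \<Sum>q\<in>?S. f p (h q) * l p' q" n] by simp
  have "(\<Sum>p\<in>?S. \<Sum>q\<in>?S. f p q * l p (nxt n q)) = (\<Sum>p\<in>?S. \<Sum>q\<in>?S. f p (prv n q) * l p q)"
    by (simp only: a)
  moreover have "(\<Sum>p\<in>?S. \<Sum>q\<in>?S. f p q * l (nxt n p) q) = (\<Sum>p\<in>?S. \<Sum>q\<in>?S. f (prv n p) q * l p q)"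
    by (rule b[of "\<lambda>q. q"])
  moreover have "(\<Sum>p\<in>?S. \<Sum>q\<in>?S. f p q * l (nxt n p) (nxt n q)) = (\<Sum>p\<in>?S. \<Sum>q\<in>?S. f (prv n p) (prv n q) * l p q)"
    by (simp only: a b)
  ultimately show ?thesis
    by (simp add: sdiff_def algebra_simps sum.distrib sum_subtractf)
qed

lemma nxt_prv [simp]: "p \<in> {1..n} ==> nxt n (prv n p) = p" "p \<in> {1..n} ==> prv n (nxt n p) = p"
  "p \<in> {1..n} ==> nxt n p \<in> {1..n}" "p \<in> {1..n} ==> prv n p \<in> {1..n}"
  by (auto simp: nxt_def prv_def)

text \<open>Extended by \<open>0\<close> to all pairs, a function on chords becomes a symmetric function which
  vanishes on equal and adjacent indices, as \<open>\<delta>\<^sub>i\<^sub>j\<close> does.\<close>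

definition ext :: "nat \<Rightarrow> (nat set \<Rightarrow> complex) \<Rightarrow> nat \<Rightarrow> nat \<Rightarrow> complex" where
  "ext n f p q = (if {p, q} \<in> chords n then f {p, q} else 0)"

lemma not_chord_nxt: "{p, p} \<notin> chords n" "{p, nxt n p} \<notin> chords n" "{nxt n p, p} \<notin> chords n"
proof -
  show "{p, p} \<notin> chords n"
  proof
    assume "{p, p} \<in> chords n"
    then obtain a b where "{p, p} = {a, b}" "chordp n a b" using chordsE by blast
    then show False by (auto simp: doubleton_eq_iff chordp_def)
  qed
  show "{p, nxt n p} \<notin> chords n"
  proof
    assume "{p, nxt n p} \<in> chords n"
    then obtain a b where "{p, nxt n p} = {a, b}" "chordp n a b" using chordsE by blast
    then show False by (auto simp: doubleton_eq_iff chordp_def nxt_def split: if_splits)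
  qed
  then show "{nxt n p, p} \<notin> chords n" by (simp add: insert_commute)
qed

lemma ext_prv: "p \<in> {1..n} ==> ext n f (prv n p) p = 0" "p \<in> {1..n} ==> ext n f p (prv n p) = 0" "ext n f p p = 0"
  using not_chord_nxt(2)[of "prv n p" n] not_chord_nxt(3)[of n "prv n p"] not_chord_nxt(1)[of p n]
  by (auto simp: ext_def)

lemma sum_chords_ext:
  assumes "\<And>p q. l p q = l q p"
  shows "(\<Sum>p\<in>{1..n}. \<Sum>q\<in>{1..n}. ext n f p q * l p q) = 2 * (\<Sum>c\<in>chords n. f c * l (Min c) (Max c))"
proof -
  let ?g = "\<lambda>(p, q). ext n f p q * l p q"
  let ?A = "{(p, q). chordp n p q}" and ?B = "{(q, p). chordp n p q}"
  have sub: "?A \<subseteq> {1..n} \<times> {1..n}" "?B \<subseteq> {1..n} \<times> {1..n}" by (auto simp: chordp_def)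
  have fin: "finite ?A" "finite ?B" using sub finite_subset by blast+
  have inj: "inj_on (\<lambda>(p, q). {p, q}) ?A" by (auto simp: inj_on_def doubleton_eq_iff chordp_def)
  have im: "(\<lambda>(p, q). {p, q}) ` ?A = chords n" using chordp_chord by (fastforce elim: chordsE)
  have mm: "Min {a, b} = a" "Max {a, b} = b" if "chordp n a b" for a b using chordp_less[OF that] by auto
  have A: "sum ?g ?A = (\<Sum>c\<in>chords n. f c * l (Min c) (Max c))"
    unfolding im[symmetric] sum.reindex[OF inj]
    by (intro sum.cong) (auto simp only: ext_def chordp_chord mm if_True o_apply split: prod.splits)
  have "sum ?g ?B = sum ?g ?A"
    by (rule sum.reindex_bij_witness[where i="\<lambda>(p, q). (q, p)" and j="\<lambda>(p, q). (q, p)"])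
      (use assms in \<open>auto simp: ext_def insert_commute\<close>)
  moreover have "sum ?g ({1..n} \<times> {1..n}) = sum ?g (?A \<union> ?B)"
  proof (rule sum.mono_neutral_right)
    show "\<forall>i\<in>{1..n} \<times> {1..n} - (?A \<union> ?B). ?g i = 0"
    proof
      fix i assume i: "i \<in> {1..n} \<times> {1..n} - (?A \<union> ?B)"
      obtain p q where pq: "i = (p, q)" by (cases i)
      have "{p, q} \<notin> chords n"
      proof
        assume "{p, q} \<in> chords n"
        then show False
          by (rule chordsE) (use i pq in \<open>auto simp: doubleton_eq_iff\<close>)
      qed
      then show "?g i = 0" by (simp add: pq ext_def)
    qed
  qed (use sub in auto)
  moreover have "sum ?g (?A \<union> ?B) = sum ?g ?A + sum ?g ?B"
    by (rule sum.union_disjoint) (use fin in \<open>auto simp: chordp_def\<close>)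
  ultimately show ?thesis using A by (simp add: sum.cartesian_product)
qed

text \<open>The form \<open>d log\<close> of the dihedral coordinate of \<open>c\<close> at \<zeta>:
  an alternating sum of four terms, as in the cross-ratio.\<close>

definition lam2 :: "nat \<Rightarrow> (nat \<Rightarrow> complex) \<Rightarrow> (nat \<Rightarrow> complex) \<Rightarrow> nat set \<Rightarrow> complex" where
  "lam2 n z \<zeta> c = (let p = Min c; q = Max c; l = lam n z \<zeta>
     in l p (nxt n q) + l (nxt n p) q - l p q - l (nxt n p) (nxt n q))"

text \<open>The factor 2 counts each chord with both orders of its end points. The second difference
  moves from the forms to the coefficients.\<close>

lemma sum_chords_lam2:
  "2 * (\<Sum>c\<in>chords n. f c * lam2 n z \<zeta> c) = (\<Sum>p\<in>{1..n}. \<Sum>q\<in>{1..n}. sdiff n (ext n f) p q * lam n z \<zeta> p q)"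
  unfolding sum_by_parts[symmetric] lam2_def Let_def
  by (rule sum_chords_ext[symmetric]) (metis (no_types, lifting) add.commute lam_sym)

text \<open>Summation by parts in both chords replaces \<beta> by its second differences
  \<open>B\<close> in both slots. These vanish at distinct indices by \<open>rel\<close>, which the
  braid relations will supply, and have cyclic row sums 0, so that \<open>arnold_sum\<close>
  applies.\<close>

lemma chords_integrable:
  fixes \<beta> :: "nat set \<Rightarrow> nat set \<Rightarrow> complex"
  assumes z: "inj_on z {2..n}" and anti: "\<And>c d. \<beta> c d = - \<beta> d c"
    and rel: "\<And>p q r s. {p, q, r, s} \<subseteq> {1..n} ==> distinct [p, q, r, s] ==>
      sdiff n (\<lambda>p q. sdiff n (ext n (\<lambda>d. ext n (\<lambda>c. \<beta> c d) p q)) r s) p q = 0"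
  shows "(\<Sum>c\<in>chords n. \<Sum>d\<in>chords n. \<beta> c d * lam2 n z \<zeta> c * lam2 n z \<eta> d) = 0"
proof -
  define B where "B p q r s = sdiff n (\<lambda>p q. sdiff n (ext n (\<lambda>d. ext n (\<lambda>c. \<beta> c d) p q)) r s) p q" for p q r s
  define b where "b p q r s = ext n (\<lambda>d. ext n (\<lambda>c. \<beta> c d) p q) r s" for p q r s
  have b1: "b p q r s = b q p r s" "b p q r s = b p q s r" for p q r s
    unfolding b_def by (simp_all add: ext_def insert_commute)
  have b2: "b p q r s = - b r s p q" for p q r s
    unfolding b_def ext_def using anti[of "{p, q}" "{r, s}"] by auto
  have b3: "b p q r r = 0" "r \<in> {1..n} ==> b p q (prv n r) r = 0" "r \<in> {1..n} ==> b p q r (prv n r) = 0" for p q r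
    unfolding b_def by (rule ext_prv; assumption?)+
  have B: "B p q r s = sdiff n (\<lambda>p q. sdiff n (b p q) r s) p q" for p q r s
    unfolding B_def b_def by (simp add: sdiff_def)
  have Bx: "B p q r s =
     (b (prv n p) q (prv n r) s + b (prv n p) q r (prv n s) - b (prv n p) q (prv n r) (prv n s) - b (prv n p) q r s)
   + (b p (prv n q) (prv n r) s + b p (prv n q) r (prv n s) - b p (prv n q) (prv n r) (prv n s) - b p (prv n q) r s)
   - (b (prv n p) (prv n q) (prv n r) s + b (prv n p) (prv n q) r (prv n s) - b (prv n p) (prv n q) (prv n r) (prv n s) - b (prv n p) (prv n q) r s)
   - (b p q (prv n r) s + b p q r (prv n s) - b p q (prv n r) (prv n s) - b p q r s)" for p q r s
    unfolding B sdiff_def by simp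
  have shift: "(\<Sum>s\<in>{1..n}. f (prv n s)) = (\<Sum>s\<in>{1..n}. f s)" for f :: "nat \<Rightarrow> complex"
    by (rule sum.reindex_bij_witness[where i="nxt n" and j="prv n"]) (auto simp: nxt_def prv_def)
  have row: "(\<Sum>s\<in>{1..n}. sdiff n (b p q) r s) = 0" for p q r
    using shift[of "b p q r"] shift[of "b p q (prv n r)"] by (simp add: sdiff_def sum.distrib sum_subtractf)
  have "(\<Sum>p\<in>{1..n}. \<Sum>q\<in>{1..n}. \<Sum>r\<in>{1..n}. \<Sum>s\<in>{1..n}. B p q r s * lam n z \<zeta> p q * lam n z \<eta> r s) = 0"
  proof (rule arnold_sum[OF z])
    show "B p q r s = B q p r s" for p q r s
      unfolding Bx using b1(1) by (simp add: algebra_simps)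
    show "B p q r s = B p q s r" for p q r s
      unfolding Bx using b1(2) by (simp add: algebra_simps)
    show "B p q r s = - B r s p q" for p q r s
      unfolding Bx[of p q r s] b2[of _ _ _ s] b2[of _ _ _ "prv n s"] unfolding Bx[of r s p q] by simp
    show "B p q r r = 0" if "r \<in> {1..n}" for p q r
      unfolding Bx using b3 that by simp
    show "B p q r s = 0" if "{p, q, r, s} \<subseteq> {1..n}" "distinct [p, q, r, s]" for p q r s
      unfolding B_def by (rule rel[OF that])
    show "(\<Sum>s\<in>{1..n}. B p q r s) = 0" for p q r
      using row unfolding B sdiff_def[of n "\<lambda>p q. sdiff n (b p q) r _" p q] by (simp add: sum.distrib sum_subtractf)
  qed
  moreover have "4 * (\<Sum>c\<in>chords n. \<Sum>d\<in>chords n. \<beta> c d * lam2 n z \<zeta> c * lam2 n z \<eta> d)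
     = (\<Sum>p\<in>{1..n}. \<Sum>q\<in>{1..n}. \<Sum>r\<in>{1..n}. \<Sum>s\<in>{1..n}. B p q r s * lam n z \<zeta> p q * lam n z \<eta> r s)"
  proof -
    define F where "F c = 2 * (\<Sum>d\<in>chords n. \<beta> c d * lam2 n z \<eta> d)" for c
    have extF: "ext n F p q = (\<Sum>r\<in>{1..n}. \<Sum>s\<in>{1..n}. sdiff n (b p q) r s * lam n z \<eta> r s)" for p q
    proof -
      have "ext n F p q = 2 * (\<Sum>d\<in>chords n. ext n (\<lambda>c. \<beta> c d) p q * lam2 n z \<eta> d)"
        by (simp add: ext_def F_def)
      also have "\<dots> = (\<Sum>r\<in>{1..n}. \<Sum>s\<in>{1..n}. sdiff n (b p q) r s * lam n z \<eta> r s)"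
        unfolding sum_chords_lam2 b_def ..
      finally show ?thesis .
    qed
    have SF: "sdiff n (ext n F) p q = (\<Sum>r\<in>{1..n}. \<Sum>s\<in>{1..n}. B p q r s * lam n z \<eta> r s)" for p q
      unfolding B sdiff_def[of n "ext n F"] sdiff_def[of n "\<lambda>p q. sdiff n (b p q) _ _"]
      by (simp add: extF ring_distribs sum.distrib sum_subtractf left_diff_distrib)
    have "4 * (\<Sum>c\<in>chords n. \<Sum>d\<in>chords n. \<beta> c d * lam2 n z \<zeta> c * lam2 n z \<eta> d) = 2 * (\<Sum>c\<in>chords n. F c * lam2 n z \<zeta> c)"
      by (simp add: F_def sum_distrib_left sum_distrib_right mult_ac)
    also have "\<dots> = (\<Sum>p\<in>{1..n}. \<Sum>q\<in>{1..n}. sdiff n (ext n F) p q * lam n z \<zeta> p q)" by (rule sum_chords_lam2)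
    also have "\<dots> = (\<Sum>p\<in>{1..n}. \<Sum>q\<in>{1..n}. \<Sum>r\<in>{1..n}. \<Sum>s\<in>{1..n}. B p q r s * lam n z \<zeta> p q * lam n z \<eta> r s)"
      unfolding SF by (simp add: sum_distrib_left sum_distrib_right mult_ac)
    finally show ?thesis .
  qed
  ultimately show ?thesis by simp
qed

section \<open>Logarithmic derivatives along curves in \<open>M0\<close>\<close>

lemma DERIV_finite_prod:
  fixes f :: "'i \<Rightarrow> complex \<Rightarrow> complex"
  assumes "finite I" "\<And>i. i \<in> I ==> \<exists>d. (f i has_field_derivative d) (at t)"
  shows "\<exists>d. ((\<lambda>t. \<Prod>i\<in>I. f i t) has_field_derivative d) (at t)"
  using assms
proof (induction I)
  case empty then show ?case by (auto intro: exI[of _ 0])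
next
  case (insert i I)
  obtain d e where "(f i has_field_derivative d) (at t)" "((\<lambda>t. \<Prod>i\<in>I. f i t) has_field_derivative e) (at t)"
    using insert by blast
  from DERIV_mult[OF this] show ?case using insert by auto
qed

text \<open>The points \<open>zz n u\<close> are products of coordinates, so a differentiable curve
  in \<open>M0\<close> carries a tangent vector \<zeta> of points, and differentiating the
  cross-ratios expresses \<xi> through it.\<close>

lemma M0_log_derivative:
  fixes \<gamma> :: "complex \<Rightarrow> nat set \<Rightarrow> complex"
  assumes n: "n \<ge> 4" and ev: "\<forall>\<^sub>F t in nhds t0. \<gamma> t \<in> M0 n"
    and d: "\<And>c. c \<in> chords n ==> ((\<lambda>t. \<gamma> t c) has_field_derivative \<xi> c) (at t0)"
  obtains \<zeta> where "\<And>c. c \<in> chords n ==> \<xi> c = \<gamma> t0 c * lam2 n (zz n (\<gamma> t0)) \<zeta> c"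
proof -
  let ?z = "\<lambda>t. zz n (\<gamma> t)"
  have "\<exists>e. ((\<lambda>t. ?z t j) has_field_derivative e) (at t0)" if "j \<in> {2..n}" for j
  proof (cases "j = 2")
    case True then show ?thesis by (auto simp: zz_def intro: exI[of _ 0])
  next
    case False
    have "\<exists>e. ((\<lambda>t. \<gamma> t {1, k}) has_field_derivative e) (at t0)" if "k \<in> {j..<n}" for k
      using d[of "{1, k}"] chordp_chord[of n 1 k] that \<open>j \<in> {2..n}\<close> False by (auto simp: chordp_def)
    then show ?thesis using DERIV_finite_prod[of "{j..<n}" "\<lambda>k t. \<gamma> t {1, k}"] False that by (simp add: zz_def)
  qed
  then have "\<forall>j. \<exists>e. j \<in> {2..n} \<longrightarrow> ((\<lambda>t. ?z t j) has_field_derivative e) (at t0)" by blast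
  from choice[OF this] obtain \<zeta> where \<zeta>: "\<And>j. j \<in> {2..n} ==> ((\<lambda>t. ?z t j) has_field_derivative \<zeta> j) (at t0)" by blast
  let ?W = "\<lambda>t p q. wedge (cf (?z t) p) (cf (?z t) q)"
  have M0: "\<gamma> t0 \<in> M0 n" using ev by (rule eventually_nhds_x_imp_x)
  note inj = M0_Dih(1)[OF M0 n]
  have W: "((\<lambda>t. ?W t p q) has_field_derivative lam n (?z t0) \<zeta> p q * ?W t0 p q) (at t0)" "?W t0 p q \<noteq> 0"
    if "p \<in> {1..n}" "q \<in> {1..n}" "p \<noteq> q" for p q
  proof -
    show "?W t0 p q \<noteq> 0" using cf_configurations[OF inj] that by (auto simp: configurations_def)
    show "((\<lambda>t. ?W t p q) has_field_derivative lam n (?z t0) \<zeta> p q * ?W t0 p q) (at t0)"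
    proof (cases "p = 1 \<or> q = 1")
      case True
      then have "lam n (?z t0) \<zeta> p q = 0" by (auto simp: lam_def)
      moreover have "(\<lambda>t. ?W t p q) = (\<lambda>t. if p = 1 then (if q = 1 then 0 else 1) else -1)"
        using True by (auto simp: wedge_cf fun_eq_iff)
      ultimately show ?thesis by simp
    next
      case False
      then have pq: "p \<in> {2..n}" "q \<in> {2..n}" using that by auto
      then have "?z t0 p \<noteq> ?z t0 q" using inj that(3) by (auto simp: inj_on_def)
      then show ?thesis using DERIV_diff[OF \<zeta>[OF pq(1)] \<zeta>[OF pq(2)]] False pq that(3)
        by (simp add: wedge_cf lam_def)
    qed
  qed
  show ?thesis
  proof
    fix c assume c: "c \<in> chords n"
    obtain p q where pq: "c = {p, q}" "chordp n p q" using chordsE[OF c] .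
    let ?p = "nxt n p" and ?q = "nxt n q"
    have S: "p \<in> {1..n}" "q \<in> {1..n}" "?p \<in> {1..n}" "?q \<in> {1..n}" "p \<noteq> ?q" "?p \<noteq> q" "p \<noteq> q" "?p \<noteq> ?q"
      using pq(2) by (auto simp: chordp_def nxt_def split: if_splits)
    have mm: "Min c = p" "Max c = q" using chordp_less[OF pq(2)] pq(1) by auto
    let ?F = "\<lambda>t. ?W t p ?q * ?W t ?p q / (?W t p q * ?W t ?p ?q)"
    have F: "\<gamma> t c = ?F t" if "\<gamma> t \<in> M0 n" for t
      using M0_Dih(2)[OF that n] dihedral_coords_eq[of p q n "cf (?z t)"] c unfolding pq(1) by (metis Dih_def)
    have evF: "\<forall>\<^sub>F t in nhds t0. ?F t = \<gamma> t c" using ev by eventually_elim (use F in auto)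
    have DF: "(?F has_field_derivative ?F t0 * lam2 n (?z t0) \<zeta> c) (at t0)"
    proof -
      note D = DERIV_divide[OF DERIV_mult[OF W(1)[OF S(1,4,5)] W(1)[OF S(3,2,6)]] DERIV_mult[OF W(1)[OF S(1,2,7)] W(1)[OF S(3,4,8)]]]
      show ?thesis
        by (rule DERIV_cong[OF D]) (use W(2)[OF S(1,2,7)] W(2)[OF S(3,4,8)] in \<open>auto simp: lam2_def mm Let_def divide_simps\<close>, simp add: algebra_simps)
    qed
    have "((\<lambda>t. \<gamma> t c) has_field_derivative ?F t0 * lam2 n (?z t0) \<zeta> c) (at t0)"
      by (rule iffD1[OF DERIV_cong_ev[OF refl evF refl] DF])
    then show "\<xi> c = \<gamma> t0 c * lam2 n (zz n (\<gamma> t0)) \<zeta> c"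
      using DERIV_unique[OF d[OF c]] F[OF M0] by simp
  qed
qed

section \<open>Normal forms in the braid algebra\<close>

abbreviation carr :: "nat \<Rightarrow> ncseries set" where "carr n \<equiv> carrier (nc_ring n)"

abbreviation idl :: "nat \<Rightarrow> ncseries set" where "idl n \<equiv> braid_ideal n"

lemma nc_ring_simps: "mult (nc_ring n) = nc_mult" "one (nc_ring n) = (\<lambda>w. if w = [] then 1 else 0)"
  "zero (nc_ring n) = (\<lambda>w. 0)" "add (nc_ring n) = (\<lambda>a b w. a w + b w)"
  by (simp_all add: nc_ring_def)

lemma carr_iff: "a \<in> carr n \<longleftrightarrow> (\<forall>w. \<not> set w \<subseteq> chords n \<longrightarrow> a w = 0)"
  by (simp add: nc_ring_def)

lemma nc_mult_add: "nc_mult (\<lambda>w. a w + b w) c = (\<lambda>w. nc_mult a c w + nc_mult b c w)"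
  "nc_mult c (\<lambda>w. a w + b w) = (\<lambda>w. nc_mult c a w + nc_mult c b w)"
  by (simp_all add: nc_mult_def algebra_simps sum.distrib fun_eq_iff)

lemma nc_mult_diff: "nc_mult (\<lambda>w. a w - b w) c = (\<lambda>w. nc_mult a c w - nc_mult b c w)"
  "nc_mult c (\<lambda>w. a w - b w) = (\<lambda>w. nc_mult c a w - nc_mult c b w)"
  by (simp_all add: nc_mult_def algebra_simps sum_subtractf fun_eq_iff)

lemma nc_mult_scale: "nc_mult (\<lambda>w. k * a w) c = (\<lambda>w. k * nc_mult a c w)"
  "nc_mult c (\<lambda>w. k * a w) = (\<lambda>w. k * nc_mult c a w)"
  by (simp_all add: nc_mult_def sum_distrib_left mult_ac fun_eq_iff)

lemma nc_mult_zero: "nc_mult (\<lambda>w. 0) c = (\<lambda>w. 0)" "nc_mult c (\<lambda>w. 0) = (\<lambda>w. 0)"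
  by (simp_all add: nc_mult_def fun_eq_iff)

lemma nc_mult_sum: "nc_mult (\<lambda>w. \<Sum>i\<in>I. f i w) c = (\<lambda>w. \<Sum>i\<in>I. nc_mult (f i) c w)"
  "nc_mult c (\<lambda>w. \<Sum>i\<in>I. f i w) = (\<lambda>w. \<Sum>i\<in>I. nc_mult c (f i) w)"
  by (induction I rule: infinite_finite_induct) (simp_all add: nc_mult_zero nc_mult_add)

lemma letter_carr: "c \<in> chords n ==> letter c \<in> carr n"
  by (auto simp: carr_iff letter_def)

lemma carr_closed:
  "a \<in> carr n ==> b \<in> carr n ==> (\<lambda>w. a w + b w) \<in> carr n"
  "a \<in> carr n ==> b \<in> carr n ==> (\<lambda>w. a w - b w) \<in> carr n"
  "a \<in> carr n ==> (\<lambda>w. k * a w) \<in> carr n"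
  "(\<lambda>w. 0) \<in> carr n"
  "(\<lambda>w. if w = [] then 1 else 0) \<in> carr n"
  by (auto simp: carr_iff)

lemma carr_sum: "(\<And>i. i \<in> I ==> f i \<in> carr n) ==> (\<lambda>w. \<Sum>i\<in>I. f i w) \<in> carr n"
  by (auto simp: carr_iff intro!: sum.neutral)

lemma nc_mult_letter: "nc_mult (letter c) a w = (case w of [] \<Rightarrow> 0 | d # w' \<Rightarrow> if d = c then a w' else 0)"
proof (cases w)
  case Nil then show ?thesis by (simp add: nc_mult_def letter_def)
next
  case (Cons d w')
  have "nc_mult (letter c) a w = (\<Sum>k\<le>length w. if k = 1 then (if d = c then a w' else 0) else 0)"
    unfolding nc_mult_def
  proof (intro sum.cong refl)
    fix k assume "k \<in> {..length w}"
    then show "letter c (take k w) * a (drop k w) = (if k = 1 then (if d = c then a w' else 0) else 0)"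
      using Cons by (cases k) (auto simp: letter_def)
  qed
  also have "\<dots> = (if d = c then a w' else 0)" by (subst sum.delta) (use Cons in auto)
  finally show ?thesis using Cons by simp
qed

lemma nc_mult_letter_right: "nc_mult a (letter c) w = (if w \<noteq> [] \<and> last w = c then a (butlast w) else 0)"
proof (cases w rule: rev_cases)
  case Nil then show ?thesis by (simp add: nc_mult_def letter_def)
next
  case (snoc w' d)
  have "nc_mult a (letter c) w = (\<Sum>k\<le>length w. if k = length w' then (if d = c then a w' else 0) else 0)"
    unfolding nc_mult_def
  proof (intro sum.cong refl)
    fix k assume k: "k \<in> {..length w}"
    show "a (take k w) * letter c (drop k w) = (if k = length w' then (if d = c then a w' else 0) else 0)"
    proof (cases "k = length w'")
      case False
      then have "length (drop k w) \<noteq> 1" using k snoc by auto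
      then have "drop k w \<noteq> [c]" by (metis One_nat_def length_Cons list.size(3))
      then show ?thesis using False by (simp add: letter_def)
    qed (use snoc in \<open>auto simp: letter_def\<close>)
  qed
  then show ?thesis using snoc by simp
qed

lemma idl_add: "a \<in> idl n ==> b \<in> idl n ==> (\<lambda>w. a w + b w) \<in> idl n"
  using additive_subgroup.a_closed[OF ideal.axioms(1)[OF braid_ideal_ideal]] by (fastforce simp: nc_ring_simps)

lemma idl_mult: "a \<in> idl n ==> b \<in> carr n ==> nc_mult a b \<in> idl n" "a \<in> idl n ==> b \<in> carr n ==> nc_mult b a \<in> idl n"
  using ideal.I_r_closed[OF braid_ideal_ideal, of a n b] ideal.I_l_closed[OF braid_ideal_ideal, of a n b]
  by (simp_all add: nc_ring_simps)

lemma idl_carr: "a \<in> idl n ==> a \<in> carr n"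
  using additive_subgroup.a_subset[OF ideal.axioms(1)[OF braid_ideal_ideal]] by blast

lemma idl_scale: "a \<in> idl n ==> (\<lambda>w. k * a w) \<in> idl n"
proof -
  assume a: "a \<in> idl n"
  have "nc_mult (\<lambda>w. k * (if w = [] then 1 else 0)) a \<in> idl n"
    by (rule idl_mult(2)[OF a]) (rule carr_closed, rule carr_closed)
  then show ?thesis unfolding nc_mult_scale nc_mult_one .
qed

lemma idl_zero: "(\<lambda>w. 0) \<in> idl n"
  using additive_subgroup.zero_closed[OF ideal.axioms(1)[OF braid_ideal_ideal]] by (simp add: nc_ring_simps)

lemma idl_diff: "a \<in> idl n ==> b \<in> idl n ==> (\<lambda>w. a w - b w) \<in> idl n"
  using idl_add[OF _ idl_scale[of b n "-1"]] by simp

lemma idl_sum: "(\<And>i. i \<in> I ==> f i \<in> idl n) ==> (\<lambda>w. \<Sum>i\<in>I. f i w) \<in> idl n"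
  by (induction I rule: infinite_finite_induct) (auto intro: idl_zero idl_add)

lemma idl_closed: "closed (idl n)"
  by (simp add: braid_ideal_def)

section \<open>Homogeneous parts and the linear normal form\<close>

definition hpart :: "nat \<Rightarrow> ncseries \<Rightarrow> ncseries" where
  "hpart k a = (\<lambda>w. if length w = k then a w else 0)"

lemma hpart_add: "hpart k (\<lambda>w. a w + b w) = (\<lambda>w. hpart k a w + hpart k b w)"
  by (auto simp: hpart_def)

lemma hpart_mult: "hpart k (nc_mult a b) = (\<lambda>w. \<Sum>i\<le>k. nc_mult (hpart i a) (hpart (k - i) b) w)"
proof
  fix w
  show "hpart k (nc_mult a b) w = (\<Sum>i\<le>k. nc_mult (hpart i a) (hpart (k - i) b) w)"
  proof (cases "length w = k")
    case True
    have "(\<Sum>i\<le>k. nc_mult (hpart i a) (hpart (k - i) b) w) = (\<Sum>i\<le>k. \<Sum>j\<le>k. if j = i then a (take i w) * b (drop i w) else 0)"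
      unfolding nc_mult_def True by (intro sum.cong refl) (auto simp: hpart_def True)
    also have "\<dots> = nc_mult a b w" by (simp add: nc_mult_def True)
    finally show ?thesis using True by (simp add: hpart_def)
  next
    case False
    have "nc_mult (hpart i a) (hpart (k - i) b) w = 0" if "i \<le> k" for i
      unfolding nc_mult_def using that False by (intro sum.neutral) (auto simp: hpart_def)
    then show ?thesis using False by (simp add: hpart_def)
  qed
qed

lemma hpart_carr: "a \<in> carr n ==> hpart k a \<in> carr n"
  by (auto simp: carr_iff hpart_def)

lemma relation_homogeneous:
  assumes "a \<in> braid_relations n"
  shows "hpart k a = (if k = 2 then a else (\<lambda>w. 0))"
proof -
  have "delta n i j w = 0" if "length w \<noteq> 1" for i j w
  proof -
    have "w \<noteq> [c]" for c using that by auto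
    then show ?thesis by (simp add: delta_def letter_def)
  qed
  then have t: "braid_term n i j w = 0" if "length w \<noteq> 1" for i j w
    using that by (simp add: braid_term_def)
  obtain i j r s where a: "a = nc_commutator (braid_term n i j) (braid_term n r s)"
    using assms by (auto simp: braid_relations_def)
  have m: "nc_mult (braid_term n i j) (braid_term n r s) w = 0" if "length w \<noteq> 2" for i j r s w
    unfolding nc_mult_def
  proof (intro sum.neutral ballI)
    fix k assume "k \<in> {..length w}"
    then show "braid_term n i j (take k w) * braid_term n r s (drop k w) = 0"
      using t[of "take k w" i j] t[of "drop k w" r s] that by (cases "k = 1") auto
  qed
  have "a w = 0" if "length w \<noteq> 2" for w using m[OF that] by (simp add: a nc_commutator_def)
  then show ?thesis by (auto simp: hpart_def)
qed

text \<open>The series whose homogeneous parts all lie in the closed ideal form an ideal, and it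
  contains the relations because they are homogeneous. So the generated ideal has the property, and
  its closure inherits it by continuity of \<open>hpart\<close>.\<close>

lemma hpart_idl: "a \<in> idl n ==> hpart k a \<in> idl n"
proof -
  interpret R: ring "nc_ring n" by (rule nc_ring_ring)
  let ?G = "genideal (nc_ring n) (braid_relations n)"
  have G: "?G \<subseteq> idl n" by (simp add: braid_ideal_def closure_subset)
  define J where "J = {a \<in> carr n. \<forall>k. hpart k a \<in> idl n}"
  have "ideal J (nc_ring n)"
  proof (rule idealI[OF nc_ring_ring])
    show "subgroup J (add_monoid (nc_ring n))"
    proof (rule R.add.subgroupI)
      show "J \<subseteq> carrier (nc_ring n)" by (auto simp: J_def)
      have "hpart k (\<lambda>w. 0) = (\<lambda>w. 0)" for k by (auto simp: hpart_def)
      then have "(\<lambda>w. 0) \<in> J" using idl_zero[of n] carr_closed(4)[of n] by (simp add: J_def)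
      then show "J \<noteq> {}" by blast
      fix a assume a: "a \<in> J"
      then have ac: "a \<in> carr n" "(\<lambda>w. - 1 * a w) \<in> carr n" using carr_closed(3)[of a n "-1"] by (simp_all only: J_def mem_Collect_eq)
      have "\<ominus>\<^bsub>nc_ring n\<^esub> a = (\<lambda>w. - 1 * a w)"
        by (rule R.minus_equality[OF _ ac]) (simp add: nc_ring_simps)
      moreover have "(\<lambda>w. - 1 * a w) \<in> J"
      proof -
        have h: "hpart k (\<lambda>w. - 1 * a w) = (\<lambda>w. - 1 * hpart k a w)" for k by (auto simp: hpart_def)
        have "hpart k (\<lambda>w. - 1 * a w) \<in> idl n" for k
          unfolding h using a by (intro idl_scale) (simp add: J_def)
        then show ?thesis using ac(2) unfolding J_def by blast
      qed
      ultimately show "\<ominus>\<^bsub>nc_ring n\<^esub> a \<in> J" by simp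
      fix b assume b: "b \<in> J"
      show "a \<oplus>\<^bsub>nc_ring n\<^esub> b \<in> J"
        using a b carr_closed(1)[of a n b] by (simp add: J_def nc_ring_simps hpart_add idl_add)
    qed
    fix a x assume ax: "a \<in> J" "x \<in> carr n"
    show "x \<otimes>\<^bsub>nc_ring n\<^esub> a \<in> J" "a \<otimes>\<^bsub>nc_ring n\<^esub> x \<in> J"
      using ax nc_mult_closed[of a n x] nc_mult_closed[of x n a]
      by (simp_all add: J_def nc_ring_simps hpart_mult idl_sum idl_mult hpart_carr)
  qed
  moreover have "braid_relations n \<subseteq> J"
  proof
    fix a assume a: "a \<in> braid_relations n"
    have "a \<in> idl n" using G R.genideal_self[OF braid_relations_carrier] a by blast
    then show "a \<in> J" using relation_homogeneous[OF a] idl_zero idl_carr by (auto simp: J_def)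
  qed
  ultimately have "?G \<subseteq> J" by (rule R.genideal_minimal)
  moreover have "closed {a. hpart k a \<in> idl n}" for k
  proof -
    have "continuous_on UNIV (hpart k)"
    proof (rule continuous_on_coordinatewise_then_product)
      show "continuous_on UNIV (\<lambda>a. hpart k a w)" for w
        by (cases "length w = k") (simp_all add: hpart_def continuous_on_coord)
    qed
    then show ?thesis using closed_vimage[OF idl_closed[of n]] by (simp add: vimage_def)
  qed
  ultimately have "closure ?G \<subseteq> {a. hpart k a \<in> idl n}" for k
    by (intro closure_minimal) (auto simp: J_def)
  then show "a \<in> idl n ==> hpart k a \<in> idl n" by (auto simp: braid_ideal_def)
qed

lemma tendsto_coordinatewise:
  fixes f :: "'a \<Rightarrow> 'i \<Rightarrow> 'b::topological_space"
  assumes "\<And>i. ((\<lambda>x. f x i) \<longlongrightarrow> l i) F"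
  shows "(f \<longlongrightarrow> l) F"
proof -
  have "limitin (product_topology (\<lambda>i. euclidean) UNIV) f l F"
    unfolding limitin_componentwise using assms by simp
  then show ?thesis by (simp add: euclidean_product_topology)
qed

text \<open>The partial sums of the homogeneous parts converge coefficientwise, and the ideal is
  closed.\<close>

lemma idl_if_hparts:
  assumes "\<And>k. hpart k a \<in> idl n"
  shows "a \<in> idl n"
proof (rule closed_sequentially[OF idl_closed])
  let ?s = "\<lambda>N w. \<Sum>k<N. hpart k a w"
  show "?s N \<in> idl n" for N by (rule idl_sum) (rule assms)
  show "?s \<longlonglongrightarrow> a"
  proof (rule tendsto_coordinatewise)
    fix w
    have "?s N w = a w" if "length w < N" for N using that by (simp add: hpart_def)
    then show "(\<lambda>N. ?s N w) \<longlonglongrightarrow> a w"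
      by (intro tendsto_eventually) (auto simp: eventually_at_top_dense)
  qed
qed

definition words :: "nat \<Rightarrow> nat \<Rightarrow> nat set list set" where
  "words n k = {w. set w \<subseteq> chords n \<and> length w = k}"

lemma finite_words [simp]: "finite (words n k)"
  unfolding words_def by (rule finite_lists_length_eq) simp

lemma sum_fun_apply: "(\<Sum>i\<in>I. f i) w = (\<Sum>i\<in>I. f i w :: complex)" for f :: "'i \<Rightarrow> 'w \<Rightarrow> complex"
  by (induction I rule: infinite_finite_induct) auto

text \<open>In each degree a linear projection onto the homogeneous part of the ideal is subtracted;
  it is a left inverse of the inclusion. As there are finitely many words of each length, the
  remainder is given by a finite matrix \<open>P\<close> that respects the length.\<close>

lemma normal_form_exists:
  "\<exists>P. \<forall>a\<in>carr n. let b = (\<lambda>w. if set w \<subseteq> chords n then \<Sum>w'\<in>words n (length w). P w w' * a w' else 0) in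
     (\<lambda>w. a w - b w) \<in> idl n \<and> (a \<in> idl n \<longrightarrow> b = (\<lambda>w. 0))"
proof -
  let ?sc = "\<lambda>(k::complex) (a::ncseries) w. k * a w"
  interpret V: vector_space ?sc
    by standard (auto simp: fun_eq_iff algebra_simps)
  interpret VP: vector_space_pair ?sc ?sc ..
  define I where "I k = {a \<in> idl n. hpart k a = a}" for k
  have sub: "V.subspace (I k)" for k
  proof (rule V.subspaceI)
    show "0 \<in> I k" using idl_zero by (auto simp: I_def hpart_def zero_fun_def func_zero)
    show "a + b \<in> I k" if "a \<in> I k" "b \<in> I k" for a b
      using that idl_add[of a n b] hpart_add[of k a b] by (simp add: I_def plus_fun_def)
    show "(\<lambda>w. c * a w) \<in> I k" if "a \<in> I k" for a c
    proof -
      have "hpart k (\<lambda>w. c * a w) = (\<lambda>w. c * hpart k a w)" by (auto simp: hpart_def)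
      then show ?thesis using that idl_scale[of a n c] by (simp add: I_def)
    qed
  qed
  have "\<exists>g. range g \<subseteq> I k \<and> Vector_Spaces.linear ?sc ?sc g \<and> (\<forall>v\<in>I k. g v = v)" for k
    using VP.linear_exists_left_inverse_on[OF V.linear_id sub, of k] by (simp add: inj_on_def)
  then obtain g where g: "\<And>k. range (g k) \<subseteq> I k" "\<And>k. Vector_Spaces.linear ?sc ?sc (g k)" "\<And>k v. v \<in> I k ==> g k v = v"
    by metis
  define e :: "nat set list \<Rightarrow> ncseries" where "e w' = (\<lambda>w. if w = w' then 1 else 0)" for w'
  define P where "P w w' = e w' w - g (length w) (e w') w" for w w'
  have hp: "hpart k a = (\<Sum>w'\<in>words n k. (\<lambda>w. a w' * e w' w))" if "a \<in> carr n" for a k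
  proof
    fix w
    have "(\<Sum>w'\<in>words n k. a w' * e w' w) = (\<Sum>w'\<in>words n k. if w' = w then a w else 0)"
      by (intro sum.cong) (auto simp: e_def)
    also have "\<dots> = (if w \<in> words n k then a w else 0)" by (simp add: sum.delta)
    also have "\<dots> = hpart k a w" using that by (auto simp: hpart_def words_def carr_iff)
    finally show "hpart k a w = (\<Sum>w'\<in>words n k. (\<lambda>w. a w' * e w' w)) w" by (simp add: sum_fun_apply)
  qed
  have main: "(\<Sum>w'\<in>words n (length w). P w w' * a w') = a w - g (length w) (hpart (length w) a) w" if "a \<in> carr n" for a and w :: "nat set list"
  proof -
    interpret L: Vector_Spaces.linear ?sc ?sc "g (length w)" by (rule g)
    have "g (length w) (hpart (length w) a) = (\<Sum>w'\<in>words n (length w). (\<lambda>x. a w' * g (length w) (e w') x))"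
      unfolding hp[OF that] by (simp add: L.sum L.scale)
    moreover have "a w = (\<Sum>w'\<in>words n (length w). a w' * e w' w)"
      using fun_cong[OF hp[OF that, of "length w"], of w] by (simp add: hpart_def sum_fun_apply)
    ultimately show ?thesis
      by (simp add: P_def sum_fun_apply right_diff_distrib left_diff_distrib sum_subtractf mult.commute)
  qed
  show ?thesis
  proof (intro exI[of _ P] ballI)
    fix a assume a: "a \<in> carr n"
    define b where "b = (\<lambda>w. if set w \<subseteq> chords n then \<Sum>w'\<in>words n (length w). P w w' * a w' else 0)"
    have gk: "g k x \<in> idl n" "hpart k (g k x) = g k x" "g k x \<in> carr n" for k x
      using g(1)[of k] idl_carr[of "g k x" n] unfolding I_def by blast+
    have d: "a w - b (w :: nat set list) = g (length w) (hpart (length w) a) w" for w :: "nat set list"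
      using main[OF a, of w] a gk(3)[of "length w" "hpart (length w) a"] by (auto simp: b_def carr_iff)
    have "(\<lambda>w. a w - b w) \<in> idl n"
    proof (rule idl_if_hparts)
      fix k
      have "hpart k (\<lambda>w. a w - b w) = hpart k (g k (hpart k a))" by (auto simp: hpart_def d)
      then show "hpart k (\<lambda>w. a w - b w) \<in> idl n" using gk by simp
    qed
    moreover have "b = (\<lambda>w. 0)" if "a \<in> idl n"
    proof
      fix w :: "nat set list"
      have "hpart (length w) a \<in> I (length w)" using hpart_idl[OF that] by (auto simp: I_def hpart_def)
      then have "a w - b w = a w" unfolding d using g(3) by (simp add: hpart_def)
      then show "b w = 0" by simp
    qed
    ultimately show "let b = (\<lambda>w. if set w \<subseteq> chords n then \<Sum>w'\<in>words n (length w). P w w' * a w' else 0) in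
       (\<lambda>w. a w - b w) \<in> idl n \<and> (a \<in> idl n \<longrightarrow> b = (\<lambda>w. 0))"
      unfolding Let_def b_def by blast
  qed
qed

definition nfm :: "nat \<Rightarrow> nat set list \<Rightarrow> nat set list \<Rightarrow> complex" where
  "nfm n = (SOME P. \<forall>a\<in>carr n. let b = (\<lambda>w. if set w \<subseteq> chords n then \<Sum>w'\<in>words n (length w). P w w' * a w' else 0) in
     (\<lambda>w. a w - b w) \<in> idl n \<and> (a \<in> idl n \<longrightarrow> b = (\<lambda>w. 0)))"

definition nf :: "nat \<Rightarrow> ncseries \<Rightarrow> ncseries" where
  "nf n a = (\<lambda>w. if set w \<subseteq> chords n then \<Sum>w'\<in>words n (length w). nfm n w w' * a w' else 0)"

lemma nf_idl: assumes "a \<in> carr n" shows "(\<lambda>w. a w - nf n a w) \<in> idl n" "a \<in> idl n ==> nf n a = (\<lambda>w. 0)"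
  using someI_ex[OF normal_form_exists[of n], folded nfm_def] assms
  unfolding Let_def nf_def by blast+

lemma nf_carr: "nf n a \<in> carr n"
  by (auto simp: carr_iff nf_def)

lemma nf_add: "nf n (\<lambda>w. a w + b w) = (\<lambda>w. nf n a w + nf n b w)"
  by (auto simp: nf_def fun_eq_iff algebra_simps sum.distrib)

lemma nf_diff: "nf n (\<lambda>w. a w - b w) = (\<lambda>w. nf n a w - nf n b w)"
  by (auto simp: nf_def fun_eq_iff algebra_simps sum_subtractf)

lemma nf_scale: "nf n (\<lambda>w. k * a w) = (\<lambda>w. k * nf n a w)"
  by (auto simp: nf_def fun_eq_iff sum_distrib_left mult_ac)

lemma nf_zero: "nf n (\<lambda>w. 0) = (\<lambda>w. 0)"
  by (auto simp: nf_def)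

lemma nf_sum: "nf n (\<lambda>w. \<Sum>i\<in>I. f i w) = (\<lambda>w. \<Sum>i\<in>I. nf n (f i) w)"
  by (induction I rule: infinite_finite_induct) (simp_all add: nf_zero nf_add)

text \<open>Coefficients of different lengths are not mixed. Together with \<open>Lop_cong\<close>
  this makes the system for the coefficients triangular.\<close>

lemma nf_cong: "(\<And>w'. length w' = length w ==> a w' = b w') ==> nf n a w = nf n b w"
  by (auto simp: nf_def words_def intro!: sum.cong)

lemma nf_eq_iff:
  assumes "a \<in> carr n" "b \<in> carr n"
  shows "nf n a = nf n b \<longleftrightarrow> (\<lambda>w. a w - b w) \<in> idl n"
proof
  assume e: "nf n a = nf n b"
  have "(\<lambda>w. (a w - nf n a w) - (b w - nf n b w)) \<in> idl n"
    by (intro idl_diff nf_idl assms)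
  then show "(\<lambda>w. a w - b w) \<in> idl n" by (simp add: e)
next
  assume "(\<lambda>w. a w - b w) \<in> idl n"
  from nf_idl(2)[OF idl_carr[OF this] this] show "nf n a = nf n b"
    by (simp add: nf_diff fun_eq_iff)
qed

lemma nf_nf: "a \<in> carr n ==> nf n (nf n a) = nf n a"
  using nf_eq_iff[OF _ nf_carr, of a n a] nf_idl(1) by metis

lemma nf_mult:
  assumes "a \<in> carr n" "b \<in> carr n"
  shows "nf n (nc_mult (nf n a) b) = nf n (nc_mult a b)" "nf n (nc_mult a (nf n b)) = nf n (nc_mult a b)"
proof -
  have "(\<lambda>w. nc_mult a b w - nc_mult (nf n a) b w) \<in> idl n"
    using idl_mult(1)[OF nf_idl(1)[OF assms(1)] assms(2)] by (simp add: nc_mult_diff)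
  then show "nf n (nc_mult (nf n a) b) = nf n (nc_mult a b)"
    by (rule iffD2[OF nf_eq_iff[OF nc_mult_closed[OF assms] nc_mult_closed[OF nf_carr assms(2)]], symmetric])
  have "(\<lambda>w. nc_mult a b w - nc_mult a (nf n b) w) \<in> idl n"
    using idl_mult(2)[OF nf_idl(1)[OF assms(2)] assms(1)] by (simp add: nc_mult_diff)
  then show "nf n (nc_mult a (nf n b)) = nf n (nc_mult a b)"
    by (rule iffD2[OF nf_eq_iff[OF nc_mult_closed[OF assms] nc_mult_closed[OF assms(1) nf_carr]], symmetric])
qed

section \<open>Charts\<close>

text \<open>The factors are exchanged one at a time. Each exchange costs \<epsilon> and leaves a
  product of factors bounded by \<open>K\<close>.\<close>

lemma psn_prod_diff:
  fixes K \<epsilon> :: real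
  assumes "finite I" "\<And>i. i \<in> I ==> psn Z r K (F i)" "\<And>i. i \<in> I ==> psn Z r K (G i)"
    "\<And>i. i \<in> I ==> psn Z r \<epsilon> (\<lambda>x. F i x - G i x)" "1 \<le> K" "0 \<le> \<epsilon>" "0 \<le> r"
  shows "psn Z r (card I * K ^ card I * \<epsilon>) (\<lambda>x. (\<Prod>i\<in>I. F i x) - (\<Prod>i\<in>I. G i x))"
  using assms(1-4)
proof (induction I)
  case empty then show ?case using psn_const[of 0 0 Z r] by simp
next
  case (insert i I)
  let ?m = "card I"
  have 1: "psn Z r (\<epsilon> * K ^ ?m) (\<lambda>x. (F i x - G i x) * (\<Prod>i\<in>I. F i x))"
    using insert assms by (intro psn_mult psn_prod) auto
  have 2: "psn Z r (K * (?m * K ^ ?m * \<epsilon>)) (\<lambda>x. G i x * ((\<Prod>i\<in>I. F i x) - (\<Prod>i\<in>I. G i x)))"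
    using insert assms by (intro psn_mult) auto
  have "\<epsilon> * K ^ ?m \<le> \<epsilon> * K ^ Suc ?m" using assms by (intro mult_left_mono power_increasing) auto
  then have "\<epsilon> * K ^ ?m + K * (?m * K ^ ?m * \<epsilon>) \<le> Suc ?m * K ^ Suc ?m * \<epsilon>"
    by (simp add: algebra_simps)
  from psn_mono[OF psn_add[OF 1 2 assms(7)] this] insert(1,2) show ?case
    by (simp add: algebra_simps)
qed

text \<open>Numbers are treated as constant functions on the polydisc without coordinates.\<close>

lemma norm_prod_diff_le:
  fixes f g :: "'i \<Rightarrow> complex" and K \<epsilon> :: real
  assumes "finite I" "\<And>i. i \<in> I ==> cmod (f i) \<le> K" "\<And>i. i \<in> I ==> cmod (g i) \<le> K"
    "\<And>i. i \<in> I ==> cmod (f i - g i) \<le> \<epsilon>" "1 \<le> K" "0 \<le> \<epsilon>"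
  shows "cmod ((\<Prod>i\<in>I. f i) - (\<Prod>i\<in>I. g i)) \<le> card I * K ^ card I * \<epsilon>"
proof -
  have "psn {} 1 (card I * K ^ card I * \<epsilon>) (\<lambda>x. (\<Prod>i\<in>I. f i) - (\<Prod>i\<in>I. g i))"
    using assms by (intro psn_prod_diff psn_const) auto
  from psn_bound[OF this zero_in_pd] show ?thesis by simp
qed

lemma pd_neighbourhood:
  assumes "open U" "(\<lambda>c. 0) \<in> U" "finite Z"
  obtains r where "0 < r" "pd Z r \<subseteq> U"
proof -
  obtain X where X: "(\<lambda>c. 0) \<in> Pi\<^sub>E UNIV X" "\<And>i. open (X i)" "finite {i. X i \<noteq> UNIV}" "Pi\<^sub>E UNIV X \<subseteq> U"
    using product_topology_open_contains_basis[of "\<lambda>_. euclidean" UNIV U "\<lambda>c. 0"] assms(1,2)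
    by (auto simp: open_fun_def)
  have "\<forall>i. \<exists>e>0. ball (0::complex) e \<subseteq> X i" using X(1,2) open_contains_ball by (metis PiE_iff UNIV_I)
  then obtain e where e: "\<And>i. 0 < e i" "\<And>i. ball 0 (e i) \<subseteq> X i" by metis
  define r where "r = Min (insert 1 (e ` Z))"
  have fin: "finite (insert 1 (e ` Z))" using assms(3) by simp
  show ?thesis
  proof
    show "0 < r" unfolding r_def using e(1) fin by (subst Min_gr_iff) auto
    show "pd Z r \<subseteq> U"
    proof
      fix x assume x: "x \<in> pd Z r"
      have "x i \<in> X i" for i
      proof (cases "i \<in> Z")
        case True
        then have "r \<le> e i" unfolding r_def using fin by (intro Min_le) auto
        then have "cmod (x i) < e i" using x True unfolding pd_def by fastforce
        then show ?thesis using e(2)[of i] by auto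
      next
        case False
        then have "x i = 0" using x by (auto simp: pd_def)
        then show ?thesis using e[of i] by auto
      qed
      then show "x \<in> U" using X(4) by auto
    qed
  qed
qed

context polydisc begin

lemma hol_chain:
  fixes \<gamma> :: "'a::real_normed_vector \<Rightarrow> nat set \<Rightarrow> complex"
  assumes F: "hol Z r F" and x: "\<gamma> s0 \<in> pd Z r" and ev: "\<forall>\<^sub>F s in at s0 within S. \<gamma> s \<in> pd Z r"
    and d: "\<And>c. c \<in> Z ==> ((\<lambda>s. \<gamma> s c) has_derivative \<gamma>' c) (at s0 within S)"
  shows "((\<lambda>s. F (\<gamma> s)) has_derivative (\<lambda>h. \<Sum>c\<in>Z. dp c F (\<gamma> s0) * \<gamma>' c h)) (at s0 within S)"
proof (rule has_differential_chain[OF hol_has_differential[OF F x] fin ev])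
  have "((\<lambda>s. \<gamma> s c) \<longlongrightarrow> \<gamma> s0 c) (at s0 within S)" for c
  proof (cases "c \<in> Z")
    case True
    then show ?thesis using has_derivative_continuous[OF d] by (simp add: continuous_within)
  next
    case False
    have "\<forall>\<^sub>F s in at s0 within S. \<gamma> s c = \<gamma> s0 c"
      using ev by eventually_elim (use False x in \<open>auto simp: pd_def\<close>)
    then show ?thesis by (rule tendsto_eventually)
  qed
  then show "(\<gamma> \<longlongrightarrow> \<gamma> s0) (at s0 within S)"
    using limitin_componentwise[of "\<lambda>_. euclidean" UNIV \<gamma> "\<gamma> s0"] by (simp add: euclidean_product_topology)
qed (use d in auto)

lemma hol_line_deriv:
  assumes F: "hol Z r F" and x: "(\<lambda>c. x c + s0 * y c) \<in> pd Z r" and y: "\<And>c. c \<notin> Z ==> y c = 0"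
  shows "((\<lambda>s. F (\<lambda>c. x c + s * y c)) has_field_derivative (\<Sum>c\<in>Z. dp c F (\<lambda>c. x c + s0 * y c) * y c)) (at s0)"
proof -
  have x0: "x c = 0" if "c \<notin> Z" for c using x y[OF that] that by (auto simp: pd_def)
  have "\<forall>\<^sub>F s in at s0. \<forall>c\<in>Z. cmod (x c + s * y c) < r"
  proof (intro eventually_ball_finite[OF fin] ballI)
    fix c assume "c \<in> Z"
    have "((\<lambda>s. cmod (x c + s * y c)) \<longlongrightarrow> cmod (x c + s0 * y c)) (at s0)" by (intro tendsto_intros)
    then show "\<forall>\<^sub>F s in at s0. cmod (x c + s * y c) < r"
      by (rule order_tendstoD) (use x \<open>c \<in> Z\<close> in \<open>auto simp: pd_def\<close>)
  qed
  then have ev: "\<forall>\<^sub>F s in at s0. (\<lambda>c. x c + s * y c) \<in> pd Z r"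
    by eventually_elim (use x0 y in \<open>auto simp: pd_def\<close>)
  have "((\<lambda>s. F (\<lambda>c. x c + s * y c)) has_derivative (\<lambda>h. \<Sum>c\<in>Z. dp c F (\<lambda>c. x c + s0 * y c) * (h * y c))) (at s0)"
    by (rule hol_chain[OF F x ev]) (auto intro!: derivative_eq_intros)
  then show ?thesis
    unfolding has_field_derivative_def by (rule has_derivative_eq_rhs) (auto simp: sum_distrib_left sum_distrib_right mult_ac fun_eq_iff)
qed

text \<open>The coordinate hyperplanes have dense complement: moving \<open>x\<close> by the same
  small \<open>s \<noteq> 0\<close> in all coordinates leaves every one of them. In this way
  identities known where a chart lands in \<open>M0\<close> extend to its poles.\<close>

lemma hol_zero_off_axes:
  assumes F: "hol Z r F" and 0: "\<And>x. x \<in> pd Z r ==> \<forall>c\<in>Z. x c \<noteq> 0 ==> F x = 0" and x: "x \<in> pd Z r"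
  shows "F x = 0"
proof -
  define y :: "nat set \<Rightarrow> complex" where "y c = (if c \<in> Z then 1 else 0)" for c
  have x0: "(\<lambda>c. x c + 0 * y c) = x" by simp
  have "isCont (\<lambda>s. F (\<lambda>c. x c + s * y c)) 0"
    using hol_line_deriv[OF F, of x 0 y] x by (intro DERIV_isCont) (auto simp: y_def)
  then have l: "((\<lambda>s. F (\<lambda>c. x c + s * y c)) \<longlongrightarrow> F x) (at 0)" by (simp add: isCont_def)
  have ev1: "\<forall>\<^sub>F s in at 0. \<forall>c\<in>Z. cmod (x c + s * y c) < r"
  proof (intro eventually_ball_finite[OF fin] ballI)
    fix c assume "c \<in> Z"
    have "((\<lambda>s. cmod (x c + s * y c)) \<longlongrightarrow> cmod (x c + 0 * y c)) (at 0)" by (intro tendsto_intros)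
    then show "\<forall>\<^sub>F s in at 0. cmod (x c + s * y c) < r"
      by (rule order_tendstoD) (use x \<open>c \<in> Z\<close> in \<open>auto simp: pd_def\<close>)
  qed
  have ev2: "\<forall>\<^sub>F s in at 0. \<forall>c\<in>Z. x c + s * y c \<noteq> 0"
  proof (intro eventually_ball_finite[OF fin] ballI)
    fix c assume c: "c \<in> Z"
    show "\<forall>\<^sub>F s in at 0. x c + s * y c \<noteq> 0"
    proof (cases "x c = 0")
      case True then show ?thesis using c by (auto simp: y_def eventually_at_filter)
    next
      case False
      have "((\<lambda>s. x c + s * y c) \<longlongrightarrow> x c + 0 * y c) (at 0)" by (intro tendsto_intros)
      then show ?thesis using False tendsto_imp_eventually_ne by fastforce
    qed
  qed
  have "\<forall>\<^sub>F s in at 0. F (\<lambda>c. x c + s * y c) = 0"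
    using ev1 ev2
  proof eventually_elim
    case (elim s)
    then show ?case using x by (intro 0) (auto simp: pd_def y_def)
  qed
  then have "((\<lambda>s. F (\<lambda>c. x c + s * y c)) \<longlongrightarrow> 0) (at 0)" by (rule tendsto_eventually)
  from tendsto_unique[OF _ l this] show ?thesis by simp
qed

lemma hol_continuous:
  assumes F: "hol Z r F"
  shows "continuous_on (pd Z r) F"
  unfolding continuous_on_def
proof
  fix x assume x: "x \<in> pd Z r"
  have "\<forall>\<^sub>F y in at x within pd Z r. dist (F y) (F x) < \<epsilon>" if \<epsilon>: "0 < \<epsilon>" for \<epsilon>
  proof -
    define M where "M = 1 + (\<Sum>c\<in>Z. cmod (dp c F x))"
    have M: "1 \<le> M" by (simp add: M_def sum_nonneg)
    have "\<forall>\<^sub>F y in at x within pd Z r. cmod (F y - F x - (\<Sum>c\<in>Z. dp c F x * (y c - x c))) \<le> 1 * (\<Sum>c\<in>Z. cmod (y c - x c))"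
      by (rule hol_has_differential[OF F x, unfolded has_differential_def, rule_format, OF zero_less_one])
    moreover have "\<forall>\<^sub>F y in at x within pd Z r. (\<Sum>c\<in>Z. cmod (y c - x c)) < \<epsilon> / M"
      using \<epsilon> M by (intro eventually_coords_close fin) auto
    ultimately show ?thesis
    proof eventually_elim
      case (elim y)
      let ?S = "\<Sum>c\<in>Z. cmod (y c - x c)"
      have "cmod (\<Sum>c\<in>Z. dp c F x * (y c - x c)) \<le> (\<Sum>c\<in>Z. cmod (dp c F x) * ?S)"
      proof (rule sum_norm_le)
        fix c assume "c \<in> Z"
        then show "cmod (dp c F x * (y c - x c)) \<le> cmod (dp c F x) * ?S"
          using member_le_sum[of c Z "\<lambda>c. cmod (y c - x c)"] fin by (simp add: norm_mult mult_left_mono)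
      qed
      also have "\<dots> = (M - 1) * ?S" by (simp add: M_def sum_distrib_right)
      finally have "cmod (F y - F x) \<le> M * ?S"
        using elim(1) norm_triangle_sub[of "F y - F x" "\<Sum>c\<in>Z. dp c F x * (y c - x c)"] by (simp add: algebra_simps)
      also have "\<dots> < \<epsilon>" using elim(2) M by (simp add: field_simps)
      finally show ?case by (simp add: dist_norm)
    qed
  qed
  then show "(F \<longlongrightarrow> F x) (at x within pd Z r)" by (rule tendstoI)
qed

text \<open>Equality of the mixed derivatives of \<open>log F\<close> without choosing a logarithm:
  \<open>G\<close> is the inverse of \<open>F\<close>, and its derivative is found from
  \<open>F * G = 1\<close>.\<close>

lemma log_derivative_closed:
  assumes F: "hol Z r F" and G: "hol Z r G" and FG: "\<And>x. x \<in> pd Z r ==> F x * G x = 1"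
    and ij: "i \<in> Z" "j \<in> Z" and x: "x \<in> pd Z r"
  shows "x j * dp j (\<lambda>x. x i * (dp i F x * G x)) x = x i * dp i (\<lambda>x. x j * (dp j F x * G x)) x"
proof -
  have dG: "dp k G x = - dp k F x * (G x * G x)" if "k \<in> Z" for k
  proof -
    have "dp k F x * G x + dp k G x * F x = 0"
      using dp_mult[OF F G that x] dp_cong[of "\<lambda>x. F x * G x" "\<lambda>x. 1" k x] FG that x by simp
    then have "(dp k F x * G x + dp k G x * F x) * G x = 0" by simp
    then have "dp k F x * G x * G x + dp k G x * (F x * G x) = 0" by (simp add: algebra_simps)
    then show ?thesis using FG[OF x] by (simp add: eq_neg_iff_add_eq_0 add.commute mult.assoc)
  qed
  have d: "dp l (\<lambda>x. x k * (dp k F x * G x)) x = (if l = k then 1 else 0) * (dp k F x * G x)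
      + (dp l (dp k F) x * G x - dp k F x * dp l F x * (G x * G x)) * x k" if "k \<in> Z" "l \<in> Z" for k l
    using that x F G
    by (simp add: dp_mult hol_mult hol_dp hol_coord dp_coord dG algebra_simps)
  show ?thesis
    unfolding d[OF ij(1,2)] d[OF ij(2,1)] dp_commute[OF F ij x] by (auto simp: algebra_simps)
qed

end

text \<open>A square matrix with a left inverse has trivial left kernel: otherwise its columns and
  a vector outside their span would be too many independent vectors.\<close>

lemma left_kernel_trivial:
  fixes A :: "'c \<Rightarrow> 'j \<Rightarrow> complex" and B :: "'j \<Rightarrow> 'c \<Rightarrow> complex"
  assumes fin: "finite Z" "finite J" and card: "card Z = card J"
    and inv: "\<And>j k. j \<in> J ==> k \<in> J ==> (\<Sum>c\<in>Z. B j c * A c k) = (if j = k then 1 else 0)"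
    and g: "\<And>k. k \<in> J ==> (\<Sum>c\<in>Z. g c * A c k) = 0" and d: "d \<in> Z"
  shows "g d = 0"
proof (rule ccontr)
  assume gd: "g d \<noteq> 0"
  let ?sc = "\<lambda>(k::complex) (a::'c \<Rightarrow> complex) c. k * a c"
  interpret V: vector_space ?sc by standard (auto simp: fun_eq_iff algebra_simps)
  define e :: "'c \<Rightarrow> 'c \<Rightarrow> complex" where "e c = (\<lambda>c'. if c' = c then 1 else 0)" for c
  define a where "a k = (\<lambda>c. if c \<in> Z then A c k else 0)" for k
  have sumap: "(\<Sum>i\<in>I. f i) c = (\<Sum>i\<in>I. f i c)" for f :: "'x \<Rightarrow> 'c \<Rightarrow> complex" and I c
    by (induction I rule: infinite_finite_induct) auto
  have span: "v \<in> V.span (e ` Z)" if "\<And>c. c \<notin> Z ==> v c = 0" for v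
  proof -
    have "v = (\<Sum>c\<in>Z. (\<lambda>c'. v c * e c c'))"
    proof
      fix c'
      have "(\<Sum>c\<in>Z. v c * e c c') = (\<Sum>c\<in>Z. if c = c' then v c' else 0)" by (intro sum.cong) (auto simp: e_def)
      then show "v c' = (\<Sum>c\<in>Z. (\<lambda>c'. v c * e c c')) c'" using that fin by (auto simp: sumap)
    qed
    also have "\<dots> \<in> V.span (e ` Z)" by (intro V.span_sum V.span_scale V.span_base) auto
    finally show ?thesis .
  qed
  have Ba: "(\<Sum>c\<in>Z. B j c * a k c) = (if j = k then 1 else 0)" if "j \<in> J" "k \<in> J" for j k
    using inv[OF that] by (simp add: a_def)
  have inj: "inj_on a J"
    using Ba by (intro inj_onI) (metis zero_neq_one)
  have "V.independent (a ` J)"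
    unfolding V.dependent_explicit
  proof
    assume "\<exists>t u. finite t \<and> t \<subseteq> a ` J \<and> (\<Sum>v\<in>t. ?sc (u v) v) = 0 \<and> (\<exists>v\<in>t. u v \<noteq> 0)"
    then obtain t u v where t: "finite t" "t \<subseteq> a ` J" "(\<Sum>v\<in>t. ?sc (u v) v) = 0" "v \<in> t" "u v \<noteq> 0" by blast
    obtain k where k: "k \<in> J" "v = a k" using t by blast
    have "0 = (\<Sum>c\<in>Z. B k c * (\<Sum>v\<in>t. ?sc (u v) v) c)" using t(3) by simp
    also have "\<dots> = (\<Sum>v\<in>t. u v * (\<Sum>c\<in>Z. B k c * v c))"
      unfolding sumap sum_distrib_left by (subst sum.swap) (simp add: mult_ac)
    also have "\<dots> = (\<Sum>v'\<in>t. if v' = v then u v else 0)"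
    proof (intro sum.cong refl)
      fix v' assume "v' \<in> t"
      then obtain k' where k': "k' \<in> J" "v' = a k'" using t by blast
      then show "u v' * (\<Sum>c\<in>Z. B k c * v' c) = (if v' = v then u v else 0)"
        using Ba[OF k(1) k'(1)] k inj by (auto simp: inj_on_def)
    qed
    also have "\<dots> = u v" using t by simp
    finally show False using t by simp
  qed
  moreover have "e d \<notin> V.span (a ` J)"
  proof
    assume "e d \<in> V.span (a ` J)"
    moreover have "V.span (a ` J) \<subseteq> {v. (\<Sum>c\<in>Z. g c * v c) = 0}"
    proof (rule V.span_minimal)
      show "a ` J \<subseteq> {v. (\<Sum>c\<in>Z. g c * v c) = 0}" using g by (auto simp: a_def)
      show "V.subspace {v. (\<Sum>c\<in>Z. g c * v c) = 0}"
        by (rule V.subspaceI) (auto simp: algebra_simps sum.distrib sum_distrib_left[symmetric] mult.left_commute[of "g _"])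
    qed
    moreover have "(\<Sum>c\<in>Z. g c * e d c) = (\<Sum>c\<in>Z. if c = d then g d else 0)" by (intro sum.cong) (auto simp: e_def)
    ultimately show False using gd d fin by auto
  qed
  ultimately have ind: "V.independent (insert (e d) (a ` J))" by (simp add: V.independent_insert)
  have "e d \<notin> a ` J" using \<open>e d \<notin> V.span (a ` J)\<close> V.span_base by blast
  then have "card (insert (e d) (a ` J)) = Suc (card J)" using fin card_image[OF inj] by simp
  moreover have "e d \<in> V.span (e ` Z)" by (rule span) (use d in \<open>auto simp: e_def\<close>)
  moreover have "a k \<in> V.span (e ` Z)" for k by (rule span) (auto simp: a_def)
  ultimately have "insert (e d) (a ` J) \<subseteq> V.span (e ` Z)" "card (insert (e d) (a ` J)) = Suc (card J)" by auto
  moreover from this(1) have "card (insert (e d) (a ` J)) \<le> card (e ` Z)"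
    using V.independent_span_bound[OF _ ind] fin by blast
  moreover have "card (e ` Z) \<le> card Z" using card_image_le[OF fin(1)] .
  ultimately show False using card by simp
qed

section \<open>Triangulations and their vertices\<close>

text \<open>The side between the vertices 1 and \<open>n\<close> is added as an outermost pair, so
  that every vertex strictly between them lies under some pair.\<close>

definition tpairs :: "nat \<Rightarrow> nat set set \<Rightarrow> (nat \<times> nat) set" where
  "tpairs n \<alpha> = insert (1, n) {(a, b). chordp n a b \<and> {a, b} \<in> \<alpha>}"

definition noncrossing :: "nat set set \<Rightarrow> bool" where
  "noncrossing \<alpha> \<longleftrightarrow> (\<forall>c\<in>\<alpha>. \<forall>d\<in>\<alpha>. \<not> crosses c d)"

lemma tpairs_bounds: "(a, b) \<in> tpairs n \<alpha> ==> n \<ge> 4 ==> 1 \<le> a \<and> a + 2 \<le> b \<and> b \<le> n"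
  by (auto simp: tpairs_def chordp_def)

lemma finite_tpairs [simp]: "finite (tpairs n \<alpha>)"
proof -
  have "tpairs n \<alpha> \<subseteq> insert (1, n) ({1..n} \<times> {1..n})" by (auto simp: tpairs_def chordp_def)
  then show ?thesis by (rule finite_subset) auto
qed

lemma tpairs_noncrossing:
  assumes "noncrossing \<alpha>" "(a, b) \<in> tpairs n \<alpha>" "(c, d) \<in> tpairs n \<alpha>" "a < c" "c < b" "b < d" "n \<ge> 4"
  shows False
proof -
  have "(a, b) \<noteq> (1, n)" "(c, d) \<noteq> (1, n)"
    using assms(4-6) tpairs_bounds[OF assms(2,7)] tpairs_bounds[OF assms(3,7)] by auto
  then have "{a, b} \<in> \<alpha>" "{c, d} \<in> \<alpha>" using assms(2,3) by (auto simp: tpairs_def)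
  moreover have "crosses {a, b} {c, d}" using crosses_iff[of a b c d] assms(4-6) by auto
  ultimately show False using assms(1) by (auto simp: noncrossing_def)
qed

lemma card_tpairs:
  assumes "\<alpha> \<subseteq> chords n" "n \<ge> 4"
  shows "card (tpairs n \<alpha>) = Suc (card \<alpha>)"
proof -
  let ?P = "{(a, b). chordp n a b \<and> {a, b} \<in> \<alpha>}"
  have "bij_betw (\<lambda>(a, b). {a, b}) ?P \<alpha>"
    unfolding bij_betw_def
  proof
    show "inj_on (\<lambda>(a, b). {a, b}) ?P" by (auto simp: inj_on_def doubleton_eq_iff chordp_def)
    show "(\<lambda>(a, b). {a, b}) ` ?P = \<alpha>"
    proof (intro equalityI subsetI)
      fix c assume c: "c \<in> \<alpha>"
      then obtain p q where "c = {p, q}" "chordp n p q" using assms chordsE by blast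
      then show "c \<in> (\<lambda>(a, b). {a, b}) ` ?P" using c by (intro image_eqI[of _ _ "(p, q)"]) auto
    qed auto
  qed
  then have "card ?P = card \<alpha>" by (rule bij_betw_same_card)
  moreover have "finite ?P" using finite_tpairs[of n \<alpha>] by (simp add: tpairs_def)
  moreover have "(1, n) \<notin> ?P" by (auto simp: chordp_def)
  ultimately show ?thesis by (simp add: tpairs_def)
qed

text \<open>A non-crossing set injects into the inner vertices: \<open>(a, b)\<close> goes to the third vertex of
  the triangle below it.\<close>

lemma noncrossing_card:
  assumes "\<alpha> \<subseteq> chords n" "noncrossing \<alpha>" "n \<ge> 4"
  shows "card \<alpha> \<le> n - 3"
proof -
  let ?P = "tpairs n \<alpha>"
  \<comment> \<open>The third vertex of the triangle below \<open>(a, b)\<close> is the far end of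
    the longest shorter pair starting at \<open>a\<close>, or \<open>Suc a\<close> if there is
    none.\<close>
  define S where "S a b = insert (Suc a) {c. a < c \<and> c < b \<and> (a, c) \<in> ?P}" for a b
  define m where "m = (\<lambda>(a, b). Max (S a b))"
  have fS: "finite (S a b)" for a b unfolding S_def by simp
  have mS: "m (a, b) \<in> S a b" for a b unfolding m_def using Max_in[OF fS] by (auto simp: S_def)
  have mge: "c \<le> m (a, b)" if "c \<in> S a b" for a b c unfolding m_def using Max_ge[OF fS that] by simp
  have b: "a < m (a, b)" "m (a, b) < b" if "(a, b) \<in> ?P" for a b
    using mS[of a b] tpairs_bounds[OF that assms(3)] by (auto simp: S_def)
  \<comment> \<open>With a common third vertex and \<open>a < a'\<close>, the pair from
    \<open>a\<close> to that vertex would cross \<open>(a', b')\<close>.\<close>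
  have lt: "\<not> a < a'" if h: "(a, b) \<in> ?P" "(a', b') \<in> ?P" "m (a, b) = m (a', b')" for a b a' b'
  proof
    assume aa: "a < a'"
    let ?m = "m (a, b)"
    have mm: "a' < ?m" "?m < b'" "?m < b" using b[OF h(1)] b[OF h(2)] h(3) by auto
    then have "(a, ?m) \<in> ?P" using mS[of a b] aa by (auto simp: S_def)
    then show False using tpairs_noncrossing[OF assms(2) _ h(2) aa mm(1,2) assms(3)] by blast
  qed
  have inj: "inj_on m ?P"
  proof (rule inj_onI)
    fix x y assume h: "x \<in> ?P" "y \<in> ?P" "m x = m y"
    obtain a b1 a' b2 where xy: "x = (a, b1)" "y = (a', b2)" by (cases x, cases y)
    have aa: "a = a'" using lt[of a b1 a' b2] lt[of a' b2 a b1] h unfolding xy by (metis linorder_neqE_nat)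
    have "\<not> b < b'" if "(a, b) \<in> ?P" "(a, b') \<in> ?P" "m (a, b) = m (a, b')" for b b'
    proof
      assume "b < b'"
      then have "b \<in> S a b'" using that(1) tpairs_bounds[OF that(1) assms(3)] by (auto simp: S_def)
      then show False using mge b[OF that(1)] that(3) by fastforce
    qed
    from this[of b1 b2] this[of b2 b1] show "x = y" using h aa unfolding xy by (metis linorder_neqE_nat)
  qed
  have "m ` ?P \<subseteq> {2..<n}"
  proof
    fix k assume "k \<in> m ` ?P"
    then obtain a b' where "(a, b') \<in> ?P" "k = m (a, b')" by auto
    then show "k \<in> {2..<n}" using b[of a b'] tpairs_bounds[of a b' n \<alpha>] assms(3) by auto
  qed
  then have "card ?P \<le> card {2..<n}" using inj by (metis card_image card_mono finite_atLeastLessThan)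
  then show ?thesis using card_tpairs[OF assms(1,3)] by simp
qed

text \<open>A further chord crossing nothing would exceed the bound \<open>n - 3\<close>.\<close>

lemma triangulation_maximal:
  assumes "triangulation n \<alpha>" "n \<ge> 4" "c \<in> chords n" "c \<notin> \<alpha>"
  obtains d where "d \<in> \<alpha>" "crosses c d"
proof -
  have t: "\<alpha> \<subseteq> chords n" "card \<alpha> = n - 3" "noncrossing \<alpha>"
    using assms(1) by (auto simp: triangulation_def noncrossing_def)
  have f: "finite \<alpha>" by (rule finite_subset[OF t(1) finite_chords])
  have "\<not> noncrossing (insert c \<alpha>)"
    using noncrossing_card[of "insert c \<alpha>" n] assms t f by auto
  then show ?thesis using that t(3) not_crosses_self crosses_sym unfolding noncrossing_def by blast
qed

text \<open>The points \<open>z\<^sub>2 < \<dots> < z\<^sub>n\<close> are chosen with gaps of very different size: the gap at the vertex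
  \<open>k\<close> is \<open>T\<close> to the length of the shortest chord of the triangulation above \<open>k\<close>.\<close>

lemma gap_ratio_identities:
  fixes A B J :: real
  assumes "A + J \<noteq> 0" "J + B \<noteq> 0"
  shows "J * (A + J + B) / ((A + J) * (J + B)) = J / (J + B) + (J / (A + J)) * (B / (J + B))"
    and "1 - J * (A + J + B) / ((A + J) * (J + B)) = (A / (A + J)) * (B / (J + B))"
proof -
  have 1: "J * (X + B) / (X * Y) = J / Y + (J / X) * (B / Y)" if "X \<noteq> 0" "Y \<noteq> 0" for X Y
    using that by (simp add: field_simps)
  have 2: "1 - J * (X + (Y - J)) / (X * Y) = ((X - J) / X) * ((Y - J) / Y)" if "X \<noteq> 0" "Y \<noteq> 0" for X Y
    using that by (simp add: field_simps)
  show "J * (A + J + B) / ((A + J) * (J + B)) = J / (J + B) + (J / (A + J)) * (B / (J + B))" by (rule 1[OF assms])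
  show "1 - J * (A + J + B) / ((A + J) * (J + B)) = (A / (A + J)) * (B / (J + B))" using 2[OF assms] by simp
qed

text \<open>These points of \<open>M0\<close>, arbitrarily close to the vertex, are where the
  identity theorem in \<open>Phi_basic_all\<close> starts.\<close>

lemma configuration_near_vertex:
  assumes tri: "triangulation n \<alpha>" and n: "n \<ge> 4" and \<epsilon>: "0 < \<epsilon>"
  obtains x :: "nat set \<Rightarrow> real" where "cpx x \<in> M0 n" "\<And>c. c \<in> \<alpha> ==> 0 < x c \<and> x c < \<epsilon>"
    "\<And>c. c \<in> chords n - \<alpha> ==> 1 - \<epsilon> < x c \<and> x c \<le> 1"
proof -
  let ?P = "tpairs n \<alpha>"
  have t: "\<alpha> \<subseteq> chords n" "noncrossing \<alpha>"
    using tri by (auto simp: triangulation_def noncrossing_def)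
  define S where "S k = {d - c | c d. (c, d) \<in> ?P \<and> c < k \<and> k < d}" for k
  define s where "s k = Min (S k)" for k
  have fS: "finite (S k)" for k
  proof -
    have "S k \<subseteq> (\<lambda>(c, d). d - c) ` ?P" by (force simp: S_def)
    then show ?thesis by (rule finite_subset) auto
  qed
  have neS: "n - 1 \<in> S k" if "2 \<le> k" "k < n" for k
    unfolding S_def using that by (intro CollectI exI[of _ 1] exI[of _ n]) (auto simp: tpairs_def)
  have s_le: "s k \<le> d - c" if "(c, d) \<in> ?P" "c < k" "k < d" for c d k
    unfolding s_def using that by (intro Min_le fS) (auto simp: S_def)
  \<comment> \<open>A pair passing strictly over an end of \<open>(c, d)\<close> cannot cross it, so
    it contains it and is longer. Hence the gaps at the ends of a pair dominate all gaps under
    it.\<close>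
  have s_end: "d - c < s k" if cd: "(c, d) \<in> ?P" and k: "k = c \<or> k = d" "2 \<le> k" "k < n" for c d k
  proof -
    have "s k \<in> S k" unfolding s_def using Min_in[OF fS] neS[OF k(2,3)] by blast
    then obtain c' d' where h: "(c', d') \<in> ?P" "c' < k" "k < d'" "s k = d' - c'" by (auto simp: S_def)
    have cd2: "c < d" using tpairs_bounds[OF cd n] by auto
    from k(1) show ?thesis
    proof
      assume "k = c"
      then have "d \<le> d'" using tpairs_noncrossing[OF t(2) h(1) cd _ _ _ n] h by fastforce
      then show ?thesis using h \<open>k = c\<close> cd2 by auto
    next
      assume "k = d"
      then have "c' \<le> c" using tpairs_noncrossing[OF t(2) cd h(1) _ _ _ n] h by fastforce
      then show ?thesis using h \<open>k = d\<close> cd2 by auto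
    qed
  qed
  \<comment> \<open>Large enough that \<open>n\<close> gaps, each smaller than a given gap by a
    factor \<open>T\<close>, add up to less than \<open>\<epsilon> / 2\<close> times that
    gap.\<close>
  define T where "T = 2 * real n / \<epsilon> + 1"
  have T1: "1 \<le> T" using \<epsilon> by (simp add: T_def)
  have Te: "2 * real n < \<epsilon> * T" using \<epsilon> by (simp add: T_def field_simps)
  have Te': "1 < \<epsilon> * T" using Te n by simp
  define G where "G k = T ^ s k" for k
  have G0: "0 < G k" for k using T1 by (simp add: G_def)
  define z where "z q = (\<Sum>k\<in>{2..<q}. G k)" for q
  have zS: "z (Suc q) = z q + G q" if "2 \<le> q" for q using that by (simp add: z_def)
  define I where "I p q = z q - z (Suc p)" for p q
  have Isum: "I p q = (\<Sum>k\<in>{Suc p..<q}. G k)" if "1 \<le> p" "p < q" for p q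
  proof -
    have "{2..<q} = {2..<Suc p} \<union> {Suc p..<q}" using that by auto
    then have "z q = z (Suc p) + (\<Sum>k\<in>{Suc p..<q}. G k)"
      unfolding z_def by (simp only:) (rule sum.union_disjoint, auto)
    then show ?thesis by (simp add: I_def)
  qed
  have Ige: "G k \<le> I p q" if "1 \<le> p" "p < k" "k < q" for p q k
    unfolding Isum[OF that(1) less_trans[OF that(2,3)]] using that G0 by (intro member_le_sum) (auto simp: less_imp_le)
  have I0: "0 < I p q" if "1 \<le> p" "p + 2 \<le> q" for p q
    using Ige[of p "Suc p" q] G0[of "Suc p"] that by auto
  have Ile: "I p q \<le> real n * T ^ m" if "1 \<le> p" "p < q" "q \<le> n" "\<And>k. p < k ==> k < q ==> s k \<le> m" for p q m
  proof -
    have "I p q \<le> (\<Sum>k\<in>{Suc p..<q}. T ^ m)"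
      unfolding Isum[OF that(1,2)] G_def using that(4) T1 by (intro sum_mono power_increasing) auto
    also have "\<dots> = real (q - Suc p) * T ^ m" by simp
    also have "\<dots> \<le> real n * T ^ m" using that T1 by (intro mult_right_mono) auto
    finally show ?thesis .
  qed
  have zlt: "z p < z q" if "2 \<le> p" "p < q" for p q
    using that(2)
  proof (induction q rule: less_induct)
    case (less q)
    then obtain q' where q': "q = Suc q'" using not0_implies_Suc by (metis not_less_zero)
    show ?case
    proof (cases "q' = p")
      case True then show ?thesis using zS[OF that(1)] G0[of p] q' by simp
    next
      case False
      then have "z p < z q'" using less q' by auto
      then show ?thesis using zS[of q'] G0[of q'] q' False less(2) that by auto
    qed
  qed
  define Z where "Z = (\<lambda>k. complex_of_real (z k))"
  have inj: "inj_on Z {2..n}"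
  proof (rule inj_onI)
    fix p q assume "p \<in> {2..n}" "q \<in> {2..n}" "Z p = Z q"
    then show "p = q" using zlt[of p q] zlt[of q p] by (cases p q rule: linorder_cases) (auto simp: Z_def)
  qed
  \<comment> \<open>The cross-ratio in terms of the inner length \<open>J\<close> and of the gaps
    \<open>A\<close> and \<open>B\<close> at the two ends. The gaps at the vertices 1 and
    \<open>n\<close> border the point at infinity, and there the formula is replaced by its
    limit.\<close>
  define x where "x c = (if c \<in> chords n then
     (let p = Min c; q = Max c; A = G p; B = G q; J = I p q in
      if p = 1 then J / (J + B) else if q = n then J / (A + J) else J * (A + J + B) / ((A + J) * (J + B))) else 0)" for c
  have x: "x {p, q} = (if p = 1 then I p q / (I p q + G q) else if q = n then I p q / (G p + I p q)
      else I p q * (G p + I p q + G q) / ((G p + I p q) * (I p q + G q)))" if "chordp n p q" for p q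
  proof -
    have "Min {p, q} = p" "Max {p, q} = q" using chordp_less[OF that] by auto
    then show ?thesis using chordp_chord[OF that] by (simp add: x_def Let_def)
  qed
  have eqx: "cpx x = Dih n Z"
  proof
    fix c
    show "cpx x c = Dih n Z c"
    proof (cases "c \<in> chords n")
      case False then show ?thesis by (simp add: cpx_def x_def Dih_def dihedral_coords_def)
    next
      case True
      then obtain p q where c: "c = {p, q}" and cp: "chordp n p q" using chordsE by blast
      have b: "p < q" "p + 2 \<le> q" "q \<le> n" "1 \<le> p" using cp by (auto simp: chordp_def)
      consider "p = 1" | "p \<noteq> 1" "q = n" | "p \<noteq> 1" "q < n" using b by linarith
      then show ?thesis
      proof cases
        case 1
        have "Dih n Z {p, q} = (Z 2 - Z q) / (Z 2 - Z (Suc q))" by (rule Dih_simps(2)[OF cp 1])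
        also have "\<dots> = complex_of_real ((z 2 - z q) / (z 2 - z (Suc q)))" by (simp add: Z_def)
        also have "z 2 - z q = - I p q" using 1 by (simp add: I_def numeral_2_eq_2)
        also have "z 2 - z (Suc q) = - (I p q + G q)" using 1 b zS[of q] by (simp add: I_def numeral_2_eq_2)
        also have "- I p q / - (I p q + G q) = I p q / (I p q + G q)" by (rule minus_divide_divide)
        finally show ?thesis using 1 x[OF cp] by (simp add: c cpx_def)
      next
        case 2
        have "Dih n Z {p, q} = (Z n - Z (Suc p)) / (Z n - Z p)" by (rule Dih_simps(3)[OF cp 2(2)])
        also have "\<dots> = complex_of_real ((z n - z (Suc p)) / (z n - z p))" by (simp add: Z_def)
        also have "(z n - z (Suc p)) / (z n - z p) = I p q / (G p + I p q)"
          using 2 b zS[of p] by (simp add: I_def)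
        finally show ?thesis using 2 x[OF cp] by (simp add: c cpx_def)
      next
        case 3
        have "Dih n Z {p, q} = (Z p - Z (Suc q)) * (Z (Suc p) - Z q) / ((Z p - Z q) * (Z (Suc p) - Z (Suc q)))"
          by (rule Dih_simps(1)[OF cp 3])
        also have "\<dots> = complex_of_real ((z p - z (Suc q)) * (z (Suc p) - z q) / ((z p - z q) * (z (Suc p) - z (Suc q))))"
          by (simp add: Z_def)
        also have "z p - z (Suc q) = - (G p + I p q + G q)" using 3 b zS[of p] zS[of q] by (simp add: I_def)
        also have "z (Suc p) - z q = - I p q" by (simp add: I_def)
        also have "z p - z q = - (G p + I p q)" using 3 b zS[of p] by (simp add: I_def)
        also have "z (Suc p) - z (Suc q) = - (I p q + G q)" using 3 b zS[of q] by (simp add: I_def)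
        also have "- (G p + I p q + G q) * - I p q / (- (G p + I p q) * - (I p q + G q))
            = I p q * (G p + I p q + G q) / ((G p + I p q) * (I p q + G q))"
          by (simp only: minus_mult_minus mult.commute[of "G p + I p q + G q"])
        also have "\<dots> = x {p, q}" using 3 x[OF cp] by simp
        finally show ?thesis by (simp add: c cpx_def)
      qed
    qed
  qed
  have small: "0 < x c \<and> x c < \<epsilon>" if "c \<in> \<alpha>" for c
  proof -
    have cn: "c \<in> chords n" using that t(1) by blast
    obtain p q where c: "c = {p, q}" and cp: "chordp n p q" using chordsE[OF cn] .
    have b: "p < q" "p + 2 \<le> q" "q \<le> n" "1 \<le> p" using cp by (auto simp: chordp_def)
    have pq: "(p, q) \<in> ?P" using that cp c by (auto simp: tpairs_def)
    let ?I = "I p q"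
    have I: "0 < ?I" "?I \<le> real n * T ^ (q - p)" using b s_le[OF pq] by (auto intro!: I0 Ile)
    \<comment> \<open>At the ends of a chord of the triangulation the gaps exceed every inner gap by
      a factor of at least \<open>T\<close>.\<close>
    have gt: "?I / G k < \<epsilon> / 2" if k: "k = p \<or> k = q" "2 \<le> k" "k < n" for k
    proof -
      have "T * T ^ (q - p) \<le> G k"
        unfolding G_def power_Suc[symmetric] using s_end[OF pq k] T1 by (intro power_increasing) auto
      then have g: "\<epsilon> * (T * T ^ (q - p)) \<le> \<epsilon> * G k" using \<epsilon> by (intro mult_left_mono) auto
      have "2 * ?I \<le> 2 * real n * T ^ (q - p)" using I by simp
      also have "\<dots> < \<epsilon> * T * T ^ (q - p)" using Te T1 by (intro mult_strict_right_mono) auto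
      finally show ?thesis using g G0[of k] by (simp add: field_simps)
    qed
    consider "p = 1" | "p \<noteq> 1" "q = n" | "p \<noteq> 1" "q < n" using b by linarith
    then show ?thesis
    proof cases
      case 1
      then have "?I / (?I + G q) \<le> ?I / G q" using I G0 by (intro divide_left_mono) (auto intro!: mult_pos_pos add_pos_pos)
      moreover have "?I / G q < \<epsilon> / 2" by (rule gt) (use 1 cp in \<open>auto simp: chordp_def\<close>)
      ultimately have "?I / (?I + G q) < \<epsilon>" using \<epsilon> by linarith
      moreover have "0 < ?I / (?I + G q)" using I G0[of q] by (intro divide_pos_pos add_pos_pos)
      ultimately show ?thesis using x[OF cp] 1 by (simp add: c)
    next
      case 2
      then have "?I / (G p + ?I) \<le> ?I / G p" using I G0 by (intro divide_left_mono) (auto intro!: mult_pos_pos add_pos_pos)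
      moreover have "?I / G p < \<epsilon> / 2" by (rule gt) (use 2 b in auto)
      ultimately have "?I / (G p + ?I) < \<epsilon>" using \<epsilon> by linarith
      moreover have "0 < ?I / (G p + ?I)" using I G0[of p] by (intro divide_pos_pos add_pos_pos)
      ultimately show ?thesis using x[OF cp] 2 by (simp add: c)
    next
      case 3
      have "?I * (G p + ?I + G q) / ((G p + ?I) * (?I + G q)) = ?I / (?I + G q) + (?I / (G p + ?I)) * (G q / (?I + G q))"
        using I G0[of p] G0[of q] by (intro gap_ratio_identities(1)) auto
      also have "\<dots> \<le> ?I / G q + (?I / G p) * 1"
        using I G0[of p] G0[of q] by (intro add_mono mult_mono divide_left_mono) (auto intro!: mult_pos_pos add_pos_pos)
      also have "\<dots> < \<epsilon> / 2 + \<epsilon> / 2 * 1" by (intro add_strict_mono mult_strict_right_mono gt) (use 3 b in auto)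
      finally have "?I * (G p + ?I + G q) / ((G p + ?I) * (?I + G q)) < \<epsilon>" by simp
      moreover have "0 < ?I * (G p + ?I + G q) / ((G p + ?I) * (?I + G q))"
        using I G0[of p] G0[of q] by (intro divide_pos_pos mult_pos_pos add_pos_pos)
      ultimately show ?thesis using x[OF cp] 3 by (simp add: c)
    qed
  qed
  have large: "1 - \<epsilon> < x c \<and> x c \<le> 1" if "c \<in> chords n - \<alpha>" for c
  proof -
    have cn: "c \<in> chords n" "c \<notin> \<alpha>" using that by auto
    obtain p q where c: "c = {p, q}" and cp: "chordp n p q" using chordsE[OF cn(1)] .
    have b: "p < q" "p + 2 \<le> q" "q \<le> n" "1 \<le> p" using cp by (auto simp: chordp_def)
    obtain d where d: "d \<in> \<alpha>" "crosses c d" using triangulation_maximal[OF tri n cn] .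
    have dn: "d \<in> chords n" using d(1) t(1) by blast
    obtain e f where ef: "d = {e, f}" "chordp n e f" using chordsE[OF dn] .
    have P: "(e, f) \<in> ?P" using d(1) ef by (auto simp: tpairs_def)
    let ?I = "I p q"
    have I: "0 < ?I" using b by (auto intro!: I0)
    have "p < e \<and> e < q \<and> q < f \<or> e < p \<and> p < f \<and> f < q"
      using d(2) crosses_iff[OF b(1) chordp_less[OF ef(2)]] by (simp add: c ef)
    \<comment> \<open>The crossing chord has one end strictly between \<open>p\<close> and
      \<open>q\<close> and passes over \<open>p\<close> or \<open>q\<close>. The gap at that end is
      part of the inner length, and it is at least \<open>T\<close> times the gap passed
      over.\<close>
    then have "(q < n \<and> T * G q \<le> ?I) \<or> (2 \<le> p \<and> T * G p \<le> ?I)"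
    proof
      assume h: "p < e \<and> e < q \<and> q < f"
      then have "Suc (s q) \<le> s e" using s_le[OF P, of q] s_end[OF P, of e] b ef(2) by (auto simp: chordp_def)
      then have "T * G q \<le> G e" unfolding G_def power_Suc[symmetric] using T1 by (intro power_increasing)
      then show ?thesis using Ige[of p e q] h b ef(2) by (auto simp: chordp_def)
    next
      assume h: "e < p \<and> p < f \<and> f < q"
      then have "Suc (s p) \<le> s f" using s_le[OF P, of p] s_end[OF P, of f] b ef(2) by (auto simp: chordp_def)
      then have "T * G p \<le> G f" unfolding G_def power_Suc[symmetric] using T1 by (intro power_increasing)
      then show ?thesis using Ige[of p f q] h b ef(2) by (auto simp: chordp_def)
    qed
    then obtain k where k: "k = q \<and> q < n \<or> k = p \<and> 2 \<le> p" "T * G k \<le> ?I" by blast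
    have gk: "G k < \<epsilon> * ?I"
    proof -
      have "G k < (\<epsilon> * T) * G k" using Te' G0[of k] by simp
      also have "\<dots> \<le> \<epsilon> * ?I" using k(2) \<epsilon> by (simp add: mult.assoc)
      finally show ?thesis .
    qed
    consider "p = 1" | "p \<noteq> 1" "q = n" | "p \<noteq> 1" "q < n" using b by linarith
    then show ?thesis
    proof cases
      case 1
      then have "k = q" using k by auto
      then have "G q < \<epsilon> * ?I + \<epsilon> * G q" using gk mult_pos_pos[OF \<epsilon> G0[of q]] by simp
      then have "G q / (?I + G q) < \<epsilon>" "1 - ?I / (?I + G q) = G q / (?I + G q)" "0 \<le> G q / (?I + G q)"
        using I G0[of q] by (simp_all add: field_simps)
      then show ?thesis using x[OF cp] 1 unfolding c by simp
    next
      case 2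
      then have "k = p" using k by auto
      then have "G p < \<epsilon> * ?I + \<epsilon> * G p" using gk mult_pos_pos[OF \<epsilon> G0[of p]] by simp
      then have "G p / (G p + ?I) < \<epsilon>" "1 - ?I / (G p + ?I) = G p / (G p + ?I)" "0 \<le> G p / (G p + ?I)"
        using I G0[of p] by (simp_all add: field_simps)
      then show ?thesis using x[OF cp] 2 unfolding c by simp
    next
      case 3
      have e: "1 - ?I * (G p + ?I + G q) / ((G p + ?I) * (?I + G q)) = (G p / (G p + ?I)) * (G q / (?I + G q))"
        using I G0[of p] G0[of q] by (intro gap_ratio_identities(2)) auto
      have le: "G p / (G p + ?I) \<le> 1" "G q / (?I + G q) \<le> 1" "0 \<le> G p / (G p + ?I)" "0 \<le> G q / (?I + G q)"
        using I G0[of p] G0[of q] by auto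
      have "(G p / (G p + ?I)) * (G q / (?I + G q)) < \<epsilon>"
      proof (cases "k = q")
        case True
        have "G q < \<epsilon> * ?I + \<epsilon> * G q" using gk True mult_pos_pos[OF \<epsilon> G0[of q]] by simp
        then have "G q / (?I + G q) < \<epsilon>" using I G0[of q] by (simp add: field_simps)
        then show ?thesis using mult_left_le_one_le[OF le(4,3,1)] by linarith
      next
        case False
        then have "G p < \<epsilon> * ?I + \<epsilon> * G p" using k gk mult_pos_pos[OF \<epsilon> G0[of p]] by auto
        then have "G p / (G p + ?I) < \<epsilon>" using I G0[of p] by (simp add: field_simps)
        then show ?thesis using mult_right_le_one_le[OF le(3,4,2)] by linarith
      qed
      then show ?thesis using x[OF cp] 3 e mult_nonneg_nonneg[OF le(3,4)] by (auto simp: c)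
    qed
  qed
  show ?thesis
    by (rule that[of x]) (use eqx Dih_M0[OF inj] small large in auto)
qed

text \<open>At a vertex \<open>Z\<close> is the triangulation, and its elements are labels of
  dihedral coordinates that vanish there. On \<open>M0\<close> no element of \<open>Z\<close> is a
  chord, and all dihedral coordinates are units.\<close>

locale chart = polydisc Z r for Z r +
  fixes n :: nat and \<phi> :: "(nat set \<Rightarrow> complex) \<Rightarrow> nat set \<Rightarrow> complex"
  assumes n4: "n \<ge> 4"
    and phi_Z: "c \<in> chords n ==> c \<in> Z ==> x \<in> pd Z r ==> \<phi> x c = x c"
    and phi_unit: "c \<in> chords n ==> c \<notin> Z ==> hol Z r (\<lambda>x. \<phi> x c)" "c \<in> chords n ==> c \<notin> Z ==> hol Z r (\<lambda>x. 1 / \<phi> x c)"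
      "c \<in> chords n ==> c \<notin> Z ==> x \<in> pd Z r ==> \<phi> x c \<noteq> 0"
    and phi_M0: "x \<in> pd Z r ==> \<forall>c\<in>Z. x c \<noteq> 0 ==> \<phi> x \<in> M0 n"
    and phi_off: "c \<notin> chords n ==> \<phi> x c = 0"
begin

text \<open>\<open>m i c\<close> is the coefficient of \<open>dx\<^sub>i / x\<^sub>i\<close> in \<open>d log u\<^sub>c\<close>.\<close>

definition m :: "nat set \<Rightarrow> nat set \<Rightarrow> (nat set \<Rightarrow> complex) \<Rightarrow> complex" where
  "m i c x = (if c \<in> Z then (if i = c then 1 else 0) else x i * (dp i (\<lambda>x. \<phi> x c) x * (1 / \<phi> x c)))"

lemma hol_phi: "c \<in> chords n ==> hol Z r (\<lambda>x. \<phi> x c)"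
  using phi_unit(1) hol_cong[OF hol_coord[of c Z r]] phi_Z by (cases "c \<in> Z") auto

lemma hol_m: "i \<in> Z ==> c \<in> chords n ==> hol Z r (m i c)"
  unfolding m_def[abs_def]
  by (cases "c \<in> Z") (simp_all only: if_True if_False hol_const hol_mult hol_coord hol_dp phi_unit hol_phi not_False_eq_True)

lemma m_eq:
  assumes "i \<in> Z" "c \<in> chords n" "x \<in> pd Z r"
  shows "x i * dp i (\<lambda>x. \<phi> x c) x = m i c x * \<phi> x c"
proof (cases "c \<in> Z")
  case True
  have "dp i (\<lambda>x. \<phi> x c) x = dp i (\<lambda>x. x c) x" by (rule dp_cong) (use assms phi_Z True in auto)
  then show ?thesis using True phi_Z assms by (auto simp: m_def dp_coord)
next
  case False
  then show ?thesis using phi_unit(3) assms by (simp add: m_def)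
qed

lemma m_closed:
  assumes "i \<in> Z" "j \<in> Z" "c \<in> chords n" "x \<in> pd Z r"
  shows "x j * dp j (m i c) x = x i * dp i (m j c) x"
proof (cases "c \<in> Z")
  case True then show ?thesis by (simp add: m_def[abs_def])
next
  case False
  have "x j * dp j (\<lambda>x. x i * (dp i (\<lambda>x. \<phi> x c) x * (1 / \<phi> x c))) x = x i * dp i (\<lambda>x. x j * (dp j (\<lambda>x. \<phi> x c) x * (1 / \<phi> x c))) x"
    by (rule log_derivative_closed) (use assms False phi_unit in auto)
  then show ?thesis using False by (simp add: m_def[abs_def])
qed

lemma eventually_upd_nonzero:
  assumes "x \<in> pd Z r" "\<forall>c\<in>Z. x c \<noteq> 0" "i \<in> Z"
  shows "\<forall>\<^sub>F t in nhds (x i). \<phi> (x(i := t)) \<in> M0 n"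
proof -
  have "\<forall>\<^sub>F t in nhds (x i). t \<noteq> 0"
    using assms by (intro tendsto_imp_eventually_ne[OF filterlim_ident]) auto
  with eventually_upd_pd[OF assms(3,1)] show ?thesis
    by eventually_elim (rule phi_M0, use assms in auto)
qed

text \<open>Where no coordinate vanishes, \<open>m i c\<close> is \<open>x i\<close> times the
  logarithmic form at a tangent vector of \<open>M0\<close>, and \<open>chords_integrable\<close>
  applies. The hyperplanes are reached by continuity.\<close>

lemma m_integrable:
  assumes anti: "\<And>c d. \<beta> c d = - \<beta> d c"
    and rel: "\<And>p q r s. {p, q, r, s} \<subseteq> {1..n} ==> distinct [p, q, r, s] ==>
      sdiff n (\<lambda>p q. sdiff n (ext n (\<lambda>d. ext n (\<lambda>c. \<beta> c d) p q)) r s) p q = 0"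
    and ij: "i \<in> Z" "j \<in> Z" and x: "x \<in> pd Z r"
  shows "(\<Sum>c\<in>chords n. \<Sum>d\<in>chords n. \<beta> c d * m i c x * m j d x) = 0"
proof (rule hol_zero_off_axes[OF _ _ x])
  show "hol Z r (\<lambda>x. \<Sum>c\<in>chords n. \<Sum>d\<in>chords n. \<beta> c d * m i c x * m j d x)"
    using ij by (intro hol_sum hol_mult hol_const hol_m)
  fix x assume x: "x \<in> pd Z r" "\<forall>c\<in>Z. x c \<noteq> 0"
  have M0: "\<phi> x \<in> M0 n" by (rule phi_M0[OF x])
  have ex: "\<exists>\<zeta>. \<forall>c\<in>chords n. m k c x = x k * lam2 n (zz n (\<phi> x)) \<zeta> c" if k: "k \<in> Z" for k
  proof -
    have "((\<lambda>t. \<phi> (x(k := t)) c) has_field_derivative dp k (\<lambda>x. \<phi> x c) x) (at (x k))" if "c \<in> chords n" for c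
      by (rule hol_DERIV[OF hol_phi[OF that] k x(1)])
    from M0_log_derivative[OF n4 eventually_upd_nonzero[OF x k] this]
    obtain \<zeta> where \<zeta>: "\<And>c. c \<in> chords n ==> dp k (\<lambda>x. \<phi> x c) x = \<phi> x c * lam2 n (zz n (\<phi> x)) \<zeta> c" by auto
    have "m k c x = x k * lam2 n (zz n (\<phi> x)) \<zeta> c" if c: "c \<in> chords n" for c
    proof -
      have "m k c x * \<phi> x c = (x k * lam2 n (zz n (\<phi> x)) \<zeta> c) * \<phi> x c"
        by (subst m_eq[OF k c x(1), symmetric]) (simp only: \<zeta>[OF c] mult_ac)
      then show ?thesis using M0_nonzero[OF M0 c] by simp
    qed
    then show ?thesis by blast
  qed
  obtain \<zeta> where \<zeta>: "\<And>c. c \<in> chords n ==> m i c x = x i * lam2 n (zz n (\<phi> x)) \<zeta> c" using ex[OF ij(1)] by blast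
  obtain \<eta> where \<eta>: "\<And>c. c \<in> chords n ==> m j c x = x j * lam2 n (zz n (\<phi> x)) \<eta> c" using ex[OF ij(2)] by blast
  have "(\<Sum>c\<in>chords n. \<Sum>d\<in>chords n. \<beta> c d * m i c x * m j d x)
    = x i * x j * (\<Sum>c\<in>chords n. \<Sum>d\<in>chords n. \<beta> c d * lam2 n (zz n (\<phi> x)) \<zeta> c * lam2 n (zz n (\<phi> x)) \<eta> d)"
    unfolding sum_distrib_left by (intro sum.cong refl) (simp add: \<zeta> \<eta> mult_ac)
  also have "\<dots> = 0" using chords_integrable[OF M0_Dih(1)[OF M0 n4] anti rel] by simp
  finally show "(\<Sum>c\<in>chords n. \<Sum>d\<in>chords n. \<beta> c d * m i c x * m j d x) = 0" .
qed

text \<open>All equations of \<open>M_delta\<close> hold on \<open>M0\<close>, so they extend from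
  the complement of the hyperplanes by density.\<close>

lemma phi_M_delta:
  assumes x: "x \<in> pd Z r"
  shows "\<phi> x \<in> M_delta n"
  unfolding M_delta_def
proof (intro CollectI conjI allI impI)
  show "\<phi> x c = 0" if "c \<notin> chords n" for c by (rule phi_off[OF that])
  fix A B assume AB: "crossing_pair n A B"
  then have sub: "A \<subseteq> chords n" "B \<subseteq> chords n" unfolding crossing_pair_def cross_completely_def by blast+
  have "(\<lambda>x. (\<Prod>a\<in>A. \<phi> x a) + (\<Prod>b\<in>B. \<phi> x b) - 1) x = 0"
  proof (rule hol_zero_off_axes[OF _ _ x])
    show "hol Z r (\<lambda>x. (\<Prod>a\<in>A. \<phi> x a) + (\<Prod>b\<in>B. \<phi> x b) - 1)"
      using sub by (intro hol_diff hol_add hol_prod hol_const hol_phi) auto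
    show "(\<Prod>a\<in>A. \<phi> x a) + (\<Prod>b\<in>B. \<phi> x b) - 1 = 0" if "x \<in> pd Z r" "\<forall>c\<in>Z. x c \<noteq> 0" for x
      using M0_M_delta[OF phi_M0[OF that]] AB unfolding M_delta_def by blast
  qed
  then show "(\<Prod>a\<in>A. \<phi> x a) + (\<Prod>b\<in>B. \<phi> x b) - 1 = 0" .
qed

lemma phi_continuous: "continuous_on (pd Z r) \<phi>"
proof (rule continuous_on_coordinatewise_then_product)
  show "continuous_on (pd Z r) (\<lambda>x. \<phi> x c)" for c
    using hol_continuous[OF hol_phi, of c] phi_off[of c] by (cases "c \<in> chords n") auto
qed

end

text \<open>The coordinate of the point \<open>z j\<close> is labelled by \<open>{j}\<close>. These
  charts thus share the index type of the charts at vertices, and their labels are never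
  chords.\<close>

definition singles :: "nat \<Rightarrow> nat set set" where
  "singles n = (\<lambda>j. {j}) ` {3..<n}"

definition zshift :: "nat \<Rightarrow> (nat \<Rightarrow> complex) \<Rightarrow> (nat set \<Rightarrow> complex) \<Rightarrow> nat \<Rightarrow> complex" where
  "zshift n z t j = (if j \<in> {3..<n} then z j + t {j} else z j)"

definition zcoord :: "nat \<Rightarrow> (nat set \<Rightarrow> complex) \<Rightarrow> (nat set \<Rightarrow> complex) \<Rightarrow> nat set \<Rightarrow> complex" where
  "zcoord n u0 u c = (if c \<in> singles n then zz n u (the_elem c) - zz n u0 (the_elem c) else 0)"

lemma singles_not_chords: "c \<in> singles n ==> c \<notin> chords n"
proof
  assume "c \<in> singles n" "c \<in> chords n"
  then obtain j p q where "c = {j}" "c = {p, q}" "chordp n p q" by (auto simp: singles_def elim: chordsE)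
  then show False by (auto simp: chordp_def)
qed

lemma finite_singles [simp]: "finite (singles n)" "card (singles n) = n - 3"
  by (auto simp: singles_def card_image inj_on_def)

lemma zz_ends [simp]: "zz n u 2 = 0" "n \<ge> 3 ==> zz n u n = 1"
  by (auto simp: zz_def)

lemma zshift_hol: "hol (singles n) r (\<lambda>t. zshift n z t j)"
  unfolding zshift_def by (cases "j \<in> {3..<n}") (auto intro!: hol_add hol_coord simp: singles_def)

text \<open>Each of the two points moves by less than \<open>r\<close>, so their difference changes
  by at most half of its size, and its inverse is a geometric series.\<close>

lemma zshift_diff:
  fixes z :: "nat \<Rightarrow> complex"
  assumes "0 < r" "4 * r \<le> cmod (z p - z q)"
  shows "hol (singles n) r (\<lambda>t. 1 / (zshift n z t p - zshift n z t q))"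
    and "t \<in> pd (singles n) r ==> zshift n z t p - zshift n z t q \<noteq> 0"
proof -
  define a where "a = z p - z q"
  have a: "a \<noteq> 0" "4 * r \<le> cmod a" using assms by (auto simp: a_def)
  define s where "s j t = (if j \<in> {3..<n} then t {j} else 0 :: complex)" for j and t :: "nat set \<Rightarrow> complex"
  have ps: "psn (singles n) r r (s j)" for j
    unfolding s_def using assms(1) psn_const[of 0 r "singles n" r]
    by (cases "j \<in> {3..<n}") (auto intro!: psn_coord simp: singles_def)
  define y where "y t = - 1 / a * (s p t - s q t)" for t
  have "psn (singles n) r (cmod (- 1 / a) * (r + r)) y"
    unfolding y_def using assms(1) by (intro psn_mult psn_const psn_diff ps) auto
  moreover have "cmod (- 1 / a) * (r + r) \<le> 1 / 2" using a assms(1) by (simp add: norm_divide field_simps)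
  ultimately have y: "psn (singles n) r (1 / 2) y" by (rule psn_mono)
  have e: "zshift n z t p - zshift n z t q = a * (1 - y t)" for t
    using a by (simp add: zshift_def y_def s_def a_def field_simps)
  have "hol (singles n) r (\<lambda>t. 1 / a * (1 / (1 - y t)))"
    by (intro hol_mult hol_const hol_inverse_one_minus[OF y]) (use assms in auto)
  then show "hol (singles n) r (\<lambda>t. 1 / (zshift n z t p - zshift n z t q))"
    unfolding e by simp
  assume "t \<in> pd (singles n) r"
  then have "cmod (y t) \<le> 1 / 2" by (rule psn_bound[OF y])
  then have "y t \<noteq> 1" by auto
  then show "zshift n z t p - zshift n z t q \<noteq> 0" unfolding e using a by simp
qed

lemma zshift_zcoord:
  assumes "j \<in> {2..n}" "n \<ge> 4"
  shows "zshift n (zz n u0) (zcoord n u0 u) j = zz n u j"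
proof -
  consider "j = 2" | "j \<in> {3..<n}" | "j = n" using assms by fastforce
  then show ?thesis using assms by cases (auto simp: zshift_def zcoord_def singles_def)
qed

lemma Dih_cong:
  assumes "\<And>j. j \<in> {2..n} ==> z j = z' j"
  shows "Dih n z = Dih n z'"
proof
  fix c
  show "Dih n z c = Dih n z' c"
  proof (cases "c \<in> chords n")
    case True
    then obtain p q where c: "c = {p, q}" and cp: "chordp n p q" using chordsE by blast
    have S: "p \<in> {1..n}" "q \<in> {1..n}" "nxt n p \<in> {1..n}" "nxt n q \<in> {1..n}"
      using cp by (auto simp: chordp_def nxt_def)
    have e: "cf z j = cf z' j" if "j \<in> {1..n}" for j using that assms by (auto simp: cf_def)
    show ?thesis using True unfolding c Dih_def by (simp only: dihedral_coords_eq S[THEN e])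
  qed (simp add: Dih_def dihedral_coords_def)
qed

text \<open>The points \<open>z j\<close> with \<open>3 \<le> j < n\<close> are coordinates on all
  of \<open>M0\<close>, and a small radius keeps them distinct. The radius is shrunk once more,
  using the continuity of the chart already found, to bring the image into
  \<open>Op\<close>.\<close>

lemma M0_chart:
  assumes u0: "u0 \<in> M0 n" and n: "n \<ge> 4" and Op: "open Op" "u0 \<in> Op"
  obtains r \<phi> where "chart (singles n) r n \<phi>" "\<And>t. t \<in> pd (singles n) r ==> \<phi> t \<in> M0 n \<inter> Op" "\<phi> (\<lambda>c. 0) = u0"
    "\<And>t. t \<in> pd (singles n) r ==> zcoord n u0 (\<phi> t) = t"
    "\<And>u. u \<in> M0 n ==> zcoord n u0 u \<in> pd (singles n) r ==> \<phi> (zcoord n u0 u) = u"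
proof -
  define z where "z = zz n u0"
  have inj: "inj_on z {2..n}" and u0D: "u0 = Dih n z" unfolding z_def using M0_Dih[OF u0 n] by auto
  define \<phi> where "\<phi> t = Dih n (zshift n z t)" for t
  define D where "D = insert 1 ((\<lambda>(p, q). cmod (z p - z q)) ` {(p, q). p \<in> {2..n} \<and> q \<in> {2..n} \<and> p \<noteq> q})"
  have finD: "finite D"
  proof -
    have "{(p, q). p \<in> {2..n} \<and> q \<in> {2..n} \<and> p \<noteq> q} \<subseteq> {2..n} \<times> {2..n}" by auto
    then have "finite {(p, q). p \<in> {2..n} \<and> q \<in> {2..n} \<and> p \<noteq> q}" by (rule finite_subset) auto
    then show ?thesis unfolding D_def by simp
  qed
  have D0: "0 < d" if "d \<in> D" for d using that inj unfolding D_def by (auto simp: inj_on_def)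
  define r0 where "r0 = Min D / 4"
  have r0: "0 < r0" unfolding r0_def using Min_in[OF finD] D0 by (auto simp: D_def)
  have r0le: "4 * r \<le> cmod (z p - z q)" if "r \<le> r0" "p \<in> {2..n}" "q \<in> {2..n}" "p \<noteq> q" for r p q
  proof -
    have "(p, q) \<in> {(p, q). p \<in> {2..n} \<and> q \<in> {2..n} \<and> p \<noteq> q}" using that by simp
    then have "cmod (z p - z q) \<in> D" unfolding D_def by (metis (no_types, lifting) case_prod_conv image_eqI insertI2)
    then have "Min D \<le> cmod (z p - z q)" by (intro Min_le finD)
    then show ?thesis using that by (simp add: r0_def)
  qed
  have ch: "chart (singles n) r n \<phi>" and M0: "\<And>t. t \<in> pd (singles n) r ==> \<phi> t \<in> M0 n"
    and zc: "\<And>t. t \<in> pd (singles n) r ==> zcoord n u0 (\<phi> t) = t" if r: "0 < r" "r \<le> r0" for r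
  proof -
    have inj': "inj_on (zshift n z t) {2..n}" if "t \<in> pd (singles n) r" for t
    proof (rule inj_onI, rule ccontr)
      fix p q assume pq: "p \<in> {2..n}" "q \<in> {2..n}" "zshift n z t p = zshift n z t q" "p \<noteq> q"
      show False using zshift_diff(2)[OF r(1) r0le[OF r(2) pq(1,2,4)] that] pq(3) by simp
    qed
    show M0: "\<phi> t \<in> M0 n" if "t \<in> pd (singles n) r" for t
      unfolding \<phi>_def by (rule Dih_M0[OF inj'[OF that]])
    show "zcoord n u0 (\<phi> t) = t" if t: "t \<in> pd (singles n) r" for t
    proof
      fix c
      show "zcoord n u0 (\<phi> t) c = t c"
      proof (cases "c \<in> singles n")
        case False then show ?thesis using t by (simp add: zcoord_def pd_def)
      next
        case True
        then obtain j where j: "c = {j}" "j \<in> {3..<n}" by (auto simp: singles_def)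
        have "zz n (\<phi> t) j = zshift n z t j" unfolding \<phi>_def
          by (rule zz_Dih[OF inj'[OF t]]) (use j n in \<open>auto simp: zshift_def z_def\<close>)
        then show ?thesis using True j by (simp add: zcoord_def zshift_def z_def)
      qed
    qed
    let ?W = "\<lambda>t p q. wedge (cf (zshift n z t) p) (cf (zshift n z t) q)"
    have W: "hol (singles n) r (\<lambda>t. ?W t p q)" "hol (singles n) r (\<lambda>t. 1 / ?W t p q)"
      if "p \<in> {1..n}" "q \<in> {1..n}" "p \<noteq> q" for p q
    proof -
      show "hol (singles n) r (\<lambda>t. ?W t p q)"
        unfolding wedge_cf by (cases "p = 1"; cases "q = 1") (auto intro!: hol_diff zshift_hol)
      show "hol (singles n) r (\<lambda>t. 1 / ?W t p q)"
      proof (cases "p = 1 \<or> q = 1")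
        case True
        then show ?thesis unfolding wedge_cf by (cases "p = 1"; cases "q = 1") auto
      next
        case False
        then have "hol (singles n) r (\<lambda>t. 1 / (zshift n z t p - zshift n z t q))"
          using that by (intro zshift_diff(1) r(1) r0le[OF r(2)]) auto
        then show ?thesis unfolding wedge_cf using False by simp
      qed
    qed
    show "chart (singles n) r n \<phi>"
    proof
      show "finite (singles n)" "0 < r" "4 \<le> n" using r n by auto
      fix c x
      show "\<phi> x c = 0" if "c \<notin> chords n" using that by (simp add: \<phi>_def Dih_def dihedral_coords_def)
      show "\<phi> x \<in> M0 n" if "x \<in> pd (singles n) r" using M0 that .
      assume c: "c \<in> chords n"
      show "\<phi> x c = x c" if "c \<in> singles n" using singles_not_chords[OF that] c by blast
      show "\<phi> x c \<noteq> 0" if "x \<in> pd (singles n) r" using M0_nonzero[OF M0[OF that] c] .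
      obtain p q where pq: "c = {p, q}" and cp: "chordp n p q" using chordsE[OF c] .
      have S: "p \<in> {1..n}" "q \<in> {1..n}" "nxt n p \<in> {1..n}" "nxt n q \<in> {1..n}" "p \<noteq> nxt n q" "nxt n p \<noteq> q" "p \<noteq> q" "nxt n p \<noteq> nxt n q"
        using cp by (auto simp: chordp_def nxt_def split: if_splits)
      have f: "\<phi> t c = ?W t p (nxt n q) * ?W t (nxt n p) q * (1 / ?W t p q * (1 / ?W t (nxt n p) (nxt n q)))" for t
        using c unfolding pq \<phi>_def Dih_def by (subst dihedral_coords_eq) auto
      have f': "1 / \<phi> t c = (1 / ?W t p (nxt n q)) * (1 / ?W t (nxt n p) q) * (?W t p q * ?W t (nxt n p) (nxt n q))" for t
        unfolding f by simp
      show "hol (singles n) r (\<lambda>x. \<phi> x c)" unfolding f using S by (intro hol_mult W)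
      show "hol (singles n) r (\<lambda>x. 1 / \<phi> x c)" unfolding f' using S by (intro hol_mult W)
    qed
  qed
  have \<phi>0: "\<phi> (\<lambda>c. 0) = u0" unfolding \<phi>_def u0D by (rule Dih_cong) (simp add: zshift_def)
  interpret c0: chart "singles n" r0 n \<phi> by (rule ch) (use r0 in auto)
  obtain V where V: "open V" "V \<inter> pd (singles n) r0 = \<phi> -` Op \<inter> pd (singles n) r0"
    using c0.phi_continuous Op(1) unfolding continuous_on_open_invariant by blast
  have "(\<lambda>c. 0) \<in> \<phi> -` Op \<inter> pd (singles n) r0" using \<phi>0 Op(2) r0 by simp
  then have "(\<lambda>c. 0) \<in> V" using V(2) by blast
  then obtain r1 where r1: "0 < r1" "pd (singles n) r1 \<subseteq> V" using pd_neighbourhood[OF V(1)] finite_singles(1) by metis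
  define r where "r = min r0 r1"
  have r: "0 < r" "r \<le> r0" using r0 r1 by (auto simp: r_def)
  have sub: "pd (singles n) r \<subseteq> pd (singles n) r0 \<inter> pd (singles n) r1" by (auto simp: pd_def r_def)
  show ?thesis
  proof (rule that[of r \<phi>])
    show "chart (singles n) r n \<phi>" by (rule ch[OF r])
    show "\<phi> t \<in> M0 n \<inter> Op" if "t \<in> pd (singles n) r" for t
      using M0[OF r that] sub that r1(2) V(2) by blast
    show "zcoord n u0 (\<phi> t) = t" if "t \<in> pd (singles n) r" for t by (rule zc[OF r that])
    show "\<phi> (zcoord n u0 u) = u" if "u \<in> M0 n" for u
    proof -
      have "\<phi> (zcoord n u0 u) = Dih n (zz n u)" unfolding \<phi>_def z_def by (rule Dih_cong) (rule zshift_zcoord, use n in auto)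
      then show ?thesis using M0_Dih(2)[OF that n] by simp
    qed
  qed (rule \<phi>0)
qed

section \<open>The chart at a vertex\<close>

text \<open>Near the vertex of a triangulation \<open>\<alpha>\<close>, the equations of the chords outside \<open>\<alpha>\<close> are a
  contraction in their coordinates, so that the coordinates \<open>x\<^sub>c = u\<^sub>c\<close>, \<open>c \<in> \<alpha>\<close>, determine all
  others as power series.\<close>

locale triangulated =
  fixes n :: nat and \<alpha> :: "nat set set"
  assumes n4: "n \<ge> 4" and tri: "triangulation n \<alpha>"
begin

definition N :: real where "N = real (card (chords n))"

text \<open>One coordinate of norm \<open>rad\<close> has to outweigh, by a factor 8, both a product
  of up to \<open>card (chords n)\<close> factors of norm 2 and the constant of
  \<open>psn_prod_diff\<close> for such products.\<close>

definition rad :: real where "rad = 1 / (8 * (N + 1) * 2 ^ card (chords n))"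

fun iter :: "nat \<Rightarrow> (nat set \<Rightarrow> complex) \<Rightarrow> nat set \<Rightarrow> complex" where
  "iter 0 x c = (if c \<in> \<alpha> then x c else 1)"
| "iter (Suc k) x c = (if c \<in> \<alpha> then x c else 1 - (\<Prod>b\<in>crossing n c. iter k x b))"

definition \<Phi> :: "(nat set \<Rightarrow> complex) \<Rightarrow> nat set \<Rightarrow> complex" where
  "\<Phi> x c = (if c \<in> \<alpha> then x c else if c \<in> chords n then 1 + (\<Sum>k. iter (Suc k) x c - iter k x c) else 0)"

definition restr :: "(nat set \<Rightarrow> complex) \<Rightarrow> nat set \<Rightarrow> complex" where
  "restr u c = (if c \<in> \<alpha> then u c else 0)"

lemma alpha: "\<alpha> \<subseteq> chords n" "finite \<alpha>" "card \<alpha> = n - 3"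
  using tri finite_subset[OF _ finite_chords] by (auto simp: triangulation_def)

lemma N0: "0 \<le> N" by (simp add: N_def)

lemma rad: "0 < rad" "rad \<le> 1" "rad * 2 ^ card (chords n) \<le> 1 / 8" "rad * (N * 2 ^ card (chords n)) \<le> 1 / 8"
proof -
  define P :: real where "P = 2 ^ card (chords n)"
  have P: "1 \<le> P" by (simp add: P_def)
  have r: "rad = 1 / (8 * (N + 1) * P)" by (simp add: rad_def P_def)
  have NP: "1 \<le> (N + 1) * P" using mult_mono[of 1 "N + 1" 1 P] N0 P by simp
  define Q where "Q = (N + 1) * P"
  have r2: "rad = 1 / (8 * Q)" by (simp add: r Q_def mult.assoc)
  show "0 < rad" "rad \<le> 1" unfolding r2 using NP[folded Q_def] by (auto simp: divide_le_eq)
  have "rad * P = 1 / (8 * (N + 1))" unfolding r using P by (simp add: divide_simps)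
  also have "\<dots> \<le> 1 / 8" using N0 by (simp add: divide_simps)
  finally show "rad * 2 ^ card (chords n) \<le> 1 / 8" unfolding P_def .
  have "rad * (N * P) = N / (8 * (N + 1))" unfolding r using P by (simp add: divide_simps)
  also have "\<dots> \<le> 1 / 8" using N0 by (simp add: divide_simps)
  finally show "rad * (N * 2 ^ card (chords n)) \<le> 1 / 8" unfolding P_def .
qed

text \<open>By maximality of the triangulation every product in the iteration contains a factor
  \<open>x b\<close> with \<open>b \<in> \<alpha>\<close>. This small factor makes the iteration
  contract.\<close>

lemma crossing_alpha:
  assumes "c \<in> chords n" "c \<notin> \<alpha>"
  obtains b where "b \<in> crossing n c" "b \<in> \<alpha>"
proof -
  obtain d where d: "d \<in> \<alpha>" "crosses c d" using triangulation_maximal[OF tri n4 assms] .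
  then have "d \<in> crossing n c" using alpha(1) crosses_sym[of c d] by (auto simp: crossing_def)
  then show ?thesis using that d by blast
qed

lemma crossing_chords: "b \<in> crossing n c ==> b \<in> chords n"
  by (simp add: crossing_def)

lemma card_crossing: "card (crossing n c - {b}) \<le> card (chords n)"
  by (rule card_mono) (auto simp: crossing_def)

lemma prod_crossing_split:
  assumes "b \<in> crossing n c" "b \<in> \<alpha>" "\<And>k x. b \<in> \<alpha> ==> f k x b = x b"
  shows "(\<Prod>a\<in>crossing n c. f k x a) = x b * (\<Prod>a\<in>crossing n c - {b}. f k x a)"
  using prod.remove[of "crossing n c" b "f k x"] assms by simp

lemma iter_alpha: "c \<in> \<alpha> ==> iter k x c = x c"
  by (cases k) auto

lemma psn_iter: "c \<in> chords n ==> psn \<alpha> rad 2 (\<lambda>x. iter k x c)"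
proof (induction k arbitrary: c)
  case 0
  then show ?case
    using psn_mono[OF psn_coord[of c \<alpha> rad], of 2] rad psn_const[of 1 2] by (cases "c \<in> \<alpha>") auto
next
  case (Suc k)
  show ?case
  proof (cases "c \<in> \<alpha>")
    case True
    then show ?thesis using psn_mono[OF psn_coord[of c \<alpha> rad], of 2] rad by auto
  next
    case False
    obtain b where b: "b \<in> crossing n c" "b \<in> \<alpha>" using crossing_alpha[OF Suc.prems False] .
    have "psn \<alpha> rad (2 ^ card (crossing n c - {b})) (\<lambda>x. \<Prod>a\<in>crossing n c - {b}. iter k x a)"
      using rad by (intro psn_prod Suc.IH) (auto dest: crossing_chords)
    then have p: "psn \<alpha> rad (rad * 2 ^ card (crossing n c - {b})) (\<lambda>x. x b * (\<Prod>a\<in>crossing n c - {b}. iter k x a))"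
      using rad b by (intro psn_mult psn_coord) auto
    have "(2::real) ^ card (crossing n c - {b}) \<le> 2 ^ card (chords n)"
      using card_crossing by (intro power_increasing) auto
    then have "rad * 2 ^ card (crossing n c - {b}) \<le> rad * 2 ^ card (chords n)"
      using rad by (intro mult_left_mono) auto
    then have "1 + rad * 2 ^ card (crossing n c - {b}) \<le> 2" using rad by linarith
    then have "psn \<alpha> rad 2 (\<lambda>x. 1 - x b * (\<Prod>a\<in>crossing n c - {b}. iter k x a))"
      using psn_mono[OF psn_diff[OF psn_const[of 1 1] p]] rad by auto
    then show ?thesis using False prod_crossing_split[OF b, of iter k] iter_alpha by simp
  qed
qed

text \<open>Both products have the factor \<open>x b\<close> in common. The remaining ones differ by
  what \<open>psn_prod_diff\<close> gives for the previous increments, and multiplication by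
  \<open>x b\<close> turns this into a gain of 1/8.\<close>

lemma psn_iter_diff: "c \<in> chords n ==> psn \<alpha> rad ((1 / 8) ^ Suc k) (\<lambda>x. iter (Suc k) x c - iter k x c)"
proof (induction k arbitrary: c)
  case 0
  show ?case
  proof (cases "c \<in> \<alpha>")
    case True then show ?thesis using psn_const[of 0 "1/8"] by simp
  next
    case False
    obtain b where b: "b \<in> crossing n c" "b \<in> \<alpha>" using crossing_alpha[OF 0 False] .
    have "psn \<alpha> rad (2 ^ card (crossing n c - {b})) (\<lambda>x. \<Prod>a\<in>crossing n c - {b}. iter 0 x a)"
      using rad by (intro psn_prod psn_iter) (auto dest: crossing_chords)
    then have p: "psn \<alpha> rad (rad * 2 ^ card (crossing n c - {b})) (\<lambda>x. x b * (\<Prod>a\<in>crossing n c - {b}. iter 0 x a))"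
      using rad b by (intro psn_mult psn_coord) auto
    have "(2::real) ^ card (crossing n c - {b}) \<le> 2 ^ card (chords n)"
      using card_crossing by (intro power_increasing) auto
    then have "rad * 2 ^ card (crossing n c - {b}) \<le> rad * 2 ^ card (chords n)"
      using rad by (intro mult_left_mono) auto
    then have "rad * 2 ^ card (crossing n c - {b}) \<le> 1 / 8" using rad by linarith
    then have "psn \<alpha> rad (1 / 8) (\<lambda>x. - (x b * (\<Prod>a\<in>crossing n c - {b}. iter 0 x a)))"
      by (rule psn_mono[OF psn_minus[OF p less_imp_le[OF rad(1)]]])
    moreover have "iter (Suc 0) x c - iter 0 x c = - (x b * (\<Prod>a\<in>crossing n c - {b}. iter 0 x a))" for x
      using False prod_crossing_split[OF b, of iter 0 x] iter_alpha by simp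
    ultimately show ?thesis by (simp del: iter.simps)
  qed
next
  case (Suc k)
  show ?case
  proof (cases "c \<in> \<alpha>")
    case True then show ?thesis using psn_const[of 0 "(1/8) ^ Suc (Suc k)"] by simp
  next
    case False
    obtain b where b: "b \<in> crossing n c" "b \<in> \<alpha>" using crossing_alpha[OF Suc.prems False] .
    let ?I = "crossing n c - {b}"
    have "psn \<alpha> rad (real (card ?I) * 2 ^ card ?I * (1 / 8) ^ Suc k) (\<lambda>x. (\<Prod>a\<in>?I. iter (Suc k) x a) - (\<Prod>a\<in>?I. iter k x a))"
      using rad by (intro psn_prod_diff psn_iter Suc.IH) (auto dest: crossing_chords)
    then have p: "psn \<alpha> rad (rad * (real (card ?I) * 2 ^ card ?I * (1 / 8) ^ Suc k)) (\<lambda>x. x b * ((\<Prod>a\<in>?I. iter (Suc k) x a) - (\<Prod>a\<in>?I. iter k x a)))"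
      using rad b by (intro psn_mult psn_coord) auto
    have "real (card ?I) * 2 ^ card ?I \<le> N * 2 ^ card (chords n)"
      unfolding N_def using card_crossing by (intro mult_mono power_increasing) auto
    then have "rad * (real (card ?I) * 2 ^ card ?I) \<le> rad * (N * 2 ^ card (chords n))"
      using rad by (intro mult_left_mono) auto
    then have le: "rad * (real (card ?I) * 2 ^ card ?I) \<le> 1 / 8" using rad(4) by linarith
    have "rad * (real (card ?I) * 2 ^ card ?I) * (1 / 8) ^ Suc k \<le> 1 / 8 * (1 / 8) ^ Suc k"
      by (rule mult_right_mono[OF le]) simp
    then have "rad * (real (card ?I) * 2 ^ card ?I * (1 / 8) ^ Suc k) \<le> (1 / 8) ^ Suc (Suc k)"
      by (simp add: mult.assoc)
    then have "psn \<alpha> rad ((1 / 8) ^ Suc (Suc k)) (\<lambda>x. - (x b * ((\<Prod>a\<in>?I. iter (Suc k) x a) - (\<Prod>a\<in>?I. iter k x a))))"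
      by (rule psn_mono[OF psn_minus[OF p less_imp_le[OF rad(1)]]])
    moreover have "iter (Suc (Suc k)) x c - iter (Suc k) x c = - (x b * ((\<Prod>a\<in>?I. iter (Suc k) x a) - (\<Prod>a\<in>?I. iter k x a)))" for x
      using False prod_crossing_split[OF b, of iter "Suc k" x] prod_crossing_split[OF b, of iter k x] iter_alpha
      by (simp add: iter.simps(2)[of "Suc k"] iter.simps(2)[of k x c] right_diff_distrib del: iter.simps)
    ultimately show ?thesis by (simp del: iter.simps)
  qed
qed

definition Y :: "nat set \<Rightarrow> (nat set \<Rightarrow> complex) \<Rightarrow> complex" where
  "Y c x = (\<Sum>k. iter (Suc k) x c - iter k x c)"

lemma Y:
  assumes "c \<in> chords n"
  shows "psn \<alpha> rad (1 / 7) (Y c)" "x \<in> pd \<alpha> rad ==> (\<lambda>k. iter (Suc k) x c - iter k x c) sums Y c x"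
proof -
  have s: "(\<lambda>k. (1 / 8 :: real) ^ Suc k) sums (1 / 8 * (1 / (1 - 1 / 8)))"
    using sums_mult[OF geometric_sums[of "1 / 8 :: real"], of "1 / 8"] by simp
  have "psn \<alpha> rad (\<Sum>k. (1 / 8) ^ Suc k) (Y c)"
    unfolding Y_def using psn_suminf(1)[OF psn_iter_diff[OF assms] sums_summable[OF s] rad(1)] .
  moreover have "(\<Sum>k. (1 / 8 :: real) ^ Suc k) = 1 / 7"
    by (subst sums_unique[OF s, symmetric]) simp
  ultimately show "psn \<alpha> rad (1 / 7) (Y c)" by (simp only:)
  show "x \<in> pd \<alpha> rad ==> (\<lambda>k. iter (Suc k) x c - iter k x c) sums Y c x"
    unfolding Y_def using psn_suminf(2)[OF psn_iter_diff[OF assms] sums_summable[OF s] rad(1)] .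
qed

lemma Phi_Y: "c \<in> chords n ==> c \<notin> \<alpha> ==> \<Phi> x c = 1 + Y c x"
  by (simp add: \<Phi>_def Y_def)

lemma iter_limit:
  assumes "c \<in> chords n" "x \<in> pd \<alpha> rad"
  shows "(\<lambda>k. iter k x c) \<longlonglongrightarrow> \<Phi> x c"
proof (cases "c \<in> \<alpha>")
  case True then show ?thesis by (simp add: iter_alpha \<Phi>_def)
next
  case False
  have "(\<lambda>K. \<Sum>k<K. iter (Suc k) x c - iter k x c) \<longlonglongrightarrow> Y c x" using Y(2)[OF assms] by (simp add: sums_def)
  then have "(\<lambda>K. iter K x c - iter 0 x c) \<longlonglongrightarrow> Y c x" by (simp only: sum_lessThan_telescope[of "\<lambda>k. iter k x c"])
  then have "(\<lambda>K. (iter K x c - iter 0 x c) + 1) \<longlonglongrightarrow> Y c x + 1" by (rule tendsto_add[OF _ tendsto_const])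
  then show ?thesis using False Phi_Y[OF assms(1) False, of x] by (simp add: add.commute)
qed

lemma Phi_basic:
  assumes "c \<in> chords n" "c \<notin> \<alpha>" "x \<in> pd \<alpha> rad"
  shows "basic n (\<Phi> x) c"
proof -
  have "(\<lambda>k. \<Prod>b\<in>crossing n c. iter k x b) \<longlonglongrightarrow> (\<Prod>b\<in>crossing n c. \<Phi> x b)"
    using assms by (intro tendsto_prod iter_limit) (auto dest: crossing_chords)
  then have "(\<lambda>k. 1 - (\<Prod>b\<in>crossing n c. iter k x b)) \<longlonglongrightarrow> 1 - (\<Prod>b\<in>crossing n c. \<Phi> x b)"
    by (rule tendsto_diff[OF tendsto_const])
  moreover have "(\<lambda>k. iter (Suc k) x c) \<longlonglongrightarrow> \<Phi> x c" using iter_limit[OF assms(1,3)] by (rule LIMSEQ_Suc)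
  ultimately have "\<Phi> x c = 1 - (\<Prod>b\<in>crossing n c. \<Phi> x b)" using assms(2) LIMSEQ_unique by auto
  then show ?thesis by (simp add: basic_def)
qed

lemma Phi_near_one: "c \<in> chords n ==> c \<notin> \<alpha> ==> x \<in> pd \<alpha> rad ==> cmod (\<Phi> x c - 1) \<le> 1 / 7"
  using psn_bound[OF Y(1)] by (simp add: Phi_Y)

text \<open>The same contraction applied to two solutions: their largest distance satisfies
  \<open>\<delta> \<le> \<delta> / 8\<close>. Nearness to 1 provides the bound 2 for the
  factors.\<close>

lemma Phi_unique:
  assumes bas: "\<And>c. c \<in> chords n ==> c \<notin> \<alpha> ==> basic n u c" and off: "\<And>c. c \<notin> chords n ==> u c = 0"
    and x: "restr u \<in> pd \<alpha> rad" and near: "\<And>c. c \<in> chords n ==> c \<notin> \<alpha> ==> cmod (u c - 1) < 1 / 2"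
  shows "u = \<Phi> (restr u)"
proof -
  let ?v = "\<Phi> (restr u)"
  have va: "?v c = u c" if "c \<in> \<alpha>" for c using that by (simp add: \<Phi>_def restr_def)
  define \<delta> where "\<delta> = Max (insert 0 ((\<lambda>c. cmod (u c - ?v c)) ` chords n))"
  have fin: "finite (insert 0 ((\<lambda>c. cmod (u c - ?v c)) ` chords n))" by simp
  have \<delta>: "cmod (u c - ?v c) \<le> \<delta>" if "c \<in> chords n" for c unfolding \<delta>_def using that by (intro Max_ge fin) auto
  have \<delta>0: "0 \<le> \<delta>" unfolding \<delta>_def by (intro Max_ge fin) auto
  have ub: "cmod (u c) \<le> 2" "cmod (?v c) \<le> 2" if "c \<in> chords n" for c
  proof -
    have "cmod (u c) \<le> 2 \<and> cmod (?v c) \<le> 2"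
    proof (cases "c \<in> \<alpha>")
      case True
      have "cmod (restr u c) < rad" using x True by (auto simp: pd_def)
      then show ?thesis using rad True va[OF True] by (simp add: restr_def)
    next
      case False
      then show ?thesis using near[OF that False] Phi_near_one[OF that False x]
          norm_triangle_sub[of "u c" 1] norm_triangle_sub[of "?v c" 1] by simp
    qed
    then show "cmod (u c) \<le> 2" "cmod (?v c) \<le> 2" by auto
  qed
  have small: "cmod (u c - ?v c) \<le> \<delta> / 8" if c: "c \<in> chords n" for c
  proof (cases "c \<in> \<alpha>")
    case True then show ?thesis using va \<delta>0 by simp
  next
    case False
    obtain b where b: "b \<in> crossing n c" "b \<in> \<alpha>" using crossing_alpha[OF c False] .
    let ?I = "crossing n c - {b}"
    have e: "u c = 1 - u b * (\<Prod>a\<in>?I. u a)" "?v c = 1 - u b * (\<Prod>a\<in>?I. ?v a)"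
      using bas[OF c False] Phi_basic[OF c False x] b va[OF b(2)] prod.remove[OF _ b(1), of u] prod.remove[OF _ b(1), of ?v]
      by (simp_all add: basic_def eq_diff_eq)
    have "cmod ((\<Prod>a\<in>?I. ?v a) - (\<Prod>a\<in>?I. u a)) \<le> real (card ?I) * 2 ^ card ?I * \<delta>"
      using ub \<delta> \<delta>0 by (intro norm_prod_diff_le) (auto dest!: crossing_chords simp: norm_minus_commute)
    also have "\<dots> \<le> N * 2 ^ card (chords n) * \<delta>"
      unfolding N_def using card_crossing \<delta>0 by (intro mult_mono mult_nonneg_nonneg power_increasing) auto
    finally have d: "cmod ((\<Prod>a\<in>?I. ?v a) - (\<Prod>a\<in>?I. u a)) \<le> N * 2 ^ card (chords n) * \<delta>" .
    have "cmod (u b) \<le> rad" using x b(2) by (auto simp: pd_def restr_def less_imp_le)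
    then have "cmod (u b * ((\<Prod>a\<in>?I. ?v a) - (\<Prod>a\<in>?I. u a))) \<le> rad * (N * 2 ^ card (chords n) * \<delta>)"
      unfolding norm_mult using d rad by (intro mult_mono) auto
    also have "\<dots> \<le> 1 / 8 * \<delta>" using mult_right_mono[OF rad(4) \<delta>0] by (simp add: mult_ac)
    also have "u b * ((\<Prod>a\<in>?I. ?v a) - (\<Prod>a\<in>?I. u a)) = u c - ?v c" unfolding e by (simp add: algebra_simps)
    finally show ?thesis by simp
  qed
  have "\<delta> \<le> \<delta> / 8" unfolding \<delta>_def[of] using small \<delta>0 fin
    by (subst Max_le_iff) (auto simp flip: \<delta>_def)
  then have "\<delta> = 0" using \<delta>0 by simp
  then show ?thesis using \<delta> off alpha(1) by (intro ext) (metis \<Phi>_def eq_iff_diff_eq_0 norm_le_zero_iff subsetD)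
qed

sublocale polydisc \<alpha> rad
  by standard (use alpha rad in auto)

lemma hol_Phi: "c \<in> chords n ==> hol \<alpha> rad (\<lambda>x. \<Phi> x c)"
  using hol_add[OF hol_const psn_hol[OF Y(1)]] hol_coord[of c \<alpha> rad] Phi_Y by (cases "c \<in> \<alpha>") (auto simp: \<Phi>_def)

lemma Phi_real:
  assumes "\<And>c. x c \<in> \<real>" "x \<in> pd \<alpha> rad"
  shows "\<Phi> x c \<in> \<real>"
proof (cases "c \<in> chords n")
  case True
  have "iter k x c \<in> \<real>" for k c using assms(1) by (induction k arbitrary: c) (auto intro!: Reals_diff)
  then show ?thesis by (intro closed_sequentially[OF closed_complex_Reals _ iter_limit[OF True assms(2)]])
qed (use alpha(1) in \<open>auto simp: \<Phi>_def\<close>)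

lemma Phi_zero: "c \<in> chords n ==> c \<notin> \<alpha> ==> \<Phi> (\<lambda>c. 0) c = 1"
proof -
  assume c: "c \<in> chords n" "c \<notin> \<alpha>"
  obtain b where b: "b \<in> crossing n c" "b \<in> \<alpha>" using crossing_alpha[OF c] .
  have P0: "(\<Prod>b\<in>crossing n c. \<Phi> (\<lambda>c. 0) b) = 0"
    using b by (intro prod_zero) (auto simp: \<Phi>_def)
  show "\<Phi> (\<lambda>c. 0) c = 1" using Phi_basic[OF c zero_in_pd[OF rad(1)]] unfolding basic_def P0 by simp
qed

end

section \<open>An identity theorem for parametrised families\<close>

context polydisc
begin

text \<open>The identity theorem, for a function vanishing on the image of a family \<open>X\<close> with a
  holomorphic left inverse \<open>T\<close>: by the chain rule and a dimension count, all partial derivatives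
  vanish there as well.\<close>

lemma dp_zero_on_parametrised:
  assumes J: "polydisc J \<rho>" "card J = card Z"
    and X: "\<And>c. c \<in> Z ==> hol J \<rho> (\<lambda>t. X t c)" "\<And>t. t \<in> pd J \<rho> ==> X t \<in> pd Z r"
    and T: "\<And>j. j \<in> J ==> hol Z r (T j)" "\<And>j t. j \<in> J ==> t \<in> pd J \<rho> ==> T j (X t) = t j"
    and G: "hol Z r G" "\<And>t. t \<in> pd J \<rho> ==> G (X t) = 0" and d: "d \<in> Z" and t: "t \<in> pd J \<rho>"
  shows "dp d G (X t) = 0"
proof -
  interpret J: polydisc J \<rho> by fact
  have ch: "((\<lambda>s. F (X (t(k := s)))) has_field_derivative (\<Sum>c\<in>Z. dp c F (X t) * dp k (\<lambda>t. X t c) t)) (at (t k))"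
    if F: "hol Z r F" and k: "k \<in> J" for F k
  proof -
    have "\<forall>\<^sub>F s in at (t k) within UNIV. X (t(k := s)) \<in> pd Z r"
      using eventually_upd_pd[OF k t] X(2) by (auto simp: eventually_at_filter elim: eventually_mono)
    moreover have "((\<lambda>s. X (t(k := s)) c) has_derivative (*) (dp k (\<lambda>t. X t c) t)) (at (t k) within UNIV)"
      if "c \<in> Z" for c
      using J.hol_DERIV[OF X(1)[OF that] k t] by (simp add: has_field_derivative_def)
    ultimately have "((\<lambda>s. F (X (t(k := s)))) has_derivative
        (\<lambda>h. \<Sum>c\<in>Z. dp c F (X (t(k := t k))) * (dp k (\<lambda>t. X t c) t * h))) (at (t k) within UNIV)"
      using X(2)[OF t] by (intro hol_chain[OF F]) auto
    moreover have "(\<lambda>h. \<Sum>c\<in>Z. dp c F (X (t(k := t k))) * (dp k (\<lambda>t. X t c) t * h)) =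
        (*) (\<Sum>c\<in>Z. dp c F (X t) * dp k (\<lambda>t. X t c) t)"
      by (auto simp: fun_eq_iff sum_distrib_right mult.assoc)
    ultimately show ?thesis by (simp add: has_field_derivative_def)
  qed
  have ev: "\<forall>\<^sub>F s in nhds (t k). t(k := s) \<in> pd J \<rho>" if "k \<in> J" for k
    using eventually_upd_pd[OF that t] .
  show ?thesis
  \<comment> \<open>Differentiating \<open>T j (X t) = t j\<close> gives a left inverse of the
    Jacobian matrix of \<open>X\<close>; differentiating \<open>G (X t) = 0\<close> puts the
    gradient of \<open>G\<close> into its left kernel.\<close>
  proof (rule left_kernel_trivial[OF fin J.fin J(2)[symmetric], where B = "\<lambda>j c. dp c (T j) (X t)"
        and A = "\<lambda>c k. dp k (\<lambda>t. X t c) t" and g = "\<lambda>c. dp c G (X t)"])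
    show "d \<in> Z" by fact
    fix k assume k: "k \<in> J"
    have "deriv (\<lambda>s. G (X (t(k := s)))) (t k) = deriv (\<lambda>s. 0) (t k)"
      by (rule deriv_cong_ev[OF eventually_mono[OF ev[OF k]] refl], rule G(2))
    then show "(\<Sum>c\<in>Z. dp c G (X t) * dp k (\<lambda>t. X t c) t) = 0"
      using DERIV_imp_deriv[OF ch[OF G(1) k]] by simp
    fix j assume j: "j \<in> J"
    have "deriv (\<lambda>s. T j (X (t(k := s)))) (t k) = deriv (\<lambda>s. (t(k := s)) j) (t k)"
      by (rule deriv_cong_ev[OF eventually_mono[OF ev[OF k]] refl], rule T(2)[OF j])
    then show "(\<Sum>c\<in>Z. dp c (T j) (X t) * dp k (\<lambda>t. X t c) t) = (if j = k then 1 else 0)"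
      using DERIV_imp_deriv[OF ch[OF T(1)[OF j] k]] by (auto simp: fun_upd_apply)
  qed
qed

text \<open>Along the complex line from \<open>X (\<lambda>c. 0)\<close> to \<open>x\<close> all
  derivatives of \<open>G\<close> vanish at the start, because a directional derivative of a
  function vanishing on the image of \<open>X\<close> vanishes there again. The identity theorem in
  one variable finishes.\<close>

lemma hol_zero_if_zero_on_parametrised:
  assumes J: "polydisc J \<rho>" "card J = card Z"
    and X: "\<And>c. c \<in> Z ==> hol J \<rho> (\<lambda>t. X t c)" "\<And>t. t \<in> pd J \<rho> ==> X t \<in> pd Z r"
    and T: "\<And>j. j \<in> J ==> hol Z r (T j)" "\<And>j t. j \<in> J ==> t \<in> pd J \<rho> ==> T j (X t) = t j"
    and G: "hol Z r G" "\<And>t. t \<in> pd J \<rho> ==> G (X t) = 0" and x: "x \<in> pd Z r"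
  shows "G x = 0"
proof -
  interpret J: polydisc J \<rho> by fact
  define x0 where "x0 = X (\<lambda>c. 0)"
  have x0: "x0 \<in> pd Z r" unfolding x0_def by (intro X(2) zero_in_pd J.pos)
  define h where "h c = x c - x0 c" for c
  have h: "h c = 0" if "c \<notin> Z" for c using that x x0 by (auto simp: h_def pd_def)
  define l where "l s c = x0 c + s * h c" for s c
  have l01: "l 0 = x0" "l 1 = x" by (auto simp: l_def h_def)
  \<comment> \<open>The parameters for which the line stays in the polydisc: an intersection of
    preimages of discs under linear maps, hence open and convex.\<close>
  define S where "S = (\<lambda>s. l s) -` pd Z r"
  have bc: "s * h c \<in> ball (- x0 c) r \<longleftrightarrow> cmod (l s c) < r" for s c
    using norm_minus_cancel[of "l s c"] by (simp add: l_def dist_norm)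
  have Seq: "S = (\<Inter>c\<in>Z. (\<lambda>s. s * h c) -` ball (- x0 c) r)"
    using h x0 unfolding vimage_def bc by (auto simp: S_def pd_def l_def)
  have "open S" unfolding Seq using fin
    by (intro open_INT ballI open_vimage) (auto intro!: continuous_intros)
  have "convex S" unfolding Seq
    by (intro convex_INT convex_linear_vimage) (auto intro!: bounded_linear.linear bounded_linear_mult_left)
  have S01: "0 \<in> S" "1 \<in> S" using x x0 by (simp_all add: S_def l01)
  define N where "N G \<longleftrightarrow> hol Z r G \<and> (\<forall>t\<in>pd J \<rho>. G (X t) = 0)" for G
  define D where "D G y = (\<Sum>c\<in>Z. dp c G y * h c)" for G y
  have ND: "N (D G)" if "N G" for G
    unfolding N_def
  proof (intro conjI ballI)
    show "hol Z r (D G)" unfolding D_def[abs_def] using that by (auto simp: N_def intro!: hol_sum hol_mult hol_dp)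
    fix t assume t: "t \<in> pd J \<rho>"
    show "D G (X t) = 0" unfolding D_def
      using dp_zero_on_parametrised[OF J X T, of G] that t by (simp add: N_def)
  qed
  have der: "((\<lambda>s. G (l s)) has_field_derivative D G (l s)) (at s)" if "N G" "s \<in> S" for G s
    using hol_line_deriv[of G x0 s h] that h by (simp add: N_def S_def l_def[abs_def] D_def)
  have hl: "(\<lambda>s. G (l s)) holomorphic_on S" if "N G" for G
    unfolding holomorphic_on_def field_differentiable_def
    using has_field_derivative_at_within[OF der[OF that]] by blast
  have "(deriv ^^ k) (\<lambda>s. G (l s)) 0 = 0" if "N G" for G k
    using that
  proof (induction k arbitrary: G)
    case 0
    then show ?case using zero_in_pd[OF J.pos] by (auto simp: N_def l01 x0_def)
  next
    case (Suc k)
    have "(deriv ^^ Suc k) (\<lambda>s. G (l s)) 0 = (deriv ^^ k) (deriv (\<lambda>s. G (l s))) 0"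
      by (simp only: funpow_Suc_right comp_apply)
    also have "\<dots> = (deriv ^^ k) (\<lambda>s. D G (l s)) 0"
      by (rule higher_deriv_transform_within_open[OF holomorphic_deriv[OF hl[OF Suc.prems] \<open>open S\<close>] hl[OF ND[OF Suc.prems]] \<open>open S\<close> S01(1)])
        (rule DERIV_imp_deriv[OF der[OF Suc.prems]])
    also have "\<dots> = 0" by (rule Suc.IH[OF ND[OF Suc.prems]])
    finally show ?case .
  qed
  moreover have "N G" using G by (simp add: N_def)
  ultimately have "(\<lambda>s. G (l s)) 1 = 0"
    using holomorphic_fun_eq_0_on_connected[OF hl \<open>open S\<close> convex_connected[OF \<open>convex S\<close>] _ S01] by blast
  then show ?thesis by (simp add: l01)
qed

end

section \<open>The contraction solves all equations\<close>

context triangulated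
begin

lemma rad_half: "rad < 1 / 2"
proof -
  have "rad * 1 \<le> rad * 2 ^ card (chords n)" using rad(1) by (intro mult_left_mono) auto
  then show ?thesis using rad(3) by simp
qed

definition near :: "(nat set \<Rightarrow> complex) set" where
  "near = {u. (\<forall>c\<in>\<alpha>. cmod (u c) < rad) \<and> (\<forall>c\<in>chords n - \<alpha>. cmod (u c - 1) < 1 / 2)}"

lemma open_near: "open near"
proof -
  have "near = (\<Inter>c\<in>\<alpha>. {u. cmod (u c) < rad}) \<inter> (\<Inter>c\<in>chords n - \<alpha>. {u. cmod (u c - 1) < 1 / 2})"
    by (auto simp: near_def)
  then show ?thesis
    using alpha by (auto intro!: open_INT open_Int open_Collect_less continuous_intros continuous_on_coord)
qed

lemma near_eq_Phi:
  assumes "u \<in> M_delta n" "u \<in> near"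
  shows "restr u \<in> pd \<alpha> rad" "u = \<Phi> (restr u)"
proof -
  show 1: "restr u \<in> pd \<alpha> rad" using assms(2) by (auto simp: near_def pd_def restr_def)
  show "u = \<Phi> (restr u)"
    by (rule Phi_unique[OF _ _ 1]) (use assms M_delta_basic[OF assms(1)] in \<open>auto simp: near_def M_delta_def\<close>)
qed

text \<open>For a chord in \<alpha> the iteration does not impose the equation. Its defect
  \<open>G\<close> is holomorphic, and vanishes on the image of a chart of \<open>M0\<close> near
  the vertex, where uniqueness identifies the points of \<open>M0\<close> with values of
  \<Phi>.\<close>

lemma Phi_basic_all:
  assumes c: "c \<in> chords n" and x: "x \<in> pd \<alpha> rad"
  shows "basic n (\<Phi> x) c"
proof -
  obtain u0 where u0: "cpx u0 \<in> M0 n" "\<And>c. c \<in> \<alpha> ==> 0 < u0 c \<and> u0 c < rad"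
    "\<And>c. c \<in> chords n - \<alpha> ==> 1 - rad < u0 c \<and> u0 c \<le> 1"
    using configuration_near_vertex[OF tri n4 rad(1)] by metis
  have "cmod (cpx u0 c - 1) < 1 / 2" if "c \<in> chords n - \<alpha>" for c
  proof -
    have "cmod (cpx u0 c - 1) = \<bar>u0 c - 1\<bar>" unfolding cpx_def by (metis norm_of_real of_real_1 of_real_diff)
    then show ?thesis using u0(3)[OF that] rad_half by linarith
  qed
  moreover have "cmod (cpx u0 c) < rad" if "c \<in> \<alpha>" for c using u0(2)[OF that] by (simp add: cpx_def)
  ultimately have "cpx u0 \<in> near" unfolding near_def by blast
  then obtain \<rho> \<psi> where ch: "chart (singles n) \<rho> n \<psi>" and \<psi>: "\<And>t. t \<in> pd (singles n) \<rho> ==> \<psi> t \<in> M0 n \<inter> near"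
    and inv: "\<And>t. t \<in> pd (singles n) \<rho> ==> zcoord n (cpx u0) (\<psi> t) = t"
    using M0_chart[OF u0(1) n4 open_near] by metis
  interpret C: chart "singles n" \<rho> n \<psi> by (rule ch)
  define G where "G x = \<Phi> x c + (\<Prod>b\<in>crossing n c. \<Phi> x b) - 1" for x
  have near: "restr (\<psi> t) \<in> pd \<alpha> rad" "\<Phi> (restr (\<psi> t)) = \<psi> t" if "t \<in> pd (singles n) \<rho>" for t
    using near_eq_Phi[of "\<psi> t"] \<psi>[OF that] M0_M_delta[of "\<psi> t" n] by auto
  have "G x = 0"
  \<comment> \<open>\<open>X\<close> reads the coordinates in \<alpha> of a point of
    \<open>M0\<close>. The left inverse \<open>T\<close> applies \<Phi> and recovers the points by
    \<open>zz\<close>, which is holomorphic as a product.\<close>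
  proof (rule hol_zero_if_zero_on_parametrised[where G = G and x = x and J = "singles n" and \<rho> = \<rho> and X = "\<lambda>t. restr (\<psi> t)"
        and T = "\<lambda>j x. zz n (\<Phi> x) (the_elem j) - zz n (cpx u0) (the_elem j)", OF _ _ _ near(1)])
    show "polydisc (singles n) \<rho>" ..
    show "card (singles n) = card \<alpha>" using alpha by simp
    show "x \<in> pd \<alpha> rad" by fact
    show "hol \<alpha> rad G" unfolding G_def[abs_def]
      using c by (intro hol_diff hol_add hol_prod hol_const hol_Phi) (auto dest: crossing_chords)
    show "hol (singles n) \<rho> (\<lambda>t. restr (\<psi> t) c)" if "c \<in> \<alpha>" for c
      using C.hol_phi[of c] that alpha by (auto simp: restr_def)
    show "hol \<alpha> rad (\<lambda>x. zz n (\<Phi> x) (the_elem j) - zz n (cpx u0) (the_elem j))" if "j \<in> singles n" for j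
    proof -
      obtain q where q: "j = {q}" "3 \<le> q" "q < n" using \<open>j \<in> singles n\<close> by (auto simp: singles_def)
      have "{1, k} \<in> chords n" if "k \<in> {q..<n}" for k
        using that q by (intro chordp_chord) (auto simp: chordp_def)
      then have "hol \<alpha> rad (\<lambda>x. \<Prod>k\<in>{q..<n}. \<Phi> x {1, k})" by (intro hol_prod hol_Phi)
      then show ?thesis using q by (intro hol_diff hol_const) (simp add: zz_def)
    qed
    show "zz n (\<Phi> (restr (\<psi> t))) (the_elem j) - zz n (cpx u0) (the_elem j) = t j"
      if "j \<in> singles n" "t \<in> pd (singles n) \<rho>" for j t
      using fun_cong[OF inv[OF that(2)], of j] that by (simp add: near zcoord_def)
    show "G (restr (\<psi> t)) = 0" if "t \<in> pd (singles n) \<rho>" for t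
      using M_delta_basic[OF M0_M_delta c, of "\<psi> t"] \<psi>[OF that] by (simp add: G_def near[OF that] basic_def)
  qed
  then show ?thesis by (simp add: G_def basic_def)
qed

lemma Phi_nonzero: "c \<in> chords n ==> c \<notin> \<alpha> ==> x \<in> pd \<alpha> rad ==> \<Phi> x c \<noteq> 0"
  using Phi_near_one[of c x] by auto

lemma Phi_off: "c \<notin> chords n ==> \<Phi> x c = 0"
  using alpha by (auto simp: \<Phi>_def)

sublocale chart \<alpha> rad n \<Phi>
proof
  show "n \<ge> 4" by (rule n4)
  show "\<Phi> x c = x c" if "c \<in> \<alpha>" for c x using that by (simp add: \<Phi>_def)
  show "hol \<alpha> rad (\<lambda>x. \<Phi> x c)" if "c \<in> chords n" for c using that by (rule hol_Phi)
  show "hol \<alpha> rad (\<lambda>x. 1 / \<Phi> x c)" if c: "c \<in> chords n" "c \<notin> \<alpha>" for c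
    using hol_inverse_one_minus[OF psn_minus[OF Y(1)[OF c(1)]]] rad by (simp add: Phi_Y[OF c])
  show "\<Phi> x c \<noteq> 0" if "c \<in> chords n" "c \<notin> \<alpha>" "x \<in> pd \<alpha> rad" for c x using that by (rule Phi_nonzero)
  show "\<Phi> x c = 0" if "c \<notin> chords n" for c x using that by (rule Phi_off)
  show "\<Phi> x \<in> M0 n" if "x \<in> pd \<alpha> rad" "\<forall>c\<in>\<alpha>. x c \<noteq> 0" for x
  proof (rule M0I[OF Phi_basic_all _ Phi_off n4])
    show "\<Phi> x c \<noteq> 0" if "c \<in> chords n" for c
      using that \<open>\<forall>c\<in>\<alpha>. x c \<noteq> 0\<close> Phi_nonzero[OF that _ \<open>x \<in> pd \<alpha> rad\<close>] by (cases "c \<in> \<alpha>") (auto simp: \<Phi>_def)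
  qed (use that in auto)
qed

lemma restr_Phi: "x \<in> pd \<alpha> rad ==> restr (\<Phi> x) = x"
  by (auto simp: restr_def \<Phi>_def pd_def)

lemma Phi_near: "x \<in> pd \<alpha> rad ==> \<Phi> x \<in> near"
  using Phi_near_one[of _ x] by (fastforce simp: near_def \<Phi>_def pd_def)

lemma Phi_positive:
  assumes "\<And>c. c \<in> \<alpha> ==> 0 < y c" "cpx y \<in> pd \<alpha> rad"
  obtains u where "u \<in> X_open n" "cpx u = \<Phi> (cpx y)"
proof
  define u where "u c = Re (\<Phi> (cpx y) c)" for c
  show e: "cpx u = \<Phi> (cpx y)"
    using Phi_real[OF _ assms(2)] by (auto simp: cpx_def u_def fun_eq_iff complex_is_Real_iff complex_eq_iff)
  have M: "\<Phi> (cpx y) \<in> M_delta n" by (rule phi_M_delta[OF assms(2)])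
  show "u \<in> X_open n" unfolding X_open_def M_delta_def
  proof (intro CollectI conjI ballI allI impI)
    show "u c = 0" if "c \<notin> chords n" for c using that by (simp add: u_def Phi_off)
    show "(\<Prod>a\<in>A. u a) + (\<Prod>b\<in>B. u b) - 1 = 0" if "crossing_pair n A B" for A B
    proof -
      have "(\<Prod>a\<in>A. cpx u a) + (\<Prod>b\<in>B. cpx u b) - 1 = 0" using M that unfolding e[symmetric] by (simp add: M_delta_def)
      then have "complex_of_real ((\<Prod>a\<in>A. u a) + (\<Prod>b\<in>B. u b) - 1) = of_real 0" unfolding cpx_def by simp
      then show ?thesis by (simp only: of_real_eq_iff)
    qed
    show "0 < u c" if c: "c \<in> chords n" for c
    proof (cases "c \<in> \<alpha>")
      case True then show ?thesis using assms(1) by (simp add: u_def \<Phi>_def cpx_def)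
    next
      case False
      have "\<bar>Re (\<Phi> (cpx y) c - 1)\<bar> \<le> 1 / 7"
        using Phi_near_one[OF c False assms(2)] abs_Re_le_cmod order_trans by blast
      then have "\<bar>u c - 1\<bar> \<le> 1 / 7" by (simp only: u_def minus_complex.sel one_complex.sel)
      then show ?thesis by linarith
    qed
  qed
qed

end

text \<open>For a chord outside \<alpha> the product in its equation has a factor 0, so its
  coordinate at the vertex is 1. Faces are compared as sets, but \<open>v\<close> lies in the face
  of \<open>c\<close> only if \<open>v c = 0\<close>, and this singles out \<alpha>.\<close>

lemma associahedron_vertex_triangulated:
  assumes n: "n \<ge> 4" and v: "associahedron_vertex n v"
  obtains \<alpha> where "triangulated n \<alpha>" "cpx v = triangulated.\<Phi> n \<alpha> (\<lambda>c. 0)"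
    "{c \<in> chords n. face n c \<in> faces_at n v} = \<alpha>"
proof -
  obtain \<alpha> where tri: "triangulation n \<alpha>" and v0: "\<And>c. c \<in> \<alpha> ==> v c = 0" and vX: "v \<in> X_closed n"
    using v by (auto simp: associahedron_vertex_def)
  interpret triangulated n \<alpha> by unfold_locales fact+
  have v1: "v c = 1" if c: "c \<in> chords n" "c \<notin> \<alpha>" for c
  proof -
    obtain b where b: "b \<in> crossing n c" "b \<in> \<alpha>" using crossing_alpha[OF c] .
    have "(\<Prod>a\<in>crossing n c. v a) = 0" using b v0 by (intro prod_zero) auto
    moreover have "basic n v c" using vX by (intro M_delta_basic c) (simp add: X_closed_def)
    ultimately show ?thesis unfolding basic_def by (simp only: add_0_right)
  qed
  have vo: "v c = 0" if "c \<notin> chords n" for c using vX that by (simp add: X_closed_def M_delta_def)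
  have "cpx v c = \<Phi> (\<lambda>c. 0) c" for c
    using v0 v1 vo Phi_zero[of c] Phi_off[of c] by (cases "c \<in> \<alpha>"; cases "c \<in> chords n") (auto simp: cpx_def \<Phi>_def)
  moreover have "face n c \<in> faces_at n v \<longleftrightarrow> c \<in> \<alpha>" if c: "c \<in> chords n" for c
  proof
    assume "face n c \<in> faces_at n v"
    then have "v \<in> face n c" by (auto simp: faces_at_def)
    then have "v c = 0" by (simp add: face_def)
    then show "c \<in> \<alpha>" using v1[OF c] by (cases "c \<in> \<alpha>") auto
  next
    assume "c \<in> \<alpha>"
    then have "v \<in> face n c" using v0 vX by (simp add: face_def)
    then show "face n c \<in> faces_at n v" using c by (auto simp: faces_at_def)
  qed
  ultimately show ?thesis using that[of \<alpha>] alpha(1) triangulated_axioms by (auto simp: fun_eq_iff)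
qed

section \<open>Solutions in a chart\<close>

definition Lop :: "nat \<Rightarrow> nat set \<Rightarrow> ncseries \<Rightarrow> ncseries" where
  "Lop n c a = nf n (nc_mult (letter c) a)"

definition Rop :: "nat \<Rightarrow> nat set \<Rightarrow> ncseries \<Rightarrow> ncseries" where
  "Rop n c a = nf n (nc_mult a (letter c))"

text \<open>Every coefficient of a normal form or of a product with a fixed series is of this kind.
  Such functionals commute with finite sums, derivatives and \<open>has_differential\<close>, so
  series can be treated coefficientwise.\<close>

definition finite_functional :: "(ncseries \<Rightarrow> complex) \<Rightarrow> bool" where
  "finite_functional T \<longleftrightarrow> (\<exists>V t. finite V \<and> T = (\<lambda>a. \<Sum>v\<in>V. t v * a v))"

lemma finite_functional_coeff: "finite_functional (\<lambda>a. a v)"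
  unfolding finite_functional_def by (intro exI[of _ "{v}"] exI[of _ "\<lambda>_. 1"]) auto

lemma finite_functional_zero: "finite_functional (\<lambda>a. 0)"
  unfolding finite_functional_def by (intro exI[of _ "{}"] exI[of _ "\<lambda>_. 1"]) auto

lemma finite_functional_scale: "finite_functional T ==> finite_functional (\<lambda>a. k * T a)"
proof -
  assume "finite_functional T"
  then obtain V t where "finite V" "T = (\<lambda>a. \<Sum>v\<in>V. t v * a v)" unfolding finite_functional_def by blast
  then show ?thesis unfolding finite_functional_def
    by (intro exI[of _ V] exI[of _ "\<lambda>v. k * t v"]) (auto simp: sum_distrib_left mult.assoc)
qed

lemma finite_functional_add:
  assumes "finite_functional S" "finite_functional T"
  shows "finite_functional (\<lambda>a. S a + T a)"
proof -
  obtain V s W t where S: "finite V" "S = (\<lambda>a. \<Sum>v\<in>V. s v * a v)" and T: "finite W" "T = (\<lambda>a. \<Sum>v\<in>W. t v * a v)"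
    using assms unfolding finite_functional_def by metis
  have "(\<Sum>v\<in>V. s v * a v) = (\<Sum>v\<in>V \<union> W. (if v \<in> V then s v else 0) * a v)"
       "(\<Sum>v\<in>W. t v * a v) = (\<Sum>v\<in>V \<union> W. (if v \<in> W then t v else 0) * a v)" for a
    using S(1) T(1) by (auto intro!: sum.mono_neutral_cong_left)
  then show ?thesis unfolding finite_functional_def S(2) T(2) using S(1) T(1)
    by (intro exI[of _ "V \<union> W"] exI[of _ "\<lambda>v. (if v \<in> V then s v else 0) + (if v \<in> W then t v else 0)"])
      (auto simp: distrib_right sum.distrib)
qed

lemma finite_functional_sum:
  "(\<And>i. i \<in> I ==> finite_functional (T i)) ==> finite_functional (\<lambda>a. \<Sum>i\<in>I. T i a)"
  by (induction I rule: infinite_finite_induct) (auto intro: finite_functional_zero finite_functional_add)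

lemma finite_functional_comp:
  assumes "finite_functional T" "\<And>v. finite_functional (\<lambda>a. F a v)"
  shows "finite_functional (\<lambda>a. T (F a))"
proof -
  obtain V t where "T = (\<lambda>a. \<Sum>v\<in>V. t v * a v)" using assms(1) unfolding finite_functional_def by blast
  then show ?thesis by (auto intro!: finite_functional_sum finite_functional_scale assms(2))
qed

lemma finite_functional_nf: "finite_functional (\<lambda>a. nf n a w)"
  unfolding nf_def
  by (cases "set w \<subseteq> chords n")
    (auto intro!: finite_functional_sum finite_functional_scale finite_functional_coeff finite_functional_zero)

lemma finite_functional_mult:
  "finite_functional (\<lambda>a. nc_mult b a w)" "finite_functional (\<lambda>a. nc_mult a b w)"
proof -
  show "finite_functional (\<lambda>a. nc_mult b a w)" unfolding nc_mult_def
    by (intro finite_functional_sum finite_functional_scale finite_functional_coeff)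
  have "finite_functional (\<lambda>a. \<Sum>k\<le>length w. b (drop k w) * a (take k w))"
    by (intro finite_functional_sum finite_functional_scale finite_functional_coeff)
  then show "finite_functional (\<lambda>a. nc_mult a b w)" unfolding nc_mult_def by (simp add: mult.commute)
qed

lemma finite_functional_Lop: "finite_functional (\<lambda>a. Lop n c a w)"
  unfolding Lop_def by (rule finite_functional_comp[OF finite_functional_nf finite_functional_mult(1)])

lemma finite_functional_Rop: "finite_functional (\<lambda>a. Rop n c a w)"
  unfolding Rop_def by (rule finite_functional_comp[OF finite_functional_nf finite_functional_mult(2)])

lemma finite_functional_linear:
  assumes "finite_functional T"
  shows "T (\<lambda>w. a w + b w) = T a + T b" "T (\<lambda>w. a w - b w) = T a - T b" "T (\<lambda>w. k * a w) = k * T a"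
    "T (\<lambda>w. \<Sum>i\<in>I. f i w) = (\<Sum>i\<in>I. T (f i))" "T (\<lambda>w. 0) = 0"
proof -
  obtain V t where T: "T = (\<lambda>a. \<Sum>v\<in>V. t v * a v)" using assms unfolding finite_functional_def by blast
  show "T (\<lambda>w. a w + b w) = T a + T b" "T (\<lambda>w. a w - b w) = T a - T b" "T (\<lambda>w. k * a w) = k * T a" "T (\<lambda>w. 0) = 0"
    unfolding T by (simp_all add: algebra_simps sum.distrib sum_subtractf sum_distrib_left)
  show "T (\<lambda>w. \<Sum>i\<in>I. f i w) = (\<Sum>i\<in>I. T (f i))"
    unfolding T by (subst sum.swap) (simp add: sum_distrib_left)
qed

lemma Lop_carr: "Lop n c a \<in> carr n" and Rop_carr: "Rop n c a \<in> carr n"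
  by (simp_all add: Lop_def Rop_def nf_carr)

lemma Lop_Nil [simp]: "Lop n c a [] = 0" and Rop_Nil [simp]: "Rop n c a [] = 0"
proof -
  have "nf n b [] = 0" if "b [] = 0" for b
    using nf_cong[of "[]" b "\<lambda>w. 0" n] that by (simp add: nf_zero)
  then show "Lop n c a [] = 0" "Rop n c a [] = 0"
    by (simp_all add: Lop_def Rop_def nc_mult_letter nc_mult_letter_right)
qed

text \<open>Multiplication by a letter shifts the length by one, so the coefficient at
  \<open>w\<close> only sees words one letter shorter. All inductions on length rest on
  this.\<close>

lemma Lop_cong:
  assumes "\<And>w'. Suc (length w') = length w ==> a w' = b w'"
  shows "Lop n c a w = Lop n c b w" "Rop n c a w = Rop n c b w"
proof -
  show "Lop n c a w = Lop n c b w" unfolding Lop_def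
    by (intro nf_cong) (use assms in \<open>auto simp: nc_mult_letter split: list.splits\<close>)
  show "Rop n c a w = Rop n c b w" unfolding Rop_def
  proof (intro nf_cong)
    fix w' :: "nat set list" assume l: "length w' = length w"
    have "w' \<noteq> [] ==> a (butlast w') = b (butlast w')" using l by (intro assms) (cases w', auto)
    then show "nc_mult a (letter c) w' = nc_mult b (letter c) w'" by (simp add: nc_mult_letter_right)
  qed
qed

lemma LL: "c \<in> chords n ==> d \<in> chords n ==> a \<in> carr n ==>
    Lop n c (Lop n d a) = nf n (nc_mult (nc_mult (letter c) (letter d)) a)"
  unfolding Lop_def by (subst nf_mult(2)) (auto simp: nc_mult_assoc intro!: letter_carr nc_mult_closed)

lemma RR: "c \<in> chords n ==> d \<in> chords n ==> a \<in> carr n ==>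
    Rop n c (Rop n d a) = nf n (nc_mult a (nc_mult (letter d) (letter c)))"
  unfolding Rop_def by (subst nf_mult(1)) (auto simp: nc_mult_assoc intro!: letter_carr nc_mult_closed)

lemma LR: "c \<in> chords n ==> d \<in> chords n ==> a \<in> carr n ==> Lop n c (Rop n d a) = Rop n d (Lop n c a)"
  unfolding Rop_def Lop_def
  by (subst nf_mult(2), (auto intro!: letter_carr nc_mult_closed)[2], subst nf_mult(1))
    (auto simp: nc_mult_assoc intro!: letter_carr nc_mult_closed)

lemma nc_commutator_add:
  "nc_commutator (\<lambda>w. a w + b w) c = (\<lambda>w. nc_commutator a c w + nc_commutator b c w)"
  "nc_commutator c (\<lambda>w. a w + b w) = (\<lambda>w. nc_commutator c a w + nc_commutator c b w)"
  "nc_commutator (\<lambda>w. a w - b w) c = (\<lambda>w. nc_commutator a c w - nc_commutator b c w)"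
  "nc_commutator c (\<lambda>w. a w - b w) = (\<lambda>w. nc_commutator c a w - nc_commutator c b w)"
  "nc_commutator (\<lambda>w. 0) c = (\<lambda>w. 0)" "nc_commutator c (\<lambda>w. 0) = (\<lambda>w. 0)"
  by (simp_all add: nc_commutator_def nc_mult_add nc_mult_diff nc_mult_zero fun_eq_iff)

lemma braid_relations_idl: "a \<in> braid_relations n ==> a \<in> idl n"
  using ring.genideal_self[OF nc_ring_ring braid_relations_carrier, of n] closure_subset
  unfolding braid_ideal_def by blast

text \<open>With \<open>\<beta> c d\<close> the value of \<open>T\<close> at a commutator of
  letters, \<open>ext\<close> matches the convention that \<open>delta\<close> is 0 off the chords,
  and the second differences in both slots assemble the commutator of two braid terms.\<close>

lemma functional_braid_relation:
  assumes add: "\<And>X Y. T (\<lambda>w. X w + Y w) = T X + (T Y :: complex)" "\<And>X Y. T (\<lambda>w. X w - Y w) = T X - T Y"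
    and idl: "\<And>X. X \<in> idl n ==> T X = 0"
    and \<beta>: "\<And>c d. c \<in> chords n ==> d \<in> chords n ==> \<beta> c d = T (nc_commutator (letter c) (letter d))"
    and pqrs: "{p, q, r, s} \<subseteq> {1..n}" "distinct [p, q, r, s]"
  shows "sdiff n (\<lambda>p q. sdiff n (ext n (\<lambda>d. ext n (\<lambda>c. \<beta> c d) p q)) r s) p q = 0"
proof -
  have T0: "T (\<lambda>w. 0) = 0" by (rule idl[OF idl_zero])
  have E: "ext n (\<lambda>d. ext n (\<lambda>c. \<beta> c d) p q) r s = T (nc_commutator (delta n p q) (delta n r s))" for p q r s
    using \<beta> T0 by (simp add: ext_def delta_def nc_commutator_add)
  have "sdiff n (\<lambda>p q. sdiff n (ext n (\<lambda>d. ext n (\<lambda>c. \<beta> c d) p q)) r s) p q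
      = T (nc_commutator (braid_term n p q) (braid_term n r s))"
    unfolding sdiff_def E braid_term_def[abs_def] nc_commutator_add add by simp
  also have "\<dots> = 0"
    using pqrs by (intro idl braid_relations_idl) (auto simp: braid_relations_def)
  finally show ?thesis .
qed

context chart
begin

text \<open>The equation \<open>\<Omega> \<and> \<Omega> = 0\<close> in the directions
  \<open>i\<close> and \<open>j\<close>, acting from the left: the relations are tested with a
  coefficient of the product of \<open>X\<close> with \<open>a\<close>.\<close>

lemma m_LL:
  assumes "i \<in> Z" "j \<in> Z" "x \<in> pd Z r" "a \<in> carr n"
  shows "(\<Sum>c\<in>chords n. \<Sum>d\<in>chords n. m i c x * m j d x * Lop n c (Lop n d a) w)
    = (\<Sum>c\<in>chords n. \<Sum>d\<in>chords n. m j c x * m i d x * Lop n c (Lop n d a) w)" (is "?A = ?B")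
proof -
  define \<beta> where "\<beta> c d = Lop n c (Lop n d a) w - Lop n d (Lop n c a) w" for c d
  have "(\<Sum>c\<in>chords n. \<Sum>d\<in>chords n. \<beta> c d * m i c x * m j d x) = 0"
  proof (rule m_integrable[OF _ functional_braid_relation[where T = "\<lambda>X. nf n (nc_mult X a) w"]])
    show "nf n (nc_mult X a) w = 0" if "X \<in> idl n" for X
      using nf_idl(2)[of "nc_mult X a"] idl_mult(1)[OF that assms(4)] idl_carr by simp
    show "\<beta> c d = nf n (nc_mult (nc_commutator (letter c) (letter d)) a) w" if "c \<in> chords n" "d \<in> chords n" for c d
      unfolding \<beta>_def nc_commutator_def LL[OF that assms(4)] LL[OF that(2,1) assms(4)] nc_mult_diff nf_diff ..
  qed (use assms in \<open>auto simp: \<beta>_def nc_mult_add nc_mult_diff nf_add nf_diff\<close>)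
  moreover have "(\<Sum>c\<in>chords n. \<Sum>d\<in>chords n. \<beta> c d * m i c x * m j d x)
      = ?A - (\<Sum>c\<in>chords n. \<Sum>d\<in>chords n. m i c x * m j d x * Lop n d (Lop n c a) w)"
    by (simp add: \<beta>_def algebra_simps sum_subtractf)
  moreover have "(\<Sum>c\<in>chords n. \<Sum>d\<in>chords n. m i c x * m j d x * Lop n d (Lop n c a) w) = ?B"
    by (subst sum.swap) (simp add: mult.commute)
  ultimately show ?thesis by simp
qed

text \<open>Right multiplication reverses the order of two letters, whence the minus sign in the
  functional.\<close>

lemma m_RR:
  assumes "i \<in> Z" "j \<in> Z" "x \<in> pd Z r" "a \<in> carr n"
  shows "(\<Sum>c\<in>chords n. \<Sum>d\<in>chords n. m i c x * m j d x * Rop n c (Rop n d a) w)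
    = (\<Sum>c\<in>chords n. \<Sum>d\<in>chords n. m j c x * m i d x * Rop n c (Rop n d a) w)" (is "?A = ?B")
proof -
  define \<beta> where "\<beta> c d = Rop n c (Rop n d a) w - Rop n d (Rop n c a) w" for c d
  have "(\<Sum>c\<in>chords n. \<Sum>d\<in>chords n. \<beta> c d * m i c x * m j d x) = 0"
  proof (rule m_integrable[OF _ functional_braid_relation[where T = "\<lambda>X. - nf n (nc_mult a X) w"]])
    show "- nf n (nc_mult a X) w = 0" if "X \<in> idl n" for X
      using nf_idl(2)[of "nc_mult a X"] idl_mult(2)[OF that assms(4)] idl_carr by simp
    show "\<beta> c d = - nf n (nc_mult a (nc_commutator (letter c) (letter d))) w" if "c \<in> chords n" "d \<in> chords n" for c d
      unfolding \<beta>_def nc_commutator_def RR[OF that assms(4)] RR[OF that(2,1) assms(4)] nc_mult_diff nf_diff by simp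
  qed (use assms in \<open>auto simp: \<beta>_def nc_mult_add nc_mult_diff nf_add nf_diff\<close>)
  moreover have "(\<Sum>c\<in>chords n. \<Sum>d\<in>chords n. \<beta> c d * m i c x * m j d x)
      = ?A - (\<Sum>c\<in>chords n. \<Sum>d\<in>chords n. m i c x * m j d x * Rop n d (Rop n c a) w)"
    by (simp add: \<beta>_def algebra_simps sum_subtractf)
  moreover have "(\<Sum>c\<in>chords n. \<Sum>d\<in>chords n. m i c x * m j d x * Rop n d (Rop n c a) w) = ?B"
    by (subst sum.swap) (simp add: mult.commute)
  ultimately show ?thesis by simp
qed

lemma hol_functional:
  assumes "finite_functional T" "\<And>w. hol Z r (\<lambda>x. f x w)"
  shows "hol Z r (\<lambda>x. T (f x))"
    and "c \<in> Z ==> x \<in> pd Z r ==> dp c (\<lambda>x. T (f x)) x = T (\<lambda>w. dp c (\<lambda>x. f x w) x)"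
proof -
  obtain V t where T: "T = (\<lambda>a. \<Sum>v\<in>V. t v * a v)" using assms(1) unfolding finite_functional_def by blast
  show "hol Z r (\<lambda>x. T (f x))" unfolding T by (intro hol_sum hol_mult hol_const assms(2))
  show "c \<in> Z ==> x \<in> pd Z r ==> dp c (\<lambda>x. T (f x)) x = T (\<lambda>w. dp c (\<lambda>x. f x w) x)"
    unfolding T using assms(2) by (subst dp_sum) (auto simp: hol_mult dp_mult mult.commute)
qed

text \<open>The right hand side, in the logarithmic vector field of \<open>x\<^sub>i\<close>, of
  \<open>df = \<Omega> f - f \<Omega>\<^sub>0\<close>, where \<open>\<Omega>\<^sub>0\<close> is the polar part of \<open>\<Omega>\<close> at the origin of the chart.\<close>

definition rhs :: "nat set \<Rightarrow> (nat set \<Rightarrow> complex) \<Rightarrow> ncseries \<Rightarrow> ncseries" where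
  "rhs i x a w = (\<Sum>c\<in>chords n. m i c x * Lop n c a w) - (\<Sum>c\<in>chords n. m i c (\<lambda>c. 0) * Rop n c a w)"

lemma rhs_carr: "rhs i x a \<in> carr n"
  using Lop_carr[of n _ a] Rop_carr[of n _ a] by (auto simp: carr_iff rhs_def)

text \<open>The mixed terms are symmetric because left and right multiplication commute. The others
  are so by \<open>m_LL\<close> at \<open>x\<close> and by \<open>m_RR\<close> at the origin, where
  the polar part is taken.\<close>

lemma rhs_symmetric:
  assumes ij: "i \<in> Z" "j \<in> Z" and x: "x \<in> pd Z r" and a: "a \<in> carr n"
  shows "rhs i x (rhs j x a) w = rhs j x (rhs i x a) w"
proof -
  let ?C = "chords n" let ?\<rho> = "\<lambda>i c. m i c (\<lambda>c. 0)"
  have 0: "(\<lambda>c. 0) \<in> pd Z r" by (rule zero_in_pd[OF pos])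
  have e: "T (rhs j x a) = (\<Sum>d\<in>?C. m j d x * T (Lop n d a)) - (\<Sum>d\<in>?C. ?\<rho> j d * T (Rop n d a))"
    if "finite_functional T" for T j
    unfolding rhs_def[abs_def] by (simp only: finite_functional_linear[OF that])
  have main: "rhs i x (rhs j x a) w = (\<Sum>c\<in>?C. \<Sum>d\<in>?C. m i c x * m j d x * Lop n c (Lop n d a) w)
     - (\<Sum>c\<in>?C. \<Sum>d\<in>?C. m i c x * ?\<rho> j d * Lop n c (Rop n d a) w)
     - (\<Sum>c\<in>?C. \<Sum>d\<in>?C. m j c x * ?\<rho> i d * Lop n c (Rop n d a) w)
     + (\<Sum>c\<in>?C. \<Sum>d\<in>?C. ?\<rho> i c * ?\<rho> j d * Rop n c (Rop n d a) w)" for i j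
  proof -
    have "(\<Sum>c\<in>?C. \<Sum>d\<in>?C. ?\<rho> i c * m j d x * Rop n c (Lop n d a) w)
      = (\<Sum>d\<in>?C. \<Sum>c\<in>?C. m j d x * ?\<rho> i c * Lop n d (Rop n c a) w)"
      using a by (subst sum.swap) (auto intro!: sum.cong simp: LR mult_ac)
    moreover have "rhs i x (rhs j x a) w = (\<Sum>c\<in>?C. \<Sum>d\<in>?C. m i c x * m j d x * Lop n c (Lop n d a) w)
     - (\<Sum>c\<in>?C. \<Sum>d\<in>?C. m i c x * ?\<rho> j d * Lop n c (Rop n d a) w)
     - (\<Sum>c\<in>?C. \<Sum>d\<in>?C. ?\<rho> i c * m j d x * Rop n c (Lop n d a) w)
     + (\<Sum>c\<in>?C. \<Sum>d\<in>?C. ?\<rho> i c * ?\<rho> j d * Rop n c (Rop n d a) w)"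
      unfolding rhs_def[of i x "rhs j x a"] e[OF finite_functional_Lop] e[OF finite_functional_Rop]
      by (simp add: right_diff_distrib sum_subtractf sum_distrib_left mult.assoc)
    ultimately show ?thesis by simp
  qed
  show ?thesis unfolding main m_LL[OF ij x a] m_RR[OF ij 0 a] by simp
qed

text \<open>The derivative of the form has one part from its coefficients, symmetric by
  \<open>m_closed\<close>, and one part \<open>rhs i x (rhs j x (\<psi> x))\<close>, symmetric by
  \<open>rhs_symmetric\<close>; so the form is closed. The condition on \<open>k\<close> makes it
  vanish at the origin, so that no logarithm arises.\<close>

lemma solution_step:
  assumes \<phi>: "\<And>x. \<phi>' x \<in> carr n" "\<And>w. hol Z r (\<lambda>x. \<phi>' x w)" "\<phi>' (\<lambda>c. 0) = k"
    and \<psi>: "\<And>x. \<psi> x \<in> carr n" "\<And>i x w. i \<in> Z ==> x \<in> pd Z r ==> x i * dp i (\<lambda>x. \<phi>' x w) x = rhs i x (\<psi> x) w"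
    and k: "\<And>i w. i \<in> Z ==> rhs i (\<lambda>c. 0) k w = 0"
  obtains \<chi>' where "\<And>x. \<chi>' x \<in> carr n" "\<And>w. hol Z r (\<lambda>x. \<chi>' x w)" "\<chi>' (\<lambda>c. 0) = k"
    "\<And>i x w. i \<in> Z ==> x \<in> pd Z r ==> x i * dp i (\<lambda>x. \<chi>' x w) x = rhs i x (\<phi>' x) w"
proof -
  have "\<forall>w. \<exists>g. hol Z r g \<and> g (\<lambda>c. 0) = k w \<and> (\<forall>i\<in>Z. \<forall>x\<in>pd Z r. x i * dp i g x = rhs i x (\<phi>' x) w) \<and>
      (\<not> set w \<subseteq> chords n \<longrightarrow> g = (\<lambda>x. 0))" (is "\<forall>w. \<exists>g. ?P w g")
  proof
    fix w
    show "\<exists>g. ?P w g"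
  proof (cases "set w \<subseteq> chords n")
    case False
    then show ?thesis using \<phi>(1)[of "\<lambda>c. 0"] rhs_carr[of _ _ "\<phi>' _"] unfolding \<phi>(3)
      by (intro exI[of _ "\<lambda>x. 0"]) (auto simp: carr_iff)
  next
    case True
    define b where "b i x = rhs i x (\<phi>' x) w" for i x
    note hL = hol_functional[OF finite_functional_Lop[of n _ w], of \<phi>', OF \<phi>(2)]
      and hR = hol_functional[OF finite_functional_Rop[of n _ w], of \<phi>', OF \<phi>(2)]
    have hb: "hol Z r (b i)" if "i \<in> Z" for i
      unfolding b_def[abs_def] rhs_def using that by (intro hol_diff hol_sum hol_mult hol_const hol_m hL hR)
    have db: "x j * dp j (b i) x = (\<Sum>c\<in>chords n. x j * dp j (m i c) x * Lop n c (\<phi>' x) w) + rhs i x (rhs j x (\<psi> x)) w"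
      if ij: "i \<in> Z" "j \<in> Z" and x: "x \<in> pd Z r" for i j x
    proof -
      have L: "x j * dp j (\<lambda>x. Lop n c (\<phi>' x) w) x = Lop n c (rhs j x (\<psi> x)) w" for c
        unfolding hL(2)[OF ij(2) x] finite_functional_linear(3)[OF finite_functional_Lop, symmetric]
        using \<psi>(2)[OF ij(2) x] by simp
      have R: "x j * dp j (\<lambda>x. Rop n c (\<phi>' x) w) x = Rop n c (rhs j x (\<psi> x)) w" for c
        unfolding hR(2)[OF ij(2) x] finite_functional_linear(3)[OF finite_functional_Rop, symmetric]
        using \<psi>(2)[OF ij(2) x] by simp
      have "dp j (b i) x = (\<Sum>c\<in>chords n. dp j (m i c) x * Lop n c (\<phi>' x) w + dp j (\<lambda>x. Lop n c (\<phi>' x) w) x * m i c x)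
          - (\<Sum>c\<in>chords n. dp j (\<lambda>x. Rop n c (\<phi>' x) w) x * m i c (\<lambda>c. 0))"
        unfolding b_def[abs_def] rhs_def using ij x
        by (simp add: dp_diff dp_sum dp_mult hol_diff hol_sum hol_mult hol_m hL(1) hR(1))
      then have "x j * dp j (b i) x = (\<Sum>c\<in>chords n. x j * dp j (m i c) x * Lop n c (\<phi>' x) w
            + x j * dp j (\<lambda>x. Lop n c (\<phi>' x) w) x * m i c x)
          - (\<Sum>c\<in>chords n. x j * dp j (\<lambda>x. Rop n c (\<phi>' x) w) x * m i c (\<lambda>c. 0))"
        by (simp add: right_diff_distrib sum_distrib_left distrib_left mult.assoc)
      then show ?thesis unfolding L R rhs_def[of i x "rhs j x (\<psi> x)"] by (simp add: sum.distrib mult.commute)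
    qed
    obtain g where g: "hol Z r g" "g (\<lambda>c. 0) = k w" "\<And>i x. i \<in> Z ==> x \<in> pd Z r ==> x i * dp i g x = b i x"
    proof (rule log_poincare[of b "k w"])
      show "hol Z r (b i)" if "i \<in> Z" for i by (rule hb[OF that])
      show "b i (\<lambda>c. 0) = 0" if "i \<in> Z" for i using k[OF that] by (simp add: b_def \<phi>(3))
      show "x i * dp i (b j) x = x j * dp j (b i) x" if "i \<in> Z" "j \<in> Z" "x \<in> pd Z r" for i j x
        using m_closed[OF that(1,2) _ that(3)] rhs_symmetric[OF that \<psi>(1), of x w]
        by (simp add: db that)
    qed (rule that)
    then show ?thesis using True by (auto simp: b_def intro!: exI[of _ g])
  qed
  qed
  from choice[OF this] obtain G where G: "\<And>w. hol Z r (G w)" "\<And>w. G w (\<lambda>c. 0) = k w"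
    "\<And>w i x. i \<in> Z ==> x \<in> pd Z r ==> x i * dp i (G w) x = rhs i x (\<phi>' x) w"
    "\<And>w. \<not> set w \<subseteq> chords n ==> G w = (\<lambda>x. 0)" by blast
  show ?thesis
    by (rule that[of "\<lambda>x w. G w x"]) (use G in \<open>auto simp: carr_iff\<close>)
qed

text \<open>The sequence begins with the constant \<open>k\<close>. At a word only shorter words
  enter the right hand side, so reading the term number \<open>length w\<close> at \<open>w\<close>
  gives a solution without a passage to the limit.\<close>

theorem chart_solution:
  assumes k: "k \<in> carr n" "\<And>i w. i \<in> Z ==> rhs i (\<lambda>c. 0) k w = 0"
  obtains f where "\<And>x. f x \<in> carr n" "\<And>w. hol Z r (\<lambda>x. f x w)" "f (\<lambda>c. 0) = k"
    "\<And>i x w. i \<in> Z ==> x \<in> pd Z r ==> x i * dp i (\<lambda>x. f x w) x = rhs i x (f x) w"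
proof -
  define P where "P N \<phi>' \<longleftrightarrow> (N = 0 \<longrightarrow> \<phi>' = (\<lambda>x. k)) \<and> (\<forall>x. \<phi>' x \<in> carr n) \<and> (\<forall>w. hol Z r (\<lambda>x. \<phi>' x w)) \<and> \<phi>' (\<lambda>c. 0) = k \<and>
     (\<exists>\<psi>. (\<forall>x. \<psi> x \<in> carr n) \<and> (\<forall>i\<in>Z. \<forall>x\<in>pd Z r. \<forall>w. x i * dp i (\<lambda>x. \<phi>' x w) x = rhs i x (\<psi> x) w))"
    for N :: nat and \<phi>' :: "(nat set \<Rightarrow> complex) \<Rightarrow> ncseries"
  define Q where "Q N \<phi>' \<chi>' \<longleftrightarrow> (\<forall>i\<in>Z. \<forall>x\<in>pd Z r. \<forall>w. x i * dp i (\<lambda>x. \<chi>' x w) x = rhs i x (\<phi>' x) w)"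
    for N :: nat and \<phi>' \<chi>' :: "(nat set \<Rightarrow> complex) \<Rightarrow> ncseries"
  have "\<exists>f. \<forall>N. P N (f N) \<and> Q N (f N) (f (Suc N))"
  proof (rule dependent_nat_choice)
    have "rhs i x (\<lambda>w. 0) w = 0" for i x w
      by (simp add: rhs_def finite_functional_linear(5)[OF finite_functional_Lop] finite_functional_linear(5)[OF finite_functional_Rop])
    then show "\<exists>\<phi>'. P 0 \<phi>'" using k(1) carr_closed(4)[of n]
      by (intro exI[of _ "\<lambda>x. k"]) (auto simp: P_def intro!: exI[of _ "\<lambda>x w. 0"])
    fix \<phi>' N assume "P N \<phi>'"
    then obtain \<psi> where A: "\<And>x. \<phi>' x \<in> carr n" "\<And>w. hol Z r (\<lambda>x. \<phi>' x w)" "\<phi>' (\<lambda>c. 0) = k" "\<And>x. \<psi> x \<in> carr n"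
      "\<And>i x w. i \<in> Z ==> x \<in> pd Z r ==> x i * dp i (\<lambda>x. \<phi>' x w) x = rhs i x (\<psi> x) w"
      unfolding P_def by blast
    obtain \<chi>' where B: "\<And>x. \<chi>' x \<in> carr n" "\<And>w. hol Z r (\<lambda>x. \<chi>' x w)" "\<chi>' (\<lambda>c. 0) = k"
      "\<And>i x w. i \<in> Z ==> x \<in> pd Z r ==> x i * dp i (\<lambda>x. \<chi>' x w) x = rhs i x (\<phi>' x) w"
      by (rule solution_step[OF A k(2)]) (assumption+, rule that, blast+)
    then show "\<exists>\<chi>'. P (Suc N) \<chi>' \<and> Q N \<phi>' \<chi>'"
      unfolding P_def Q_def using A(1) by (intro exI[of _ \<chi>']) blast
  qed
  then obtain F where F: "\<And>N. P N (F N)" "\<And>N. Q N (F N) (F (Suc N))" by blast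
  define f where "f x w = F (length w) x w" for x w
  show ?thesis
  proof (rule that[of f])
    have F1: "F N x \<in> carr n" "hol Z r (\<lambda>x. F N x w)" "F N (\<lambda>c. 0) = k" for N x w
      using F(1)[of N] by (simp_all add: P_def)
    show "f x \<in> carr n" for x using F1(1) by (simp add: f_def carr_iff)
    show "hol Z r (\<lambda>x. f x w)" for w using F1(2) by (simp add: f_def)
    show "f (\<lambda>c. 0) = k" by (simp add: f_def F1(3) fun_eq_iff)
    fix i x w assume i: "i \<in> Z" and x: "x \<in> pd Z r"
    show "x i * dp i (\<lambda>x. f x w) x = rhs i x (f x) w"
    proof (cases w)
      case Nil
      have "F 0 = (\<lambda>x. k)" using F(1)[of 0] by (simp add: P_def)
      then show ?thesis by (simp add: Nil f_def rhs_def)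
    next
      case (Cons c w')
      have "rhs i x (f x) w = rhs i x (F (length w') x) w"
        unfolding rhs_def using Lop_cong[of w "f x" "F (length w') x"] by (simp add: Cons f_def)
      then show ?thesis using F(2)[of "length w'"] i x by (simp add: Q_def f_def Cons)
    qed
  qed
qed

end

section \<open>Solutions on the universal covering\<close>

lemma eventually_openin:
  assumes "openin (top_of_set E) W" "e \<in> W"
  shows "\<forall>\<^sub>F e' in at e within E. e' \<in> W"
  using assms by (auto simp: openin_open eventually_at_topological)

lemma has_differential_diff:
  assumes "has_differential C p E f D e" "has_differential C p E g D' e"
  shows "has_differential C p E (\<lambda>e. f e - g e) (\<lambda>c. D c - D' c) e"
  unfolding has_differential_def
proof (intro allI impI)
  fix \<epsilon> :: real assume "0 < \<epsilon>"
  then have "0 < \<epsilon> / 2" by simp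
  then have "\<forall>\<^sub>F e' in at e within E. cmod (f e' - f e - (\<Sum>c\<in>C. D c * (p e' c - p e c))) \<le> \<epsilon> / 2 * (\<Sum>c\<in>C. cmod (p e' c - p e c))"
    "\<forall>\<^sub>F e' in at e within E. cmod (g e' - g e - (\<Sum>c\<in>C. D' c * (p e' c - p e c))) \<le> \<epsilon> / 2 * (\<Sum>c\<in>C. cmod (p e' c - p e c))"
    using assms unfolding has_differential_def by blast+
  then show "\<forall>\<^sub>F e' in at e within E. cmod (f e' - g e' - (f e - g e) - (\<Sum>c\<in>C. (D c - D' c) * (p e' c - p e c)))
      \<le> \<epsilon> * (\<Sum>c\<in>C. cmod (p e' c - p e c))"
  proof eventually_elim
    case (elim e')
    have "f e' - g e' - (f e - g e) - (\<Sum>c\<in>C. (D c - D' c) * (p e' c - p e c))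
      = (f e' - f e - (\<Sum>c\<in>C. D c * (p e' c - p e c))) - (g e' - g e - (\<Sum>c\<in>C. D' c * (p e' c - p e c)))"
      by (simp add: left_diff_distrib sum_subtractf)
    then show ?case using elim norm_triangle_ineq4[of "f e' - f e - (\<Sum>c\<in>C. D c * (p e' c - p e c))"
      "g e' - g e - (\<Sum>c\<in>C. D' c * (p e' c - p e c))"] by (simp only:)
  qed
qed

lemma path_connected_pd: "path_connected (pd Z r)"
  unfolding path_connected_def
proof (intro ballI)
  fix x y assume xy: "x \<in> pd Z r" "y \<in> pd Z r"
  define g where "g s c = x c + of_real s * (y c - x c)" for s :: real and c
  have "path g" unfolding path_def g_def
    by (intro continuous_on_coordinatewise_then_product continuous_intros)
  moreover have "path_image g \<subseteq> pd Z r"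
  proof
    fix w assume "w \<in> path_image g"
    then obtain s :: real where s: "0 \<le> s" "s \<le> 1" and w: "w = g s" by (auto simp: path_image_def)
    have "cmod (g s c) < r" if "c \<in> Z" for c
    proof -
      have "x c \<in> ball 0 r" "y c \<in> ball 0 r" using xy that by (auto simp: pd_def)
      then have "(1 - s) *\<^sub>R x c + s *\<^sub>R y c \<in> ball 0 r" using s convexD_alt[OF convex_ball] by blast
      then show ?thesis by (simp add: g_def scaleR_conv_of_real algebra_simps)
    qed
    then show "w \<in> pd Z r" using xy unfolding w by (auto simp: pd_def g_def)
  qed
  moreover have "pathstart g = x" "pathfinish g = y" by (auto simp: pathstart_def pathfinish_def g_def)
  ultimately show "\<exists>g. path g \<and> path_image g \<subseteq> pd Z r \<and> pathstart g = x \<and> pathfinish g = y" by blast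
qed

context chart
begin

text \<open>\<open>has_differential\<close> measures errors by the functions \<open>p\<close>, a
  chart by its own coordinates, and \<open>lip\<close> compares the two. Any coefficients
  \<open>D\<close> that pull back to the differential of \<open>G\<close> will do.\<close>

lemma has_differential_pullback:
  fixes \<tau> :: "'e::topological_space \<Rightarrow> nat set \<Rightarrow> complex"
  assumes G: "hol Z r G" and e: "\<tau> e \<in> pd Z r" "p e = \<phi> (\<tau> e)" "g e = G (\<tau> e)"
    and ev: "\<forall>\<^sub>F e' in at e within E. \<tau> e' \<in> pd Z r \<and> p e' = \<phi> (\<tau> e') \<and> g e' = G (\<tau> e')"
    and lip: "\<forall>\<^sub>F e' in at e within E. (\<Sum>i\<in>Z. cmod (\<tau> e' i - \<tau> e i)) \<le> K * (\<Sum>c\<in>chords n. cmod (p e' c - p e c))"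
    and lim: "(\<tau> \<longlongrightarrow> \<tau> e) (at e within E)"
    and D: "\<And>i. i \<in> Z ==> dp i G (\<tau> e) = (\<Sum>c\<in>chords n. D c * dp i (\<lambda>x. \<phi> x c) (\<tau> e))"
  shows "has_differential (chords n) p E g D e"
  unfolding has_differential_def
proof (intro allI impI)
  fix \<epsilon> :: real assume \<epsilon>: "0 < \<epsilon>"
  define M where "M = 1 + (\<Sum>c\<in>chords n. cmod (D c))"
  have M: "1 \<le> M" by (simp add: M_def sum_nonneg)
  define \<eta> where "\<eta> = \<epsilon> / (M * (\<bar>K\<bar> + 1))"
  have \<eta>: "0 < \<eta>" using \<epsilon> M by (auto simp: \<eta>_def intro!: divide_pos_pos mult_pos_pos)
  have approx: "\<forall>\<^sub>F e' in at e within E. cmod (F (\<tau> e') - F (\<tau> e) - (\<Sum>i\<in>Z. dp i F (\<tau> e) * (\<tau> e' i - \<tau> e i)))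
      \<le> \<eta> * (\<Sum>i\<in>Z. cmod (\<tau> e' i - \<tau> e i))" if F: "hol Z r F" for F
  proof -
    have "\<forall>\<^sub>F x in at (\<tau> e) within pd Z r. cmod (F x - F (\<tau> e) - (\<Sum>i\<in>Z. dp i F (\<tau> e) * (x i - \<tau> e i)))
        \<le> \<eta> * (\<Sum>i\<in>Z. cmod (x i - \<tau> e i))"
      using hol_has_differential[OF F e(1)] \<eta> unfolding has_differential_def by blast
    then obtain S where S: "open S" "\<tau> e \<in> S" "\<And>x. x \<in> S ==> x \<noteq> \<tau> e ==> x \<in> pd Z r ==>
        cmod (F x - F (\<tau> e) - (\<Sum>i\<in>Z. dp i F (\<tau> e) * (x i - \<tau> e i))) \<le> \<eta> * (\<Sum>i\<in>Z. cmod (x i - \<tau> e i))"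
      unfolding eventually_at_topological by blast
    from topological_tendstoD[OF lim S(1,2)] ev show ?thesis
    proof eventually_elim
      case (elim e')
      then show ?case using S(3)[of "\<tau> e'"] by (cases "\<tau> e' = \<tau> e") auto
    qed
  qed
  have approx_phi: "\<forall>\<^sub>F e' in at e within E. \<forall>c\<in>chords n.
      cmod (\<phi> (\<tau> e') c - \<phi> (\<tau> e) c - (\<Sum>i\<in>Z. dp i (\<lambda>x. \<phi> x c) (\<tau> e) * (\<tau> e' i - \<tau> e i)))
      \<le> \<eta> * (\<Sum>i\<in>Z. cmod (\<tau> e' i - \<tau> e i))"
    by (intro eventually_ball_finite ballI approx hol_phi) auto
  from ev lip approx[OF G] approx_phi
  show "\<forall>\<^sub>F e' in at e within E. cmod (g e' - g e - (\<Sum>c\<in>chords n. D c * (p e' c - p e c)))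
      \<le> \<epsilon> * (\<Sum>c\<in>chords n. cmod (p e' c - p e c))"
  proof eventually_elim
    case (elim e')
    define S where "S = (\<Sum>i\<in>Z. cmod (\<tau> e' i - \<tau> e i))"
    define P where "P = (\<Sum>c\<in>chords n. cmod (p e' c - p e c))"
    have P0: "0 \<le> P" "0 \<le> S" by (simp_all add: P_def S_def sum_nonneg)
    define A where "A = G (\<tau> e') - G (\<tau> e) - (\<Sum>i\<in>Z. dp i G (\<tau> e) * (\<tau> e' i - \<tau> e i))"
    define B where "B c = \<phi> (\<tau> e') c - \<phi> (\<tau> e) c - (\<Sum>i\<in>Z. dp i (\<lambda>x. \<phi> x c) (\<tau> e) * (\<tau> e' i - \<tau> e i))" for c
    have "(\<Sum>i\<in>Z. dp i G (\<tau> e) * (\<tau> e' i - \<tau> e i))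
        = (\<Sum>i\<in>Z. \<Sum>c\<in>chords n. D c * (dp i (\<lambda>x. \<phi> x c) (\<tau> e) * (\<tau> e' i - \<tau> e i)))"
      by (intro sum.cong refl) (simp add: D sum_distrib_right mult.assoc)
    also have "\<dots> = (\<Sum>c\<in>chords n. D c * (\<Sum>i\<in>Z. dp i (\<lambda>x. \<phi> x c) (\<tau> e) * (\<tau> e' i - \<tau> e i)))"
      by (subst sum.swap) (simp add: sum_distrib_left)
    finally have "g e' - g e - (\<Sum>c\<in>chords n. D c * (p e' c - p e c)) = A - (\<Sum>c\<in>chords n. D c * B c)"
      using elim(1) e by (simp add: A_def B_def right_diff_distrib sum_subtractf)
    also have "cmod \<dots> \<le> cmod A + cmod (\<Sum>c\<in>chords n. D c * B c)" by (rule norm_triangle_ineq4)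
    also have "cmod (\<Sum>c\<in>chords n. D c * B c) \<le> (\<Sum>c\<in>chords n. cmod (D c) * (\<eta> * S))"
      using elim(4) by (intro sum_norm_le) (auto simp: norm_mult B_def S_def intro!: mult_left_mono)
    also have "cmod A \<le> \<eta> * S" using elim(3) by (simp add: A_def S_def)
    also have "\<eta> * S + (\<Sum>c\<in>chords n. cmod (D c) * (\<eta> * S)) = M * \<eta> * S"
      by (simp add: M_def algebra_simps sum_distrib_left sum_distrib_right)
    also have "\<dots> \<le> M * \<eta> * ((\<bar>K\<bar> + 1) * P)"
    proof (rule mult_left_mono)
      have "S \<le> K * P" using elim(2) by (simp add: S_def P_def)
      also have "\<dots> \<le> (\<bar>K\<bar> + 1) * P" using P0 by (intro mult_right_mono) auto
      finally show "S \<le> (\<bar>K\<bar> + 1) * P" .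
    qed (use M \<eta> in auto)
    also have "M * \<eta> * ((\<bar>K\<bar> + 1) * P) = \<epsilon> * P" using M by (simp add: \<eta>_def add_nonneg_pos order_less_imp_not_eq2)
    finally show ?case by (simp add: P_def)
  qed
qed

text \<open>In a chart of \<open>M0 n\<close> the form has no poles, and the logarithmic vector fields may be divided
  by their coordinates.\<close>

lemma rhs_regular:
  assumes "chords n \<inter> Z = {}"
  shows "rhs i x a w = x i * (\<Sum>c\<in>chords n. Lop n c a w * (dp i (\<lambda>x. \<phi> x c) x / \<phi> x c))"
proof -
  have "c \<notin> Z" if "c \<in> chords n" for c using assms that by blast
  then show ?thesis by (simp add: rhs_def m_def sum_distrib_left mult_ac)
qed

text \<open>Off the hyperplanes the factor \<open>x i\<close> cancels. Both sides are holomorphic,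
  so the equality extends.\<close>

lemma regular_equation:
  assumes Z: "chords n \<inter> Z = {}" and G: "hol Z r G" and f: "\<And>w. hol Z r (\<lambda>x. f x w)"
    and eq: "\<And>x. x \<in> pd Z r ==> x i * dp i G x = rhs i x (f x) w" and i: "i \<in> Z" and x: "x \<in> pd Z r"
  shows "dp i G x = (\<Sum>c\<in>chords n. Lop n c (f x) w * (dp i (\<lambda>x. \<phi> x c) x / \<phi> x c))"
proof -
  let ?d = "\<lambda>x. dp i G x - (\<Sum>c\<in>chords n. Lop n c (f x) w * (dp i (\<lambda>x. \<phi> x c) x * (1 / \<phi> x c)))"
  have nz: "c \<notin> Z" if "c \<in> chords n" for c using Z that by blast
  have "?d x = 0"
  proof (rule hol_zero_off_axes[OF _ _ x])
    show "hol Z r ?d"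
      by (intro hol_diff hol_dp G i hol_sum hol_mult hol_functional(1)[OF finite_functional_Lop f] hol_phi phi_unit(2))
        (use nz in auto)
    fix y assume "y \<in> pd Z r" "\<forall>c\<in>Z. y c \<noteq> 0"
    then show "?d y = 0" using eq[of y] i by (simp add: rhs_regular[OF Z])
  qed
  then show ?thesis by simp
qed

end

text \<open>\<open>\<sigma> e\<close> is the local inverse of \<open>p\<close> through
  \<open>e\<close>, read in a chart of \<open>M0\<close> centred at \<open>p e\<close>.\<close>

locale covered =
  fixes n :: nat and E :: "'e::topological_space set" and p :: "'e \<Rightarrow> nat set \<Rightarrow> complex"
    and \<rho> :: "'e \<Rightarrow> real" and \<phi> :: "'e \<Rightarrow> (nat set \<Rightarrow> complex) \<Rightarrow> nat set \<Rightarrow> complex"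
    and \<sigma> :: "'e \<Rightarrow> (nat set \<Rightarrow> complex) \<Rightarrow> 'e"
  assumes sc: "simply_connected E" and p_cont: "continuous_on E p"
    and ch: "e \<in> E ==> chart (singles n) (\<rho> e) n (\<phi> e)"
    and sig: "e \<in> E ==> continuous_on (pd (singles n) (\<rho> e)) (\<sigma> e)"
    and sig_E: "e \<in> E ==> t \<in> pd (singles n) (\<rho> e) ==> \<sigma> e t \<in> E"
    and p_sig: "e \<in> E ==> t \<in> pd (singles n) (\<rho> e) ==> p (\<sigma> e t) = \<phi> e t"
    and sig0: "e \<in> E ==> \<sigma> e (\<lambda>c. 0) = e"
    and op: "e \<in> E ==> openin (top_of_set E) (\<sigma> e ` pd (singles n) (\<rho> e))"
    and zc: "e \<in> E ==> t \<in> pd (singles n) (\<rho> e) ==> zcoord n (p e) (\<phi> e t) = t"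
begin

abbreviation "PD e \<equiv> pd (singles n) (\<rho> e)"
abbreviation "W e \<equiv> \<sigma> e ` PD e"
abbreviation "\<tau> e e' \<equiv> zcoord n (p e) (p e')"

lemma zero_PD: "e \<in> E ==> (\<lambda>c. 0) \<in> PD e"
  using chart.axioms(1)[OF ch] polydisc.pos zero_in_pd by blast

lemma centre_W: "e \<in> E ==> e \<in> W e"
  using sig0[of e] zero_PD[of e] by (metis imageI)

lemma tau_sig: "e \<in> E ==> t \<in> PD e ==> \<tau> e (\<sigma> e t) = t"
  by (simp add: p_sig zc)

lemma tau_continuous: "continuous_on E (\<tau> e)"
proof -
  have pc: "continuous_on E (\<lambda>e'. p e' c)" for c
    using continuous_on_compose2[OF continuous_on_coord[of UNIV c] p_cont] by simp
  have z: "continuous_on E (\<lambda>e'. zz n (p e') q)" for q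
    by (cases "q \<le> 2") (auto simp: zz_def intro!: continuous_intros pc)
  show ?thesis unfolding zcoord_def
  proof (rule continuous_on_coordinatewise_then_product)
    fix c show "continuous_on E (\<lambda>e'. if c \<in> singles n then zz n (p e') (the_elem c) - zz n (p e) (the_elem c) else 0)"
      by (cases "c \<in> singles n") (auto intro!: continuous_on_diff z)
  qed
qed

lemma p_tendsto: "e \<in> E ==> ((\<lambda>e'. p e' c) \<longlongrightarrow> p e c) (at e within E)"
  using continuous_on_compose2[OF continuous_on_coord[of UNIV c] p_cont] by (simp add: continuous_on)

text \<open>Up to constants the chart coordinates are products of the coordinates
  \<open>p e' {1, k}\<close>, hence Lipschitz where these are bounded; \<open>B\<close> is such a
  bound near \<open>e'\<close>.\<close>

lemma tau_lipschitz:
  assumes e': "e' \<in> E"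
  obtains K where "\<forall>\<^sub>F e'' in at e' within E.
    (\<Sum>i\<in>singles n. cmod (\<tau> e e'' i - \<tau> e e' i)) \<le> K * (\<Sum>c\<in>chords n. cmod (p e'' c - p e' c))"
proof -
  define B where "B = 1 + (\<Sum>c\<in>chords n. cmod (p e' c))"
  have pB: "cmod (p e' c) \<le> B - 1" if "c \<in> chords n" for c
    unfolding B_def using member_le_sum[of c "chords n" "\<lambda>c. cmod (p e' c)"] that by simp
  have B1: "1 \<le> B" by (simp add: B_def sum_nonneg)
  have "\<forall>\<^sub>F e'' in at e' within E. \<forall>c\<in>chords n. cmod (p e'' c - p e' c) < 1"
  proof (intro eventually_ball_finite ballI)
    fix c show "\<forall>\<^sub>F e'' in at e' within E. cmod (p e'' c - p e' c) < 1"
      using tendstoD[OF p_tendsto[OF e'], of 1 c] by (simp add: dist_norm)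
  qed simp
  then have "\<forall>\<^sub>F e'' in at e' within E. (\<Sum>i\<in>singles n. cmod (\<tau> e e'' i - \<tau> e e' i))
      \<le> (real (n - 3) * (real n * B ^ n)) * (\<Sum>c\<in>chords n. cmod (p e'' c - p e' c))"
  proof eventually_elim
    case (elim e'')
    define \<epsilon> where "\<epsilon> = (\<Sum>c\<in>chords n. cmod (p e'' c - p e' c))"
    have \<epsilon>: "cmod (p e'' c - p e' c) \<le> \<epsilon>" if "c \<in> chords n" for c
      unfolding \<epsilon>_def using member_le_sum[of c "chords n" "\<lambda>c. cmod (p e'' c - p e' c)"] that by simp
    have \<epsilon>0: "0 \<le> \<epsilon>" by (simp add: \<epsilon>_def sum_nonneg)
    have pB': "cmod (p e'' c) \<le> B" if "c \<in> chords n" for c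
      using elim that pB[OF that] norm_triangle_sub[of "p e'' c" "p e' c"] by fastforce
    have pB'': "cmod (p e' c) \<le> B" if "c \<in> chords n" for c using pB[OF that] by simp
    have "cmod (\<tau> e e'' i - \<tau> e e' i) \<le> real n * B ^ n * \<epsilon>" if i: "i \<in> singles n" for i
    proof -
      obtain q where q: "i = {q}" "3 \<le> q" "q < n" using i by (auto simp: singles_def)
      have c: "{1, k} \<in> chords n" if "k \<in> {q..<n}" for k
        using that q by (intro chordp_chord) (auto simp: chordp_def)
      have "cmod ((\<Prod>k\<in>{q..<n}. p e'' {1, k}) - (\<Prod>k\<in>{q..<n}. p e' {1, k})) \<le> card {q..<n} * B ^ card {q..<n} * \<epsilon>"
        by (rule norm_prod_diff_le, rule finite_atLeastLessThan, rule pB', erule c, rule pB'', erule c, rule \<epsilon>, erule c)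
          (fact B1 \<epsilon>0)+
      also have "\<dots> \<le> real n * B ^ n * \<epsilon>"
        using B1 \<epsilon>0 by (intro mult_right_mono mult_mono power_increasing) auto
      finally show ?thesis using i q by (simp add: zcoord_def zz_def)
    qed
    then have "(\<Sum>i\<in>singles n. cmod (\<tau> e e'' i - \<tau> e e' i)) \<le> (\<Sum>i\<in>singles n. real n * B ^ n * \<epsilon>)"
      by (rule sum_mono)
    then show ?case by (simp add: \<epsilon>_def mult.assoc)
  qed
  then show ?thesis by (rule that)
qed

lemma differential_from_chart:
  assumes e: "e \<in> E" and G: "hol (singles n) (\<rho> e) G" "\<And>t. t \<in> PD e ==> g (\<sigma> e t) = G t" and t: "t \<in> PD e"
    and D: "\<And>i. i \<in> singles n ==> dp i G t = (\<Sum>c\<in>chords n. D c * dp i (\<lambda>x. \<phi> e x c) t)"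
  shows "has_differential (chords n) p E g D (\<sigma> e t)"
proof -
  interpret C: chart "singles n" "\<rho> e" n "\<phi> e" by (rule ch[OF e])
  have st: "\<sigma> e t \<in> E" by (rule sig_E[OF e t])
  obtain K where K: "\<forall>\<^sub>F e'' in at (\<sigma> e t) within E.
    (\<Sum>i\<in>singles n. cmod (\<tau> e e'' i - \<tau> e (\<sigma> e t) i)) \<le> K * (\<Sum>c\<in>chords n. cmod (p e'' c - p (\<sigma> e t) c))"
    using tau_lipschitz[OF st] .
  show ?thesis
  proof (rule C.has_differential_pullback[where \<tau> = "\<tau> e", OF G(1) _ _ _ _ K])
    show "\<tau> e (\<sigma> e t) \<in> PD e" "p (\<sigma> e t) = \<phi> e (\<tau> e (\<sigma> e t))" "g (\<sigma> e t) = G (\<tau> e (\<sigma> e t))"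
      using e t by (simp_all add: tau_sig G(2) p_sig zc)
    have "\<forall>\<^sub>F e' in at (\<sigma> e t) within E. e' \<in> W e"
      using t by (intro eventually_openin[OF op[OF e]]) auto
    then show "\<forall>\<^sub>F e' in at (\<sigma> e t) within E. \<tau> e e' \<in> PD e \<and> p e' = \<phi> e (\<tau> e e') \<and> g e' = G (\<tau> e e')"
      by eventually_elim (use e in \<open>auto simp: tau_sig G(2) p_sig zc\<close>)
    show "(\<tau> e \<longlongrightarrow> \<tau> e (\<sigma> e t)) (at (\<sigma> e t) within E)"
      using tau_continuous[of e] st by (simp add: continuous_on)
    show "dp i G (\<tau> e (\<sigma> e t)) = (\<Sum>c\<in>chords n. D c * dp i (\<lambda>x. \<phi> e x c) (\<tau> e (\<sigma> e t)))" if "i \<in> singles n" for i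
      using D[OF that] e t by (simp add: tau_sig)
  qed
qed

text \<open>In the chart at \<open>e\<close> a nearby point is joined to the centre by a segment,
  along which the chain rule gives derivative 0.\<close>

lemma zero_differential_locally_constant:
  assumes V: "openin (top_of_set E) V" and d: "\<And>e. e \<in> V ==> has_differential (chords n) p E d (\<lambda>c. 0) e" and e: "e \<in> V"
  shows "\<forall>\<^sub>F e' in at e within E. d e' = d e"
proof -
  have eE: "e \<in> E" using V e openin_imp_subset by blast
  interpret C: chart "singles n" "\<rho> e" n "\<phi> e" by (rule ch[OF eE])
  have "openin (top_of_set (PD e)) (PD e \<inter> \<sigma> e -` V)"
    by (rule continuous_openin_preimage[OF sig[OF eE] _ V]) (use sig_E[OF eE] in auto)
  then obtain A where A: "open A" "PD e \<inter> \<sigma> e -` V = PD e \<inter> A" by (auto simp: openin_open)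
  have "(\<lambda>c. 0) \<in> A" using A(2) zero_PD[OF eE] sig0[OF eE] e by auto
  then obtain r1 where r1: "0 < r1" "pd (singles n) r1 \<subseteq> A" using pd_neighbourhood[OF A(1) _ C.fin] by blast
  define r2 where "r2 = min r1 (\<rho> e)"
  have r2: "0 < r2" "pd (singles n) r2 \<subseteq> A \<inter> PD e" using r1 C.pos by (auto simp: r2_def pd_def subset_iff)
  have main: "d (\<sigma> e t) = d e" if t: "t \<in> pd (singles n) r2" for t
  proof -
    define \<gamma> where "\<gamma> s c = of_real s * t c" for s :: real and c
    have seg: "\<gamma> s \<in> pd (singles n) r2" if "s \<in> {0..1}" for s
    proof -
      have "cmod (of_real s * t c) \<le> cmod (t c)" for c
        using that mult_right_mono[of "\<bar>s\<bar>" 1 "cmod (t c)"] by (simp add: norm_mult)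
      then show ?thesis using t by (auto simp: pd_def \<gamma>_def intro: le_less_trans)
    qed
    then have seg': "\<gamma> s \<in> PD e" "\<sigma> e (\<gamma> s) \<in> V" if "s \<in> {0..1}" for s
      using that r2(2) A(2) by blast+
    have "((\<lambda>s. d (\<sigma> e (\<gamma> s))) has_derivative (\<lambda>h. 0)) (at s within {0..1})" if s: "s \<in> {0..1}" for s
    proof -
      have c: "((\<lambda>s. p (\<sigma> e (\<gamma> s)) c) has_derivative
           (\<lambda>h. \<Sum>b\<in>singles n. dp b (\<lambda>x. \<phi> e x c) (\<gamma> s) * (of_real h * t b))) (at s within {0..1})"
        if "c \<in> chords n" for c
      proof (rule has_derivative_transform_within[OF C.hol_chain[OF C.hol_phi[OF that]], where d = 1])
        show "\<gamma> s \<in> PD e" by (rule seg'(1)[OF s])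
        show "\<forall>\<^sub>F s in at s within {0..1}. \<gamma> s \<in> PD e"
          using seg'(1) by (auto simp: eventually_at_filter intro!: always_eventually)
        show "((\<lambda>s. \<gamma> s b) has_derivative (\<lambda>h. of_real h * t b)) (at s within {0..1})" for b
          unfolding \<gamma>_def by (auto intro!: derivative_eq_intros)
      qed (use s seg'(1) p_sig[OF eE] in auto)
      have "((\<lambda>s. d (\<sigma> e (\<gamma> s))) has_derivative (\<lambda>h. \<Sum>c\<in>chords n. 0 *
           (\<Sum>b\<in>singles n. dp b (\<lambda>x. \<phi> e x c) (\<gamma> s) * (of_real h * t b)))) (at s within {0..1})"
      proof (rule has_differential_chain[OF d[OF seg'(2)[OF s]] _ _ _ c])
        show "\<forall>\<^sub>F s in at s within {0..1}. \<sigma> e (\<gamma> s) \<in> E"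
          using seg'(1) sig_E[OF eE] by (auto simp: eventually_at_filter intro!: always_eventually)
        have "continuous_on {0..1} \<gamma>" unfolding \<gamma>_def
          by (intro continuous_on_coordinatewise_then_product continuous_intros)
        then have "continuous_on {0..1} (\<lambda>s. \<sigma> e (\<gamma> s))"
          using seg'(1) by (intro continuous_on_compose2[OF sig[OF eE]]) auto
        then show "((\<lambda>s. \<sigma> e (\<gamma> s)) \<longlongrightarrow> \<sigma> e (\<gamma> s)) (at s within {0..1})" using s by (simp add: continuous_on)
      qed auto
      then show ?thesis by simp
    qed
    then obtain k where "\<forall>s\<in>{0..1}. d (\<sigma> e (\<gamma> s)) = k"
      using has_derivative_zero_constant[of "{0..1::real}" "\<lambda>s. d (\<sigma> e (\<gamma> s))"] by auto
    then have "d (\<sigma> e (\<gamma> 0)) = d (\<sigma> e (\<gamma> 1))" by simp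
    moreover have "\<gamma> 0 = (\<lambda>c. 0)" "\<gamma> 1 = t" by (auto simp: \<gamma>_def)
    ultimately show ?thesis using sig0[OF eE] by simp
  qed
  have "\<forall>\<^sub>F e' in at e within E. \<forall>c\<in>singles n. cmod (\<tau> e e' c) < r2"
  proof (intro eventually_ball_finite ballI)
    fix c
    have "\<tau> e e = (\<lambda>c. 0)" using tau_sig[OF eE zero_PD[OF eE]] sig0[OF eE] by simp
    moreover have "continuous_on E (\<lambda>e'. \<tau> e e' c)"
      using continuous_on_compose2[OF continuous_on_coord[of UNIV c] tau_continuous] by simp
    ultimately have "((\<lambda>e'. \<tau> e e' c) \<longlongrightarrow> 0) (at e within E)" using eE by (simp add: continuous_on) metis
    from tendstoD[OF this r2(1)] show "\<forall>\<^sub>F e' in at e within E. cmod (\<tau> e e' c) < r2" by simp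
  qed simp
  moreover have "\<forall>\<^sub>F e' in at e within E. e' \<in> W e" by (rule eventually_openin[OF op[OF eE] centre_W[OF eE]])
  ultimately show ?thesis
  proof eventually_elim
    case (elim e')
    then obtain t where t: "t \<in> PD e" "e' = \<sigma> e t" by blast
    then have "t \<in> pd (singles n) r2" using elim(1) tau_sig[OF eE t(1)] by (auto simp: pd_def)
    then show ?case using main t by simp
  qed
qed

lemma path_connected_W: "e \<in> E ==> path_connected (W e)"
  by (intro path_connected_continuous_image sig path_connected_pd)

lemma zero_differential_constant:
  assumes "connected E" "\<And>e. e \<in> E ==> has_differential (chords n) p E d (\<lambda>c. 0) e" "e \<in> E" "e' \<in> E"
  shows "d e = d e'"
  using locally_constant_on_connected[OF assms(1) zero_differential_locally_constant[of E d] assms(3,4)] assms(2) by simp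

text \<open>The equation \<open>dF = \<Omega> H\<close> read in all charts, where \<open>H\<close>
  will be the preceding approximation.\<close>

definition equation :: "('e \<Rightarrow> ncseries) \<Rightarrow> ('e \<Rightarrow> ncseries) \<Rightarrow> bool" where
  "equation F H \<longleftrightarrow> (\<forall>e. F e \<in> carr n) \<and> (\<forall>e\<in>E. \<forall>w. hol (singles n) (\<rho> e) (\<lambda>t. F (\<sigma> e t) w)) \<and>
     (\<forall>e\<in>E. \<forall>i\<in>singles n. \<forall>t\<in>PD e. \<forall>w. dp i (\<lambda>t. F (\<sigma> e t) w) t
        = (\<Sum>c\<in>chords n. Lop n c (H (\<sigma> e t)) w * (dp i (\<lambda>t. \<phi> e t c) t / \<phi> e t c)))"

lemma singles_disjoint: "chords n \<inter> singles n = {}"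
  using singles_not_chords by blast

text \<open>In these charts the form has no poles, so every initial value satisfies the condition of
  \<open>solution_step\<close>; \<open>regular_equation\<close> then removes the factors
  \<open>t i\<close>.\<close>

lemma local_solution:
  assumes FH: "equation F H" and H: "\<And>e. H e \<in> carr n" and e: "e \<in> E"
  obtains X where "\<And>w. hol (singles n) (\<rho> e) (\<lambda>t. X t w)"
    "\<And>i t w. i \<in> singles n ==> t \<in> PD e ==> dp i (\<lambda>t. X t w) t
        = (\<Sum>c\<in>chords n. Lop n c (F (\<sigma> e t)) w * (dp i (\<lambda>t. \<phi> e t c) t / \<phi> e t c))"
proof -
  interpret C: chart "singles n" "\<rho> e" n "\<phi> e" by (rule ch[OF e])
  have hF: "hol (singles n) (\<rho> e) (\<lambda>t. F (\<sigma> e t) w)" for w using FH e unfolding equation_def by blast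
  obtain X where X: "\<And>w. hol (singles n) (\<rho> e) (\<lambda>t. X t w)"
    "\<And>i t w. i \<in> singles n ==> t \<in> PD e ==> t i * dp i (\<lambda>t. X t w) t = C.rhs i t (F (\<sigma> e t)) w"
  proof (rule C.solution_step[of "\<lambda>t. F (\<sigma> e t)" "F (\<sigma> e (\<lambda>c. 0))" "\<lambda>t. H (\<sigma> e t)"])
    show "F (\<sigma> e t) \<in> carr n" for t using FH unfolding equation_def by blast
    show "H (\<sigma> e t) \<in> carr n" for t by (rule H)
    show "hol (singles n) (\<rho> e) (\<lambda>t. F (\<sigma> e t) w)" for w by (rule hF)
    show "t i * dp i (\<lambda>t. F (\<sigma> e t) w) t = C.rhs i t (H (\<sigma> e t)) w" if "i \<in> singles n" "t \<in> PD e" for i t w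
      using FH e that unfolding equation_def C.rhs_regular[OF singles_disjoint] by simp
    show "C.rhs i (\<lambda>c. 0) (F (\<sigma> e (\<lambda>c. 0))) w = 0" for i w by (simp add: C.rhs_regular[OF singles_disjoint])
  qed (rule refl, rule that)
  show ?thesis
    by (rule that[of X, OF X(1) C.regular_equation[OF singles_disjoint X(1) hF X(2)]])
qed

text \<open>For each word, the local primitives on two charts have the same differential and hence
  differ by locally constant functions. They patch over the simply connected space, and a constant
  adjusts the value at \<open>e0\<close>.\<close>

lemma global_solution_step:
  assumes FH: "equation F H" and H: "\<And>e. H e \<in> carr n" and e0: "e0 \<in> E" and k: "k \<in> carr n"
  obtains F' where "equation F' F" "F' e0 = k"
proof -
  define A where "A e X \<longleftrightarrow> (\<forall>w. hol (singles n) (\<rho> e) (\<lambda>t. X t w)) \<and> (\<forall>i\<in>singles n. \<forall>t\<in>PD e. \<forall>w. dp i (\<lambda>t. X t w) t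
        = (\<Sum>c\<in>chords n. Lop n c (F (\<sigma> e t)) w * (dp i (\<lambda>t. \<phi> e t c) t / \<phi> e t c)))" for e X
  have "\<exists>X. A e X" if e: "e \<in> E" for e
    by (rule local_solution[OF FH H e]) (unfold A_def, blast)
  then have "\<forall>e\<in>E. \<exists>X. A e X" by blast
  from bchoice[OF this] obtain X where "\<forall>e\<in>E. A e (X e)" ..
  then have X: "\<And>e w. e \<in> E ==> hol (singles n) (\<rho> e) (\<lambda>t. X e t w)"
    "\<And>e i t w. e \<in> E ==> i \<in> singles n ==> t \<in> PD e ==> dp i (\<lambda>t. X e t w) t
        = (\<Sum>c\<in>chords n. Lop n c (F (\<sigma> e t)) w * (dp i (\<lambda>t. \<phi> e t c) t / \<phi> e t c))"
    unfolding A_def by simp_all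
  have diff: "has_differential (chords n) p E (\<lambda>e'. X e (\<tau> e e') w) (\<lambda>c. Lop n c (F e') w / p e' c) e'"
    if e: "e \<in> E" and e': "e' \<in> W e" for e e' w
  proof -
    obtain t where t: "t \<in> PD e" "e' = \<sigma> e t" using e' by blast
    show ?thesis unfolding t(2)
      by (rule differential_from_chart[OF e X(1)[OF e] _ t(1)])
        (use e t in \<open>simp_all add: tau_sig X(2) p_sig zc\<close>)
  qed
  have "\<exists>G. \<forall>e\<in>E. \<forall>e'\<in>W e. G e' - G e = X e (\<tau> e e') w - X e (\<lambda>c. 0) w" for w
  proof -
    obtain G where G: "\<And>i e e'. i \<in> E ==> e \<in> W i ==> e' \<in> W i ==> G e' - G e = X i (\<tau> i e') w - X i (\<tau> i e) w"
    proof (rule global_primitive[where E = E and I = E and W = W and g = "\<lambda>i e. X i (\<tau> i e) w", OF sc])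
      show "openin (top_of_set E) (W i)" if "i \<in> E" for i by (rule op[OF that])
      show "E \<subseteq> (\<Union>i\<in>E. W i)" using centre_W by blast
      show "path_connected (W i)" if "i \<in> E" for i by (rule path_connected_W[OF that])
      fix i j e assume ij: "i \<in> E" "j \<in> E" and e: "e \<in> W i \<inter> W j"
      show "\<forall>\<^sub>F e' in at e within E. X i (\<tau> i e') w - X j (\<tau> j e') w = X i (\<tau> i e) w - X j (\<tau> j e) w"
      proof (rule zero_differential_locally_constant[OF openin_Int[OF op[OF ij(1)] op[OF ij(2)]] _ e])
        fix e assume "e \<in> W i \<inter> W j"
        then show "has_differential (chords n) p E (\<lambda>e'. X i (\<tau> i e') w - X j (\<tau> j e') w) (\<lambda>c. 0) e"
          using has_differential_diff[OF diff[OF ij(1), of e w] diff[OF ij(2), of e w]] by simp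
      qed
    qed (assumption | rule that)+
    have "\<tau> e e = (\<lambda>c. 0)" if "e \<in> E" for e using tau_sig[OF that zero_PD[OF that]] sig0[OF that] by simp
    then show ?thesis using G[OF _ centre_W] by (intro exI[of _ G]) simp
  qed
  then have "\<forall>w. \<exists>G. \<forall>e\<in>E. \<forall>e'\<in>W e. G e' - G e = X e (\<tau> e e') w - X e (\<lambda>c. 0) w" by blast
  from choice[OF this] obtain G where G: "\<And>w e e'. e \<in> E ==> e' \<in> W e ==> G w e' - G w e = X e (\<tau> e e') w - X e (\<lambda>c. 0) w"
    by blast
  define F' where "F' e w = (if set w \<subseteq> chords n then G w e - G w e0 + k w else 0)" for e w
  have chart: "F' (\<sigma> e t) w = (if set w \<subseteq> chords n then X e t w + (G w e - X e (\<lambda>c. 0) w - G w e0 + k w) else 0)"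
    if "e \<in> E" "t \<in> PD e" for e t w
  proof -
    have "G w (\<sigma> e t) - G w e = X e t w - X e (\<lambda>c. 0) w"
      using G[OF that(1) imageI[OF that(2)], of w] that by (simp add: tau_sig)
    then show ?thesis by (simp add: F'_def algebra_simps)
  qed
  have hX: "hol (singles n) (\<rho> e) (\<lambda>t. if set w \<subseteq> chords n then X e t w + K else 0)" if "e \<in> E" for e w K
    using X(1)[OF that, of w] by (cases "set w \<subseteq> chords n") (auto intro!: hol_add)
  have "equation F' F"
    unfolding equation_def
  proof (intro conjI allI ballI)
    show "F' e \<in> carr n" for e by (simp add: F'_def carr_iff)
    fix e w assume e: "e \<in> E"
    interpret C: chart "singles n" "\<rho> e" n "\<phi> e" by (rule ch[OF e])
    show "hol (singles n) (\<rho> e) (\<lambda>t. F' (\<sigma> e t) w)"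
      by (rule hol_cong[OF hX[OF e]]) (simp add: chart[OF e])
    fix i t assume i: "i \<in> singles n" and t: "t \<in> PD e"
    show "dp i (\<lambda>t. F' (\<sigma> e t) w) t = (\<Sum>c\<in>chords n. Lop n c (F (\<sigma> e t)) w * (dp i (\<lambda>t. \<phi> e t c) t / \<phi> e t c))"
    proof (cases "set w \<subseteq> chords n")
      case True
      then show ?thesis using C.dp_cong[OF chart[OF e, of _ w] i t] i t X(2)[OF e i t]
        by (simp add: C.dp_add X(1)[OF e])
    next
      case False
      then have "Lop n c a w = 0" for c a using Lop_carr[of n c a] by (simp add: carr_iff)
      then show ?thesis using C.dp_cong[OF chart[OF e, of _ w] i t] False by simp
    qed
  qed
  moreover have "F' e0 = k" using k by (auto simp: F'_def carr_iff fun_eq_iff)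
  ultimately show ?thesis by (rule that)
qed

theorem global_solution:
  assumes e0: "e0 \<in> E" and k: "k \<in> carr n"
  obtains F where "\<And>e. F e \<in> carr n" "F e0 = k"
    "\<And>e w. e \<in> E ==> has_differential (chords n) p E (\<lambda>e. F e w) (\<lambda>c. Lop n c (F e) w / p e c) e"
proof -
  have L0: "Lop n c (\<lambda>w. 0) w = 0" for c w by (rule finite_functional_linear(5)[OF finite_functional_Lop])
  define P where "P N F \<longleftrightarrow> (N = 0 \<longrightarrow> F = (\<lambda>e. k)) \<and> F e0 = k \<and> (\<exists>H. (\<forall>e. H e \<in> carr n) \<and> equation F H)"
    for N :: nat and F :: "'e \<Rightarrow> ncseries"
  have "\<exists>f. \<forall>N. P N (f N) \<and> equation (f (Suc N)) (f N)"
  proof (rule dependent_nat_choice)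
    have "equation (\<lambda>e. k) (\<lambda>e w. 0)"
      unfolding equation_def using k by (auto simp: L0 dp_def)
    then show "\<exists>F. P 0 F" unfolding P_def using carr_closed(4)[of n]
      by (intro exI[of _ "\<lambda>e. k"] conjI exI[of _ "\<lambda>e w. 0"]) auto
    fix F N assume "P N F"
    then obtain H where H: "\<And>e. H e \<in> carr n" "equation F H" unfolding P_def by blast
    obtain F' where F': "equation F' F" "F' e0 = k" using global_solution_step[OF H(2,1) e0 k] .
    have "\<forall>e. F e \<in> carr n" using H(2) by (simp add: equation_def)
    then show "\<exists>F'. P (Suc N) F' \<and> equation F' F" unfolding P_def using F' by (intro exI[of _ F']) blast
  qed
  then obtain f where f: "\<And>N. P N (f N)" "\<And>N. equation (f (Suc N)) (f N)" by blast
  define F where "F e w = f (length w) e w" for e w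
  have f1: "f N e \<in> carr n" "f N e0 = k" "e \<in> E ==> hol (singles n) (\<rho> e) (\<lambda>t. f N (\<sigma> e t) w)" for N e w
    using f(1)[of N] by (auto simp: P_def equation_def)
  show ?thesis
  proof (rule that[of F])
    show "F e \<in> carr n" for e using f1(1) by (simp add: F_def carr_iff)
    show "F e0 = k" by (simp add: F_def f1(2) fun_eq_iff)
    fix e w assume e: "e \<in> E"
    interpret C: chart "singles n" "\<rho> e" n "\<phi> e" by (rule ch[OF e])
    have "has_differential (chords n) p E (\<lambda>e. F e w) (\<lambda>c. Lop n c (F e) w / p e c) (\<sigma> e (\<lambda>c. 0))"
    proof (rule differential_from_chart[OF e _ _ zero_PD[OF e]])
      show "hol (singles n) (\<rho> e) (\<lambda>t. F (\<sigma> e t) w)" unfolding F_def by (rule f1(3)[OF e])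
      fix i assume i: "i \<in> singles n"
      show "dp i (\<lambda>t. F (\<sigma> e t) w) (\<lambda>c. 0) = (\<Sum>c\<in>chords n. Lop n c (F e) w / p e c * dp i (\<lambda>x. \<phi> e x c) (\<lambda>c. 0))"
      proof (cases w)
        case Nil
        have "f 0 = (\<lambda>e. k)" using f(1)[of 0] by (simp add: P_def)
        then show ?thesis by (simp add: Nil F_def)
      next
        case (Cons c w')
        have "Lop n c (f (length w') e) w = Lop n c (F e) w" for c
          by (rule Lop_cong(1)) (simp add: Cons F_def)
        moreover have "p e = \<phi> e (\<lambda>c. 0)" using p_sig[OF e zero_PD[OF e]] sig0[OF e] by simp
        ultimately show ?thesis using f(2)[of "length w'"] e i zero_PD[OF e] sig0[OF e]
          by (simp add: equation_def F_def Cons)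
      qed
    qed simp
    then show "has_differential (chords n) p E (\<lambda>e. F e w) (\<lambda>c. Lop n c (F e) w / p e c) e" by (simp add: sig0[OF e])
  qed
qed

end

text \<open>A chart of \<open>M0\<close> inside an evenly covered set is lifted to the sheet through
  \<open>e\<close>.\<close>

lemma universal_covering_charts:
  assumes n: "n \<ge> 4" and cov: "universal_covering_M0 n E p s"
  obtains \<rho> \<phi> \<sigma> where "covered n E p \<rho> \<phi> \<sigma>"
proof -
  have cs: "covering_space E p (M0 n)" and sc: "simply_connected E" using cov by (auto simp: universal_covering_M0_def)
  have pc: "continuous_on E p" and pE: "p ` E = M0 n" using cs by (auto simp: covering_space_def)
  define A where "A e = (\<lambda>(\<rho>, \<phi>, \<sigma>). chart (singles n) \<rho> n \<phi> \<and> continuous_on (pd (singles n) \<rho>) \<sigma> \<and>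
     (\<forall>t\<in>pd (singles n) \<rho>. \<sigma> t \<in> E \<and> p (\<sigma> t) = \<phi> t \<and> zcoord n (p e) (\<phi> t) = t) \<and> \<sigma> (\<lambda>c. 0) = e \<and>
     openin (top_of_set E) (\<sigma> ` pd (singles n) \<rho>))" for e
  have "\<exists>y. A e y" if e: "e \<in> E" for e
  proof -
    have "p e \<in> M0 n" using e pE by blast
    then obtain T \<V> where T: "p e \<in> T" "openin (top_of_set (M0 n)) T" and V: "\<Union>\<V> = E \<inter> p -` T"
      "\<And>u. u \<in> \<V> ==> openin (top_of_set E) u" "\<And>u. u \<in> \<V> ==> \<exists>q. homeomorphism u T p q"
      using cs unfolding covering_space_def by metis
    obtain u where u: "u \<in> \<V>" "e \<in> u" using V(1) e T(1) by blast
    obtain q where q: "homeomorphism u T p q" using V(3)[OF u(1)] ..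
    obtain Op where Op: "open Op" "T = M0 n \<inter> Op" using T(2) by (auto simp: openin_open)
    obtain \<rho> \<phi> where ch: "chart (singles n) \<rho> n \<phi>" and in_T: "\<And>t. t \<in> pd (singles n) \<rho> ==> \<phi> t \<in> M0 n \<inter> Op"
      and \<phi>0: "\<phi> (\<lambda>c. 0) = p e" and zc: "\<And>t. t \<in> pd (singles n) \<rho> ==> zcoord n (p e) (\<phi> t) = t"
      and cz: "\<And>u. u \<in> M0 n ==> zcoord n (p e) u \<in> pd (singles n) \<rho> ==> \<phi> (zcoord n (p e) u) = u"
      by (rule M0_chart[OF \<open>p e \<in> M0 n\<close> n Op(1)]) (use T(1) Op(2) in blast, rule that)
    interpret C: chart "singles n" \<rho> n \<phi> by (rule ch)
    have \<phi>T: "\<phi> t \<in> T" if "t \<in> pd (singles n) \<rho>" for t using in_T[OF that] Op(2) by blast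
    have uE: "u \<subseteq> E" using V(2)[OF u(1)] openin_imp_subset by blast
    \<comment> \<open>Inside the sheet the lifted chart is cut out by strict inequalities for
      continuous functions, which is why it is open.\<close>
    have im: "(\<lambda>t. q (\<phi> t)) ` pd (singles n) \<rho> = u \<inter> (\<lambda>e'. zcoord n (p e) (p e')) -` {y. \<forall>c\<in>singles n. cmod (y c) < \<rho>}"
      (is "?L = ?R")
    proof
      have "q (\<phi> t) \<in> u \<and> p (q (\<phi> t)) = \<phi> t" if "t \<in> pd (singles n) \<rho>" for t
        using \<phi>T[OF that] q by (auto simp: homeomorphism_def)
      then show "?L \<subseteq> ?R" using zc by (auto simp: pd_def)
      show "?R \<subseteq> ?L"
      proof
        fix e' assume e': "e' \<in> ?R"
        then have pd: "zcoord n (p e) (p e') \<in> pd (singles n) \<rho>" by (auto simp: pd_def zcoord_def)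
        have "p e' \<in> M0 n" using e' q Op(2) by (auto simp: homeomorphism_def)
        then have "q (\<phi> (zcoord n (p e) (p e'))) = e'" using cz[OF _ pd] e' q by (auto simp: homeomorphism_def)
        then show "e' \<in> ?L" using pd by (metis imageI)
      qed
    qed
    have pcc: "continuous_on u (\<lambda>e'. p e' c)" for c
      using continuous_on_compose2[OF continuous_on_coord[of UNIV c] continuous_on_subset[OF pc uE]] by simp
    have z: "continuous_on u (\<lambda>e'. zz n (p e') j)" for j
      by (cases "j \<le> 2") (auto simp: zz_def intro!: continuous_intros pcc)
    have "continuous_on u (\<lambda>e'. zcoord n (p e) (p e'))" unfolding zcoord_def
    proof (rule continuous_on_coordinatewise_then_product)
      fix c show "continuous_on u (\<lambda>e'. if c \<in> singles n then zz n (p e') (the_elem c) - zz n (p e) (the_elem c) else 0)"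
        by (cases "c \<in> singles n") (auto intro!: continuous_on_diff z)
    qed
    moreover have "open {y :: nat set \<Rightarrow> complex. \<forall>c\<in>singles n. cmod (y c) < \<rho>}"
    proof -
      have "{y :: nat set \<Rightarrow> complex. \<forall>c\<in>singles n. cmod (y c) < \<rho>} = (\<Inter>c\<in>singles n. {y. cmod (y c) < \<rho>})" by auto
      then show ?thesis by (auto intro!: open_INT open_Collect_less continuous_intros continuous_on_coord)
    qed
    ultimately have "openin (top_of_set u) ?L" unfolding im by (rule continuous_openin_preimage_gen)
    then have opL: "openin (top_of_set E) ?L" using V(2)[OF u(1)] openin_trans by blast
    have "A e (\<rho>, \<phi>, \<lambda>t. q (\<phi> t))"
      unfolding A_def prod.case
    proof (intro conjI ballI ch opL)
      show "continuous_on (pd (singles n) \<rho>) (\<lambda>t. q (\<phi> t))"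
        using \<phi>T q by (intro continuous_on_compose2[OF _ C.phi_continuous, of T]) (auto simp: homeomorphism_def)
      show "q (\<phi> (\<lambda>c. 0)) = e" unfolding \<phi>0 using q u(2) by (simp add: homeomorphism_def)
      fix t assume t: "t \<in> pd (singles n) \<rho>"
      show "q (\<phi> t) \<in> E" using \<phi>T[OF t] q uE by (auto simp: homeomorphism_def)
      show "p (q (\<phi> t)) = \<phi> t" using \<phi>T[OF t] q by (simp add: homeomorphism_def)
      show "zcoord n (p e) (\<phi> t) = t" by (rule zc[OF t])
    qed
    then show ?thesis ..
  qed
  then have "\<forall>e\<in>E. \<exists>y. A e y" by blast
  from bchoice[OF this] obtain y where y: "\<forall>e\<in>E. A e (y e)" ..
  have "covered n E p (\<lambda>e. fst (y e)) (\<lambda>e. fst (snd (y e))) (\<lambda>e. snd (snd (y e)))"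
  proof (rule covered.intro)
    show "simply_connected E" "continuous_on E p" by fact+
  qed (use y in \<open>auto simp: A_def split_beta\<close>)
  then show ?thesis by (rule that)
qed

section \<open>Normalisation at a vertex\<close>

lemma nf_mult_cong:
  assumes "nf n a = nf n a'" "nf n b = nf n b'" "a \<in> carr n" "a' \<in> carr n" "b \<in> carr n" "b' \<in> carr n"
  shows "nf n (nc_mult a b) = nf n (nc_mult a' b')"
  by (metis assms nf_mult nf_carr)

lemma functional_has_vector_derivative:
  assumes "finite_functional T" "\<And>v. ((\<lambda>\<tau>. G \<tau> v) has_vector_derivative G' v) (at \<tau> within S)"
  shows "((\<lambda>\<tau>. T (G \<tau>)) has_vector_derivative T G') (at \<tau> within S)"
proof -
  obtain V t where "T = (\<lambda>a. \<Sum>v\<in>V. t v * a v)" using assms(1) unfolding finite_functional_def by blast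
  then show ?thesis
    by (simp only:) (intro has_vector_derivative_sum has_vector_derivative_mult_right assms(2))
qed

lemma nc_mult_has_vector_derivative:
  assumes "\<And>v. ((\<lambda>\<tau>. A \<tau> v) has_vector_derivative A' v) (at \<tau> within S)"
    "\<And>v. ((\<lambda>\<tau>. B \<tau> v) has_vector_derivative B' v) (at \<tau> within S)"
  shows "((\<lambda>\<tau>. nc_mult (A \<tau>) (B \<tau>) w) has_vector_derivative (nc_mult A' (B \<tau>) w + nc_mult (A \<tau>) B' w)) (at \<tau> within S)"
proof -
  have "((\<lambda>\<tau>. nc_mult (A \<tau>) (B \<tau>) w) has_vector_derivative
     (\<Sum>k\<le>length w. A \<tau> (take k w) * B' (drop k w) + A' (take k w) * B \<tau> (drop k w))) (at \<tau> within S)"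
    unfolding nc_mult_def by (intro has_vector_derivative_sum has_vector_derivative_mult assms)
  then show ?thesis by (simp add: nc_mult_def sum.distrib add.commute)
qed

section \<open>Exponentials of commuting letters\<close>

definition linear_series :: "nat set set \<Rightarrow> (nat set \<Rightarrow> complex) \<Rightarrow> ncseries" where
  "linear_series A l = (\<lambda>w. \<Sum>c\<in>A. l c * letter c w)"

lemma linear_series_carr: "A \<subseteq> chords n ==> linear_series A l \<in> carr n"
  unfolding linear_series_def by (intro carr_sum carr_closed(3) letter_carr) auto

lemma mult_linear_series:
  "nc_mult (linear_series A l) a = (\<lambda>w. \<Sum>c\<in>A. l c * nc_mult (letter c) a w)"
  "nc_mult a (linear_series A l) = (\<lambda>w. \<Sum>c\<in>A. l c * nc_mult a (letter c) w)"
  by (simp_all only: linear_series_def nc_mult_sum nc_mult_scale)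

context
  fixes n :: nat and A :: "nat set set"
  assumes A: "A \<subseteq> chords n"
    and commute: "\<And>c d. c \<in> A ==> d \<in> A ==> nf n (nc_mult (letter c) (letter d)) = nf n (nc_mult (letter d) (letter c))"
begin

abbreviation "lpow l k \<equiv> linear_series A l [^]\<^bsub>nc_ring n\<^esub> (k :: nat)"

lemma pow_simps: "lpow l 0 = (\<lambda>w. if w = [] then 1 else 0)" "lpow l (Suc k) = nc_mult (lpow l k) (linear_series A l)"
  by (simp_all add: nat_pow_def nc_ring_simps)

lemma pow_carr: "lpow l k \<in> carr n"
proof (induction k)
  case 0 show ?case unfolding pow_simps by (rule carr_closed(5))
next
  case (Suc k) then show ?case unfolding pow_simps by (intro nc_mult_closed linear_series_carr A)
qed

text \<open>The letters of \<open>A\<close> commute only modulo the ideal, so the statement is made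
  under \<open>nf\<close>.\<close>

lemma pow_commute: "nf n (nc_mult (lpow l k) (linear_series A h)) = nf n (nc_mult (linear_series A h) (lpow l k))"
proof (induction k)
  case 0 show ?case unfolding pow_simps nc_mult_one ..
next
  case (Suc k)
  let ?l = "linear_series A l" and ?h = "linear_series A h"
  note [simp] = linear_series_carr[OF A] pow_carr
  have c: "nf n (nc_mult ?l ?h) = nf n (nc_mult ?h ?l)"
  proof -
    have E: "nf n (nc_mult (linear_series A l) (linear_series A h))
        = (\<lambda>w. \<Sum>c\<in>A. \<Sum>d\<in>A. h c * (l d * nf n (nc_mult (letter d) (letter c)) w))" for l h
      unfolding mult_linear_series(2)[of _ A h] mult_linear_series(1)[of A l]
      by (simp only: nf_sum nf_scale sum_distrib_left)
    have "nf n (nc_mult ?l ?h) = (\<lambda>w. \<Sum>c\<in>A. \<Sum>d\<in>A. h c * (l d * nf n (nc_mult (letter c) (letter d)) w))"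
      unfolding E using commute by (intro ext sum.cong refl) auto
    also have "\<dots> = nf n (nc_mult ?h ?l)"
      unfolding E by (subst sum.swap) (simp add: mult_ac)
    finally show ?thesis .
  qed
  have "nf n (nc_mult (lpow l (Suc k)) ?h) = nf n (nc_mult (lpow l k) (nc_mult ?l ?h))"
    unfolding pow_simps nc_mult_assoc ..
  also have "\<dots> = nf n (nc_mult (lpow l k) (nc_mult ?h ?l))"
    by (rule nf_mult_cong[OF refl c]) (simp_all add: nc_mult_closed)
  also have "\<dots> = nf n (nc_mult (nc_mult (lpow l k) ?h) ?l)" by (simp add: nc_mult_assoc)
  also have "\<dots> = nf n (nc_mult (nc_mult ?h (lpow l k)) ?l)"
    by (rule nf_mult_cong[OF Suc.IH refl]) (simp_all add: nc_mult_closed)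
  also have "\<dots> = nf n (nc_mult ?h (lpow l (Suc k)))" unfolding pow_simps nc_mult_assoc ..
  finally show ?case .
qed

text \<open>The product rule puts the differentiated factor at every position; only modulo the ideal
  can it always be moved to the left. So an honest derivative \<open>D\<close> is kept, and its
  normal form is computed. At \<open>k = 0\<close> the truncated exponent meets the factor
  0.\<close>

lemma pow_has_vector_derivative:
  assumes l: "\<And>c. c \<in> A ==> ((\<lambda>\<tau>. l \<tau> c) has_vector_derivative h c) (at \<tau> within S)"
  shows "\<exists>D\<in>carr n. (\<forall>w. ((\<lambda>\<tau>. lpow (l \<tau>) k w) has_vector_derivative D w) (at \<tau> within S)) \<and>
    nf n D = nf n (\<lambda>w. of_nat k * nc_mult (linear_series A h) (lpow (l \<tau>) (k - 1)) w)"
proof (induction k)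
  case 0
  show ?case unfolding pow_simps by (intro bexI[of _ "\<lambda>w. 0"]) (auto simp: nf_zero intro: carr_closed(4))
next
  case (Suc k)
  let ?L = "linear_series A (l \<tau>)" and ?h = "linear_series A h" and ?P = "\<lambda>k. lpow (l \<tau>) k"
  note [simp] = linear_series_carr[OF A] pow_carr
  obtain D where D: "D \<in> carr n" "\<And>w. ((\<lambda>\<tau>. lpow (l \<tau>) k w) has_vector_derivative D w) (at \<tau> within S)"
    "nf n D = nf n (\<lambda>w. of_nat k * nc_mult ?h (?P (k - 1)) w)" using Suc.IH by blast
  have L: "((\<lambda>\<tau>. linear_series A (l \<tau>) w) has_vector_derivative ?h w) (at \<tau> within S)" for w
    unfolding linear_series_def by (intro has_vector_derivative_sum has_vector_derivative_mult_left l)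
  have "nf n (nc_mult D ?L) = nf n (nc_mult (\<lambda>w. of_nat k * nc_mult ?h (?P (k - 1)) w) ?L)"
    by (rule nf_mult_cong[OF D(3) refl D(1)]) (auto intro!: carr_closed(3) nc_mult_closed)
  also have "\<dots> = (\<lambda>w. of_nat k * nf n (nc_mult ?h (nc_mult (?P (k - 1)) ?L)) w)"
    by (simp only: nc_mult_scale nf_scale nc_mult_assoc)
  also have "\<dots> = (\<lambda>w. of_nat k * nf n (nc_mult ?h (?P k)) w)"
    by (cases k) (simp_all add: nc_ring_simps)
  finally have 1: "nf n (nc_mult D ?L) = (\<lambda>w. of_nat k * nf n (nc_mult ?h (?P k)) w)" .
  show ?case
  proof (intro bexI conjI allI)
    show "((\<lambda>\<tau>. lpow (l \<tau>) (Suc k) w) has_vector_derivative nc_mult D ?L w + nc_mult (?P k) ?h w) (at \<tau> within S)" for w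
      unfolding pow_simps by (rule nc_mult_has_vector_derivative[OF D(2) L])
    show "nf n (\<lambda>w. nc_mult D ?L w + nc_mult (?P k) ?h w)
        = nf n (\<lambda>w. of_nat (Suc k) * nc_mult ?h (lpow (l \<tau>) (Suc k - 1)) w)"
      unfolding nf_add 1 pow_commute nf_scale by (simp add: distrib_right add.commute)
    show "(\<lambda>w. nc_mult D ?L w + nc_mult (?P k) ?h w) \<in> carr n"
      using D(1) by (intro carr_closed(1) nc_mult_closed) auto
  qed
qed

lemma exp_carr: "nc_exp n (linear_series A l) \<in> carr n"
proof -
  have "lpow l k w = 0" if "\<not> set w \<subseteq> chords n" for k w using pow_carr[of l k] that by (simp add: carr_iff)
  then show ?thesis by (auto simp: carr_iff nc_exp_def)
qed

lemma exp_Nil: "nc_exp n (linear_series A l) [] = 1"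
  by (simp add: nc_exp_def nc_ring_simps)

lemma exp_has_vector_derivative:
  assumes l: "\<And>c. c \<in> A ==> ((\<lambda>\<tau>. l \<tau> c) has_vector_derivative h c) (at \<tau> within S)"
  obtains D where "D \<in> carr n" "\<And>w. ((\<lambda>\<tau>. nc_exp n (linear_series A (l \<tau>)) w) has_vector_derivative D w) (at \<tau> within S)"
    "nf n D = nf n (nc_mult (linear_series A h) (nc_exp n (linear_series A (l \<tau>))))"
proof -
  let ?h = "linear_series A h" and ?P = "\<lambda>k. lpow (l \<tau>) k"
  have "\<forall>k. \<exists>D. D \<in> carr n \<and> (\<forall>w. ((\<lambda>\<tau>. lpow (l \<tau>) k w) has_vector_derivative D w) (at \<tau> within S)) \<and>
    nf n D = nf n (\<lambda>w. of_nat k * nc_mult ?h (?P (k - 1)) w)"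
    by (intro allI pow_has_vector_derivative[where l = l and h = h and \<tau> = \<tau> and S = S, OF l, unfolded Bex_def])
  from choice[OF this] obtain D where D: "\<And>k. D k \<in> carr n"
    "\<And>k w. ((\<lambda>\<tau>. lpow (l \<tau>) k w) has_vector_derivative D k w) (at \<tau> within S)"
    "\<And>k. nf n (D k) = nf n (\<lambda>w. of_nat k * nc_mult ?h (?P (k - 1)) w)" by blast
  define D' where "D' w = (\<Sum>k\<le>length w. 1 / fact k * D k w)" for w
  show ?thesis
  proof (rule that[of D'])
    show "D' \<in> carr n" using D(1) by (auto simp: carr_iff D'_def)
    have e: "nc_exp n a w = (\<Sum>k\<le>length w. 1 / fact k * (a [^]\<^bsub>nc_ring n\<^esub> k) w)" for a w by (simp add: nc_exp_def)
    show "((\<lambda>\<tau>. nc_exp n (linear_series A (l \<tau>)) w) has_vector_derivative D' w) (at \<tau> within S)" for w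
      unfolding e D'_def by (intro has_vector_derivative_sum has_vector_derivative_mult_right D(2))
    show "nf n D' = nf n (nc_mult ?h (nc_exp n (linear_series A (l \<tau>))))"
    proof
      fix w :: "nat set list"
      let ?N = "length w"
      have "nf n D' w = nf n (\<lambda>w. \<Sum>k\<le>?N. 1 / fact k * D k w) w" by (rule nf_cong) (simp add: D'_def)
      also have "\<dots> = (\<Sum>k\<le>?N. 1 / fact k * (of_nat k * nf n (nc_mult ?h (?P (k - 1))) w))"
        by (simp only: nf_sum nf_scale D(3))
      also have "\<dots> = (\<Sum>k<?N. 1 / fact k * nf n (nc_mult ?h (?P k)) w)"
      proof (cases ?N)
        case (Suc M)
        have "1 / fact (Suc k) * (of_nat (Suc k) * z) = 1 / fact k * z" for k and z :: complex
          by (simp add: fact_Suc del: of_nat_Suc)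
        then show ?thesis unfolding Suc sum.atMost_Suc_shift by (simp add: lessThan_Suc_atMost del: fact_Suc of_nat_Suc sum.atMost_Suc)
      qed simp
      also have "\<dots> = nf n (nc_mult ?h (\<lambda>w. \<Sum>k<?N. 1 / fact k * ?P k w)) w"
        by (simp only: nc_mult_sum nc_mult_scale nf_sum nf_scale)
      also have "\<dots> = nf n (nc_mult ?h (nc_exp n (linear_series A (l \<tau>)))) w"
      \<comment> \<open>\<open>?h\<close> has no constant term, so the coefficient at
        \<open>w'\<close> uses the exponential at words one letter shorter, and there
        \<open>nc_exp\<close> is truncated at the same power.\<close>
      proof (rule nf_cong)
        fix w' :: "nat set list" assume l: "length w' = length w"
        show "nc_mult ?h (\<lambda>w. \<Sum>k<?N. 1 / fact k * ?P k w) w' = nc_mult ?h (nc_exp n (linear_series A (l \<tau>))) w'"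
        proof (cases w')
          case Nil then show ?thesis by (simp add: mult_linear_series nc_mult_letter)
        next
          case (Cons d w'')
          then have "?N = Suc (length w'')" using l by simp
          then show ?thesis unfolding mult_linear_series(1) e by (simp add: Cons nc_mult_letter lessThan_Suc_atMost)
        qed
      qed
      finally show "nf n D' w = nf n (nc_mult ?h (nc_exp n (linear_series A (l \<tau>)))) w" .
    qed
  qed
qed

end

section \<open>The local solution and its product with the exponential\<close>

context triangulated
begin

lemma m_zero: "i \<in> \<alpha> ==> m i c (\<lambda>c. 0) = (if i = c then 1 else 0)"
  by (auto simp: m_def)

text \<open>At the vertex the coefficients \<open>m i c\<close> are Kronecker deltas, so
  integrability there, applied to 1, says that the two letters commute.\<close>

lemma letters_commute:
  assumes "i \<in> \<alpha>" "j \<in> \<alpha>"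
  shows "nf n (nc_mult (letter i) (letter j)) = nf n (nc_mult (letter j) (letter i))"
proof
  fix w
  have ij: "i \<in> chords n" "j \<in> chords n" using assms alpha by auto
  let ?one = "(\<lambda>w. if w = [] then 1 else 0) :: ncseries"
  have D: "(\<Sum>c\<in>chords n. \<Sum>d\<in>chords n. m i c (\<lambda>c. 0) * m j d (\<lambda>c. 0) * G c d) = G i j"
    if "i \<in> \<alpha>" "j \<in> \<alpha>" for i j and G :: "nat set \<Rightarrow> nat set \<Rightarrow> complex"
  proof -
    have "(\<Sum>c\<in>chords n. \<Sum>d\<in>chords n. m i c (\<lambda>c. 0) * m j d (\<lambda>c. 0) * G c d)
      = (\<Sum>c\<in>chords n. if c = i then \<Sum>d\<in>chords n. if d = j then G c d else 0 else 0)"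
    proof (rule sum.cong[OF refl])
      fix c
      show "(\<Sum>d\<in>chords n. m i c (\<lambda>c. 0) * m j d (\<lambda>c. 0) * G c d)
          = (if c = i then \<Sum>d\<in>chords n. if d = j then G c d else 0 else 0)"
        using that by (cases "c = i") (auto simp: m_zero mult_if_delta)
    qed
    also have "\<dots> = G i j" using that alpha(1) by (simp add: subset_iff)
    finally show ?thesis .
  qed
  have "Lop n i (Lop n j ?one) w = Lop n j (Lop n i ?one) w"
    using m_LL[OF assms zero_in_pd[OF rad(1)] carr_closed(5), of w] unfolding D[OF assms] D[OF assms(2,1)] .
  then show "nf n (nc_mult (letter i) (letter j)) w = nf n (nc_mult (letter j) (letter i)) w"
    using ij by (simp add: LL carr_closed(5) nc_mult_one)
qed

lemma rhs_alpha: "i \<in> \<alpha> ==> rhs i x a w = (\<Sum>c\<in>chords n. m i c x * Lop n c a w) - Rop n i a w"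
  using alpha by (auto simp: rhs_def m_zero if_distrib[of "\<lambda>x. x * _"] sum.delta cong: if_cong)

definition expart :: "(nat set \<Rightarrow> complex) \<Rightarrow> ncseries" where
  "expart l = nc_exp n (linear_series \<alpha> l)"

lemma expart: "expart l \<in> carr n" "expart l [] = 1"
  using exp_carr[OF alpha(1) letters_commute] exp_Nil[OF alpha(1) letters_commute] by (simp_all add: expart_def)

definition vertex_solution :: "((nat set \<Rightarrow> complex) \<Rightarrow> ncseries) \<Rightarrow> bool" where
  "vertex_solution f \<longleftrightarrow> (\<forall>x. f x \<in> carr n) \<and> (\<forall>w. hol \<alpha> rad (\<lambda>x. f x w)) \<and> f (\<lambda>c. 0) = (\<lambda>w. if w = [] then 1 else 0) \<and>
    (\<forall>i\<in>\<alpha>. \<forall>x\<in>pd \<alpha> rad. \<forall>w. x i * dp i (\<lambda>x. f x w) x = rhs i x (f x) w)"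

text \<open>The condition on the initial value holds for 1 because left and right multiplication by
  a letter agree on it.\<close>

lemma vertex_solution_exists: obtains f where "vertex_solution f"
proof -
  let ?one = "(\<lambda>w. if w = [] then 1 else 0) :: ncseries"
  have "rhs i (\<lambda>c. 0) ?one w = 0" if "i \<in> \<alpha>" for i w
  proof -
    have "rhs i (\<lambda>c. 0) ?one w = (\<Sum>c\<in>chords n. m i c (\<lambda>c. 0) * Lop n c ?one w) - (\<Sum>c\<in>chords n. m i c (\<lambda>c. 0) * Rop n c ?one w)"
      by (simp only: rhs_def)
    then show ?thesis by (simp only: Lop_def Rop_def nc_mult_one diff_self)
  qed
  then have r0: "\<And>i w. i \<in> \<alpha> ==> rhs i (\<lambda>c. 0) ?one w = 0" .
  show ?thesis
  proof (rule chart_solution[OF carr_closed(5)[of n] r0])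
    fix f
    assume "\<And>x. f x \<in> carr n" "\<And>w. hol \<alpha> rad (\<lambda>x. f x w)" "f (\<lambda>c. 0) = ?one"
      "\<And>i x w. i \<in> \<alpha> ==> x \<in> pd \<alpha> rad ==> x i * dp i (\<lambda>x. f x w) x = rhs i x (f x) w"
    then have "vertex_solution f" by (simp add: vertex_solution_def)
    then show thesis by (rule that)
  qed
qed

text \<open>The point with logarithmic coordinates \<open>l\<close>. In these the positive part of
  the polydisc is convex, and Euler operators become ordinary derivatives.\<close>

definition expx :: "(nat set \<Rightarrow> real) \<Rightarrow> nat set \<Rightarrow> complex" where
  "expx l c = (if c \<in> \<alpha> then complex_of_real (exp (l c)) else 0)"

lemma expx_has_vector_derivative:
  assumes F: "hol \<alpha> rad F" and S: "\<And>\<tau>. \<tau> \<in> S ==> expx (\<lambda>c. a c + \<tau> * h c) \<in> pd \<alpha> rad" and \<tau>: "\<tau> \<in> S"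
  shows "((\<lambda>\<tau>. F (expx (\<lambda>c. a c + \<tau> * h c))) has_vector_derivative
    (\<Sum>i\<in>\<alpha>. complex_of_real (h i) * (expx (\<lambda>c. a c + \<tau> * h c) i * dp i F (expx (\<lambda>c. a c + \<tau> * h c))))) (at \<tau> within S)"
proof -
  let ?x = "\<lambda>\<tau>. expx (\<lambda>c. a c + \<tau> * h c)"
  have "((\<lambda>\<tau>. F (?x \<tau>)) has_derivative (\<lambda>t. \<Sum>i\<in>\<alpha>. dp i F (?x \<tau>) * (of_real t * (of_real (h i) * ?x \<tau> i)))) (at \<tau> within S)"
  proof (rule hol_chain[where \<gamma> = ?x, OF F S[OF \<tau>]])
    show "\<forall>\<^sub>F \<tau> in at \<tau> within S. ?x \<tau> \<in> pd \<alpha> rad" using S by (auto simp: eventually_at_filter intro!: always_eventually)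
    show "((\<lambda>\<tau>. ?x \<tau> i) has_derivative (\<lambda>t. of_real t * (of_real (h i) * ?x \<tau> i))) (at \<tau> within S)" if "i \<in> \<alpha>" for i
    proof -
      have "((\<lambda>\<tau>. exp (a i + \<tau> * h i)) has_derivative (\<lambda>t. t * (h i * exp (a i + \<tau> * h i)))) (at \<tau> within S)"
        by (auto intro!: derivative_eq_intros)
      from has_derivative_of_real[OF this, where ?'a = complex] show ?thesis using that by (simp add: expx_def)
    qed
  qed
  then show ?thesis by (simp add: has_vector_derivative_def scaleR_conv_of_real sum_distrib_left mult_ac)
qed

text \<open>The product solves \<open>dQ = \<Omega> Q\<close>: the exponential cancels the right action of the polar part.\<close>

lemma product_has_vector_derivative:
  assumes f: "vertex_solution f" and S: "\<And>\<tau>. \<tau> \<in> S ==> expx (\<lambda>c. a c + \<tau> * h c) \<in> pd \<alpha> rad" and \<tau>: "\<tau> \<in> S"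
  defines "l \<equiv> \<lambda>\<tau> c. a c + \<tau> * h c"
  defines "Q \<equiv> \<lambda>\<tau>. nf n (nc_mult (f (expx (l \<tau>))) (expart (\<lambda>c. of_real (l \<tau> c))))"
  shows "((\<lambda>\<tau>. Q \<tau> w) has_vector_derivative
    (\<Sum>c\<in>chords n. (\<Sum>i\<in>\<alpha>. of_real (h i) * m i c (expx (l \<tau>))) * Lop n c (Q \<tau>) w)) (at \<tau> within S)"
proof -
  let ?x = "expx (l \<tau>)" let ?e = "expart (\<lambda>c. of_real (l \<tau> c))" let ?h = "\<lambda>i. complex_of_real (h i)"
  have fc: "f x \<in> carr n" for x using f by (simp add: vertex_solution_def)
  note ec = expart(1)
  have sub: "c \<in> \<alpha> ==> c \<in> chords n" for c using alpha by auto
  have "((\<lambda>\<tau>. complex_of_real (l \<tau> c)) has_vector_derivative ?h c) (at \<tau> within S)" for c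
    unfolding l_def has_vector_derivative_def by (auto intro!: derivative_eq_intros simp: scaleR_conv_of_real)
  then obtain e' where e': "e' \<in> carr n"
    "\<And>w. ((\<lambda>\<tau>. expart (\<lambda>c. of_real (l \<tau> c)) w) has_vector_derivative e' w) (at \<tau> within S)"
    "nf n e' = nf n (nc_mult (linear_series \<alpha> ?h) ?e)"
    unfolding expart_def using exp_has_vector_derivative[OF alpha(1) letters_commute, of "\<lambda>\<tau> c. of_real (l \<tau> c)" ?h \<tau> S] by blast
  define f' where "f' w = (\<Sum>i\<in>\<alpha>. ?h i * rhs i ?x (f ?x) w)" for w
  have f': "((\<lambda>\<tau>. f (expx (l \<tau>)) w) has_vector_derivative f' w) (at \<tau> within S)" for w
  proof -
    have "hol \<alpha> rad (\<lambda>x. f x w)" using f by (simp add: vertex_solution_def)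
    from expx_has_vector_derivative[OF this S \<tau>] f S[OF \<tau>] show ?thesis
      by (simp add: l_def f'_def vertex_solution_def)
  qed
  have "((\<lambda>\<tau>. Q \<tau> w) has_vector_derivative nf n (\<lambda>w. nc_mult f' ?e w + nc_mult (f ?x) e' w) w) (at \<tau> within S)"
    unfolding Q_def
    by (rule functional_has_vector_derivative[OF finite_functional_nf]) (rule nc_mult_has_vector_derivative[OF f' e'(2)])
  moreover have "nf n (\<lambda>w. nc_mult f' ?e w + nc_mult (f ?x) e' w) w
      = (\<Sum>c\<in>chords n. (\<Sum>i\<in>\<alpha>. ?h i * m i c ?x) * Lop n c (Q \<tau>) w)"
  proof -
    have L: "nf n (nc_mult (Lop n c (f ?x)) ?e) = Lop n c (Q \<tau>)" if "c \<in> chords n" for c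
      unfolding Lop_def Q_def nf_mult(1)[OF nc_mult_closed[OF letter_carr[OF that] fc] ec] nc_mult_assoc
        nf_mult(2)[OF letter_carr[OF that] nc_mult_closed[OF fc ec]] ..
    have R: "nf n (nc_mult (Rop n i (f ?x)) ?e) = nf n (nc_mult (f ?x) (nc_mult (letter i) ?e))" if "i \<in> \<alpha>" for i
      unfolding Rop_def nf_mult(1)[OF nc_mult_closed[OF fc letter_carr[OF sub[OF that]]] ec] nc_mult_assoc ..
    have "f' = (\<lambda>w. \<Sum>i\<in>\<alpha>. ?h i * ((\<Sum>c\<in>chords n. m i c ?x * Lop n c (f ?x) w) - Rop n i (f ?x) w))"
      unfolding f'_def[abs_def] by (intro ext sum.cong refl) (simp add: rhs_alpha)
    then have "nf n (nc_mult f' ?e) w = (\<Sum>i\<in>\<alpha>. ?h i * ((\<Sum>c\<in>chords n. m i c ?x * nf n (nc_mult (Lop n c (f ?x)) ?e) w)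
        - nf n (nc_mult (Rop n i (f ?x)) ?e) w))"
      by (simp only: nc_mult_sum nc_mult_scale nc_mult_diff nf_sum nf_scale nf_diff)
    also have "\<dots> = (\<Sum>i\<in>\<alpha>. ?h i * ((\<Sum>c\<in>chords n. m i c ?x * Lop n c (Q \<tau>) w)
        - nf n (nc_mult (f ?x) (nc_mult (letter i) ?e)) w))"
      by (simp add: L R)
    finally have 1: "nf n (nc_mult f' ?e) w = \<dots>" .
    have "nf n (nc_mult (f ?x) e') = nf n (nc_mult (f ?x) (nc_mult (linear_series \<alpha> ?h) ?e))"
      by (rule nf_mult_cong[OF refl e'(3) fc fc e'(1)]) (intro nc_mult_closed linear_series_carr alpha ec)
    then have 2: "nf n (nc_mult (f ?x) e') w = (\<Sum>i\<in>\<alpha>. ?h i * nf n (nc_mult (f ?x) (nc_mult (letter i) ?e)) w)"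
      by (simp only: mult_linear_series nc_mult_sum nc_mult_scale nf_sum nf_scale)
    have "(\<Sum>c\<in>chords n. (\<Sum>i\<in>\<alpha>. ?h i * m i c ?x) * Lop n c (Q \<tau>) w)
        = (\<Sum>i\<in>\<alpha>. ?h i * (\<Sum>c\<in>chords n. m i c ?x * Lop n c (Q \<tau>) w))"
      unfolding sum_distrib_left sum_distrib_right by (subst sum.swap) (simp add: mult.assoc)
    then show ?thesis unfolding nf_add 1 2 by (simp add: right_diff_distrib sum_subtractf)
  qed
  ultimately show ?thesis by simp
qed

end

section \<open>The quotient described by normal forms\<close>

lemma mem_B_class: "b \<in> B_class n a \<longleftrightarrow> (\<lambda>w. b w - a w) \<in> idl n"
proof
  assume "b \<in> B_class n a"
  then obtain h where "h \<in> idl n" "b = (\<lambda>w. h w + a w)"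
    by (auto simp: B_class_def a_r_coset_def' nc_ring_simps)
  then show "(\<lambda>w. b w - a w) \<in> idl n" by simp
next
  assume "(\<lambda>w. b w - a w) \<in> idl n"
  then show "b \<in> B_class n a"
    by (auto simp: B_class_def a_r_coset_def' nc_ring_simps intro!: bexI[of _ "\<lambda>w. b w - a w"])
qed

lemma self_B_class: "a \<in> B_class n a"
  by (simp add: mem_B_class idl_zero)

lemma B_class_eq: "B_class n a = B_class n b \<longleftrightarrow> (\<lambda>w. a w - b w) \<in> idl n"
proof
  assume "B_class n a = B_class n b"
  then show "(\<lambda>w. a w - b w) \<in> idl n" using self_B_class[of a n] by (simp add: mem_B_class)
next
  assume ab: "(\<lambda>w. a w - b w) \<in> idl n"
  have "(\<lambda>w. c w - a w) \<in> idl n \<longleftrightarrow> (\<lambda>w. c w - b w) \<in> idl n" for c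
    using idl_add[OF _ ab, of "\<lambda>w. c w - a w"] idl_diff[OF _ ab, of "\<lambda>w. c w - b w"] by auto
  then show "B_class n a = B_class n b" by (auto simp: mem_B_class)
qed

lemma B_class_eq_nf: "a \<in> carr n ==> b \<in> carr n ==> B_class n a = B_class n b \<longleftrightarrow> nf n a = nf n b"
  by (simp add: B_class_eq nf_eq_iff)

lemma B_class_nf: "a \<in> carr n ==> B_class n (nf n a) = B_class n a"
  by (subst B_class_eq_nf) (simp_all add: nf_carr nf_nf)

lemma carrier_B_hat: "carrier (B_hat n) = B_class n ` carr n"
  by (auto simp: B_hat_def FactRing_def A_RCOSETS_def' B_class_def)

lemma mult_B_class: "a \<in> carr n ==> b \<in> carr n ==> B_class n a \<otimes>\<^bsub>B_hat n\<^esub> B_class n b = B_class n (nc_mult a b)"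
  using ideal.rcoset_mult_add[OF braid_ideal_ideal, of a n b]
  by (simp add: B_hat_def FactRing_def B_class_def nc_ring_simps)

lemma one_B_hat: "\<one>\<^bsub>B_hat n\<^esub> = B_class n (\<lambda>w. if w = [] then 1 else 0)"
  by (simp add: B_hat_def FactRing_def B_class_def nc_ring_simps)

lemma B_hat_representative:
  assumes "X \<in> carrier (B_hat n)" "a \<in> X"
  shows "a \<in> carr n" "X = B_class n a"
proof -
  obtain b where b: "b \<in> carr n" "X = B_class n b" using assms(1) unfolding carrier_B_hat by blast
  have ab: "(\<lambda>w. a w - b w) \<in> idl n" using assms(2) by (simp add: b mem_B_class)
  show "X = B_class n a" using ab unfolding b(2) by (simp add: B_class_eq[of n a b, THEN iffD2])
  show "a \<in> carr n" using carr_closed(1)[OF idl_carr[OF ab] b(1)] by simp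
qed

lemma has_differential_scale:
  assumes "has_differential C p E f D e"
  shows "has_differential C p E (\<lambda>e. k * f e) (\<lambda>c. k * D c) e"
  unfolding has_differential_def
proof (intro allI impI)
  fix \<epsilon> :: real assume \<epsilon>: "0 < \<epsilon>"
  have "0 < \<epsilon> / (cmod k + 1)" using \<epsilon> by (intro divide_pos_pos) (auto intro: add_nonneg_pos)
  then have "\<forall>\<^sub>F e' in at e within E. cmod (f e' - f e - (\<Sum>c\<in>C. D c * (p e' c - p e c)))
      \<le> \<epsilon> / (cmod k + 1) * (\<Sum>c\<in>C. cmod (p e' c - p e c))"
    using assms unfolding has_differential_def by blast
  then show "\<forall>\<^sub>F e' in at e within E. cmod (k * f e' - k * f e - (\<Sum>c\<in>C. k * D c * (p e' c - p e c)))
      \<le> \<epsilon> * (\<Sum>c\<in>C. cmod (p e' c - p e c))"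
  proof eventually_elim
    case (elim e')
    define S where "S = (\<Sum>c\<in>C. cmod (p e' c - p e c))"
    have S: "0 \<le> S" by (simp add: S_def sum_nonneg)
    have "k * f e' - k * f e - (\<Sum>c\<in>C. k * D c * (p e' c - p e c))
        = k * (f e' - f e - (\<Sum>c\<in>C. D c * (p e' c - p e c)))"
      by (simp add: right_diff_distrib sum_distrib_left mult.assoc)
    then have "cmod (k * f e' - k * f e - (\<Sum>c\<in>C. k * D c * (p e' c - p e c)))
        = cmod k * cmod (f e' - f e - (\<Sum>c\<in>C. D c * (p e' c - p e c)))" by (simp only: norm_mult)
    also have "\<dots> \<le> (cmod k + 1) * (\<epsilon> / (cmod k + 1) * S)"
      using elim by (intro mult_mono) (auto simp: S_def)
    also have "\<dots> = \<epsilon> * S" using norm_ge_zero[of k] by (simp add: add_nonneg_pos order_less_imp_not_eq2)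
    finally show ?case by (simp add: S_def)
  qed
qed

lemma has_differential_add:
  assumes "has_differential C p E f D e" "has_differential C p E g D' e"
  shows "has_differential C p E (\<lambda>e. f e + g e) (\<lambda>c. D c + D' c) e"
  using has_differential_diff[OF assms(1) has_differential_scale[OF assms(2), of "-1"]] by simp

lemma has_differential_const: "has_differential C p E (\<lambda>e. k) (\<lambda>c. 0) e"
  unfolding has_differential_def by (auto simp: sum_nonneg)

lemma has_differential_functional:
  assumes "finite_functional T" "\<And>v. has_differential C p E (\<lambda>e. f e v) (\<lambda>c. D c v) e"
  shows "has_differential C p E (\<lambda>e. T (f e)) (\<lambda>c. T (D c)) e"
proof -
  obtain V t where V: "finite V" "T = (\<lambda>a. \<Sum>v\<in>V. t v * a v)" using assms(1) unfolding finite_functional_def by blast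
  show ?thesis unfolding V(2) using V(1)
  proof (induction V)
    case empty show ?case using has_differential_const[of C p E 0 e] by simp
  next
    case (insert v V)
    then show ?case using has_differential_add[OF has_differential_scale[OF assms(2)[of v], of "t v"] insert.IH]
      by simp
  qed
qed

lemma has_differential_cong:
  assumes "has_differential C p E f D e" "\<And>c. c \<in> C ==> D c = D' c"
  shows "has_differential C p E f D' e"
  using assms unfolding has_differential_def by (simp cong: sum.cong)

lemma has_differential_continuous:
  assumes d: "has_differential C p E g D e" and C: "finite C"
    and p: "\<And>c. c \<in> C ==> ((\<lambda>e'. p e' c) \<longlongrightarrow> p e c) (at e within E)"
  shows "(g \<longlongrightarrow> g e) (at e within E)"
proof -
  define S where "S e' = (\<Sum>c\<in>C. cmod (p e' c - p e c))" for e'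
  have c0: "((\<lambda>e'. cmod (p e' c - p e c)) \<longlongrightarrow> 0) (at e within E)" if "c \<in> C" for c
    using p[OF that] by (simp add: LIM_zero tendsto_norm_zero)
  have S: "(S \<longlongrightarrow> 0) (at e within E)"
    unfolding S_def using tendsto_sum[of C "\<lambda>c e'. cmod (p e' c - p e c)" "\<lambda>c. 0"] c0 by simp
  have D: "((\<lambda>e'. \<Sum>c\<in>C. D c * (p e' c - p e c)) \<longlongrightarrow> (\<Sum>c\<in>C. D c * 0)) (at e within E)"
    by (intro tendsto_sum tendsto_mult tendsto_const) (use p LIM_zero in blast)
  have "((\<lambda>e'. g e' - g e - (\<Sum>c\<in>C. D c * (p e' c - p e c))) \<longlongrightarrow> 0) (at e within E)"
  proof (rule Lim_null_comparison[OF _ S])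
    show "\<forall>\<^sub>F e' in at e within E. norm (g e' - g e - (\<Sum>c\<in>C. D c * (p e' c - p e c))) \<le> S e'"
      using d[unfolded has_differential_def, rule_format, of 1] by (simp add: S_def)
  qed
  from tendsto_add[OF this D] have "((\<lambda>e'. g e' - g e) \<longlongrightarrow> 0) (at e within E)" by simp
  then show ?thesis by (rule LIM_zero_cancel)
qed

text \<open>In the quotient neither the representative nor the coefficients of its differential are
  unique. Normal forms fix the representative and turn the membership of \<open>D c\<close> in a
  class into an equation.\<close>

lemma solves_on_normal_form:
  assumes L: "solves_on n p E L"
  obtains F where "\<And>e. e \<in> E ==> F e \<in> carr n" "\<And>e. e \<in> E ==> nf n (F e) = F e" "\<And>e. e \<in> E ==> L e = B_class n (F e)"
    "\<And>e w. e \<in> E ==> has_differential (chords n) p E (\<lambda>e. F e w) (\<lambda>c. Lop n c (F e) w / p e c) e"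
proof -
  obtain f where LE: "L \<in> E \<rightarrow> carrier (B_hat n)" and f: "\<And>e. e \<in> E ==> f e \<in> L e"
    and D: "\<And>e. e \<in> E ==> \<exists>D. (\<forall>c\<in>chords n. D c \<in> Omega_coeff n (p e) c \<otimes>\<^bsub>B_hat n\<^esub> L e) \<and>
           (\<forall>w. has_differential (chords n) p E (\<lambda>e. f e w) (\<lambda>c. D c w) e)"
    using L unfolding solves_on_def by blast
  have fc: "f e \<in> carr n" "L e = B_class n (f e)" if "e \<in> E" for e
    using B_hat_representative[of "L e" n "f e"] LE f[OF that] that by auto
  show ?thesis
  proof (rule that[of "\<lambda>e. nf n (f e)"])
    show "nf n (f e) \<in> carr n" for e by (rule nf_carr)
    show "nf n (nf n (f e)) = nf n (f e)" "L e = B_class n (nf n (f e))" if "e \<in> E" for e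
      using fc[OF that] by (simp_all add: nf_nf B_class_nf)
    fix e w assume e: "e \<in> E"
    obtain D where D: "\<And>c. c \<in> chords n ==> D c \<in> Omega_coeff n (p e) c \<otimes>\<^bsub>B_hat n\<^esub> L e"
      "\<And>w. has_differential (chords n) p E (\<lambda>e. f e w) (\<lambda>c. D c w) e" using D[OF e] by blast
    have "nf n (D c) w = Lop n c (nf n (f e)) w / p e c" if c: "c \<in> chords n" for c
    proof -
      let ?a = "\<lambda>w. 1 / p e c * letter c w"
      have a: "?a \<in> carr n" by (intro carr_closed(3) letter_carr c)
      have "D c \<in> B_class n (nc_mult ?a (f e))"
        using D(1)[OF c] mult_B_class[OF a fc(1)[OF e]] by (simp add: fc[OF e] Omega_coeff_def)
      then have X: "(\<lambda>w. D c w - nc_mult ?a (f e) w) \<in> idl n" by (simp only: mem_B_class)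
      have "nf n (\<lambda>w. D c w - nc_mult ?a (f e) w) = (\<lambda>w. 0)" by (rule nf_idl(2)[OF idl_carr[OF X] X])
      then have "nf n (D c) w = nf n (nc_mult ?a (f e)) w" by (simp only: nf_diff fun_eq_iff) simp
      also have "\<dots> = 1 / p e c * nf n (nc_mult (letter c) (f e)) w" by (simp only: nc_mult_scale nf_scale)
      also have "nf n (nc_mult (letter c) (f e)) = Lop n c (nf n (f e))"
        by (simp add: Lop_def nf_mult(2) letter_carr c fc[OF e])
      finally show ?thesis by simp
    qed
    then show "has_differential (chords n) p E (\<lambda>e. nf n (f e) w) (\<lambda>c. Lop n c (nf n (f e)) w / p e c) e"
      by (rule has_differential_cong[OF has_differential_functional[OF finite_functional_nf D(2)]])
  qed
qed

lemma solves_on_class: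
  assumes F: "\<And>e. F e \<in> carr n"
    and d: "\<And>e w. e \<in> E ==> has_differential (chords n) p E (\<lambda>e. F e w) (\<lambda>c. Lop n c (F e) w / p e c) e"
  shows "solves_on n p E (restrict (\<lambda>e. B_class n (F e)) E)"
  unfolding solves_on_def
proof (intro conjI exI[of _ F] ballI)
  show "restrict (\<lambda>e. B_class n (F e)) E \<in> E \<rightarrow> carrier (B_hat n)" using F by (auto simp: carrier_B_hat)
  show "F e \<in> restrict (\<lambda>e. B_class n (F e)) E e" if "e \<in> E" for e using that by (simp add: self_B_class)
  fix e assume e: "e \<in> E"
  have "(\<lambda>w. Lop n c (F e) w / p e c) \<in> Omega_coeff n (p e) c \<otimes>\<^bsub>B_hat n\<^esub> B_class n (F e)" if c: "c \<in> chords n" for c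
  proof -
    let ?a = "\<lambda>w. 1 / p e c * letter c w"
    have a: "?a \<in> carr n" by (intro carr_closed(3) letter_carr c)
    have "(\<lambda>w. -1 / p e c * (nc_mult (letter c) (F e) w - Lop n c (F e) w)) \<in> idl n"
      unfolding Lop_def by (intro idl_scale nf_idl(1) nc_mult_closed letter_carr c F)
    then have "(\<lambda>w. Lop n c (F e) w / p e c) \<in> B_class n (nc_mult ?a (F e))"
      unfolding mem_B_class nc_mult_scale by (simp add: diff_divide_distrib)
    then show ?thesis using mult_B_class[OF a F] by (simp add: Omega_coeff_def)
  qed
  then show "\<exists>D. (\<forall>c\<in>chords n. D c \<in> Omega_coeff n (p e) c \<otimes>\<^bsub>B_hat n\<^esub> restrict (\<lambda>e. B_class n (F e)) E e) \<and>
      (\<forall>w. has_differential (chords n) p E (\<lambda>e. F e w) (\<lambda>c. D c w) e)"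
    using d[OF e] e by (intro exI[of _ "\<lambda>c w. Lop n c (F e) w / p e c"]) auto
qed

context triangulated
begin

lemma X_open_near:
  assumes u: "u \<in> X_open n" "cpx u \<in> near" "cpx u \<in> M_delta n"
  shows "restr (cpx u) = expx (\<lambda>c. ln (u c))" "\<Phi> (restr (cpx u)) = cpx u" "restr (cpx u) \<in> pd \<alpha> rad"
    "c \<in> \<alpha> ==> 0 < u c" "c \<in> \<alpha> ==> ln (u c) < ln rad"
proof -
  show pos: "0 < u c" if "c \<in> \<alpha>" for c using u(1) that alpha by (auto simp: X_open_def)
  show "restr (cpx u) = expx (\<lambda>c. ln (u c))" using pos by (auto simp: restr_def expx_def cpx_def)
  show "\<Phi> (restr (cpx u)) = cpx u" "restr (cpx u) \<in> pd \<alpha> rad" using near_eq_Phi[OF u(3,2)] by auto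
  show "ln (u c) < ln rad" if "c \<in> \<alpha>"
    using u(2) that pos[OF that] rad(1) by (auto simp: near_def cpx_def)
qed

definition product_at :: "((nat set \<Rightarrow> complex) \<Rightarrow> ncseries) \<Rightarrow> (nat set \<Rightarrow> real) \<Rightarrow> ncseries" where
  "product_at f u = nf n (nc_mult (f (restr (cpx u))) (expart (\<lambda>c. complex_of_real (ln (u c)))))"

text \<open>Both sides satisfy the same linear system along the segment from \<open>u0\<close> to
  \<open>u1\<close> in logarithmic coordinates, lifted by \<open>s\<close>, and they agree at its
  start. By induction on length their difference has derivative 0.\<close>

lemma matching:
  fixes E :: "'e::topological_space set"
  assumes s: "continuous_on (X_open n) s" "\<And>u. u \<in> X_open n ==> s u \<in> E" "\<And>u. u \<in> X_open n ==> p (s u) = cpx u"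
    and M: "\<And>u. u \<in> X_open n ==> cpx u \<in> M_delta n"
    and F: "\<And>e w. e \<in> E ==> has_differential (chords n) p E (\<lambda>e. F e w) (\<lambda>c. Lop n c (F e) w / p e c) e"
    and f: "vertex_solution f" and u0: "u0 \<in> X_open n" "cpx u0 \<in> near" and u1: "u1 \<in> X_open n" "cpx u1 \<in> near"
    and init: "F (s u0) = product_at f u0"
  shows "F (s u1) = product_at f u1"
proof -
  define S where "S = {0..1::real}"
  define h where "h c = ln (u1 c) - ln (u0 c)" for c
  define l where "l \<tau> c = ln (u0 c) + \<tau> * h c" for \<tau> :: real and c
  define x where "x \<tau> = expx (l \<tau>)" for \<tau>
  define Q where "Q \<tau> = nf n (nc_mult (f (x \<tau>)) (expart (\<lambda>c. of_real (l \<tau> c))))" for \<tau>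
  define U where "U \<tau> c = Re (\<Phi> (x \<tau>) c)" for \<tau> c
  note X0 = X_open_near[OF u0 M[OF u0(1)]] and X1 = X_open_near[OF u1 M[OF u1(1)]]
  \<comment> \<open>Logarithms of both ends lie below \<open>ln rad\<close>, so by convexity the
    segment stays in the polydisc.\<close>
  have lr: "exp (l \<tau> c) < rad" if "c \<in> \<alpha>" "\<tau> \<in> S" for \<tau> c
  proof -
    have "(1 - \<tau>) * ln (u0 c) + \<tau> * ln (u1 c) < ln rad"
      using that X0(5) X1(5) by (intro convex_bound_lt) (auto simp: S_def)
    moreover have "(1 - \<tau>) * ln (u0 c) + \<tau> * ln (u1 c) = l \<tau> c" by (simp add: l_def h_def algebra_simps)
    ultimately have "exp (l \<tau> c) < exp (ln rad)" by (simp only: exp_less_cancel_iff)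
    then show ?thesis using rad(1) by simp
  qed
  have xp: "x \<tau> \<in> pd \<alpha> rad" if "\<tau> \<in> S" for \<tau> using lr[OF _ that] by (auto simp: pd_def x_def expx_def)
  have U: "U \<tau> \<in> X_open n" "cpx (U \<tau>) = \<Phi> (x \<tau>)" if \<tau>: "\<tau> \<in> S" for \<tau>
  proof -
    define y where "y c = (if c \<in> \<alpha> then exp (l \<tau> c) else 0)" for c
    have y: "cpx y = x \<tau>" by (auto simp: cpx_def y_def x_def expx_def)
    obtain u where u: "u \<in> X_open n" "cpx u = \<Phi> (x \<tau>)"
      using Phi_positive[of y] xp[OF \<tau>] unfolding y by (auto simp: y_def)
    have "u = U \<tau>" unfolding U_def u(2)[symmetric] by (simp add: cpx_def fun_eq_iff)
    then show "U \<tau> \<in> X_open n" "cpx (U \<tau>) = \<Phi> (x \<tau>)" using u by auto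
  qed
  have ends: "U 0 = u0" "U 1 = u1" "Q 0 = product_at f u0" "Q 1 = product_at f u1"
  proof -
    have l01: "l 0 = (\<lambda>c. ln (u0 c))" "l 1 = (\<lambda>c. ln (u1 c))" by (auto simp: l_def h_def)
    then have x01: "x 0 = restr (cpx u0)" "x 1 = restr (cpx u1)" by (simp_all add: x_def X0(1) X1(1))
    have "U 0 c = u0 c" "U 1 c = u1 c" for c unfolding U_def x01 X0(2) X1(2) by (simp_all add: cpx_def)
    then show "U 0 = u0" "U 1 = u1" by blast+
    show "Q 0 = product_at f u0" "Q 1 = product_at f u1" by (simp_all add: Q_def product_at_def x01 l01)
  qed
  define \<mu> where "\<mu> \<tau> c = (\<Sum>i\<in>\<alpha>. of_real (h i) * m i c (x \<tau>))" for \<tau> c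
  have dPhi: "((\<lambda>\<tau>. \<Phi> (x \<tau>) c) has_vector_derivative \<mu> \<tau> c * \<Phi> (x \<tau>) c) (at \<tau> within S)" if c: "c \<in> chords n" and \<tau>: "\<tau> \<in> S" for \<tau> c
  proof -
    have "expx (\<lambda>c. ln (u0 c) + \<tau> * h c) \<in> pd \<alpha> rad" if "\<tau> \<in> S" for \<tau> using xp[OF that] by (simp add: x_def l_def[abs_def])
    from expx_has_vector_derivative[OF hol_Phi[OF c] this \<tau>]
    have "((\<lambda>\<tau>. \<Phi> (x \<tau>) c) has_vector_derivative (\<Sum>i\<in>\<alpha>. of_real (h i) * (x \<tau> i * dp i (\<lambda>x. \<Phi> x c) (x \<tau>)))) (at \<tau> within S)"
      by (simp add: x_def l_def[abs_def])
    moreover have "(\<Sum>i\<in>\<alpha>. of_real (h i) * (x \<tau> i * dp i (\<lambda>x. \<Phi> x c) (x \<tau>))) = \<mu> \<tau> c * \<Phi> (x \<tau>) c"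
      unfolding \<mu>_def sum_distrib_right by (intro sum.cong refl) (simp add: m_eq[OF _ c xp[OF \<tau>]] mult.assoc)
    ultimately show ?thesis by simp
  qed
  have Uc: "continuous_on S U"
  proof (rule continuous_on_coordinatewise_then_product)
    fix c
    have "continuous_on S (\<lambda>\<tau>. \<Phi> (x \<tau>) c)"
    proof (cases "c \<in> chords n")
      case True
      show ?thesis unfolding continuous_on_eq_continuous_within
        by (intro ballI has_vector_derivative_continuous[OF dPhi[OF True]])
    next
      case False then show ?thesis by (simp add: Phi_off)
    qed
    then show "continuous_on S (\<lambda>\<tau>. U \<tau> c)" unfolding U_def by (intro continuous_intros)
  qed
  have sc: "continuous_on S (\<lambda>\<tau>. s (U \<tau>))" using U(1) by (intro continuous_on_compose2[OF s(1) Uc]) auto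
  have dF: "((\<lambda>\<tau>. F (s (U \<tau>)) w) has_vector_derivative (\<Sum>c\<in>chords n. \<mu> \<tau> c * Lop n c (F (s (U \<tau>))) w)) (at \<tau> within S)"
    if \<tau>: "\<tau> \<in> S" for \<tau> w
  proof -
    have "((\<lambda>\<tau>. F (s (U \<tau>)) w) has_derivative
       (\<lambda>t. \<Sum>c\<in>chords n. Lop n c (F (s (U \<tau>))) w / p (s (U \<tau>)) c * (t *\<^sub>R (\<mu> \<tau> c * \<Phi> (x \<tau>) c)))) (at \<tau> within S)"
    proof (rule has_differential_chain[OF F])
      show "s (U \<tau>) \<in> E" by (rule s(2)[OF U(1)[OF \<tau>]])
      show "\<forall>\<^sub>F \<tau> in at \<tau> within S. s (U \<tau>) \<in> E" using s(2) U(1) by (auto simp: eventually_at_filter intro!: always_eventually)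
      show "((\<lambda>\<tau>. s (U \<tau>)) \<longlongrightarrow> s (U \<tau>)) (at \<tau> within S)" using sc \<tau> by (simp add: continuous_on)
      fix c assume c: "c \<in> chords n"
      show "((\<lambda>\<tau>. p (s (U \<tau>)) c) has_derivative (\<lambda>t. t *\<^sub>R (\<mu> \<tau> c * \<Phi> (x \<tau>) c))) (at \<tau> within S)"
        by (rule has_derivative_transform[OF \<tau> _ dPhi[OF c \<tau>, unfolded has_vector_derivative_def]]) (simp add: s(3) U)
    qed simp
    moreover have R: "Lop n c (F (s (U \<tau>))) w / p (s (U \<tau>)) c * (t *\<^sub>R (\<mu> \<tau> c * \<Phi> (x \<tau>) c))
        = t *\<^sub>R (\<mu> \<tau> c * Lop n c (F (s (U \<tau>))) w)" if c: "c \<in> chords n" for t c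
    proof -
      have "U \<tau> c \<noteq> 0" using U(1)[OF \<tau>] c by (auto simp: X_open_def)
      then have "\<Phi> (x \<tau>) c \<noteq> 0" unfolding U(2)[OF \<tau>, symmetric] by (simp add: cpx_def)
      then show ?thesis using \<tau> U by (simp add: s(3) scaleR_conv_of_real)
    qed
    moreover have "(\<lambda>t. \<Sum>c\<in>chords n. Lop n c (F (s (U \<tau>))) w / p (s (U \<tau>)) c * (t *\<^sub>R (\<mu> \<tau> c * \<Phi> (x \<tau>) c)))
        = (\<lambda>t. t *\<^sub>R (\<Sum>c\<in>chords n. \<mu> \<tau> c * Lop n c (F (s (U \<tau>))) w))"
      unfolding scaleR_sum_right by (intro ext sum.cong refl R)
    ultimately show ?thesis by (simp only: has_vector_derivative_def)
  qed
  have dQ: "((\<lambda>\<tau>. Q \<tau> w) has_vector_derivative (\<Sum>c\<in>chords n. \<mu> \<tau> c * Lop n c (Q \<tau>) w)) (at \<tau> within S)"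
    if \<tau>: "\<tau> \<in> S" for \<tau> w
  proof -
    have "expx (\<lambda>c. ln (u0 c) + \<tau> * h c) \<in> pd \<alpha> rad" if "\<tau> \<in> S" for \<tau> using xp[OF that] by (simp add: x_def l_def[abs_def])
    from product_has_vector_derivative[OF f this \<tau>, of w] show ?thesis
      unfolding Q_def x_def l_def[abs_def] \<mu>_def by simp
  qed
  have eq: "\<forall>\<tau>\<in>S. F (s (U \<tau>)) w = Q \<tau> w" for w
  proof (induction w rule: length_induct)
    case (1 w)
    define d where "d \<tau> = F (s (U \<tau>)) w - Q \<tau> w" for \<tau>
    have "(d has_derivative (\<lambda>t. 0)) (at \<tau> within S)" if \<tau>: "\<tau> \<in> S" for \<tau>
    proof -
      have "Lop n c (F (s (U \<tau>))) w = Lop n c (Q \<tau>) w" for c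
        by (rule Lop_cong(1)) (use 1 \<tau> in auto)
      then show ?thesis
        using has_vector_derivative_diff[OF dF[OF \<tau>, of w] dQ[OF \<tau>, of w]] by (simp add: has_vector_derivative_def d_def[abs_def])
    qed
    then obtain k where k: "\<forall>\<tau>\<in>S. d \<tau> = k"
      using has_derivative_zero_constant[of S d] by (auto simp: S_def)
    have "d 0 = 0" using init by (simp add: d_def ends)
    moreover have "d 0 = k" using k by (simp add: S_def)
    ultimately have "k = 0" by simp
    then show ?case using k by (simp add: d_def)
  qed
  have "F (s (U 1)) w = Q 1 w" for w using bspec[OF eq[of w], of 1] by (simp add: S_def)
  then show ?thesis unfolding ends by (rule ext)
qed

end

context triangulated
begin

definition neighbourhood :: "(nat set \<Rightarrow> complex) set" where
  "neighbourhood = M_delta n \<inter> near"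

lemma zero_pd: "(\<lambda>c. 0) \<in> pd \<alpha> rad"
  by (rule zero_in_pd[OF rad(1)])

lemma neighbourhood:
  "openin (top_of_set (M_delta n)) neighbourhood" "\<Phi> (\<lambda>c. 0) \<in> neighbourhood"
  using open_near phi_M_delta[OF zero_pd] Phi_near[OF zero_pd] by (auto simp: neighbourhood_def openin_open)

text \<open>The chart coordinates are among the functions \<open>u c\<close>, so the Lipschitz
  constant is 1, and the coefficients of the differential can be supported on \<alpha>.\<close>

lemma holomorphic_neighbourhood:
  assumes f: "vertex_solution f"
  shows "B_holomorphic_on n (\<lambda>u. B_class n (f (restr u))) neighbourhood"
  unfolding B_holomorphic_on_def
proof (intro conjI exI[of _ "\<lambda>u. f (restr u)"] ballI allI)
  show "(\<lambda>u. B_class n (f (restr u))) \<in> neighbourhood \<rightarrow> carrier (B_hat n)"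
    using f by (auto simp: carrier_B_hat vertex_solution_def)
  show "f (restr u) \<in> B_class n (f (restr u))" for u by (rule self_B_class)
  fix w u assume u: "u \<in> neighbourhood"
  have near: "restr u \<in> pd \<alpha> rad \<and> u = \<Phi> (restr u)" if "u \<in> neighbourhood" for u
    using near_eq_Phi[of u] that by (simp add: neighbourhood_def)
  define G where "G x = f x w" for x
  have G: "hol \<alpha> rad G" using f by (simp add: G_def[abs_def] vertex_solution_def)
  define D where "D c = (if c \<in> \<alpha> then dp c G (restr u) else 0)" for c
  have rc: "continuous_on UNIV restr" unfolding restr_def
  proof (rule continuous_on_coordinatewise_then_product)
    fix c show "continuous_on UNIV (\<lambda>u. if c \<in> \<alpha> then u c else (0::complex))"
      by (cases "c \<in> \<alpha>") (auto intro: continuous_on_coord)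
  qed
  have "has_differential (chords n) (\<lambda>u. u) neighbourhood (\<lambda>u. f (restr u) w) D u"
  proof (rule has_differential_pullback[where \<tau> = restr and K = 1, OF G])
    show "restr u \<in> pd \<alpha> rad" "u = \<Phi> (restr u)" using near[OF u] by auto
    show "f (restr u) w = G (restr u)" by (simp add: G_def)
    show "\<forall>\<^sub>F e' in at u within neighbourhood. restr e' \<in> pd \<alpha> rad \<and> e' = \<Phi> (restr e') \<and> f (restr e') w = G (restr e')"
      using near by (auto simp: eventually_at_filter G_def intro!: always_eventually)
    have "(\<Sum>i\<in>\<alpha>. cmod (restr e' i - restr u i)) \<le> 1 * (\<Sum>c\<in>chords n. cmod (e' c - u c))" for e'
    proof -
      have "(\<Sum>i\<in>\<alpha>. cmod (restr e' i - restr u i)) = (\<Sum>i\<in>\<alpha>. cmod (e' i - u i))"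
        by (intro sum.cong refl) (simp add: restr_def)
      also have "\<dots> \<le> (\<Sum>c\<in>chords n. cmod (e' c - u c))" using alpha(1) by (intro sum_mono2) auto
      finally show ?thesis by simp
    qed
    then show "\<forall>\<^sub>F e' in at u within neighbourhood. (\<Sum>i\<in>\<alpha>. cmod (restr e' i - restr u i)) \<le> 1 * (\<Sum>c\<in>chords n. cmod (e' c - u c))"
      by (intro always_eventually allI)
    show "(restr \<longlongrightarrow> restr u) (at u within neighbourhood)"
      using continuous_on_subset[OF rc subset_UNIV, of neighbourhood] u by (simp add: continuous_on)
    fix i assume i: "i \<in> \<alpha>"
    have "D c * dp i (\<lambda>x. \<Phi> x c) (restr u) = (if c = i then dp i G (restr u) else 0)" for c
    proof (cases "c \<in> \<alpha>")
      case True
      then have "(\<lambda>x. \<Phi> x c) = (\<lambda>x. x c)" by (simp add: \<Phi>_def)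
      then show ?thesis using True by (simp add: D_def dp_coord)
    next
      case False then show ?thesis using i by (auto simp: D_def)
    qed
    then show "dp i G (restr u) = (\<Sum>c\<in>chords n. D c * dp i (\<lambda>x. \<Phi> x c) (restr u))" using i alpha(1) by auto
  qed
  then show "\<exists>D. has_differential (chords n) (\<lambda>u. u) neighbourhood (\<lambda>u. f (restr u) w) D u" by (rule exI[of _ D])
qed

lemma product_at_class:
  assumes f: "vertex_solution f"
  shows "B_class n (product_at f u)
    = B_class n (f (restr (cpx u))) \<otimes>\<^bsub>B_hat n\<^esub> B_class n (expart (\<lambda>c. complex_of_real (ln (u c))))"
proof -
  have fc: "f x \<in> carr n" for x using f by (simp add: vertex_solution_def)
  show ?thesis unfolding mult_B_class[OF fc expart(1)] product_at_def
    by (rule B_class_nf[OF nc_mult_closed[OF fc expart(1)]])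
qed

lemma positive_points:
  obtains U where "\<And>k. U k \<in> X_open n" "(\<lambda>k. cpx (U k)) \<longlonglongrightarrow> \<Phi> (\<lambda>c. 0)"
proof -
  define y where "y k c = (if c \<in> \<alpha> then rad / (real k + 2) else 0)" for k :: nat and c
  have yr: "0 < rad / (real k + 2)" "rad / (real k + 2) < rad" for k
    using rad(1) by (auto simp: divide_less_eq)
  have yp: "cpx (y k) \<in> pd \<alpha> rad" for k
  proof -
    have "cmod (cpx (y k) c) < rad" for c
      using yr[of k] rad(1) unfolding cpx_def y_def norm_of_real by auto
    then show ?thesis by (simp add: pd_def) (simp add: cpx_def y_def)
  qed
  have "\<forall>k. \<exists>u. u \<in> X_open n \<and> cpx u = \<Phi> (cpx (y k))"
  proof
    fix k
    show "\<exists>u. u \<in> X_open n \<and> cpx u = \<Phi> (cpx (y k))"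
      by (rule Phi_positive[of "y k"]) (use yr yp in \<open>auto simp: y_def\<close>)
  qed
  from choice[OF this] obtain U where U: "\<And>k. U k \<in> X_open n" "\<And>k. cpx (U k) = \<Phi> (cpx (y k))" by blast
  have "(\<lambda>k. cpx (y k)) \<longlonglongrightarrow> (\<lambda>c. 0)"
  proof (rule tendsto_coordinatewise)
    fix c
    have "(\<lambda>k. rad / (real k + 2)) \<longlonglongrightarrow> 0" by real_asymp
    then have "(\<lambda>k. y k c) \<longlonglongrightarrow> 0" by (cases "c \<in> \<alpha>") (simp_all add: y_def)
    from tendsto_of_real[OF this, where ?'a = complex] show "(\<lambda>k. cpx (y k) c) \<longlonglongrightarrow> 0" by (simp add: cpx_def)
  qed
  then have "(\<lambda>k. \<Phi> (cpx (y k))) \<longlonglongrightarrow> \<Phi> (\<lambda>c. 0)"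
    using continuous_on_tendsto_compose[OF phi_continuous _ zero_pd always_eventually] yp by blast
  then show ?thesis using that[of U] U by simp
qed

text \<open>Two solutions normalised at the vertex differ in lowest degree by a constant, which is
  read off in the limit at the vertex.\<close>

lemma normalised_difference_zero:
  fixes F1 F2 f1 f2 :: "(nat set \<Rightarrow> real) \<Rightarrow> ncseries"
  assumes F: "\<And>u. u \<in> X ==> F1 u = nf n (nc_mult (f1 u) (e u))" "\<And>u. u \<in> X ==> F2 u = nf n (nc_mult (f2 u) (e u))"
    and fc: "\<And>u. u \<in> X ==> f1 u \<in> carr n" "\<And>u. u \<in> X ==> f2 u \<in> carr n"
    and e: "\<And>u. u \<in> X ==> e u \<in> carr n" "\<And>u. u \<in> X ==> e u [] = 1"
    and eq: "\<And>u w'. u \<in> X ==> length w' < length w ==> F1 u w' = F2 u w'" and u: "u \<in> X"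
  shows "F1 u w - F2 u w = nf n (f1 u) w - nf n (f2 u) w"
proof -
  define \<psi> where "\<psi> = nf n (\<lambda>w. f1 u w - f2 u w)"
  have dc: "(\<lambda>w. f1 u w - f2 u w) \<in> carr n" using fc[OF u] by (rule carr_closed(2))
  have d: "F1 u w' - F2 u w' = nf n (nc_mult \<psi> (e u)) w'" for w'
  proof -
    have "nf n (nc_mult \<psi> (e u)) = nf n (nc_mult (\<lambda>w. f1 u w - f2 u w) (e u))"
      unfolding \<psi>_def by (rule nf_mult(1)[OF dc e(1)[OF u]])
    then show ?thesis unfolding F(1)[OF u] F(2)[OF u] by (simp only: nc_mult_diff nf_diff)
  qed
  \<comment> \<open>Since \<open>e u\<close> has constant term 1, multiplication by it leaves the
    lowest part of \<open>\<psi>\<close> unchanged.\<close>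
  have step: "nf n (nc_mult \<psi> (e u)) w' = \<psi> w'" if z: "\<And>v. length v < length w' ==> \<psi> v = 0" for w'
  proof -
    have "nf n (nc_mult \<psi> (e u)) w' = nf n \<psi> w'"
    proof (rule nf_cong)
      fix v :: "nat set list" assume l: "length v = length w'"
      have "nc_mult \<psi> (e u) v = (\<Sum>k\<le>length v. if k = length v then \<psi> v else 0)"
        unfolding nc_mult_def using z l e(2)[OF u] by (intro sum.cong refl) auto
      then show "nc_mult \<psi> (e u) v = \<psi> v" by simp
    qed
    then show ?thesis by (simp add: \<psi>_def nf_nf dc)
  qed
  have "\<psi> v = 0" if "length v < length w" for v
    using that
  proof (induction v rule: length_induct)
    case (1 v)
    then have "\<psi> v = nf n (nc_mult \<psi> (e u)) v" by (intro step[symmetric]) auto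
    then show ?case using d[of v] eq[OF u 1(2)] by simp
  qed
  then have "F1 u w - F2 u w = \<psi> w" using d[of w] step[of w] by simp
  then show ?thesis by (simp add: \<psi>_def nf_diff)
qed

end

lemma tendsto_compose_within:
  assumes g: "(g \<longlongrightarrow> g a) (at a within S)" and x: "\<forall>\<^sub>F k in F. x k \<in> S" "(x \<longlongrightarrow> a) F"
  shows "((\<lambda>k. g (x k)) \<longlongrightarrow> g a) F"
proof (rule topological_tendstoI)
  fix V assume V: "open V" "g a \<in> V"
  obtain T where T: "open T" "a \<in> T" "\<And>y. y \<in> T ==> y \<noteq> a ==> y \<in> S ==> g y \<in> V"
    using topological_tendstoD[OF g V] unfolding eventually_at_topological by blast
  from topological_tendstoD[OF x(2) T(1,2)] x(1) show "\<forall>\<^sub>F k in F. g (x k) \<in> V"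
  proof eventually_elim
    case (elim k) then show ?case using T(3) V(2) by (cases "x k = a") auto
  qed
qed

lemma nf_continuous:
  assumes h: "B_holomorphic_on n f U" and u: "u \<in> U"
  obtains g where "\<And>u. u \<in> U ==> g u \<in> carr n \<and> f u = B_class n (g u)"
    "\<And>w. ((\<lambda>u. nf n (g u) w) \<longlongrightarrow> nf n (g u) w) (at u within U)"
proof -
  obtain g where fU: "f \<in> U \<rightarrow> carrier (B_hat n)" and g: "\<And>u. u \<in> U ==> g u \<in> f u"
    and d: "\<And>w u. u \<in> U ==> \<exists>D. has_differential (chords n) (\<lambda>u. u) U (\<lambda>u. g u w) D u"
    using h unfolding B_holomorphic_on_def by blast
  have "g u \<in> carr n \<and> f u = B_class n (g u)" if "u \<in> U" for u
    using B_hat_representative[of "f u" n "g u"] fU g[OF that] that by auto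
  moreover have "((\<lambda>u. nf n (g u) w) \<longlongrightarrow> nf n (g u) w) (at u within U)" for w
  proof -
    have "\<forall>w. \<exists>D. has_differential (chords n) (\<lambda>u. u) U (\<lambda>u. g u w) D u" using d[OF u] by blast
    from choice[OF this] obtain D where D: "\<And>w. has_differential (chords n) (\<lambda>u. u) U (\<lambda>u. g u w) (D w) u" by blast
    have "has_differential (chords n) (\<lambda>u. u) U (\<lambda>u. nf n (g u) w) (\<lambda>c. nf n (\<lambda>w. D w c) w) u"
      by (rule has_differential_functional[OF finite_functional_nf, where D = "\<lambda>c w. D w c"]) (rule D)
    then show ?thesis
    proof (rule has_differential_continuous[OF _ finite_chords])
      fix c show "((\<lambda>u. u c) \<longlongrightarrow> u c) (at u within U)"
      proof -
        have "continuous_on U (\<lambda>u :: nat set \<Rightarrow> complex. u c)" by (rule continuous_on_coord)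
        then show ?thesis using u by (simp add: continuous_on)
      qed
    qed
  qed
  ultimately show ?thesis by (rule that)
qed

lemma log_part_eq:
  "{c \<in> chords n. face n c \<in> faces_at n v} = \<alpha> ==> log_part n v u = linear_series \<alpha> (\<lambda>c. complex_of_real (ln (u c)))"
  by (simp add: log_part_def linear_series_def mult.commute)

theorem theorem1p4:
  fixes n :: nat
    and v :: "nat set \<Rightarrow> real"
    and E :: "'e::topological_space set"
    and p :: "'e \<Rightarrow> nat set \<Rightarrow> complex"
    and s :: "(nat set \<Rightarrow> real) \<Rightarrow> 'e"
  assumes "n \<ge> 4"
    and "associahedron_vertex n v"
    and "universal_covering_M0 n E p s"
  shows "\<exists>!L. L \<in> extensional E \<and> solves_on n p E L \<and> normalised_at n s v L"
proof -
  obtain \<alpha> where tri: "triangulated n \<alpha>" and v: "cpx v = triangulated.\<Phi> n \<alpha> (\<lambda>c. 0)"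
    and faces: "{c \<in> chords n. face n c \<in> faces_at n v} = \<alpha>"
    using associahedron_vertex_triangulated[OF assms(1,2)] .
  obtain \<rho> \<phi> \<sigma> where "covered n E p \<rho> \<phi> \<sigma>" using universal_covering_charts[OF assms(1,3)] .
  then interpret C: covered n E p \<rho> \<phi> \<sigma> .
  interpret T: triangulated n \<alpha> by (rule tri)
  note log = log_part_eq[OF faces]
  have s: "continuous_on (X_open n) s" "\<And>u. u \<in> X_open n ==> s u \<in> E" "\<And>u. u \<in> X_open n ==> p (s u) = cpx u"
    and pE: "p ` E = M0 n" and sc: "simply_connected E"
    using assms(3) by (auto simp: universal_covering_M0_def covering_space_def)
  have M: "cpx u \<in> M_delta n" if "u \<in> X_open n" for u
  proof -
    have "p (s u) \<in> M0 n" using s(2)[OF that] pE by blast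
    then show ?thesis using M0_M_delta s(3)[OF that] by simp
  qed
  obtain U where "\<And>k. U k \<in> X_open n" "(\<lambda>k. cpx (U k)) \<longlonglongrightarrow> T.\<Phi> (\<lambda>c. 0)"
    by (rule T.positive_points) (rule that, blast+)
  then have U: "\<And>k. U k \<in> X_open n" "(\<lambda>k. cpx (U k)) \<longlonglongrightarrow> cpx v" by (simp_all add: v)
  have evU: "\<forall>\<^sub>F k in sequentially. cpx (U k) \<in> V" if V: "openin (top_of_set (M_delta n)) V" "cpx v \<in> V" for V
  proof -
    obtain S where S: "open S" "V = M_delta n \<inter> S" using V(1) by (auto simp: openin_open)
    then have "\<forall>\<^sub>F k in sequentially. cpx (U k) \<in> S" using V(2) topological_tendstoD[OF U(2)] by blast
    then show ?thesis
    proof eventually_elim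
      case (elim k) then show ?case using S(2) M[OF U(1)] by blast
    qed
  qed
  have "connected E" by (rule path_connected_imp_connected[OF simply_connected_path_connected[OF sc]])
  have E0: "T.neighbourhood = M_delta n \<inter> T.near" by (rule T.neighbourhood_def)
  obtain k0 where "cpx (U k0) \<in> T.neighbourhood"
    using eventually_happens'[OF sequentially_bot evU[OF T.neighbourhood(1) T.neighbourhood(2)[folded v]]] ..
  then have u0: "U k0 \<in> X_open n" "cpx (U k0) \<in> T.near" using U(1)[of k0] by (simp_all add: E0)
  obtain f where f: "T.vertex_solution f" by (rule T.vertex_solution_exists)
  \<comment> \<open>The solution on the covering is prescribed at a single point of the cell.
    \<open>T.matching\<close> then gives agreement with the local product on all of the cell close
    to the vertex.\<close>
  obtain F where F: "\<And>e. F e \<in> carr n" "F (s (U k0)) = T.product_at f (U k0)"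
    "\<And>e w. e \<in> E ==> has_differential (chords n) p E (\<lambda>e. F e w) (\<lambda>c. Lop n c (F e) w / p e c) e"
  proof (rule C.global_solution[OF s(2)[OF u0(1)]])
    show "T.product_at f (U k0) \<in> carr n" unfolding T.product_at_def by (rule nf_carr)
  qed (rule that, blast+)
  define L where "L = restrict (\<lambda>e. B_class n (F e)) E"
  have L: "L \<in> extensional E \<and> solves_on n p E L \<and> normalised_at n s v L"
  proof -
    have "normalised_at n s v L" unfolding normalised_at_def
    proof (intro exI conjI ballI impI)
      show "openin (top_of_set (M_delta n)) T.neighbourhood" "cpx v \<in> T.neighbourhood"
        using T.neighbourhood by (simp_all add: v)
      show "B_holomorphic_on n (\<lambda>u. B_class n (f (T.restr u))) T.neighbourhood"
        by (rule T.holomorphic_neighbourhood[OF f])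
      have "T.restr (cpx v) = (\<lambda>c. 0)" unfolding v by (rule T.restr_Phi[OF T.zero_pd])
      then show "B_class n (f (T.restr (cpx v))) = \<one>\<^bsub>B_hat n\<^esub>" using f by (simp add: T.vertex_solution_def one_B_hat)
      fix u assume u: "u \<in> X_open n" "cpx u \<in> T.neighbourhood"
      have near: "cpx u \<in> T.near" using u(2) unfolding E0 by blast
      have "F (s u) = T.product_at f u" by (rule T.matching[OF s M F(3) f u0 u(1) near F(2)])
      then show "L (s u) = B_class n (f (T.restr (cpx u))) \<otimes>\<^bsub>B_hat n\<^esub> B_class n (nc_exp n (log_part n v u))"
        unfolding log T.expart_def[symmetric] T.product_at_class[OF f, symmetric] using s(2)[OF u(1)] by (simp add: L_def)
    qed
    then show ?thesis using solves_on_class[OF F(1,3)] by (simp add: L_def)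
  qed
  have uniq: "L1 = L2"
    if 1: "L1 \<in> extensional E" "solves_on n p E L1" "normalised_at n s v L1"
      and 2: "L2 \<in> extensional E" "solves_on n p E L2" "normalised_at n s v L2" for L1 L2
  proof -
    define e where "e u = nc_exp n (log_part n v u)" for u
    have e: "e u \<in> carr n" "e u [] = 1" for u
      using T.expart by (simp_all add: e_def log T.expart_def)
    \<comment> \<open>All data of a normalised solution are moved to normal forms, where equality in
      the quotient is equality of series and limits of coefficients at the vertex are well
      defined.\<close>
    have normal: "\<exists>F1 V g. (\<forall>e\<in>E. F1 e \<in> carr n \<and> L1 e = B_class n (F1 e)) \<and>
        (\<forall>e\<in>E. \<forall>w. has_differential (chords n) p E (\<lambda>e. F1 e w) (\<lambda>c. Lop n c (F1 e) w / p e c) e) \<and>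
        openin (top_of_set (M_delta n)) V \<and> cpx v \<in> V \<and> (\<forall>u\<in>V. g u \<in> carr n) \<and>
        (\<forall>w. ((\<lambda>u. nf n (g u) w) \<longlongrightarrow> nf n (g (cpx v)) w) (at (cpx v) within V)) \<and>
        nf n (g (cpx v)) = nf n (\<lambda>w. if w = [] then 1 else 0) \<and>
        (\<forall>u\<in>X_open n. cpx u \<in> V \<longrightarrow> F1 (s u) = nf n (nc_mult (g (cpx u)) (e u)))"
      if sol: "solves_on n p E L1" and nrm: "normalised_at n s v L1" for L1
    proof -
      obtain F1 where F1: "\<And>e. e \<in> E ==> F1 e \<in> carr n" "\<And>e. e \<in> E ==> nf n (F1 e) = F1 e"
        "\<And>e. e \<in> E ==> L1 e = B_class n (F1 e)"
        "\<And>e w. e \<in> E ==> has_differential (chords n) p E (\<lambda>e. F1 e w) (\<lambda>c. Lop n c (F1 e) w / p e c) e"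
        using solves_on_normal_form[OF sol] by blast
      obtain V h where V: "openin (top_of_set (M_delta n)) V" "cpx v \<in> V" and h: "B_holomorphic_on n h V"
        "h (cpx v) = \<one>\<^bsub>B_hat n\<^esub>"
        and match: "\<And>u. u \<in> X_open n ==> cpx u \<in> V ==> L1 (s u) = h (cpx u) \<otimes>\<^bsub>B_hat n\<^esub> B_class n (e u)"
        using nrm unfolding normalised_at_def e_def by blast
      obtain g where g: "\<And>u. u \<in> V ==> g u \<in> carr n \<and> h u = B_class n (g u)"
        "\<And>w. ((\<lambda>u. nf n (g u) w) \<longlongrightarrow> nf n (g (cpx v)) w) (at (cpx v) within V)"
        using nf_continuous[OF h(1) V(2)] by blast
      have "B_class n (g (cpx v)) = B_class n (\<lambda>w. if w = [] then 1 else 0)"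
        using g(1)[OF V(2)] h(2) by (simp add: one_B_hat)
      then have "nf n (g (cpx v)) = nf n (\<lambda>w. if w = [] then 1 else 0)"
        using B_class_eq_nf[of "g (cpx v)" n] g(1)[OF V(2)] carr_closed(5) by blast
      moreover have "F1 (s u) = nf n (nc_mult (g (cpx u)) (e u))" if u: "u \<in> X_open n" "cpx u \<in> V" for u
      proof -
        have gu: "g (cpx u) \<in> carr n" "h (cpx u) = B_class n (g (cpx u))" using g(1)[OF u(2)] by auto
        have "B_class n (F1 (s u)) = B_class n (nc_mult (g (cpx u)) (e u))"
          using match[OF u] F1(3)[OF s(2)[OF u(1)]] mult_B_class[OF gu(1) e(1)] gu(2) by simp
        then have "nf n (F1 (s u)) = nf n (nc_mult (g (cpx u)) (e u))"
          using B_class_eq_nf[OF F1(1)[OF s(2)[OF u(1)]] nc_mult_closed[OF gu(1) e(1)]] by blast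
        then show ?thesis using F1(2)[OF s(2)[OF u(1)]] by simp
      qed
      ultimately show ?thesis using F1 V g
        by (intro exI[of _ F1] exI[of _ V] exI[of _ g]) blast
    qed
    obtain F1 V1 g1 where A: "\<forall>e\<in>E. F1 e \<in> carr n \<and> L1 e = B_class n (F1 e)"
        "\<forall>e\<in>E. \<forall>w. has_differential (chords n) p E (\<lambda>e. F1 e w) (\<lambda>c. Lop n c (F1 e) w / p e c) e"
        "openin (top_of_set (M_delta n)) V1" "cpx v \<in> V1" "\<forall>u\<in>V1. g1 u \<in> carr n"
        "\<forall>w. ((\<lambda>u. nf n (g1 u) w) \<longlongrightarrow> nf n (g1 (cpx v)) w) (at (cpx v) within V1)"
        "nf n (g1 (cpx v)) = nf n (\<lambda>w. if w = [] then 1 else 0)"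
        "\<forall>u\<in>X_open n. cpx u \<in> V1 \<longrightarrow> F1 (s u) = nf n (nc_mult (g1 (cpx u)) (e u))"
      using normal[OF 1(2,3)] by (elim exE conjE) (rule that)
    obtain F2 V2 g2 where B: "\<forall>e\<in>E. F2 e \<in> carr n \<and> L2 e = B_class n (F2 e)"
        "\<forall>e\<in>E. \<forall>w. has_differential (chords n) p E (\<lambda>e. F2 e w) (\<lambda>c. Lop n c (F2 e) w / p e c) e"
        "openin (top_of_set (M_delta n)) V2" "cpx v \<in> V2" "\<forall>u\<in>V2. g2 u \<in> carr n"
        "\<forall>w. ((\<lambda>u. nf n (g2 u) w) \<longlongrightarrow> nf n (g2 (cpx v)) w) (at (cpx v) within V2)"
        "nf n (g2 (cpx v)) = nf n (\<lambda>w. if w = [] then 1 else 0)"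
        "\<forall>u\<in>X_open n. cpx u \<in> V2 \<longrightarrow> F2 (s u) = nf n (nc_mult (g2 (cpx u)) (e u))"
      using normal[OF 2(2,3)] by (elim exE conjE) (rule that)
    define X where "X = {u \<in> X_open n. cpx u \<in> V1 \<and> cpx u \<in> V2}"
    have eq: "\<forall>e\<in>E. F1 e w = F2 e w" for w
    proof (induction w rule: length_induct)
      case (1 w)
      \<comment> \<open>By induction on length the right hand sides agree at \<open>w\<close>, so
        \<open>d\<close> is constant on the connected covering. Near the vertex it is the difference
        of the two normalised factors, and this tends to 0.\<close>
      define d where "d e = F1 e w - F2 e w" for e
      have "has_differential (chords n) p E d (\<lambda>c. 0) e" if e: "e \<in> E" for e
      proof -
        have "Lop n c (F1 e) w = Lop n c (F2 e) w" for c
          by (rule Lop_cong(1)) (use 1 e in auto)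
        then show ?thesis using has_differential_diff[OF A(2)[rule_format, OF e, of w] B(2)[rule_format, OF e, of w]]
          by (simp add: d_def[abs_def])
      qed
      then have const: "d e = d (s (U 0))" if "e \<in> E" for e
        using C.zero_differential_constant[OF \<open>connected E\<close> _ that s(2)[OF U(1)]] by blast
      have diff: "d (s u) = nf n (g1 (cpx u)) w - nf n (g2 (cpx u)) w" if u: "u \<in> X" for u
        unfolding d_def
      proof (rule T.normalised_difference_zero[where X = X and e = e and ?F1.0 = "\<lambda>u. F1 (s u)" and ?F2.0 = "\<lambda>u. F2 (s u)"
            and ?f1.0 = "\<lambda>u. g1 (cpx u)" and ?f2.0 = "\<lambda>u. g2 (cpx u)"])
        fix u and w' :: "nat set list" assume u: "u \<in> X" "length w' < length w"
        then have "s u \<in> E" using s(2) by (simp add: X_def)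
        then show "F1 (s u) w' = F2 (s u) w'" using 1 u(2) by blast
      qed (use A(5,8) B(5,8) e u in \<open>auto simp: X_def\<close>)
      have ev: "\<forall>\<^sub>F k in sequentially. cpx (U k) \<in> V1" "\<forall>\<^sub>F k in sequentially. cpx (U k) \<in> V2"
        using evU A(3,4) B(3,4) by blast+
      have "(\<lambda>k. nf n (g1 (cpx (U k))) w - nf n (g2 (cpx (U k))) w)
          \<longlonglongrightarrow> nf n (g1 (cpx v)) w - nf n (g2 (cpx v)) w"
        by (rule tendsto_diff)
          (rule tendsto_compose_within[OF A(6)[rule_format] ev(1) U(2)]
             tendsto_compose_within[OF B(6)[rule_format] ev(2) U(2)])+
      then have "(\<lambda>k. nf n (g1 (cpx (U k))) w - nf n (g2 (cpx (U k))) w) \<longlonglongrightarrow> 0" by (simp add: A(7) B(7))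
      moreover have "\<forall>\<^sub>F k in sequentially. nf n (g1 (cpx (U k))) w - nf n (g2 (cpx (U k))) w = d (s (U 0))"
        using ev
      proof eventually_elim
        case (elim k)
        then have "U k \<in> X" using U(1)[of k] by (simp add: X_def)
        then show ?case using diff const[OF s(2)[OF U(1)[of k]]] by simp
      qed
      ultimately have "(\<lambda>k. d (s (U 0))) \<longlonglongrightarrow> 0" by (simp add: tendsto_cong)
      then have "d (s (U 0)) = 0" by (simp add: LIMSEQ_const_iff)
      then show ?case using const by (simp add: d_def)
    qed
    have "L1 e = L2 e" if "e \<in> E" for e
    proof -
      have "F1 e = F2 e" using eq that by blast
      then show ?thesis using A(1) B(1) that by simp
    qed
    then show ?thesis using 1(1) 2(1) by (blast intro: extensionalityI)
  qed
  show ?thesis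
  proof (rule ex1I[where a = L])
    show "L \<in> extensional E \<and> solves_on n p E L \<and> normalised_at n s v L" by (rule L)
    fix L' assume L': "L' \<in> extensional E \<and> solves_on n p E L' \<and> normalised_at n s v L'"
    show "L' = L"
      by (rule uniq) (use L' L in auto)
  qed
qed

end
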